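(* Consider a semi-simple, connected, compact matrix Lie group $G$ endowed with the horizontal distribution defined by the orthogonal complement $\mathcal{H}$ of a Cartan subalgebra $\mathcal{T}$ of its Lie algebra $\mathcal{G}$, and with the inner product $\langle X,Y\rangle=-\rho K(X,Y)$ on $\mathcal{G}$ (where $K$ is the Killing form and $\rho>0$ a constant). Then: (i) All sub-Riemannian geodesics are normal. (ii) All sub-Riemannian geodesics through the identity have the form $$\gamma(t)=e^{tX}\cdot e^{-tX^{\perp}},$$ where $X\in\mathcal{G}$ and $X^{\perp}$ is the orthogonal projection of $X$ onto $\mathcal{T}$.
   Context: $G$ is a group of $n\times n$ real or complex matrices, $\mathcal{G}$ is its (real) Lie algebra with the commutator bracket $[X,Y]=XY-YX$, and $K(X,Y)=\operatorname{trace}(\operatorname{ad}X\cdot\operatorname{ad}Y)$, where $\operatorname{ad}X(Y)=[X,Y]$. A Lie algebra is simple if it is non-commutative and has no non-trivial ideals, and semi-simple if it is a direct sum of simple Lie algebras; a Lie group is semi-simple if its Lie algebra is. The Cartan subalgebra $\mathcal{T}$ is the Lie algebra of a maximal torus of $G$, and $\mathcal{H}=\mathcal{T}^{\perp}$ with respect to $\langle\cdot,\cdot\rangle$. The inner product generates a bi-invariant metric on $G$, with norm $\|\cdot\|$. The horizontal sub-bundle of the tangent bundle of $G$ is given by $\mathcal{H}_g=g\mathcal{H}$, $g\in G$, and it is bracket-generating. An absolutely continuous curve $\gamma:[a,b]\to G$ is horizontal if $\gamma'(t)\in\mathcal{H}_{\gamma(t)}$ for every $t\in[a,b]$ where $\gamma'(t)$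 exists; its length is $\int_a^b\|\gamma'(t)\|\,dt$. A horizontal curve is a sub-Riemannian geodesic if locally it is a length minimizer (among horizontal curves). A sub-Riemannian geodesic is normal if it is the projection to $G$ of a solution in $T^*G$ of Hamilton's equations for the sub-Riemannian Hamiltonian $(g,p)\mapsto\frac12\sum_i p(gE_i)^2$, where $\{E_i\}$ is an orthonormal basis of $\mathcal{H}$.
   Formalization: Sub-Riemannian geodesics are additionally assumed to be parametrized with constant speed (norm of γ' constant almost everywhere); otherwise a nonlinear reparametrization of a geodesic, still locally length-minimizing, is neither normal nor of the stated form. *)

theory Defs
  imports "HOL-Analysis.Analysis"
begin

text \<open>
  Matrices have type \<open>'k^'n^'n\<close> where \<open>'k\<close> is both a real normed field and a Euclidean space; the
  types \<^typ>\<open>real\<close> and \<^typ>\<open>complex\<close> are the instances, so real and complex matrix groups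
  are covered uniformly. All linear algebra (\<^const>\<open>subspace\<close>, \<^const>\<open>span\<close>, \<open>linear\<close>) is over the
  reals. Note that \<open>*\<close>, \<open>^\<close> and \<open>exp\<close> on this type would be entrywise, hence the separate
  definitions of matrix powers and of the matrix exponential.
\<close>

primrec mpow :: "('k::{real_normed_field,euclidean_space})^'n^'n \<Rightarrow> nat \<Rightarrow> 'k^'n^'n" where
  "mpow A 0 = mat 1"
| "mpow A (Suc k) = A ** mpow A k"

definition mexp :: "('k::{real_normed_field,euclidean_space})^'n^'n \<Rightarrow> 'k^'n^'n" where
  "mexp A = (\<Sum>k. mpow A k /\<^sub>R fact k)"


subsection \<open>Matrix Lie groups and their Lie algebras\<close>

definition matrix_lie_group :: "(('k::{real_normed_field,euclidean_space})^'n^'n) set \<Rightarrow> bool" where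
  "matrix_lie_group G \<longleftrightarrow>
     G \<subseteq> {A. invertible A} \<and>
     mat 1 \<in> G \<and>
     (\<forall>A\<in>G. \<forall>B\<in>G. A ** B \<in> G) \<and>
     (\<forall>A\<in>G. matrix_inv A \<in> G) \<and>
     closedin (top_of_set {A. invertible A}) G"

definition lie_algebra ::
    "(('k::{real_normed_field,euclidean_space})^'n^'n) set \<Rightarrow> ('k^'n^'n) set" where
  "lie_algebra G = {X. \<forall>t::real. mexp (t *\<^sub>R X) \<in> G}"

definition lie_bracket ::
    "('k::{real_normed_field,euclidean_space})^'n^'n \<Rightarrow> 'k^'n^'n \<Rightarrow> 'k^'n^'n" where
  "lie_bracket X Y = X ** Y - Y ** X"

definition lie_subalgebra :: "(('k::{real_normed_field,euclidean_space})^'n^'n) set \<Rightarrow> bool" where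
  "lie_subalgebra L \<longleftrightarrow> subspace L \<and> (\<forall>X\<in>L. \<forall>Y\<in>L. lie_bracket X Y \<in> L)"

definition lie_ideal ::
    "(('k::{real_normed_field,euclidean_space})^'n^'n) set \<Rightarrow> ('k^'n^'n) set \<Rightarrow> bool" where
  "lie_ideal I L \<longleftrightarrow> subspace I \<and> I \<subseteq> L \<and> (\<forall>X\<in>L. \<forall>Y\<in>I. lie_bracket X Y \<in> I)"

definition simple_lie_algebra ::
    "(('k::{real_normed_field,euclidean_space})^'n^'n) set \<Rightarrow> bool" where
  "simple_lie_algebra L \<longleftrightarrow>
     lie_subalgebra L \<and>
     (\<exists>X\<in>L. \<exists>Y\<in>L. lie_bracket X Y \<noteq> 0) \<and>
     (\<forall>I. lie_ideal I L \<longrightarrow> I = {0} \<or> I = L)"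

text \<open>The direct sum is one of Lie algebras, so distinct summands commute. The empty sum is allowed.\<close>

definition semisimple_lie_algebra ::
    "(('k::{real_normed_field,euclidean_space})^'n^'n) set \<Rightarrow> bool" where
  "semisimple_lie_algebra L \<longleftrightarrow>
     (\<exists>\<S>. finite \<S> \<and>
        (\<forall>I\<in>\<S>. simple_lie_algebra I) \<and>
        (\<forall>I\<in>\<S>. \<forall>J\<in>\<S>. I \<noteq> J \<longrightarrow> (\<forall>X\<in>I. \<forall>Y\<in>J. lie_bracket X Y = 0)) \<and>
        L = {(\<Sum>I\<in>\<S>. f I) | f. \<forall>I\<in>\<S>. f I \<in> I} \<and>
        (\<forall>f. (\<forall>I\<in>\<S>. f I \<in> I) \<and> (\<Sum>I\<in>\<S>. f I) = 0 \<longrightarrow> (\<forall>I\<in>\<S>. f I = 0)))"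

text \<open>Trace of an endomorphism of a subspace; it does not depend on the chosen basis.\<close>

definition trace_on :: "'a::euclidean_space set \<Rightarrow> ('a \<Rightarrow> 'a) \<Rightarrow> real" where
  "trace_on V f =
     (let B = (SOME B. independent B \<and> span B = V) in \<Sum>b\<in>B. representation B (f b) b)"

definition killing_form ::
    "(('k::{real_normed_field,euclidean_space})^'n^'n) set \<Rightarrow> 'k^'n^'n \<Rightarrow> 'k^'n^'n \<Rightarrow> real" where
  "killing_form L X Y = trace_on L (lie_bracket X \<circ> lie_bracket Y)"

text \<open>
  A torus is a matrix Lie group isomorphic, as a topological group, to a power of the unit circle
  (continuous isomorphisms of Lie groups are automatically smooth).
\<close>

definition is_torus :: "(('k::{real_normed_field,euclidean_space})^'n^'n) set \<Rightarrow> bool" where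
  "is_torus T \<longleftrightarrow>
     matrix_lie_group T \<and>
     (\<exists>(k::nat) f.
        homeomorphic_map (product_topology (\<lambda>_. top_of_set (sphere (0::complex) 1)) {..<k})
          (top_of_set T) f \<and>
        (\<forall>z \<in> {..<k} \<rightarrow>\<^sub>E sphere 0 1. \<forall>w \<in> {..<k} \<rightarrow>\<^sub>E sphere 0 1.
           f (\<lambda>i\<in>{..<k}. z i * w i) = f z ** f w))"

definition maximal_torus ::
    "(('k::{real_normed_field,euclidean_space})^'n^'n) set \<Rightarrow> ('k^'n^'n) set \<Rightarrow> bool" where
  "maximal_torus T G \<longleftrightarrow>
     is_torus T \<and> T \<subseteq> G \<and> (\<forall>T'. is_torus T' \<and> T \<subseteq> T' \<and> T' \<subseteq> G \<longrightarrow> T' = T)"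


subsection \<open>Orthogonality with respect to a bilinear form \<open>ip\<close>\<close>

definition orth_complement :: "('a \<Rightarrow> 'a \<Rightarrow> real) \<Rightarrow> 'a set \<Rightarrow> 'a set \<Rightarrow> 'a set" where
  "orth_complement ip L C = {Y \<in> L. \<forall>X\<in>C. ip X Y = 0}"

definition orth_proj :: "('a::minus \<Rightarrow> 'a \<Rightarrow> real) \<Rightarrow> 'a set \<Rightarrow> 'a \<Rightarrow> 'a" where
  "orth_proj ip C X = (THE Y. Y \<in> C \<and> (\<forall>Z\<in>C. ip (X - Y) Z = 0))"

definition orthonormal_basis ::
    "('a::real_vector \<Rightarrow> 'a \<Rightarrow> real) \<Rightarrow> 'a set \<Rightarrow> 'a set \<Rightarrow> bool" where
  "orthonormal_basis ip H E \<longleftrightarrow>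
     finite E \<and> span E = H \<and> (\<forall>e\<in>E. \<forall>e'\<in>E. ip e e' = (if e = e' then 1 else 0))"


subsection \<open>Left-invariant sub-Riemannian structures\<close>

text \<open>
  Here \<open>H\<close> is the horizontal subspace of the Lie algebra and \<open>ip\<close> the inner product. Tangent vectors
  of \<open>G\<close> at \<open>g\<close> are matrices \<open>g ** X\<close> with \<open>X\<close> in the Lie algebra.
\<close>

definition horizontal_at ::
    "(('k::{real_normed_field,euclidean_space})^'n^'n) set \<Rightarrow> 'k^'n^'n \<Rightarrow> ('k^'n^'n) set" where
  "horizontal_at H g = (\<lambda>X. g ** X) ` H"

definition tangent_norm ::
    "(('k::{real_normed_field,euclidean_space})^'n^'n \<Rightarrow> 'k^'n^'n \<Rightarrow> real)
       \<Rightarrow> 'k^'n^'n \<Rightarrow> 'k^'n^'n \<Rightarrow> real" where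
  "tangent_norm ip g v = sqrt (ip (matrix_inv g ** v) (matrix_inv g ** v))"

definition abs_cont_curve :: "real \<Rightarrow> real \<Rightarrow> (real \<Rightarrow> 'a::real_normed_vector) \<Rightarrow> bool" where
  "abs_cont_curve a b \<gamma> \<longleftrightarrow>
     (\<forall>\<epsilon>>0. \<exists>\<delta>>0. \<forall>(m::nat) u v.
        (\<forall>i<m. a \<le> u i \<and> u i \<le> v i \<and> v i \<le> b) \<and>
        (\<forall>i<m. \<forall>j<m. i \<noteq> j \<longrightarrow> v i \<le> u j \<or> v j \<le> u i) \<and>
        (\<Sum>i<m. v i - u i) < \<delta>
        \<longrightarrow> (\<Sum>i<m. norm (\<gamma> (v i) - \<gamma> (u i))) < \<epsilon>)"

definition horizontal_curve ::
    "(('k::{real_normed_field,euclidean_space})^'n^'n) set \<Rightarrow> ('k^'n^'n) set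
       \<Rightarrow> real \<Rightarrow> real \<Rightarrow> (real \<Rightarrow> 'k^'n^'n) \<Rightarrow> bool" where
  "horizontal_curve G H a b \<gamma> \<longleftrightarrow>
     a < b \<and> \<gamma> ` {a..b} \<subseteq> G \<and> abs_cont_curve a b \<gamma> \<and>
     (\<forall>t\<in>{a..b}. \<forall>v. (\<gamma> has_vector_derivative v) (at t within {a..b})
                      \<longrightarrow> v \<in> horizontal_at H (\<gamma> t))"

definition curve_length ::
    "(('k::{real_normed_field,euclidean_space})^'n^'n \<Rightarrow> 'k^'n^'n \<Rightarrow> real)
       \<Rightarrow> real \<Rightarrow> real \<Rightarrow> (real \<Rightarrow> 'k^'n^'n) \<Rightarrow> real" where
  "curve_length ip a b \<gamma> =
     integral {a..b} (\<lambda>t. tangent_norm ip (\<gamma> t) (vector_derivative \<gamma> (at t within {a..b})))"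

definition length_minimizer ::
    "(('k::{real_normed_field,euclidean_space})^'n^'n) set
       \<Rightarrow> ('k^'n^'n \<Rightarrow> 'k^'n^'n \<Rightarrow> real) \<Rightarrow> ('k^'n^'n) set
       \<Rightarrow> real \<Rightarrow> real \<Rightarrow> (real \<Rightarrow> 'k^'n^'n) \<Rightarrow> bool" where
  "length_minimizer G ip H a b \<gamma> \<longleftrightarrow>
     horizontal_curve G H a b \<gamma> \<and>
     (\<forall>c d \<eta>. horizontal_curve G H c d \<eta> \<and> \<eta> c = \<gamma> a \<and> \<eta> d = \<gamma> b
               \<longrightarrow> curve_length ip a b \<gamma> \<le> curve_length ip c d \<eta>)"

definition sr_geodesic ::
    "(('k::{real_normed_field,euclidean_space})^'n^'n) set
       \<Rightarrow> ('k^'n^'n \<Rightarrow> 'k^'n^'n \<Rightarrow> real) \<Rightarrow> ('k^'n^'n) set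
       \<Rightarrow> real \<Rightarrow> real \<Rightarrow> (real \<Rightarrow> 'k^'n^'n) \<Rightarrow> bool" where
  "sr_geodesic G ip H a b \<gamma> \<longleftrightarrow>
     horizontal_curve G H a b \<gamma> \<and>
     (\<forall>t\<in>{a..b}. \<exists>\<delta>>0. \<forall>c d. c < d \<and> {c..d} \<subseteq> {a..b} \<inter> {t - \<delta><..<t + \<delta>}
                      \<longrightarrow> length_minimizer G ip H c d \<gamma>)"

text \<open>
  Length does not see the parametrization, whereas solutions of Hamilton's equations and the
  curves \<open>exp (t X) exp (- t Y)\<close> have constant speed. Geodesics are therefore taken with a
  parametrization of constant speed, i.e. \<open>\<parallel>\<gamma>'(t)\<parallel> = s\<close> for almost every \<open>t\<close>. (A local length
  minimizer that pauses may even continue in an unrelated direction, so a statement for arbitrary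
  parametrizations fails also up to reparametrization.)
\<close>

definition constant_speed ::
    "(('k::{real_normed_field,euclidean_space})^'n^'n \<Rightarrow> 'k^'n^'n \<Rightarrow> real)
       \<Rightarrow> real \<Rightarrow> real \<Rightarrow> (real \<Rightarrow> 'k^'n^'n) \<Rightarrow> bool" where
  "constant_speed ip a b \<gamma> \<longleftrightarrow>
     (\<exists>s. negligible {t \<in> {a..b}.
        \<not> (\<exists>v. (\<gamma> has_vector_derivative v) (at t within {a..b}) \<and> tangent_norm ip (\<gamma> t) v = s)})"


subsection \<open>Hamilton's equations on the cotangent bundle\<close>

text \<open>
  A covector at \<open>g\<close> is represented by a linear functional on the space of all matrices; only its
  restriction to the tangent space \<open>g ** L\<close> matters, where \<open>L\<close> is the Lie algebra.
\<close>

definition sr_hamiltonian ::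
    "(('k::{real_normed_field,euclidean_space})^'n^'n) set
       \<Rightarrow> 'k^'n^'n \<Rightarrow> ('k^'n^'n \<Rightarrow> real) \<Rightarrow> real" where
  "sr_hamiltonian E g p = 1/2 * (\<Sum>e\<in>E. (p (g ** e))\<^sup>2)"

text \<open>
  Local coordinates on \<open>G\<close> around \<open>g\<close>, with values in the vector space \<open>L\<close>, are given by the
  parametrization \<open>X \<mapsto> g exp X\<close>. The induced canonical coordinates of a covector \<open>p\<close> at
  \<open>g exp X\<close> are \<open>(X, \<xi>)\<close>, where \<open>\<xi> = p \<circ> D\<^sub>X\<close> is a linear functional on \<open>L\<close> and \<open>D\<^sub>X\<close> is the derivative
  of the parametrization at \<open>X\<close>; conversely \<open>p = \<xi> \<circ> D\<^sub>X\<inverse>\<close>.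
\<close>

definition exp_chart ::
    "('k::{real_normed_field,euclidean_space})^'n^'n \<Rightarrow> 'k^'n^'n \<Rightarrow> 'k^'n^'n" where
  "exp_chart g X = g ** mexp X"

definition chart_deriv ::
    "('k::{real_normed_field,euclidean_space})^'n^'n \<Rightarrow> 'k^'n^'n \<Rightarrow> 'k^'n^'n \<Rightarrow> 'k^'n^'n" where
  "chart_deriv g X = frechet_derivative (exp_chart g) (at X)"

definition coord_hamiltonian ::
    "(('k::{real_normed_field,euclidean_space})^'n^'n) set \<Rightarrow> ('k^'n^'n) set
       \<Rightarrow> 'k^'n^'n \<Rightarrow> 'k^'n^'n \<Rightarrow> ('k^'n^'n \<Rightarrow> real) \<Rightarrow> real" where
  "coord_hamiltonian L E g X \<xi> =
     sr_hamiltonian E (exp_chart g X) (\<xi> \<circ> inv_into L (chart_deriv g X))"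

text \<open>
  Hamilton's equations \<open>X' = \<partial>h/\<partial>\<xi>\<close>, \<open>\<xi>' = - \<partial>h/\<partial>X\<close> at the time \<open>t\<close>, in the canonical coordinates
  centred at \<open>\<gamma>(t)\<close>; \<open>h\<close> is the Hamiltonian in these coordinates, \<open>(X(s), \<xi>(s))\<close> are the coordinates
  of \<open>(\<gamma>(s), p(s))\<close> for \<open>s\<close> near \<open>t\<close>, and \<open>X(t) = 0\<close>. The partial derivatives are taken in all
  directions \<open>\<eta>\<close> of the dual of \<open>L\<close> and \<open>Y\<close> of \<open>L\<close>. Hamilton's equations are invariant under changes
  of canonical coordinates, so it does not matter that the chart depends on \<open>t\<close>.
\<close>

definition hamilton_equations_at ::
    "(('k::{real_normed_field,euclidean_space})^'n^'n) set \<Rightarrow> ('k^'n^'n) set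
       \<Rightarrow> real set \<Rightarrow> (real \<Rightarrow> 'k^'n^'n) \<Rightarrow> (real \<Rightarrow> 'k^'n^'n \<Rightarrow> real) \<Rightarrow> real \<Rightarrow> bool" where
  "hamilton_equations_at L E S \<gamma> p t \<longleftrightarrow>
     (\<exists>X X' \<xi> \<xi>'.
        X t = 0 \<and>
        (\<forall>\<^sub>F s in at t within S. X s \<in> L \<and> exp_chart (\<gamma> t) (X s) = \<gamma> s) \<and>
        (\<forall>s. \<xi> s = p s \<circ> chart_deriv (\<gamma> t) (X s)) \<and>
        (X has_vector_derivative X') (at t within S) \<and>
        (\<forall>Y\<in>L. ((\<lambda>s. \<xi> s Y) has_real_derivative \<xi>' Y) (at t within S)) \<and>
        (\<forall>\<eta>. linear \<eta> \<longrightarrow>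
           ((\<lambda>\<epsilon>. coord_hamiltonian L E (\<gamma> t) (X t) (\<lambda>Y. \<xi> t Y + \<epsilon> * \<eta> Y))
              has_real_derivative \<eta> X') (at 0)) \<and>
        (\<forall>Y\<in>L.
           ((\<lambda>\<epsilon>. coord_hamiltonian L E (\<gamma> t) (X t + \<epsilon> *\<^sub>R Y) (\<xi> t))
              has_real_derivative - \<xi>' Y) (at 0)))"

text \<open>The Hamiltonian does not depend on the choice of the orthonormal basis \<open>E\<close>.\<close>

definition normal_geodesic ::
    "(('k::{real_normed_field,euclidean_space})^'n^'n) set
       \<Rightarrow> ('k^'n^'n \<Rightarrow> 'k^'n^'n \<Rightarrow> real) \<Rightarrow> ('k^'n^'n) set
       \<Rightarrow> real \<Rightarrow> real \<Rightarrow> (real \<Rightarrow> 'k^'n^'n) \<Rightarrow> bool" where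
  "normal_geodesic G ip H a b \<gamma> \<longleftrightarrow>
     sr_geodesic G ip H a b \<gamma> \<and>
     (\<exists>E p. orthonormal_basis ip H E \<and>
        (\<forall>t\<in>{a..b}. linear (p t)) \<and>
        (\<forall>t\<in>{a..b}. hamilton_equations_at (lie_algebra G) E {a..b} \<gamma> p t))"

end

theory Submission
  imports Defs
begin

text \<open>
  Let \<open>u\<close> be the control of a minimizing curve \<open>\<gamma>\<close> of constant speed. Since \<open>\<T>\<close> is abelian and normalizes \<open>\<H>\<close>, a
  variation \<open>\<gamma> e\<^sup>\<eta>\<close> becomes horizontal after right multiplication by \<open>e\<^sup>-\<^sup>\<theta>\<close> with \<open>\<theta>\<close> the integral of the \<open>\<T>\<close>-part
  of its control. It has the endpoints of \<open>\<gamma>\<close> as soon as \<open>\<theta>\<close> vanishes at the end, which is a constraint with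
  values in the finite-dimensional space \<open>\<T>\<close>. The functionals on \<open>\<T>\<close> that annihilate the linearized constraint
  are given by the elements of \<open>\<T>\<close> that commute with all values of \<open>u\<close>; for \<open>\<eta>\<close> in the centralizer of these
  elements the constraint is regular onto their complement in \<open>\<T>\<close>, so there is always a Lagrange multiplier
  \<open>Z \<in> \<T>\<close> and no abnormal case is left. The Euler--Lagrange equation is \<open>u' = [Z, u]\<close>. Its solutions are
  \<open>\<gamma>(t) = \<gamma>(p) exp((t - p)(U + Z)) exp(-(t - p) Z)\<close>. Two multipliers on overlapping intervals differ by an element that
  commutes with \<open>u\<close>, so the local formulas fit together, and the covector dual to \<open>u + Z\<close> solves Hamilton's
  equations along \<open>\<gamma>\<close>.
\<close>

text \<open>The control of a minimizer is a priori only bounded and measurable, so the first-order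
  condition cannot be differentiated: it is tested in integrated form against Lipschitz variations,
  and smoothness is an outcome, since off a null set the control coincides with an affine function
  of the bracket of the multiplier with its own primitive. The multiplier comes from an open mapping
  argument: if energy and constraint had independent first variations, a finite-dimensional family
  of variations would contain a closed-up curve of smaller energy. This asks for continuity near 0
  and differentiability at 0 only. A multiplier without energy component would lie in the set
  \<open>A\<close> of annihilators and be orthogonal to it at the same time, hence vanish.
  Compactness enters through the metric (the maps Ad(exp(tX)) are bounded, which together with the
  trivial centre of a semisimple algebra makes the Killing form negative definite), through the
  closedness of \<open>G\<close>, which provides small logarithms in the Lie algebra, and through
  bounds on the curves themselves.\<close>

section \<open>The exponential of matrices and its differential\<close>

text \<open>The library's \<open>exp\<close> needs a Banach algebra, which the type of square matrices is not; endomorphisms are one.\<close>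

typedef (overloaded) 'a endo = "UNIV :: ('a::euclidean_space \<Rightarrow>\<^sub>L 'a) set"
  by simp

setup_lifting type_definition_endo

instantiation endo :: (euclidean_space) "{real_algebra_1, real_normed_vector}"
begin

lift_definition zero_endo :: "'a endo" is "0" .
lift_definition one_endo :: "'a endo" is "id_blinfun" .
lift_definition plus_endo :: "'a endo \<Rightarrow> 'a endo \<Rightarrow> 'a endo" is "(+)" .
lift_definition minus_endo :: "'a endo \<Rightarrow> 'a endo \<Rightarrow> 'a endo" is "(-)" .
lift_definition uminus_endo :: "'a endo \<Rightarrow> 'a endo" is "uminus" .
lift_definition times_endo :: "'a endo \<Rightarrow> 'a endo \<Rightarrow> 'a endo" is "(o\<^sub>L)" .
lift_definition scaleR_endo :: "real \<Rightarrow> 'a endo \<Rightarrow> 'a endo" is "(*\<^sub>R)" .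
lift_definition norm_endo :: "'a endo \<Rightarrow> real" is "norm" .
lift_definition sgn_endo :: "'a endo \<Rightarrow> 'a endo" is "sgn" .

definition dist_endo :: "'a endo \<Rightarrow> 'a endo \<Rightarrow> real" where "dist_endo x y = norm (x - y)"
definition uniformity_endo :: "('a endo \<times> 'a endo) filter"
  where "uniformity_endo = (INF e\<in>{0<..}. principal {(x, y). dist x y < e})"
definition open_endo :: "'a endo set \<Rightarrow> bool"
  where "open_endo U = (\<forall>x\<in>U. \<forall>\<^sub>F (x', y) in uniformity. x' = x \<longrightarrow> y \<in> U)"

instance
proof
  fix a b c :: "'a endo" and r s :: real and U :: "'a endo set"
  show "a + b + c = a + (b + c)" "a + b = b + a" "0 + a = a" "- a + a = 0" "a - b = a + - b"
    "r *\<^sub>R (a + b) = r *\<^sub>R a + r *\<^sub>R b" "(r + s) *\<^sub>R a = r *\<^sub>R a + s *\<^sub>R a"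
    "r *\<^sub>R s *\<^sub>R a = (r * s) *\<^sub>R a" "1 *\<^sub>R a = a"
    by (transfer; simp add: algebra_simps)+
  show "a * b * c = a * (b * c)" "1 * a = a" "a * 1 = a"
    "(a + b) * c = a * c + b * c" "a * (b + c) = a * b + a * c"
    "r *\<^sub>R a * b = r *\<^sub>R (a * b)" "a * r *\<^sub>R b = r *\<^sub>R (a * b)"
    by (transfer; rule blinfun_eqI; simp add: blinfun.bilinear_simps)+
  show "(0::'a endo) \<noteq> 1"
  proof transfer
    have "blinfun_apply 0 (SOME b. b \<in> (Basis::'a set)) \<noteq> blinfun_apply id_blinfun (SOME b. b \<in> Basis)"
      using SOME_Basis nonzero_Basis by fastforce
    then show "(0::'a \<Rightarrow>\<^sub>L 'a) \<noteq> id_blinfun" by metis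
  qed
  show "dist a b = norm (a - b)" "open U = (\<forall>x\<in>U. \<forall>\<^sub>F (x', y) in uniformity. x' = x \<longrightarrow> y \<in> U)"
    "(uniformity :: ('a endo \<times> 'a endo) filter) = (INF e\<in>{0<..}. principal {(x, y). dist x y < e})"
    by (simp_all add: dist_endo_def open_endo_def uniformity_endo_def)
  show "(norm a = 0) = (a = 0)" by transfer simp
  show "norm (a + b) \<le> norm a + norm b" by transfer (rule norm_triangle_ineq)
  show "norm (r *\<^sub>R a) = \<bar>r\<bar> * norm a" by transfer simp
  show "sgn a = inverse (norm a) *\<^sub>R a" 
    by transfer (rule sgn_div_norm)
qed

end

instance endo :: (euclidean_space) real_normed_algebra_1
proof
  fix a b :: "'a endo"
  show "norm (a * b) \<le> norm a * norm b" by transfer (rule norm_blinfun_compose)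
  show "norm (1::'a endo) = 1" by transfer (rule norm_blinfun_id)
qed

lemma bounded_linear_Rep_endo: "bounded_linear Rep_endo"
  by (rule bounded_linear_intro[where K=1]) (transfer; simp)+

lemma bounded_linear_Abs_endo: "bounded_linear Abs_endo"
  by (rule bounded_linear_intro[where K=1])
    (simp_all add: plus_endo.abs_eq scaleR_endo.abs_eq norm_endo.abs_eq eq_onp_def)

instance endo :: (euclidean_space) banach
proof
  fix X :: "nat \<Rightarrow> 'a endo"
  assume "Cauchy X"
  then have "Cauchy (\<lambda>n. Rep_endo (X n))" by (rule bounded_linear.Cauchy[OF bounded_linear_Rep_endo])
  then obtain l where "(\<lambda>n. Rep_endo (X n)) \<longlonglongrightarrow> l" by (auto simp: Cauchy_convergent_iff convergent_def)
  from bounded_linear.tendsto[OF bounded_linear_Abs_endo this]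
  show "convergent X" by (auto simp: Rep_endo_inverse convergent_def)
qed

lemma bilinear_matrix_matrix_mult:
  "bilinear ((**) :: (('k::{real_normed_field,euclidean_space})^'n^'n) \<Rightarrow> _)"
  by (auto simp: bilinear_def linear_iff vec_eq_iff matrix_matrix_mult_def
      distrib_right distrib_left sum.distrib scaleR_sum_right)

interpretation mm: bounded_bilinear "(**) :: (('k::{real_normed_field,euclidean_space})^'n^'n) \<Rightarrow> _"
  using bilinear_matrix_matrix_mult bilinear_conv_bounded_bilinear by blast

text \<open>Left multiplication embeds the matrices as an algebra into the Banach algebra of
  endomorphisms. Evaluation at the identity matrix, \<open>ev1\<close>, is a continuous linear left
  inverse, so facts about \<open>exp\<close> pass to \<open>mexp\<close>.\<close>

definition lmult :: "('k::{real_normed_field,euclidean_space})^'n^'n \<Rightarrow> ('k^'n^'n) endo" where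
  "lmult A = Abs_endo (mm.prod_right A)"

definition ev1 :: "('k^'n^'n) endo \<Rightarrow> ('k::{real_normed_field,euclidean_space})^'n^'n" where
  "ev1 T = blinfun_apply (Rep_endo T) (mat 1)"

lemma Rep_lmult: "Rep_endo (lmult A) = mm.prod_right A"
  by (simp add: lmult_def Abs_endo_inverse)

lemma bounded_linear_ev1: "bounded_linear ev1"
  unfolding ev1_def by (intro bounded_linear_compose[OF blinfun.bounded_linear_left bounded_linear_Rep_endo])

lemma bounded_linear_lmult: "bounded_linear lmult"
  unfolding lmult_def[abs_def] 
  by (rule bounded_linear_compose[OF bounded_linear_Abs_endo mm.bounded_linear_prod_right])

lemma lmult_mult: "lmult (A ** B) = lmult A * lmult B"
  by (subst Rep_endo_inject[symmetric])
    (rule blinfun_eqI, simp add: times_endo.rep_eq Rep_lmult mm.prod_right.rep_eq matrix_mul_assoc)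

lemma lmult_mat1: "lmult (mat 1) = 1"
  by (subst Rep_endo_inject[symmetric])
    (rule blinfun_eqI, simp add: one_endo.rep_eq Rep_lmult mm.prod_right.rep_eq)

lemma ev1_lmult [simp]: "ev1 (lmult A) = A"
  by (simp add: ev1_def Rep_lmult mm.prod_right.rep_eq)

lemma lmult_mpow: "lmult (mpow A k) = lmult A ^ k"
  by (induction k) (simp_all add: lmult_mat1 lmult_mult)

lemma lmult_scaleR: "lmult (r *\<^sub>R A) = r *\<^sub>R lmult A"
  by (rule linear_simps(5)[OF bounded_linear_lmult])

text \<open>The series defining \<open>mexp\<close> converges because it is the image under
  \<open>ev1\<close> of an exponential series in a Banach algebra; only then may
  \<open>lmult\<close> be moved inside the sum.\<close>

lemma lmult_mexp: "lmult (mexp A) = exp (lmult A)"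
proof -
  have s: "(\<lambda>k. lmult A ^ k /\<^sub>R fact k) sums exp (lmult A)" by (rule exp_converges)
  have e: "ev1 (lmult A ^ k /\<^sub>R fact k) = mpow A k /\<^sub>R fact k" for k
    by (simp add: lmult_scaleR[symmetric] lmult_mpow[symmetric])
  have "(\<lambda>k. mpow A k /\<^sub>R fact k) sums ev1 (exp (lmult A))"
    using bounded_linear.sums[OF bounded_linear_ev1 s] by (simp add: e)
  then have m: "(\<lambda>k. mpow A k /\<^sub>R fact k) sums mexp A"
    unfolding mexp_def by (rule summable_sums[OF sums_summable])
  have "(\<lambda>k. lmult A ^ k /\<^sub>R fact k) sums lmult (mexp A)"
    using bounded_linear.sums[OF bounded_linear_lmult m] by (simp add: lmult_scaleR lmult_mpow)
  with s show ?thesis using sums_unique2 by blast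
qed

lemma lmult_inj: "lmult A = lmult B \<Longrightarrow> A = B"
  by (metis ev1_lmult)

lemma mexp_ev1: "mexp A = ev1 (exp (lmult A))"
  by (metis ev1_lmult lmult_mexp)

lemma mexp_0 [simp]: "mexp 0 = mat 1"
  by (rule lmult_inj) (simp add: lmult_mexp lmult_mat1 linear_simps(3)[OF bounded_linear_lmult])

lemma lmult_add: "lmult (A + B) = lmult A + lmult B"
  and lmult_minus: "lmult (- A) = - lmult A"
  by (rule linear_simps(1)[OF bounded_linear_lmult], rule linear_simps(4)[OF bounded_linear_lmult])

lemma mexp_add_commuting:
  assumes "A ** B = B ** A"
  shows "mexp (A + B) = mexp A ** mexp B"
proof (rule lmult_inj)
  have "lmult A * lmult B = lmult B * lmult A" using assms by (metis lmult_mult)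
  then show "lmult (mexp (A + B)) = lmult (mexp A ** mexp B)"
    by (simp add: lmult_mexp lmult_mult lmult_add exp_add_commuting)
qed

lemma mexp_minus_left [simp]: "mexp (- A) ** mexp A = mat 1"
  using mexp_add_commuting[of "-A" A] by (simp add: mm.minus_left mm.minus_right)

lemma mexp_minus_right [simp]: "mexp A ** mexp (- A) = mat 1"
  using mexp_add_commuting[of A "-A"] by (simp add: mm.minus_left mm.minus_right)

lemma mexp_scaleR_has_vector_derivative_left:
  "((\<lambda>t. mexp (t *\<^sub>R A)) has_vector_derivative A ** mexp (t *\<^sub>R A)) (at t within S)"
proof -
  have "((\<lambda>t. ev1 (exp (t *\<^sub>R lmult A))) has_vector_derivative ev1 (lmult A * exp (t *\<^sub>R lmult A))) (at t within S)"
    by (rule bounded_linear.has_vector_derivative[OF bounded_linear_ev1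
        has_vector_derivative_at_within[OF exp_scaleR_has_vector_derivative_left]])
  then show ?thesis
    by (simp add: lmult_scaleR[symmetric] mexp_ev1[symmetric]) (simp add: lmult_mexp[symmetric] lmult_mult[symmetric])
qed

lemma mexp_scaleR_has_vector_derivative_right:
  "((\<lambda>t. mexp (t *\<^sub>R A)) has_vector_derivative mexp (t *\<^sub>R A) ** A) (at t within S)"
proof -
  have "((\<lambda>t. ev1 (exp (t *\<^sub>R lmult A))) has_vector_derivative ev1 (exp (t *\<^sub>R lmult A) * lmult A)) (at t within S)"
    by (rule bounded_linear.has_vector_derivative[OF bounded_linear_ev1
        exp_scaleR_has_vector_derivative_right])
  then show ?thesis
    by (simp add: lmult_scaleR[symmetric] mexp_ev1[symmetric]) (simp add: lmult_mexp[symmetric] lmult_mult[symmetric])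
qed

lemma norm_mexp_bound: "\<exists>K>0. \<forall>A::('k::{real_normed_field,euclidean_space})^'n^'n. norm (mexp A) \<le> K * exp (K * norm A)"
proof -
  obtain K1 where K1: "K1 > 0" "\<And>T::('k^'n^'n) endo. norm (ev1 T) \<le> norm T * K1"
    using bounded_linear.pos_bounded[OF bounded_linear_ev1] by blast
  obtain K2 where K2: "K2 > 0" "\<And>A::'k^'n^'n. norm (lmult A) \<le> norm A * K2"
    using bounded_linear.pos_bounded[OF bounded_linear_lmult] by blast
  have "norm (mexp A) \<le> (K1 + K2) * exp ((K1 + K2) * norm A)" for A :: "'k^'n^'n"
  proof -
    have "norm (mexp A) \<le> exp (norm (lmult A)) * K1"
      unfolding mexp_ev1 using K1 norm_exp[of "lmult A"]
      by (meson mult_right_mono order_trans less_imp_le)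
    also have "\<dots> \<le> exp ((K1 + K2) * norm A) * (K1 + K2)"
    proof (rule mult_mono)
      have "norm A * K2 \<le> (K1 + K2) * norm A" using K1(1) by (simp add: algebra_simps)
      then show "exp (norm (lmult A)) \<le> exp ((K1 + K2) * norm A)"
        using K2(2)[of A] by simp
    qed (use K1 K2 in auto)
    finally show ?thesis by (simp add: mult.commute)
  qed
  then show ?thesis using K1 K2 by (intro exI[of _ "K1 + K2"]) auto
qed

text \<open>This is the integrand of Duhamel's formula. Over s in [0,1] it compares exp(A + B) with
  exp A through an expression with an explicit factor \<open>B\<close>, which yields both the
  Lipschitz bound and the differential of the exponential.\<close>

lemma duhamel_has_vector_derivative:
  "((\<lambda>s. mexp (- (s *\<^sub>R A)) ** mexp (s *\<^sub>R (A + B))) has_vector_derivative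
     mexp (- (s *\<^sub>R A)) ** B ** mexp (s *\<^sub>R (A + B))) (at s within S)"
proof -
  have 1: "((\<lambda>s. mexp (s *\<^sub>R (- A))) has_vector_derivative mexp (s *\<^sub>R (- A)) ** (- A)) (at s within S)"
    by (rule mexp_scaleR_has_vector_derivative_right)
  have 2: "((\<lambda>s. mexp (s *\<^sub>R (A + B))) has_vector_derivative (A + B) ** mexp (s *\<^sub>R (A + B))) (at s within S)"
    by (rule mexp_scaleR_has_vector_derivative_left)
  from mm.has_vector_derivative[OF 1 2] show ?thesis
    by (simp add: mm.minus_right mm.minus_left mm.add_right mm.add_left matrix_mul_assoc)
qed

text \<open>By Duhamel and the mean value inequality, exp(-A) exp(B) differs from 1 by a multiple of
  |B - A|; multiplication by exp(A) gives the claim. In the constant, each \<open>b\<close> bounds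
  one of the three exponentials involved and each \<open>M\<close> one matrix product.\<close>

lemma mexp_lipschitz:
  "\<exists>c\<ge>0. \<forall>(A::('k::{real_normed_field,euclidean_space})^'n^'n) (B::'k^'n^'n).
     norm A \<le> R \<longrightarrow> norm B \<le> R \<longrightarrow> norm (mexp B - mexp A) \<le> c * norm (B - A)"
proof -
  obtain K where K: "K > 0" "\<And>A::'k^'n^'n. norm (mexp A) \<le> K * exp (K * norm A)"
    using norm_mexp_bound by blast
  obtain M where M: "M > 0" "\<And>(A::'k^'n^'n) (B::'k^'n^'n). norm (A ** B) \<le> norm A * norm B * M"
    using mm.pos_bounded by blast
  define b where "b = K * exp (K * R)"
  have b: "norm (mexp A) \<le> b" if "norm A \<le> R" for A :: "'k^'n^'n"
    using K(2)[of A] that K(1) by (smt (verit, best) b_def exp_le_cancel_iff mult_left_mono)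
  have b0: "b > 0" using K by (simp add: b_def)
  define c where "c = b * M * b * M * b * M"
  have "norm (mexp B - mexp A) \<le> c * norm (B - A)" if A: "norm A \<le> R" and B: "norm B \<le> R" for A B :: "'k^'n^'n"
  proof -
    have dh: "((\<lambda>s. mexp (- (s *\<^sub>R A)) ** mexp (s *\<^sub>R B)) has_vector_derivative
        mexp (- (s *\<^sub>R A)) ** (B - A) ** mexp (s *\<^sub>R B)) (at s within S)" for s S
      using duhamel_has_vector_derivative[of A "B - A"] by simp
    have sc: "norm (s *\<^sub>R X) \<le> R" if "norm X \<le> R" "0 < s" "s < 1" for s and X :: "'k^'n^'n"
      using that by (simp add: order_trans[OF mult_left_le_one_le])
    have "norm (mexp (- (1 *\<^sub>R A)) ** mexp (1 *\<^sub>R B) - mexp (- (0 *\<^sub>R A)) ** mexp (0 *\<^sub>R B))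
         \<le> b * M * b * M * norm (B - A) * 1 - b * M * b * M * norm (B - A) * 0"
    proof (rule differentiable_bound_general[where f' = "\<lambda>s. mexp (- (s *\<^sub>R A)) ** (B - A) ** mexp (s *\<^sub>R B)"
            and \<phi>' = "\<lambda>s. b * M * b * M * norm (B - A)"])
      show "continuous_on {0..1} (\<lambda>s. mexp (- (s *\<^sub>R A)) ** mexp (s *\<^sub>R B))"
        by (rule continuous_on_vector_derivative[OF dh])
      show "((*) (b * M * b * M * norm (B - A)) has_vector_derivative b * M * b * M * norm (B - A)) (at s)" for s :: real
        using has_real_derivative_iff_has_vector_derivative by (fastforce intro!: derivative_eq_intros)
      fix s :: real assume s: "0 < s" "s < 1"
      have 1: "norm (mexp (- (s *\<^sub>R A))) \<le> b" "norm (mexp (s *\<^sub>R B)) \<le> b"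
        using b[of "- (s *\<^sub>R A)"] b[of "s *\<^sub>R B"] sc[OF A s] sc[OF B s] by auto
      have "norm (mexp (- (s *\<^sub>R A)) ** (B - A) ** mexp (s *\<^sub>R B))
           \<le> (norm (mexp (- (s *\<^sub>R A))) * norm (B - A) * M) * norm (mexp (s *\<^sub>R B)) * M"
        using M(2)[of "mexp (- (s *\<^sub>R A)) ** (B - A)" "mexp (s *\<^sub>R B)"]
            mult_right_mono[OF mult_right_mono[OF M(2)[of "mexp (- (s *\<^sub>R A))" "B - A"], of "norm (mexp (s *\<^sub>R B))"], of M] M(1)
        by simp
      also have "\<dots> \<le> (b * norm (B - A) * M) * b * M"
        using 1 M(1) b0 by (intro mult_mono mult_nonneg_nonneg order_refl) auto
      finally show "norm (mexp (- (s *\<^sub>R A)) ** (B - A) ** mexp (s *\<^sub>R B)) \<le> b * M * b * M * norm (B - A)"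
        by (simp add: mult_ac)
    qed (auto intro!: continuous_intros intro: dh)
    then have 2: "norm (mexp (- A) ** mexp B - mat 1) \<le> b * M * b * M * norm (B - A)"
      by (simp add: matrix_mul_assoc)
    have "mexp B - mexp A = mexp A ** (mexp (- A) ** mexp B - mat 1)"
      by (simp add: mm.diff_right matrix_mul_assoc)
    then have "norm (mexp B - mexp A) \<le> norm (mexp A) * norm (mexp (- A) ** mexp B - mat 1) * M"
      using M(2) by simp
    also have "\<dots> \<le> b * (b * M * b * M * norm (B - A)) * M"
      using 2 b[OF A] M(1) b0 by (intro mult_mono) auto
    finally show ?thesis by (simp add: c_def mult_ac)
  qed
  moreover have "c \<ge> 0" using b0 M by (simp add: c_def)
  ultimately show ?thesis by blast
qed

lemma continuous_mexp: "continuous_on UNIV (mexp :: ('k::{real_normed_field,euclidean_space})^'n^'n \<Rightarrow> _)"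
proof -
  have "isCont mexp A" for A :: "'k^'n^'n"
  proof -
    obtain c where c: "\<And>A' B::'k^'n^'n. norm A' \<le> norm A + 1 \<Longrightarrow> norm B \<le> norm A + 1 \<Longrightarrow> norm (mexp B - mexp A') \<le> c * norm (B - A')"
      using mexp_lipschitz[of "norm A + 1"] by blast
    have "(\<lambda>h. mexp (A + h) - mexp A) \<midarrow>0\<rightarrow> 0"
    proof (rule Lim_transform_bound)
      have "norm (mexp (A + h) - mexp A) \<le> norm (c * norm h)" if "norm h < 1" for h
        using c[of A "A + h"] norm_triangle_ineq[of A h] that by auto
      then show "\<forall>\<^sub>F h in at 0. norm (mexp (A + h) - mexp A) \<le> norm (c * norm h)"
        by (auto simp: eventually_at intro!: exI[of _ 1])
      show "(\<lambda>h. c * norm h) \<midarrow>(0::'k^'n^'n)\<rightarrow> 0" by (auto intro!: tendsto_eq_intros)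
    qed
    from LIM_zero_cancel[OF this] show ?thesis by (simp only: isCont_iff)
  qed
  then show ?thesis by (simp add: continuous_on_eq_continuous_at)
qed

lemma continuous_on_mexp [continuous_intros]:
  "continuous_on S f \<Longrightarrow> continuous_on S (\<lambda>x. mexp (f x))"
  using continuous_on_compose2[OF continuous_mexp] by blast

lemma tendsto_mexp [tendsto_intros]: "(f \<longlongrightarrow> a) F \<Longrightarrow> ((\<lambda>x. mexp (f x)) \<longlongrightarrow> mexp a) F"
  by (rule isCont_tendsto_compose[of a mexp], rule continuous_on_interior[OF continuous_mexp]) auto

lemma mexp_conj:
  fixes A P Q :: "('k::{real_normed_field,euclidean_space})^'n^'n"
  assumes "P ** Q = mat 1" "Q ** P = mat 1"
  shows "mexp (P ** A ** Q) = P ** mexp A ** Q"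
proof -
  have s: "(\<lambda>k. mpow B k /\<^sub>R fact k) sums mexp B" for B :: "'k^'n^'n"
    using bounded_linear.sums[OF bounded_linear_ev1 exp_converges[of "lmult B"]]
    by (simp add: lmult_scaleR[symmetric] lmult_mpow[symmetric] mexp_ev1)
  have m: "mpow (P ** A ** Q) k = P ** mpow A k ** Q" for k
  proof (induction k)
    case (Suc k)
    have "mpow (P ** A ** Q) (Suc k) = P ** A ** (Q ** P) ** mpow A k ** Q"
      by (simp add: Suc matrix_mul_assoc)
    then show ?case by (simp only: assms matrix_mul_rid mpow.simps matrix_mul_assoc)
  qed (simp add: assms)
  have "P ** (mpow A k /\<^sub>R fact k) ** Q = mpow (P ** A ** Q) k /\<^sub>R fact k" for k
    by (simp add: m mm.scaleR_left mm.scaleR_right)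
  then have "(\<lambda>k. P ** (mpow A k /\<^sub>R fact k) ** Q) sums mexp (P ** A ** Q)"
    using s[of "P ** A ** Q"] by (simp del: mpow.simps)
  moreover have "(\<lambda>k. P ** (mpow A k /\<^sub>R fact k) ** Q) sums (P ** mexp A ** Q)"
    by (rule bounded_linear.sums[OF mm.bounded_linear_left bounded_linear.sums[OF mm.bounded_linear_right s]])
  ultimately show ?thesis using sums_unique2 by blast
qed


section \<open>The adjoint action and the differential of the exponential\<close>

definition conj_mexp :: "('k::{real_normed_field,euclidean_space})^'n^'n \<Rightarrow> 'k^'n^'n \<Rightarrow> 'k^'n^'n" where
  "conj_mexp X V = mexp (- X) ** V ** mexp X"

text \<open>The integrand is Ad(exp(-sX)) V, so this is the operator (1 - e^(-ad X)) / ad X, the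
  left-trivialized differential of the exponential. In integral form it visibly preserves every
  subspace that contains the integrand.\<close>

definition dexp :: "('k::{real_normed_field,euclidean_space})^'n^'n \<Rightarrow> 'k^'n^'n \<Rightarrow> 'k^'n^'n" where
  "dexp X V = integral {0..1} (\<lambda>s::real. conj_mexp (s *\<^sub>R X) V)"

lemma linear_conj_mexp: "linear (conj_mexp X)"
  by (auto simp: linear_iff conj_mexp_def mm.add_left mm.add_right mm.scaleR_left mm.scaleR_right)

lemma conj_mexp_0 [simp]: "conj_mexp 0 V = V"
  by (simp add: conj_mexp_def)

lemma conj_mexp_minus [simp]: "conj_mexp (- X) (conj_mexp X V) = V"
proof -
  have "mexp X ** (mexp (- X) ** V ** mexp X) ** mexp (- X) = (mexp X ** mexp (- X)) ** V ** (mexp X ** mexp (- X))"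
    by (simp only: matrix_mul_assoc)
  then show ?thesis by (simp add: conj_mexp_def)
qed

lemma conj_mexp_mult: "conj_mexp X (U ** V) = conj_mexp X U ** conj_mexp X V"
proof -
  have "conj_mexp X U ** conj_mexp X V = mexp (- X) ** U ** (mexp X ** mexp (- X)) ** V ** mexp X"
    by (simp only: conj_mexp_def matrix_mul_assoc)
  then show ?thesis by (simp add: conj_mexp_def matrix_mul_assoc)
qed

lemma conj_mexp_bracket: "conj_mexp X (lie_bracket U V) = lie_bracket (conj_mexp X U) (conj_mexp X V)"
  by (simp add: lie_bracket_def linear_diff[OF linear_conj_mexp] conj_mexp_mult)

lemma continuous_on_conj_mexp [continuous_intros]:
  "continuous_on S f \<Longrightarrow> continuous_on S g \<Longrightarrow> continuous_on S (\<lambda>x. conj_mexp (f x) (g x))"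
  unfolding conj_mexp_def by (intro continuous_intros mm.continuous_on)

lemma conj_mexp_has_vector_derivative:
  "((\<lambda>s. conj_mexp (s *\<^sub>R X) V) has_vector_derivative conj_mexp (s *\<^sub>R X) (lie_bracket V X)) (at s within S)"
proof -
  have 1: "((\<lambda>s. mexp (s *\<^sub>R (- X))) has_vector_derivative mexp (s *\<^sub>R (- X)) ** (- X)) (at s within S)"
    by (rule mexp_scaleR_has_vector_derivative_right)
  have 2: "((\<lambda>s. mexp (s *\<^sub>R X)) has_vector_derivative X ** mexp (s *\<^sub>R X)) (at s within S)"
    by (rule mexp_scaleR_has_vector_derivative_left)
  from mm.has_vector_derivative[OF bounded_linear.has_vector_derivative[OF mm.bounded_linear_left 1, of V] 2]
  show ?thesis
    by (simp add: conj_mexp_def lie_bracket_def mm.diff_left mm.diff_right mm.minus_right mm.minus_left matrix_mul_assoc)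
qed

lemma conj_mexp_integrable: "(\<lambda>s. conj_mexp (s *\<^sub>R X) V) integrable_on {a..b}"
  by (intro integrable_continuous_interval continuous_intros)

text \<open>The fundamental theorem along s -> Ad(exp(-sX)) V. It trades a difference of conjugates
  for \<open>dexp\<close> of a bracket, which later merges the two terms of a varied control into
  one and lets the bounds on \<open>dexp\<close> improve themselves.\<close>

lemma conj_mexp_diff: "conj_mexp X V - V = dexp X (lie_bracket V X)"
proof -
  have "((\<lambda>s. conj_mexp (s *\<^sub>R X) (lie_bracket V X)) has_integral conj_mexp (1 *\<^sub>R X) V - conj_mexp (0 *\<^sub>R X) V) {0..1}"
    by (rule fundamental_theorem_of_calculus) (auto intro: conj_mexp_has_vector_derivative)
  then show ?thesis by (simp add: dexp_def integral_unique)
qed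

lemma linear_dexp: "linear (dexp X)"
  by (auto simp: linear_iff dexp_def linear_add[OF linear_conj_mexp] linear_scale[OF linear_conj_mexp]
      integral_add conj_mexp_integrable)

lemma dexp_0 [simp]: "dexp 0 V = V"
  by (simp add: dexp_def)

text \<open>A subspace is its double orthogonal complement, so it suffices to test the integral
  against vectors orthogonal to it. For a non-integrable \<open>f\<close> the integral is the
  default value 0.\<close>

lemma integral_in_subspace:
  fixes f :: "'b::euclidean_space \<Rightarrow> 'a::euclidean_space"
  assumes S: "subspace S" and f: "\<And>t. t \<in> T \<Longrightarrow> f t \<in> S"
  shows "integral T f \<in> S"
proof (cases "f integrable_on T")
  case True
  have "y \<bullet> integral T f = 0" if "y \<in> orthogonal_comp S" for y
  proof -
    have "y \<bullet> integral T f = integral T (\<lambda>t. y \<bullet> f t)"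
      using integral_linear[OF True bounded_linear_inner_right[of y]] by (simp add: o_def)
    also have "\<dots> = integral T (\<lambda>t. 0)"
      using f that by (intro integral_cong) (auto simp: orthogonal_comp_def orthogonal_def inner_commute)
    finally show ?thesis by simp
  qed
  then have "integral T f \<in> orthogonal_comp (orthogonal_comp S)"
    by (auto simp: orthogonal_comp_def orthogonal_def)
  then show ?thesis using orthogonal_comp_self[OF S] by simp
qed (use S in \<open>simp add: not_integrable_integral subspace_0\<close>)

lemma dexp_in_subspace:
  assumes "subspace S" "\<And>s. conj_mexp (s *\<^sub>R X) V \<in> S"
  shows "dexp X V \<in> S"
  unfolding dexp_def by (rule integral_in_subspace) (use assms in auto)

text \<open>Duhamel's formula expresses exp(-X) exp(X + V) - 1 exactly. Replacing exp(s(X + V)) by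
  exp(sX) in its integrand changes it by the Lipschitz constant times |V|, next to a factor
  \<open>V\<close>, so the total error is quadratic in \<open>V\<close>.\<close>

lemma mexp_has_derivative: "(mexp has_derivative (\<lambda>V. mexp X ** dexp X V)) (at X)"
proof -
  obtain M where M: "M > 0" "\<And>(A::'a^'b^'b) (B::'a^'b^'b). norm (A ** B) \<le> norm A * norm B * M"
    using mm.pos_bounded by blast
  obtain c where c: "c \<ge> 0" "\<And>A' B::'a^'b^'b. norm A' \<le> norm X + 1 \<Longrightarrow> norm B \<le> norm X + 1 \<Longrightarrow> norm (mexp B - mexp A') \<le> c * norm (B - A')"
    using mexp_lipschitz[of "norm X + 1"] by blast
  \<comment> \<open>\<open>b\<close> bounds the exponential of every matrix of norm at most that of
    \<open>X\<close>, by comparison with the exponential of 0.\<close>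
  define b where "b = c * (norm X + 1) + norm (mat 1 :: 'a^'b^'b)"
  have b: "norm (mexp A) \<le> b" if "norm A \<le> norm X" for A :: "'a^'b^'b"
  proof -
    have "norm (mexp A - mexp 0) \<le> c * norm (A - 0)" using that by (intro c) auto
    also have "\<dots> \<le> c * (norm X + 1)" using that c(1) by (intro mult_left_mono) auto
    finally show ?thesis using norm_triangle_sub[of "mexp A" "mexp 0"] by (simp add: b_def)
  qed
  have b0: "0 \<le> b" using b[of 0] by (simp add: b_def c(1))
  define C where "C = b * (b * M * (c * 1) * M) * M"
  have bd: "norm (mexp (X + V) - mexp X - mexp X ** dexp X V) \<le> C * norm V * norm V" if V: "norm V \<le> 1" for V
  proof -
    have h1: "((\<lambda>s. mexp (- (s *\<^sub>R X)) ** V ** mexp (s *\<^sub>R (X + V))) has_integral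
        mexp (- (1 *\<^sub>R X)) ** mexp (1 *\<^sub>R (X + V)) - mexp (- (0 *\<^sub>R X)) ** mexp (0 *\<^sub>R (X + V))) {0..1}"
      by (rule fundamental_theorem_of_calculus[OF _ duhamel_has_vector_derivative]) simp
    have h2: "((\<lambda>s. conj_mexp (s *\<^sub>R X) V) has_integral dexp X V) {0..1}"
      unfolding dexp_def by (rule integrable_integral[OF conj_mexp_integrable])
    have hi: "((\<lambda>s. mexp (- (s *\<^sub>R X)) ** V ** mexp (s *\<^sub>R (X + V)) - conj_mexp (s *\<^sub>R X) V) has_integral
       mexp (- X) ** mexp (X + V) - mat 1 - dexp X V) {0..1}" (is "(?f has_integral ?I) _")
      using has_integral_diff[OF h1 h2] by simp
    have "norm ?I \<le> (b * norm V * M * (c * norm V) * M) * measure lborel (cbox 0 (1::real))"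
    proof (rule has_integral_bound[OF _ hi[folded cbox_interval]])
      fix s :: real assume s: "s \<in> cbox 0 1"
      have sb: "s * norm Y \<le> norm Y" for Y :: "'a^'b^'b" using s by (simp add: mult_left_le_one_le)
      have 1: "norm (mexp (- (s *\<^sub>R X))) \<le> b" using s sb[of X] by (intro b) auto
      have "norm (mexp (s *\<^sub>R (X + V)) - mexp (s *\<^sub>R X)) \<le> c * norm (s *\<^sub>R (X + V) - s *\<^sub>R X)"
        using s sb[of X] sb[of "X + V"] norm_triangle_ineq[of X V] V by (intro c) auto
      also have "\<dots> \<le> c * norm V" using s sb[of V] c(1) by (intro mult_left_mono) (auto simp: algebra_simps)
      finally have 2: "norm (mexp (s *\<^sub>R (X + V)) - mexp (s *\<^sub>R X)) \<le> c * norm V" .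
      have "?f s = mexp (- (s *\<^sub>R X)) ** V ** (mexp (s *\<^sub>R (X + V)) - mexp (s *\<^sub>R X))"
        by (simp add: conj_mexp_def mm.diff_right)
      then have "norm (?f s) \<le> norm (mexp (- (s *\<^sub>R X)) ** V) * norm (mexp (s *\<^sub>R (X + V)) - mexp (s *\<^sub>R X)) * M"
        using M(2) by simp
      also have "\<dots> \<le> (b * norm V * M) * (c * norm V) * M"
      proof -
        have "norm (mexp (- (s *\<^sub>R X)) ** V) \<le> norm (mexp (- (s *\<^sub>R X))) * norm V * M" by (rule M)
        also have "\<dots> \<le> b * norm V * M" using 1 M(1) by (intro mult_right_mono) auto
        finally show ?thesis using 2 M(1) c(1) b0 1 by (intro mult_mono) auto
      qed
      finally show "norm (?f s) \<le> b * norm V * M * (c * norm V) * M" .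
    qed (use M(1) c(1) b0 in auto)
    then have I: "norm ?I \<le> b * norm V * M * (c * norm V) * M" by simp
    have "mexp (X + V) - mexp X - mexp X ** dexp X V = mexp X ** ?I"
      by (simp add: mm.diff_right matrix_mul_assoc)
    then have "norm (mexp (X + V) - mexp X - mexp X ** dexp X V) \<le> norm (mexp X) * norm ?I * M"
      using M(2) by simp
    also have "\<dots> \<le> b * (b * norm V * M * (c * norm V) * M) * M"
      using I b[of X] M(1) b0 c(1) by (intro mult_mono) auto
    finally show ?thesis by (simp add: C_def mult_ac)
  qed
  show ?thesis
  proof (rule has_derivativeI)
    show "bounded_linear (\<lambda>V. mexp X ** dexp X V)"
      by (rule bounded_linear_compose[OF mm.bounded_linear_right linear_dexp[unfolded linear_conv_bounded_linear]])
    have "((\<lambda>V. norm (mexp (X + V) - mexp X - mexp X ** dexp X V) / norm V) \<longlongrightarrow> 0) (at 0)"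
    proof (rule Lim_null_comparison)
      have "norm (norm (mexp (X + V) - mexp X - mexp X ** dexp X V) / norm V) \<le> C * norm V" if "norm V < 1" "V \<noteq> 0" for V
        using bd[of V] that by (simp add: divide_simps)
      then show "\<forall>\<^sub>F V in at 0. norm (norm (mexp (X + V) - mexp X - mexp X ** dexp X V) / norm V) \<le> C * norm V"
        by (auto simp: eventually_at intro!: exI[of _ 1])
    qed (auto intro!: tendsto_eq_intros)
    then have "((\<lambda>V. (mexp (X + V) - mexp X - mexp X ** dexp X V) /\<^sub>R norm V) \<longlongrightarrow> 0) (at 0)"
      by (intro tendsto_norm_zero_cancel[where f = "\<lambda>V. (mexp (X + V) - mexp X - mexp X ** dexp X V) /\<^sub>R norm V"])
        (simp add: divide_inverse mult.commute)
    then have "((\<lambda>h. (mexp (X + h) - mexp X - mexp X ** dexp X (X + h - X)) /\<^sub>R norm (X + h - X)) \<longlongrightarrow> 0) (at 0)"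
      by (simp only: add_diff_cancel_left')
    then show "(\<lambda>y. (mexp y - mexp X - mexp X ** dexp X (y - X)) /\<^sub>R norm (y - X)) \<midarrow>X\<rightarrow> 0"
      by (rule LIM_offset_zero_cancel)
  qed
qed

text \<open>Each estimate feeds the next. By \<open>conj_mexp_diff\<close> the deviation of a
  conjugate from \<open>V\<close> is \<open>dexp\<close> of a bracket, so the bound on
  \<open>dexp\<close> gives the first-order estimate, and that one applied to the bracket gives the
  second-order estimate. The coefficient 1/2 is the integral of s over [0,1].\<close>

lemma dexp_bounds:
  fixes R :: real
  obtains K where "K > 0"
    "\<And>(X::('k::{real_normed_field,euclidean_space})^'n^'n) (V::'k^'n^'n). norm X \<le> R \<Longrightarrow> norm (conj_mexp X V) \<le> K * norm V"
    "\<And>(X::'k^'n^'n) (V::'k^'n^'n). norm X \<le> R \<Longrightarrow> norm (dexp X V) \<le> K * norm V"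
    "\<And>(X::'k^'n^'n) (V::'k^'n^'n). norm X \<le> R \<Longrightarrow> norm (dexp X V - V) \<le> K * norm X * norm V"
    "\<And>(X::'k^'n^'n) (V::'k^'n^'n). norm X \<le> R \<Longrightarrow> norm (dexp X V - V - (1/2) *\<^sub>R lie_bracket V X) \<le> K * (norm X)\<^sup>2 * norm V"
proof -
  obtain M where M: "M > 0" "\<And>(A::'k^'n^'n) (B::'k^'n^'n). norm (A ** B) \<le> norm A * norm B * M"
    using mm.pos_bounded by blast
  obtain K0 where K0: "K0 > 0" "\<And>A::'k^'n^'n. norm (mexp A) \<le> K0 * exp (K0 * norm A)"
    using norm_mexp_bound by blast
  define b where "b = K0 * exp (K0 * R)"
  have b: "norm (mexp A) \<le> b" if "norm A \<le> R" for A :: "'k^'n^'n"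
    using K0(2)[of A] that K0(1) by (smt (verit, best) b_def exp_le_cancel_iff mult_left_mono)
  have b0: "b > 0" using K0 by (simp add: b_def)
  define C where "C = b * b * M * M"
  have C0: "C > 0" using b0 M by (simp add: C_def)
  have conj: "norm (conj_mexp X V) \<le> C * norm V" if "norm X \<le> R" for X V :: "'k^'n^'n"
  proof -
    have "norm (conj_mexp X V) \<le> norm (mexp (- X) ** V) * norm (mexp X) * M"
      unfolding conj_mexp_def by (rule M)
    also have "\<dots> \<le> (norm (mexp (- X)) * norm V * M) * norm (mexp X) * M"
      using M by (intro mult_right_mono) auto
    also have "\<dots> \<le> (b * norm V * M) * b * M"
      using b[of X] b[of "- X"] that M(1) b0 by (intro mult_mono mult_nonneg_nonneg) auto
    finally show ?thesis by (simp add: C_def mult_ac)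
  qed
  have sc: "norm (s *\<^sub>R X) \<le> R" if "norm X \<le> R" "s \<in> {0..1}" for s and X :: "'k^'n^'n"
  proof -
    have "s * norm X \<le> norm X" using that(2) by (simp add: mult_left_le_one_le)
    then show ?thesis using that by simp
  qed
  have bnd: "norm (integral {0..1} f) \<le> B"
    if "f integrable_on {0..1}" "\<And>s. s \<in> {0..1} \<Longrightarrow> norm (f s) \<le> B" for f :: "real \<Rightarrow> 'k^'n^'n" and B
  proof -
    have B0: "0 \<le> B" using that(2)[of 0] norm_ge_zero[of "f 0"] by (smt (verit) atLeastAtMost_iff zero_le_one)
    have "norm (integral {0..1} f) \<le> B * measure lborel (cbox 0 (1::real))"
      by (rule has_integral_bound[OF B0]) (use that integrable_integral in auto)
    then show ?thesis by simp
  qed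
  have dx: "norm (dexp X V) \<le> C * norm V" if "norm X \<le> R" for X V :: "'k^'n^'n"
    unfolding dexp_def by (rule bnd[OF conj_mexp_integrable]) (rule conj[OF sc[OF that]])
  have br: "norm (lie_bracket V X) \<le> 2 * M * norm X * norm V" for X V :: "'k^'n^'n"
    using norm_triangle_ineq4[of "V ** X" "X ** V"] M(2)[of V X] M(2)[of X V]
    by (simp add: lie_bracket_def mult_ac)
  have lb: "lie_bracket V (s *\<^sub>R X) = s *\<^sub>R lie_bracket V X" for s and V X :: "'k^'n^'n"
    by (simp add: lie_bracket_def mm.scaleR_left mm.scaleR_right scaleR_diff_right)
  have int1: "(\<lambda>s. conj_mexp (s *\<^sub>R X) V - V) integrable_on {0..1}" for X V :: "'k^'n^'n"
    by (intro integrable_continuous_interval continuous_intros)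
  have dd: "dexp X V - V = integral {0..1} (\<lambda>s. conj_mexp (s *\<^sub>R X) V - V)" for X V :: "'k^'n^'n"
    using integral_diff[OF conj_mexp_integrable integrable_const_ivl, of 0 1 X V V] by (simp add: dexp_def)
  have d1: "norm (dexp X V - V) \<le> C * (2 * M) * norm X * norm V" if X: "norm X \<le> R" for X V :: "'k^'n^'n"
    unfolding dd
  proof (rule bnd[OF int1])
    fix s :: real assume s: "s \<in> {0..1}"
    have "norm (conj_mexp (s *\<^sub>R X) V - V) \<le> C * norm (lie_bracket V (s *\<^sub>R X))"
      unfolding conj_mexp_diff by (rule dx[OF sc[OF X s]])
    also have "\<dots> \<le> C * norm (lie_bracket V X)"
      using s C0 by (intro mult_left_mono) (auto simp: lb mult_left_le_one_le)
    also have "\<dots> \<le> C * (2 * M * norm X * norm V)" using br[of V X] C0 by (intro mult_left_mono) auto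
    finally show "norm (conj_mexp (s *\<^sub>R X) V - V) \<le> C * (2 * M) * norm X * norm V" by (simp add: mult_ac)
  qed
  define C2 where "C2 = C * (2 * M)"
  have C2: "C2 > 0" using C0 M by (simp add: C2_def)
  have d2: "norm (dexp X V - V - (1/2) *\<^sub>R lie_bracket V X) \<le> C2 * (2 * M) * (norm X)\<^sup>2 * norm V"
    if X: "norm X \<le> R" for X V :: "'k^'n^'n"
  proof -
    have "((\<lambda>s::real. s *\<^sub>R lie_bracket V X) has_integral (1/2) *\<^sub>R lie_bracket V X) {0..1}"
    proof (rule has_integral_scaleR_left)
      have "((\<lambda>s::real. s) has_integral (1\<^sup>2 / 2 - 0\<^sup>2 / 2)) {0..1}"
        using ident_has_integral[of 0 "1::real"] by simp
      then show "((\<lambda>s::real. s) has_integral (1/2)) {0..1}" by simp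
    qed
    from has_integral_diff[OF integrable_integral[OF int1] this]
    have hi: "((\<lambda>s. conj_mexp (s *\<^sub>R X) V - V - s *\<^sub>R lie_bracket V X) has_integral
       (dexp X V - V - (1/2) *\<^sub>R lie_bracket V X)) {0..1}"
      by (simp only: dd)
    have "norm (integral {0..1} (\<lambda>s. conj_mexp (s *\<^sub>R X) V - V - s *\<^sub>R lie_bracket V X)) \<le> C2 * (2 * M) * (norm X)\<^sup>2 * norm V"
    proof (rule bnd)
      show "(\<lambda>s. conj_mexp (s *\<^sub>R X) V - V - s *\<^sub>R lie_bracket V X) integrable_on {0..1}"
        using hi by blast
      fix s :: real assume s: "s \<in> {0..1}"
      have "conj_mexp (s *\<^sub>R X) V - V - s *\<^sub>R lie_bracket V X = s *\<^sub>R (dexp (s *\<^sub>R X) (lie_bracket V X) - lie_bracket V X)"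
        by (simp add: conj_mexp_diff lb linear_scale[OF linear_dexp] scaleR_diff_right)
      then have "norm (conj_mexp (s *\<^sub>R X) V - V - s *\<^sub>R lie_bracket V X) \<le> norm (dexp (s *\<^sub>R X) (lie_bracket V X) - lie_bracket V X)"
        using s by (simp add: mult_left_le_one_le)
      also have "\<dots> \<le> C2 * norm (s *\<^sub>R X) * norm (lie_bracket V X)"
        unfolding C2_def by (rule d1[OF sc[OF X s]])
      also have "\<dots> \<le> C2 * norm X * (2 * M * norm X * norm V)"
        using s C2 M br by (intro mult_mono) (auto simp: mult_left_le_one_le)
      finally show "norm (conj_mexp (s *\<^sub>R X) V - V - s *\<^sub>R lie_bracket V X) \<le> C2 * (2 * M) * (norm X)\<^sup>2 * norm V"
        by (simp add: power2_eq_square mult_ac)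
    qed
    then show ?thesis using hi by (simp add: integral_unique)
  qed
  define K where "K = C + C2 + C2 * (2 * M)"
  have K: "C \<le> K" "C2 \<le> K" "C2 * (2 * M) \<le> K" "K > 0"
    using C0 C2 M(1) by (auto simp: K_def intro!: add_pos_pos)
  have mono: "x \<le> K * y" if "x \<le> c * y" "c \<le> K" "0 \<le> y" for x c y
    using that by (meson mult_right_mono order_trans)
  show ?thesis
  proof (rule that[OF K(4)])
    show "norm (conj_mexp X V) \<le> K * norm V" if "norm X \<le> R" for X V :: "'k^'n^'n"
      using mono[OF conj[OF that] K(1)] by simp
    show "norm (dexp X V) \<le> K * norm V" if "norm X \<le> R" for X V :: "'k^'n^'n"
      using mono[OF dx[OF that] K(1)] by simp
    show "norm (dexp X V - V) \<le> K * norm X * norm V" if "norm X \<le> R" for X V :: "'k^'n^'n"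
      using mono[of _ C2 "norm X * norm V"] d1[OF that, of V] K(2) by (simp add: C2_def mult.assoc)
    show "norm (dexp X V - V - (1/2) *\<^sub>R lie_bracket V X) \<le> K * (norm X)\<^sup>2 * norm V" if "norm X \<le> R" for X V :: "'k^'n^'n"
      using mono[of _ "C2 * (2 * M)" "(norm X)\<^sup>2 * norm V"] d2[OF that, of V] K(3) by (simp add: mult.assoc)
  qed
qed

lemma continuous_on_dexp [continuous_intros]:
  fixes f g :: "'b::topological_space \<Rightarrow> ('k::{real_normed_field,euclidean_space})^'n^'n"
  assumes f: "continuous_on S f" and g: "continuous_on S g"
  shows "continuous_on S (\<lambda>x. dexp (f x) (g x))"
proof -
  have "continuous_on UNIV (\<lambda>p::('k^'n^'n) \<times> ('k^'n^'n). integral (cbox 0 1) (\<lambda>s::real. conj_mexp (s *\<^sub>R fst p) (snd p)))"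
    by (rule integral_continuous_on_param) (auto simp: case_prod_unfold intro!: continuous_intros)
  then have "continuous_on UNIV (\<lambda>p::('k^'n^'n) \<times> ('k^'n^'n). dexp (fst p) (snd p))"
    by (simp add: dexp_def)
  from continuous_on_compose2[OF this continuous_on_Pair[OF f g]] show ?thesis by simp
qed

text \<open>With the triangle inequality this bounds a small logarithm by twice the distance of its
  exponential from the identity.\<close>

lemma mexp_eq_imp_near:
  obtains r where "r > 0" "\<And>X::('k::{real_normed_field,euclidean_space})^'n^'n. norm X \<le> r \<Longrightarrow> norm (mexp X - mat 1 - X) \<le> (1/2) * norm X"
proof -
  have "(mexp has_derivative (\<lambda>V::'k^'n^'n. V)) (at 0)"
    using mexp_has_derivative[of "0::'k^'n^'n"] by simp
  then obtain d where "d > 0" "\<And>X::'k^'n^'n. norm (X - 0) < d \<Longrightarrow> norm (mexp X - mexp 0 - (X - 0)) \<le> (1/2) * norm (X - 0)"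
    unfolding has_derivative_at_alt by (metis half_gt_zero_iff zero_less_one)
  then show ?thesis by (intro that[of "d/2"]) auto
qed

section \<open>Orthonormal bases and traces\<close>

lemma bilinear_sum_simps:
  assumes "bilinear B"
  shows "B (\<Sum>i\<in>I. f i) y = (\<Sum>i\<in>I. B (f i) y)" "B x (\<Sum>i\<in>I. f i) = (\<Sum>i\<in>I. B x (f i))"
proof -
  have "linear (\<lambda>x. B x y)" "linear (B x)" using assms by (auto simp: bilinear_def)
  then show "B (\<Sum>i\<in>I. f i) y = (\<Sum>i\<in>I. B (f i) y)" "B x (\<Sum>i\<in>I. f i) = (\<Sum>i\<in>I. B x (f i))"
    by (auto intro: linear_sum)
qed

lemma orthonormal_expansion:
  assumes B: "bilinear B" and E: "finite E" "\<And>e e'. e \<in> E \<Longrightarrow> e' \<in> E \<Longrightarrow> B e e' = (if e = e' then 1 else (0::real))"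
    and v: "v \<in> span E"
  shows "v = (\<Sum>e\<in>E. B v e *\<^sub>R e)"
proof -
  obtain u where u: "v = (\<Sum>e\<in>E. u e *\<^sub>R e)" using v E(1) by (auto simp: span_finite)
  have "B v e = u e" if "e \<in> E" for e
  proof -
    have "B v e = (\<Sum>e'\<in>E. u e' * B e' e)"
      unfolding u by (simp add: bilinear_sum_simps[OF B] bilinear_lmul[OF B])
    also have "\<dots> = (\<Sum>e'\<in>E. if e' = e then u e' else 0)"
      using E(2) that by (intro sum.cong) auto
    finally show ?thesis using that E(1) by simp
  qed
  then show ?thesis using u by simp
qed

lemma orthonormal_independent:
  assumes B: "bilinear B" and E: "finite E" "\<And>e e'. e \<in> E \<Longrightarrow> e' \<in> E \<Longrightarrow> B e e' = (if e = e' then 1 else (0::real))"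
  shows "independent E"
proof (subst independent_explicit_finite_subsets, intro allI impI ballI)
  fix S u v assume S: "S \<subseteq> E" "finite S" "(\<Sum>v\<in>S. u v *\<^sub>R v) = 0" "v \<in> S"
  have "0 = B (\<Sum>w\<in>S. u w *\<^sub>R w) v" using S bilinear_lzero[OF B] by simp
  also have "\<dots> = (\<Sum>w\<in>S. u w * B w v)"
    by (simp add: bilinear_sum_simps[OF B] bilinear_lmul[OF B])
  also have "\<dots> = (\<Sum>w\<in>S. if w = v then u w else 0)"
  proof (rule sum.cong[OF refl])
    fix w assume "w \<in> S"
    then have "w \<in> E" "v \<in> E" using S(1,4) by auto
    then have "B w v = (if w = v then 1 else 0)" by (rule E(2))
    then show "u w * B w v = (if w = v then u w else 0)" by simp
  qed
  finally show "u v = 0" using S by simp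
qed

text \<open>Gram-Schmidt over a finite spanning set. Positivity is asked on \<open>V\<close> only,
  because the form that extends the Killing form to all matrices degenerates off the Lie
  algebra.\<close>

lemma ex_orthonormal_basis:
  fixes V :: "'a::euclidean_space set" and B :: "'a \<Rightarrow> 'a \<Rightarrow> real"
  assumes V: "subspace V" and B: "bilinear B"
    and sym: "\<And>x y. x \<in> V \<Longrightarrow> y \<in> V \<Longrightarrow> B x y = B y x"
    and pos: "\<And>x. x \<in> V \<Longrightarrow> x \<noteq> 0 \<Longrightarrow> B x x > 0"
  shows "\<exists>E. orthonormal_basis B V E"
proof -
  have *: "\<exists>E. orthonormal_basis B (span S) E" if "finite S" "S \<subseteq> V" for S
    using that
  proof (induction S)
    case empty
    then show ?case by (intro exI[of _ "{}"]) (simp add: orthonormal_basis_def)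
  next
    case (insert a S)
    then obtain E where E: "finite E" "span E = span S" "\<And>e e'. e \<in> E \<Longrightarrow> e' \<in> E \<Longrightarrow> B e e' = (if e = e' then 1 else 0)"
      by (auto simp: orthonormal_basis_def)
    have EV: "E \<subseteq> V" using E(2) insert.prems V by (metis insert_subset span_minimal span_superset subset_trans)
    define p where "p = (\<Sum>e\<in>E. B a e *\<^sub>R e)"
    have p: "p \<in> span E" unfolding p_def by (intro span_sum span_mul span_base)
    have orth: "B (a - p) e = 0" if "e \<in> E" for e
    proof -
      have "B p e = (\<Sum>e'\<in>E. B a e' * B e' e)"
        unfolding p_def by (simp add: bilinear_sum_simps[OF B] bilinear_lmul[OF B])
      also have "\<dots> = (\<Sum>e'\<in>E. if e' = e then B a e' else 0)"
        using E(3) that by (intro sum.cong) auto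
      finally show ?thesis using that E(1) by (simp add: bilinear_lsub[OF B])
    qed
    have apV: "a - p \<in> V"
      using insert.prems p EV V by (meson insert_subset span_minimal subsetD subspace_diff)
    show ?case
    proof (cases "a = p")
      case True
      then have "span (insert a S) = span S" using p E(2) by (metis span_redundant)
      then show ?thesis using E by (auto simp: orthonormal_basis_def)
    next
      case False
      define r where "r = sqrt (B (a - p) (a - p))"
      have r: "r > 0" "r * r = B (a - p) (a - p)" using pos[OF apV] False by (auto simp: r_def)
      define c where "c = (1 / r) *\<^sub>R (a - p)"
      have cc: "B c c = 1" 
        unfolding c_def bilinear_lmul[OF B] bilinear_rmul[OF B] r(2)[symmetric] using r(1) by simp
      have ce: "B c e = 0" if "e \<in> E" for e using orth[OF that] by (simp add: c_def bilinear_lmul[OF B])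
      have cE: "c \<notin> E" using cc ce by force
      have ec: "B e c = 0" if "e \<in> E" for e
        using ce[OF that] sym[of e c] that EV apV V by (auto simp: c_def subspace_scale)
      have "span (insert c E) = span (insert a E)"
      proof -
        have ce': "c \<in> span (insert a E)"
          unfolding c_def using p by (intro span_mul span_diff) (auto intro: span_base span_mono[THEN subsetD])
        have "a = r *\<^sub>R c + p" using r by (simp add: c_def)
        then have ae: "a \<in> span (insert c E)"
          using p by (metis insertI1 span_add span_base span_mono span_mul subsetD subset_insertI)
        have "insert c E \<subseteq> span (insert a E)" "insert a E \<subseteq> span (insert c E)"
          using ce' ae by (auto intro: span_base)
        then show ?thesis by (metis span_minimal subset_antisym subspace_span)
      qed
      also have "\<dots> = span (insert a S)" using E(2) by (simp add: span_insert)
      finally have "orthonormal_basis B (span (insert a S)) (insert c E)"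
        unfolding orthonormal_basis_def using E cc ce ec cE by auto
      then show ?thesis by blast
    qed
  qed
  obtain S where S: "S \<subseteq> V" "independent S" "V \<subseteq> span S" using basis_exists[of V] by metis
  then have "span S = V" using V by (metis span_minimal subset_antisym)
  then show ?thesis using *[of S] S independent_bound by metis
qed

text \<open>The basis inside \<open>trace_on\<close> is an arbitrary choice, so independence of the
  basis has to come first: expanding the vectors of one basis in the other turns both diagonal sums
  into the same double sum.\<close>

lemma trace_on_eq_sum:
  fixes V :: "'a::euclidean_space set"
  assumes f: "linear f" "f ` V \<subseteq> V" and B: "independent B" "span B = V"
  shows "trace_on V f = (\<Sum>b\<in>B. representation B (f b) b)"
proof -
  have main: "(\<Sum>b\<in>B. representation B (f b) b) = (\<Sum>b\<in>D. representation D (f b) b)"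
    if B: "independent B" "span B = V" and D: "independent D" "span D = V" for B D :: "'a set"
  proof -
    have fin: "finite B" "finite D" using B D independent_bound by auto
    have fV: "f x \<in> V" if "x \<in> V" for x using f that by auto
    have BV: "b \<in> V" if "b \<in> B" for b using that B span_base by blast
    have DV: "b \<in> V" if "b \<in> D" for b using that D span_base by blast
    have expB: "x = (\<Sum>b\<in>B. representation B x b *\<^sub>R b)" if "x \<in> V" for x
      using sum_representation_eq[OF B(1), of x B] that B fin by auto
    have expD: "x = (\<Sum>b\<in>D. representation D x b *\<^sub>R b)" if "x \<in> V" for x
      using sum_representation_eq[OF D(1), of x D] that D fin by auto
    have "(\<Sum>b\<in>B. representation B (f b) b) = (\<Sum>b\<in>B. \<Sum>d\<in>D. representation D b d * representation B (f d) b)"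
    proof (rule sum.cong[OF refl])
      fix b assume b: "b \<in> B"
      have "f b = (\<Sum>d\<in>D. representation D b d *\<^sub>R f d)"
        by (subst expD[OF BV[OF b]]) (simp add: linear_sum[OF f(1)] linear_scale[OF f(1)])
      then have "representation B (f b) b = representation B (\<Sum>d\<in>D. representation D b d *\<^sub>R f d) b" by simp
      also have "\<dots> = (\<Sum>d\<in>D. representation B (representation D b d *\<^sub>R f d) b)"
        by (subst representation_sum[OF B(1)]) (use fV DV B in \<open>auto intro: span_mul\<close>)
      also have "\<dots> = (\<Sum>d\<in>D. representation D b d * representation B (f d) b)"
        by (intro sum.cong refl, subst representation_scale[OF B(1)]) (use fV DV B in auto)
      finally show "representation B (f b) b = (\<Sum>d\<in>D. representation D b d * representation B (f d) b)" .
    qed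
    also have "\<dots> = (\<Sum>d\<in>D. \<Sum>b\<in>B. representation D b d * representation B (f d) b)"
      by (rule sum.swap)
    also have "\<dots> = (\<Sum>d\<in>D. representation D (f d) d)"
    proof (rule sum.cong[OF refl])
      fix d assume d: "d \<in> D"
      have "representation D (f d) d = representation D (\<Sum>b\<in>B. representation B (f d) b *\<^sub>R b) d"
        using expB[OF fV[OF DV[OF d]]] by simp
      also have "\<dots> = (\<Sum>b\<in>B. representation D (representation B (f d) b *\<^sub>R b) d)"
        by (subst representation_sum[OF D(1)]) (use BV D in \<open>auto intro: span_mul\<close>)
      also have "\<dots> = (\<Sum>b\<in>B. representation D b d * representation B (f d) b)"
        by (intro sum.cong refl, subst representation_scale[OF D(1)]) (use BV D in auto)
      finally show "(\<Sum>b\<in>B. representation D b d * representation B (f d) b) = representation D (f d) d" ..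
    qed
    finally show ?thesis .
  qed
  have "\<exists>B. independent B \<and> span B = V" using B by blast
  then have "independent (SOME B. independent B \<and> span B = V)" "span (SOME B. independent B \<and> span B = V) = V"
    using someI_ex[of "\<lambda>B. independent B \<and> span B = V"] by auto
  from main[OF this B] show ?thesis by (simp add: trace_on_def Let_def)
qed

lemma trace_on_orthonormal:
  fixes V :: "'a::euclidean_space set"
  assumes f: "linear f" "f ` V \<subseteq> V" and B: "bilinear B" and E: "orthonormal_basis B V E"
  shows "trace_on V f = (\<Sum>e\<in>E. B (f e) e)"
proof -
  have E': "finite E" "span E = V" "\<And>e e'. e \<in> E \<Longrightarrow> e' \<in> E \<Longrightarrow> B e e' = (if e = e' then 1 else 0)"
    using E by (auto simp: orthonormal_basis_def)
  have ind: "independent E" using orthonormal_independent[OF B E'(1,3)] .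
  have "representation E (f e) e = B (f e) e" if "e \<in> E" for e
  proof -
    have fe: "f e \<in> span E" using f(2) E'(2) that span_base by blast
    have "representation E (\<Sum>e'\<in>E. B (f e) e' *\<^sub>R e') e = (\<Sum>e'\<in>E. representation E (B (f e) e' *\<^sub>R e') e)"
      by (subst representation_sum[OF ind]) (auto intro: span_mul span_base)
    also have "\<dots> = (\<Sum>e'\<in>E. if e' = e then B (f e) e' else 0)"
      by (intro sum.cong refl, subst representation_scale[OF ind]) (auto simp: representation_basis[OF ind] span_base)
    finally show ?thesis using that E'(1) orthonormal_expansion[OF B E'(1,3) fe] by simp
  qed
  then show ?thesis using trace_on_eq_sum[OF f ind E'(2)] by simp
qed

lemma ex_basis:
  fixes V :: "'a::euclidean_space set"
  assumes "subspace V" obtains E where "orthonormal_basis (\<bullet>) V E"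
proof -
  have bl: "bilinear ((\<bullet>) :: 'a \<Rightarrow> 'a \<Rightarrow> real)"
    using bilinear_conv_bounded_bilinear bounded_bilinear_inner by blast
  show ?thesis
    using ex_orthonormal_basis[OF assms bl] that by (auto simp: inner_commute)
qed

lemma bilinear_inner: "bilinear ((\<bullet>) :: 'a::euclidean_space \<Rightarrow> 'a \<Rightarrow> real)"
  using bilinear_conv_bounded_bilinear bounded_bilinear_inner by blast

lemma trace_on_inner:
  fixes V :: "'a::euclidean_space set"
  assumes V: "subspace V"
  obtains E where "finite E" "\<And>x. x \<in> V \<Longrightarrow> x = (\<Sum>e\<in>E. (x \<bullet> e) *\<^sub>R e)" "E \<subseteq> V"
    "\<And>f. linear f \<Longrightarrow> f ` V \<subseteq> V \<Longrightarrow> trace_on V f = (\<Sum>e\<in>E. f e \<bullet> e)"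
proof -
  obtain E where E: "orthonormal_basis (\<bullet>) V E" using ex_basis[OF V] .
  show ?thesis
  proof (rule that)
    show "finite E" "E \<subseteq> V" using E by (auto simp: orthonormal_basis_def intro: span_base)
    show "x = (\<Sum>e\<in>E. (x \<bullet> e) *\<^sub>R e)" if "x \<in> V" for x
      using E that by (intro orthonormal_expansion[OF bilinear_inner]) (auto simp: orthonormal_basis_def)
    show "trace_on V f = (\<Sum>e\<in>E. f e \<bullet> e)" if "linear f" "f ` V \<subseteq> V" for f
      by (rule trace_on_orthonormal[OF that bilinear_inner E])
  qed
qed

lemma trace_on_commute:
  fixes V :: "'a::euclidean_space set"
  assumes V: "subspace V" and f: "linear f" "f ` V \<subseteq> V" and g: "linear g" "g ` V \<subseteq> V"
  shows "trace_on V (f \<circ> g) = trace_on V (g \<circ> f)"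
proof -
  obtain E where E: "finite E" "\<And>x. x \<in> V \<Longrightarrow> x = (\<Sum>e\<in>E. (x \<bullet> e) *\<^sub>R e)" "E \<subseteq> V"
    "\<And>f. linear f \<Longrightarrow> f ` V \<subseteq> V \<Longrightarrow> trace_on V f = (\<Sum>e\<in>E. f e \<bullet> e)"
    using trace_on_inner[OF V] by blast
  have tr: "trace_on V (f \<circ> g) = (\<Sum>e\<in>E. \<Sum>e'\<in>E. (g e \<bullet> e') * (f e' \<bullet> e))"
    if f: "linear f" "f ` V \<subseteq> V" and g: "linear g" "g ` V \<subseteq> V" for f g
  proof -
    have "f (g e) \<bullet> e = (\<Sum>e'\<in>E. (g e \<bullet> e') * (f e' \<bullet> e))" if "e \<in> E" for e
    proof -
      have "g e = (\<Sum>e'\<in>E. (g e \<bullet> e') *\<^sub>R e')" using g(2) E(3) that by (intro E(2)) auto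
      then have "f (g e) = (\<Sum>e'\<in>E. (g e \<bullet> e') *\<^sub>R f e')"
        by (metis (mono_tags, lifting) linear_scale[OF f(1)] linear_sum[OF f(1)] sum.cong)
      then show ?thesis by (simp add: inner_sum_left)
    qed
    then show ?thesis
      using E(4)[of "f \<circ> g"] linear_compose[OF g(1) f(1)] f(2) g(2) by (auto simp: o_def image_subset_iff)
  qed
  show ?thesis
    unfolding tr[OF f g] tr[OF g f] by (subst sum.swap) (simp add: mult.commute)
qed

text \<open>
  The averages of the standard inner product over \<open>S t\<close>, \<open>t \<in> {0..N}\<close>, make \<open>A\<close> skew up to an error
  \<open>O(1 / N)\<close>, and \<open>A \<circ> A\<close> has trace \<open>- \<Sum>\<parallel>A e\<parallel>\<^sup>2\<close> in an orthonormal basis when \<open>A\<close> is skew.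
\<close>

lemma trace_on_square_neg:
  fixes V :: "'a::euclidean_space set" and S :: "real \<Rightarrow> 'a \<Rightarrow> 'a"
  assumes V: "subspace V" and A: "linear A" "A ` V \<subseteq> V"
    and S: "\<And>t. linear (S t)" "\<And>x. S 0 x = x"
    and deriv: "\<And>t x. ((\<lambda>t. S t x) has_vector_derivative S t (A x)) (at t)"
    and M: "\<And>t x. norm (S t x) \<le> M * norm x" "\<And>t x. norm x \<le> M * norm (S t x)"
    and y: "y \<in> V" "A y \<noteq> 0"
  shows "trace_on V (A \<circ> A) < 0"
proof -
  have M0: "M > 0"
  proof -
    have "y \<noteq> 0" using y A(1) linear_0 by blast
    moreover have "norm y \<le> M * norm y" using M(1)[of 0 y] S(2) by simp
    ultimately show ?thesis by (smt (verit) mult_nonpos_nonneg norm_ge_zero zero_less_norm_iff)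
  qed
  obtain kA where kA: "kA > 0" "\<And>x. norm (A x) \<le> norm x * kA"
    using bounded_linear.pos_bounded linear_conv_bounded_linear A(1) by blast
  have cont: "continuous_on T (\<lambda>t. S t x)" for T x
    by (rule continuous_on_vector_derivative[OF has_vector_derivative_at_within[OF deriv]])
  define n where "n = real (dim V)"
  \<comment> \<open>\<open>a\<close> will be a lower bound for the sum of the norms of
    \<open>A e\<close> over any basis that is orthonormal for an average: expand \<open>A y\<close>
    in it, with coefficients of size at most M^3 |y|.\<close>
  define a where "a = norm (A y) / (M ^ 3 * norm y)"
  have y0: "norm y > 0" using y A(1) linear_0 by force
  have a0: "a > 0" using y y0 M0 by (simp add: a_def)
  \<comment> \<open>The basis that is orthonormal for the average changes with \<open>N\<close>. The
    bound on the trace is therefore expressed through \<open>n\<close>, \<open>a\<close>,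
    \<open>M\<close> and \<open>kA\<close>, none of which depends on \<open>N\<close>.\<close>
  have key: "n > 0 \<and> trace_on V (A \<circ> A) \<le> n * (M\<^sup>2 + 1) * kA * M\<^sup>2 / N - (a / n)\<^sup>2 / M\<^sup>2" if N: "N > 0" for N :: real
  proof -
    define P where "P = (\<lambda>x y. integral {0..N} (\<lambda>t. S t x \<bullet> S t y) / N)"
    have int: "(\<lambda>t. S t x \<bullet> S t y) integrable_on {0..N}" for x y
      by (intro integrable_continuous_interval continuous_intros cont)
    have bil: "bilinear P"
      unfolding bilinear_def linear_iff P_def
      by (auto simp: linear_add[OF S(1)] linear_scale[OF S(1)] inner_add_left inner_add_right
          integral_add int add_divide_distrib)
    have sym: "P x y = P y x" for x y by (simp add: P_def inner_commute)
    have lower: "(norm x)\<^sup>2 / M\<^sup>2 \<le> P x x" for x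
    proof -
      have "integral {0..N} (\<lambda>t. (norm x)\<^sup>2 / M\<^sup>2) \<le> integral {0..N} (\<lambda>t. S t x \<bullet> S t x)"
      proof (rule integral_le)
        fix t
        have "(norm x)\<^sup>2 \<le> (M * norm (S t x))\<^sup>2" using M(2)[of x t] by (intro power_mono) auto
        then show "(norm x)\<^sup>2 / M\<^sup>2 \<le> S t x \<bullet> S t x"
          using M0 by (simp add: power_mult_distrib divide_le_eq mult.commute dot_square_norm)
      qed (use int in auto)
      then show ?thesis using N by (simp add: P_def field_simps)
    qed
    have upper: "\<bar>P x y\<bar> \<le> M\<^sup>2 * norm x * norm y" for x y
    proof -
      have "norm (integral {0..N} (\<lambda>t. S t x \<bullet> S t y)) \<le> (M\<^sup>2 * norm x * norm y) * measure lborel (cbox 0 N)"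
      proof (rule has_integral_bound)
        show "((\<lambda>t. S t x \<bullet> S t y) has_integral integral {0..N} (\<lambda>t. S t x \<bullet> S t y)) (cbox 0 N)"
          using integrable_integral[OF int] by simp
        fix t
        have "\<bar>S t x \<bullet> S t y\<bar> \<le> norm (S t x) * norm (S t y)" by (rule Cauchy_Schwarz_ineq2)
        also have "\<dots> \<le> (M * norm x) * (M * norm y)" using M(1) M0 by (intro mult_mono) auto
        finally show "norm (S t x \<bullet> S t y) \<le> M\<^sup>2 * norm x * norm y" by (simp add: power2_eq_square mult_ac)
      qed (use M0 in auto)
      then show ?thesis using N by (simp add: P_def field_simps)
    qed
    \<comment> \<open>The sum of the two integrands is the derivative of the inner product of
      \<open>S t x\<close> and \<open>S t y\<close>, so the average is a boundary term divided by
      \<open>N\<close>.\<close>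
    have defect: "P (A x) y + P x (A y) \<le> (M\<^sup>2 + 1) * norm x * norm y / N" for x y
    proof -
      have "((\<lambda>t. S t x \<bullet> S t (A y) + S t (A x) \<bullet> S t y) has_integral (S N x \<bullet> S N y - S 0 x \<bullet> S 0 y)) {0..N}"
      proof (rule fundamental_theorem_of_calculus)
        show "((\<lambda>t. S t x \<bullet> S t y) has_vector_derivative S t x \<bullet> S t (A y) + S t (A x) \<bullet> S t y) (at t within {0..N})" for t
          by (rule bounded_bilinear.has_vector_derivative[OF bounded_bilinear_inner]) (auto intro: has_vector_derivative_at_within deriv)
      qed (use N in simp)
      from integral_unique[OF this] have "P (A x) y + P x (A y) = (S N x \<bullet> S N y - x \<bullet> y) / N"
        using integral_add[OF int int, of x "A y" "A x" y] S(2)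
        by (simp add: P_def add_divide_distrib[symmetric] add.commute)
      also have "\<dots> \<le> (M\<^sup>2 + 1) * norm x * norm y / N"
      proof -
        have "\<bar>S N x \<bullet> S N y\<bar> \<le> (M * norm x) * (M * norm y)"
          by (rule order_trans[OF Cauchy_Schwarz_ineq2]) (use M(1) M0 in \<open>intro mult_mono, auto\<close>)
        moreover have "\<bar>x \<bullet> y\<bar> \<le> norm x * norm y" by (rule Cauchy_Schwarz_ineq2)
        ultimately have "S N x \<bullet> S N y - x \<bullet> y \<le> (M\<^sup>2 + 1) * norm x * norm y"
          by (simp add: power2_eq_square algebra_simps)
        then show ?thesis using N by (simp add: divide_right_mono)
      qed
      finally show ?thesis .
    qed
    have pos: "P x x > 0" if "x \<noteq> 0" for x
      using lower[of x] that M0 by (smt (verit) divide_pos_pos zero_less_norm_iff zero_less_power)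
    obtain E where E: "orthonormal_basis P V E"
      using ex_orthonormal_basis[OF V bil] sym pos by blast
    then have E': "finite E" "span E = V" "\<And>e e'. e \<in> E \<Longrightarrow> e' \<in> E \<Longrightarrow> P e e' = (if e = e' then 1 else 0)"
      by (auto simp: orthonormal_basis_def)
    have cardE: "real (card E) = n"
      using orthonormal_independent[OF bil E'(1,3)] E'(2) by (metis n_def dim_span dim_eq_card_independent)
    have ne: "norm e \<le> M" if "e \<in> E" for e
      using lower[of e] E'(3)[OF that that] M0 by (simp add: divide_le_eq power2_le_iff_abs_le abs_le_iff)
    have "norm (A y) = norm (\<Sum>e\<in>E. P y e *\<^sub>R A e)"
    proof -
      have "y = (\<Sum>e\<in>E. P y e *\<^sub>R e)" using orthonormal_expansion[OF bil E'(1,3)] E'(2) y(1) by blast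
      then have "A y = A (\<Sum>e\<in>E. P y e *\<^sub>R e)" by simp
      then show ?thesis by (simp add: linear_sum[OF A(1)] linear_scale[OF A(1)])
    qed
    also have "\<dots> \<le> (\<Sum>e\<in>E. norm (P y e *\<^sub>R A e))" by (rule norm_sum)
    also have "\<dots> \<le> (\<Sum>e\<in>E. (M ^ 3 * norm y) * norm (A e))"
    proof (rule sum_mono)
      fix e assume e: "e \<in> E"
      have "\<bar>P y e\<bar> \<le> M\<^sup>2 * norm y * norm e" by (rule upper)
      also have "\<dots> \<le> M\<^sup>2 * norm y * M" using ne[OF e] M0 by (intro mult_left_mono) auto
      finally show "norm (P y e *\<^sub>R A e) \<le> (M ^ 3 * norm y) * norm (A e)"
        using mult_right_mono[of "\<bar>P y e\<bar>" "M\<^sup>2 * norm y * M" "norm (A e)"]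
        by (simp add: power3_eq_cube power2_eq_square mult_ac)
    qed
    finally have "norm (A y) \<le> (M ^ 3 * norm y) * (\<Sum>e\<in>E. norm (A e))" by (simp add: sum_distrib_left)
    then have asum: "a \<le> (\<Sum>e\<in>E. norm (A e))" using M0 y0 by (simp add: a_def divide_le_eq mult.commute)
    have "E \<noteq> {}" using asum a0 by auto
    then have n0: "n > 0" using E'(1) cardE by (metis card_gt_0_iff of_nat_0_less_iff)
    obtain e0 where e0: "e0 \<in> E" "a / n \<le> norm (A e0)"
    proof (rule ccontr)
      assume "\<not> thesis"
      then have "\<And>e. e \<in> E \<Longrightarrow> norm (A e) < a / n" using that by force
      then have "(\<Sum>e\<in>E. norm (A e)) < (\<Sum>e\<in>E. a / n)" using E'(1) \<open>E \<noteq> {}\<close> by (intro sum_strict_mono) auto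
      then show False using asum cardE n0 by simp
    qed
    have "trace_on V (A \<circ> A) = (\<Sum>e\<in>E. P (A (A e)) e)"
      using trace_on_orthonormal[OF linear_compose[OF A(1) A(1)] _ bil E] A(2) by (auto simp: o_def image_subset_iff)
    also have "\<dots> \<le> (\<Sum>e\<in>E. (M\<^sup>2 + 1) * kA * M\<^sup>2 / N - (norm (A e))\<^sup>2 / M\<^sup>2)"
    proof (rule sum_mono)
      fix e assume e: "e \<in> E"
      have "P (A (A e)) e \<le> (M\<^sup>2 + 1) * norm (A e) * norm e / N - P (A e) (A e)"
        using defect[of "A e" e] by simp
      also have "\<dots> \<le> (M\<^sup>2 + 1) * kA * M\<^sup>2 / N - (norm (A e))\<^sup>2 / M\<^sup>2"
      proof -
        have "norm (A e) \<le> M * kA" by (rule order_trans[OF kA(2)]) (use ne[OF e] kA(1) in \<open>simp add: mult_right_mono\<close>)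
        then have "norm (A e) * norm e \<le> (M * kA) * M" using ne[OF e] kA(1) M0 by (intro mult_mono) auto
        then have "(M\<^sup>2 + 1) * (norm (A e) * norm e) / N \<le> (M\<^sup>2 + 1) * ((M * kA) * M) / N"
          using N by (intro divide_right_mono mult_left_mono) auto
        then show ?thesis using lower[of "A e"] by (simp add: power2_eq_square mult_ac)
      qed
      finally show "P (A (A e)) e \<le> (M\<^sup>2 + 1) * kA * M\<^sup>2 / N - (norm (A e))\<^sup>2 / M\<^sup>2" .
    qed
    also have "\<dots> = n * (M\<^sup>2 + 1) * kA * M\<^sup>2 / N - (\<Sum>e\<in>E. (norm (A e))\<^sup>2 / M\<^sup>2)"
      by (simp add: sum_subtractf cardE mult_ac)
    also have "\<dots> \<le> n * (M\<^sup>2 + 1) * kA * M\<^sup>2 / N - (a / n)\<^sup>2 / M\<^sup>2"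
    proof -
      have "(a / n)\<^sup>2 / M\<^sup>2 \<le> (norm (A e0))\<^sup>2 / M\<^sup>2"
        using e0 a0 n0 by (intro divide_right_mono power_mono) auto
      also have "\<dots> \<le> (\<Sum>e\<in>E. (norm (A e))\<^sup>2 / M\<^sup>2)" using e0 E'(1) by (intro member_le_sum) auto
      finally show ?thesis by simp
    qed
    finally show ?thesis using n0 by blast
  qed
  have n0: "n > 0" using key[of 1] by simp
  define \<delta> where "\<delta> = (a / n)\<^sup>2 / M\<^sup>2"
  define c where "c = n * (M\<^sup>2 + 1) * kA * M\<^sup>2"
  have pos: "\<delta> > 0" "c > 0" using a0 n0 M0 kA by (auto simp: \<delta>_def c_def add_pos_pos)
  have key': "trace_on V (A \<circ> A) \<le> c / N - \<delta>" if "N > 0" for N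
    using key[OF that] unfolding c_def \<delta>_def by blast
  \<comment> \<open>At N = 2c/\<delta> the error term is half of the negative term.\<close>
  have "trace_on V (A \<circ> A) \<le> c / (2 * c / \<delta>) - \<delta>"
    using pos by (intro key') simp
  also have "\<dots> < 0" using pos by simp
  finally show ?thesis .
qed

section \<open>Absolutely continuous and Lipschitz curves\<close>

text \<open>A gauge argument. At tags outside \<open>N\<close> the gauge comes from
  differentiability. Intervals tagged in \<open>N\<close> are forced into an open set that exceeds
  \<open>N\<close> by less than \<delta> in measure; since \<open>N\<close> is null their total
  length is below \<delta>, and absolute continuity bounds the increments of \<open>f\<close> over
  them. The integrand is set to 0 on \<open>N\<close>, so these increments are the whole error
  there.\<close>

lemma abs_cont_fundamental_theorem:
  fixes f :: "real \<Rightarrow> 'a::euclidean_space"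
  assumes ab: "a \<le> b" and ac: "abs_cont_curve a b f" and N: "negligible N"
    and deriv: "\<And>t. t \<in> {a..b} - N \<Longrightarrow> (f has_vector_derivative f' t) (at t within {a..b})"
  shows "(f' has_integral (f b - f a)) {a..b}"
proof -
  define g where "g = (\<lambda>t. if t \<in> N then 0 else f' t)"
  have "(g has_integral (f b - f a)) (cbox a b)"
    unfolding has_integral_factor_content
  proof safe
    fix e0 :: real assume e0: "e0 > 0"
    show "\<exists>d. gauge d \<and> (\<forall>p. p tagged_division_of (cbox a b) \<and> d fine p \<longrightarrow>
      norm ((\<Sum>(x, k)\<in>p. measure lborel k *\<^sub>R g x) - (f b - f a)) \<le> e0 * measure lborel (cbox a b))"
    \<comment> \<open>On a one-point interval the admissible error is 0, and
      \<open>e * (b - a)\<close> would not be a positive tolerance for absolute continuity.\<close>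
    proof (cases "a = b")
      case True
      have *: "(\<Sum>(x, k)\<in>p. measure lborel k *\<^sub>R g x) = 0" if pt: "p tagged_division_of (cbox a b)" for p
      proof (rule sum.neutral, clarify)
        fix x k assume xk: "(x, k) \<in> p"
        then have "k \<subseteq> cbox a b" using pt by blast
        moreover obtain u v where k: "k = cbox u v" using tagged_division_ofD(4)[OF pt xk] by blast
        ultimately have "{u..v} \<subseteq> {b}" using True by simp
        then have "\<not> u < v" by (metis atLeastAtMost_iff less_imp_le nless_le order_refl singletonD subsetD)
        then have "measure lborel k = 0" by (simp add: k)
        then show "measure lborel k *\<^sub>R g x = 0" by simp
      qed
      show ?thesis
      proof (intro exI conjI allI impI)
        show "gauge (\<lambda>x::real. ball x 1)" by (rule gauge_ball) simp
        fix p assume "p tagged_division_of (cbox a b) \<and> (\<lambda>x. ball x 1) fine p"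
        then have "(\<Sum>(x, k)\<in>p. measure lborel k *\<^sub>R g x) = 0" using * by blast
        then show "norm ((\<Sum>(x, k)\<in>p. measure lborel k *\<^sub>R g x) - (f b - f a)) \<le> e0 * measure lborel (cbox a b)"
          using True by simp
      qed
    next
      case False
      \<comment> \<open>One half of the error is spent on the tags outside \<open>N\<close>, the
        other on the tags in \<open>N\<close>.\<close>
      define e where "e = e0 / 2"
      have e: "e > 0" using e0 by (simp add: e_def)
      have eab: "e * (b - a) > 0" using e ab False by simp
      obtain \<delta> where \<delta>0: "\<delta> > 0" and \<delta>1: "\<forall>(m::nat) u v.
        (\<forall>i<m. a \<le> u i \<and> u i \<le> v i \<and> v i \<le> b) \<and>
        (\<forall>i<m. \<forall>j<m. i \<noteq> j \<longrightarrow> v i \<le> u j \<or> v j \<le> u i) \<and>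
        (\<Sum>i<m. v i - u i) < \<delta> \<longrightarrow> (\<Sum>i<m. norm (f (v i) - f (u i))) < e * (b - a)"
        by (rule exE[OF mp[OF spec[OF ac[unfolded abs_cont_curve_def]] eab]], elim conjE) (rule that)
      note \<delta> = \<delta>0 \<delta>1[rule_format, OF conjI[OF _ conjI]]
      have Nn: "N \<in> null_sets lebesgue" using N by (simp add: negligible_iff_null_sets)
      then have "N \<in> sets lebesgue" by auto
      then obtain U where U: "open U" "N \<subseteq> U" "U - N \<in> lmeasurable" "emeasure lebesgue (U - N) < ennreal \<delta>"
        using sets_lebesgue_outer_open[OF _ \<delta>(1)] by blast
      have "\<exists>d>0. (x \<in> N \<longrightarrow> ball x d \<subseteq> U) \<and> (x \<in> {a..b} - N \<longrightarrow>
         (\<forall>y\<in>{a..b}. norm (y-x) < d \<longrightarrow> norm (f y - f x - (y-x) *\<^sub>R g x) \<le> e * norm (y-x)))" for x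
      proof (cases "x \<in> N")
        case True
        then show ?thesis using U(1,2) openE by blast
      next
        case False
        show ?thesis
        proof (cases "x \<in> {a..b}")
          case True
          then show ?thesis using deriv[of x] False e
            unfolding has_vector_derivative_def has_derivative_within_alt g_def by auto
        qed (auto intro: exI[of _ 1] simp: False)
      qed
      then obtain d where d: "\<And>x. 0 < d x" "\<And>x. x \<in> N \<Longrightarrow> ball x (d x) \<subseteq> U"
        "\<And>x y. x \<in> {a..b} - N \<Longrightarrow> y \<in> {a..b} \<Longrightarrow> norm (y-x) < d x \<Longrightarrow> norm (f y - f x - (y-x) *\<^sub>R g x) \<le> e * norm (y-x)"
        by metis
      show ?thesis
      proof (rule exI, safe)
        show "gauge (\<lambda>x. ball x (d x))" using d(1) gauge_ball_dependent by blast
      next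
        fix p assume p: "p tagged_division_of cbox a b" and fine: "(\<lambda>x. ball x (d x)) fine p"
        have finp: "finite p" using p by blast
        have ba: "b - a = (\<Sum>(x,K)\<in>p. Sup K - Inf K)" "f b - f a = (\<Sum>(x,K)\<in>p. f(Sup K) - f(Inf K))"
          using additive_tagged_division_1[where f= "\<lambda>x. x"] additive_tagged_division_1[where f= f] ab p by auto
        have elem: "\<exists>u v. K = {u..v} \<and> u \<le> v \<and> x \<in> {u..v} \<and> a \<le> u \<and> v \<le> b \<and> {u..v} \<subseteq> ball x (d x)" if "(x, K) \<in> p" for x K
        proof -
          have "x \<in> K" "K \<subseteq> cbox a b" "\<exists>u v. K = cbox u v" using p that by blast+
          moreover have "K \<subseteq> ball x (d x)" using fine that by blast
          ultimately show ?thesis by (auto simp: subset_iff)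
        qed
        \<comment> \<open>Degenerate intervals are left out: they contribute nothing, and without
          them an interval determines its tag, so that the sum over \<open>q\<close> can be
          reindexed by intervals.\<close>
        define q where "q = {z \<in> p. fst z \<in> N \<and> Inf (snd z) < Sup (snd z)}"
        define h where "h = (\<lambda>(x::real, K). f (Sup K) - f (Inf K))"
        have qp: "q \<subseteq> p" "finite q" using finp by (auto simp: q_def)
        have injq: "inj_on snd q"
        proof (rule inj_onI, rule ccontr)
          fix z z' assume z: "z \<in> q" "z' \<in> q" "snd z = snd z'" "z \<noteq> z'"
          obtain x K x' where zz: "z = (x, K)" "z' = (x', K)" using z(3) by (metis prod.collapse)
          then have "interior K \<inter> interior K = {}"
            using tagged_division_ofD(5)[OF p, of x K x' K] z qp by auto
          moreover obtain u v where "K = {u..v}" "u < v"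
            using elem[of x K] z zz qp by (force simp: q_def)
          ultimately show False by (simp add: interior_atLeastAtMost_real)
        qed
        define D where "D = snd ` q"
        have D: "\<exists>u v. K = {u..v} \<and> u < v \<and> a \<le> u \<and> v \<le> b \<and> K \<subseteq> U" if KD: "K \<in> D" for K
        proof -
          obtain x where x: "(x, K) \<in> q" using KD by (auto simp: D_def)
          with elem[of x K] qp obtain u v where uv: "K = {u..v}" "u \<le> v" "x \<in> {u..v}" "a \<le> u" "v \<le> b" "{u..v} \<subseteq> ball x (d x)"
            by blast
          then show ?thesis using x d(2)[of x] by (auto simp: q_def)
        qed
        have disj: "interior K \<inter> interior K' = {}" if KK: "K \<in> D" "K' \<in> D" "K \<noteq> K'" for K K'
        proof -
          have "\<exists>x. (x, K) \<in> q" "\<exists>x. (x, K') \<in> q" using KK by (auto simp: D_def)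
          then obtain x x' where "(x, K) \<in> q" "(x', K') \<in> q" by blast
          then show ?thesis using tagged_division_ofD(5)[OF p, of x K x' K'] KK qp by auto
        qed
        have finD: "finite D" using qp by (simp add: D_def)
        obtain \<sigma> where \<sigma>: "bij_betw \<sigma> {..<card D} D"
          using ex_bij_betw_nat_finite[OF finD] by (metis atLeast0LessThan)
        have \<sigma>D: "\<sigma> i \<in> D" if "i < card D" for i using \<sigma> that by (auto simp: bij_betw_def)
        have Ddiv: "D division_of \<Union>D"
          unfolding division_of_def using finD disj D by (fastforce simp: box_real)
        have len: "(\<Sum>i<card D. Sup (\<sigma> i) - Inf (\<sigma> i)) < \<delta>"
        proof -
          have "(\<Sum>i<card D. Sup (\<sigma> i) - Inf (\<sigma> i)) = (\<Sum>K\<in>D. Sup K - Inf K)"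
            using sum.reindex_bij_betw[OF \<sigma>, of "\<lambda>K. Sup K - Inf K"] by simp
          also have "\<dots> = (\<Sum>K\<in>D. measure lebesgue K)"
            by (intro sum.cong refl) (use D in force)
          also have "\<dots> = measure lebesgue (\<Union>D)" by (rule content_division[OF Ddiv])
          also have "\<dots> < \<delta>"
          proof -
            have DL: "\<Union>D \<in> lmeasurable" using Ddiv by (metis lmeasurable_division)
            have "emeasure lebesgue (\<Union>D) = emeasure lebesgue (\<Union>D - N)"
              using emeasure_Diff_null_set[OF Nn] DL by (metis fmeasurableD)
            also have "\<dots> \<le> emeasure lebesgue (U - N)"
              using D U(3) by (intro emeasure_mono) (auto dest: fmeasurableD)
            also have "\<dots> < ennreal \<delta>" by (rule U(4))
            finally have "ennreal (measure lebesgue (\<Union>D)) < ennreal \<delta>"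
              using emeasure_eq_measure2[OF DL] by simp
            then show ?thesis using \<delta>(1) by (simp add: ennreal_less_iff)
          qed
          finally show ?thesis .
        qed
        have bad: "(\<Sum>i<card D. norm (f (Sup (\<sigma> i)) - f (Inf (\<sigma> i)))) < e * (b - a)"
        proof (rule \<delta>(2)[OF _ _ len])
          show "\<forall>i<card D. a \<le> Inf (\<sigma> i) \<and> Inf (\<sigma> i) \<le> Sup (\<sigma> i) \<and> Sup (\<sigma> i) \<le> b"
            using D \<sigma>D by (metis atLeastAtMost_iff cInf_atLeastAtMost cSup_atLeastAtMost less_imp_le)
          show "\<forall>i<card D. \<forall>j<card D. i \<noteq> j \<longrightarrow> Sup (\<sigma> i) \<le> Inf (\<sigma> j) \<or> Sup (\<sigma> j) \<le> Inf (\<sigma> i)"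
          proof (intro allI impI)
            fix i j assume ij: "i < card D" "j < card D" "i \<noteq> j"
            then have ne: "\<sigma> i \<noteq> \<sigma> j" using \<sigma> by (auto simp: bij_betw_def inj_on_def)
            obtain u v u' v' where uv: "\<sigma> i = {u..v}" "u < v" "\<sigma> j = {u'..v'}" "u' < v'"
              using D[OF \<sigma>D[OF ij(1)]] D[OF \<sigma>D[OF ij(2)]] by auto
            have "{u<..<v} \<inter> {u'<..<v'} = {}"
              using disj[OF \<sigma>D[OF ij(1)] \<sigma>D[OF ij(2)] ne] uv by (simp add: interior_atLeastAtMost_real)
            then have "v \<le> u' \<or> v' \<le> u"
            proof -
              have "(max u u' + min v v') / 2 \<notin> {u<..<v} \<inter> {u'<..<v'}" using \<open>_ = {}\<close> by blast
              then show ?thesis using uv by (auto simp: max_def min_def field_simps split: if_splits)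
            qed
            then show "Sup (\<sigma> i) \<le> Inf (\<sigma> j) \<or> Sup (\<sigma> j) \<le> Inf (\<sigma> i)" using uv by simp
          qed
        qed
        have "(\<Sum>z\<in>q. norm (h z)) = (\<Sum>K\<in>D. norm (f (Sup K) - f (Inf K)))"
          unfolding D_def by (subst sum.reindex[OF injq]) (auto simp: h_def case_prod_unfold)
        also have "\<dots> = (\<Sum>i<card D. norm (f (Sup (\<sigma> i)) - f (Inf (\<sigma> i))))"
          using sum.reindex_bij_betw[OF \<sigma>, of "\<lambda>K. norm (f (Sup K) - f (Inf K))"] by simp
        finally have badq: "(\<Sum>z\<in>q. norm (h z)) \<le> e * (b - a)" using bad by simp
        have "norm ((\<Sum>(x, k)\<in>p. measure lborel k *\<^sub>R g x) - (f b - f a))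
           = norm (\<Sum>z\<in>p. measure lborel (snd z) *\<^sub>R g (fst z) - h z)"
          by (simp add: ba(2) sum_subtractf case_prod_unfold h_def)
        also have "\<dots> \<le> (\<Sum>z\<in>p. norm (measure lborel (snd z) *\<^sub>R g (fst z) - h z))" by (rule norm_sum)
        also have "\<dots> \<le> (\<Sum>z\<in>p. e * (Sup (snd z) - Inf (snd z)) + (if z \<in> q then norm (h z) else 0))"
        proof (rule sum_mono)
          fix z assume zp: "z \<in> p"
          obtain x K where z: "z = (x, K)" by (cases z)
          obtain u v where uv: "K = {u..v}" "u \<le> v" "x \<in> {u..v}" "a \<le> u" "v \<le> b" "{u..v} \<subseteq> ball x (d x)"
            using elem[of x K] zp z by blast
          show "norm (measure lborel (snd z) *\<^sub>R g (fst z) - h z) \<le> e * (Sup (snd z) - Inf (snd z)) + (if z \<in> q then norm (h z) else 0)"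
          proof (cases "x \<in> N")
            case True
            show ?thesis
            proof (cases "u < v")
              case True
              then show ?thesis using \<open>x \<in> N\<close> zp z uv e by (simp add: q_def g_def)
            next
              case False
              then have "u = v" using uv by simp
              then show ?thesis using z uv by (simp add: h_def)
            qed
          next
            case False
            have xab: "x \<in> {a..b} - N" using uv False by auto
            have "u \<in> ball x (d x)" "v \<in> ball x (d x)" using uv(2,6) by auto
            then have uvd: "norm (u - x) < d x" "norm (v - x) < d x" by (auto simp: dist_norm norm_minus_commute)
            have "measure lborel K *\<^sub>R g x - h z = (f u - f x - (u - x) *\<^sub>R g x) - (f v - f x - (v - x) *\<^sub>R g x)"
              using uv z by (simp add: h_def algebra_simps)
            then have "norm (measure lborel K *\<^sub>R g x - h z) \<le> norm (f u - f x - (u - x) *\<^sub>R g x) + norm (f v - f x - (v - x) *\<^sub>R g x)"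
              by (metis norm_triangle_ineq4)
            also have "\<dots> \<le> e * norm (u - x) + e * norm (v - x)"
              using d(3)[OF xab _ uvd(1)] d(3)[OF xab _ uvd(2)] uv by (intro add_mono) auto
            also have "\<dots> = e * (v - u)" using uv by (simp add: algebra_simps)
            finally have "norm (measure lborel K *\<^sub>R g x - h z) \<le> e * (v - u)" .
            moreover have "0 \<le> (if z \<in> q then norm (h z) else 0)" by simp
            ultimately show ?thesis using z uv by simp
          qed
        qed
        also have "\<dots> = e * (b - a) + (\<Sum>z\<in>p. if z \<in> q then norm (h z) else 0)"
          using ba(1) by (simp add: sum.distrib sum_distrib_left[symmetric] case_prod_unfold)
        also have "(\<Sum>z\<in>p. if z \<in> q then norm (h z) else 0) = (\<Sum>z\<in>q. norm (h z))"
          using qp finp by (simp add: sum.If_cases Int_absorb1 inf.absorb2)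
        also have "e * (b - a) + (\<Sum>z\<in>q. norm (h z)) \<le> e0 * measure lborel (cbox a b)"
          using badq ab by (simp add: e_def field_simps)
        finally show "norm ((\<Sum>(x, k)\<in>p. measure lborel k *\<^sub>R g x) - (f b - f a)) \<le> e0 * measure lborel (cbox a b)"
          by simp
      qed
    qed
  qed
  then have "(f' has_integral (f b - f a)) (cbox a b)"
    by (rule has_integral_spike[OF N, rotated]) (auto simp: g_def)
  then show ?thesis by simp
qed

text \<open>A class of curves that carries its derivative along and is closed under products,
  exponentials and primitives. The function f' is bounded on the whole interval but is the
  derivative only off a null set, so it may be altered on null sets as long as it stays
  bounded.\<close>

definition lip_ae :: "real \<Rightarrow> real \<Rightarrow> (real \<Rightarrow> 'a::euclidean_space) \<Rightarrow> (real \<Rightarrow> 'a) \<Rightarrow> bool" where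
  "lip_ae a b f f' \<longleftrightarrow>
     (\<exists>K. \<forall>x\<in>{a..b}. \<forall>y\<in>{a..b}. norm (f x - f y) \<le> K * \<bar>x - y\<bar>) \<and> bounded (f' ` {a..b}) \<and>
     (\<exists>N. negligible N \<and> (\<forall>t\<in>{a..b} - N. (f has_vector_derivative f' t) (at t within {a..b})))"

lemma lip_aeI:
  assumes "\<And>x y. x \<in> {a..b} \<Longrightarrow> y \<in> {a..b} \<Longrightarrow> norm (f x - f y) \<le> K * \<bar>x - y\<bar>"
    and "bounded (f' ` {a..b})" and "negligible N"
    and "\<And>t. t \<in> {a..b} - N \<Longrightarrow> (f has_vector_derivative f' t) (at t within {a..b})"
  shows "lip_ae a b f f'"
  unfolding lip_ae_def by (intro conjI exI[of _ K] exI[of _ N] ballI assms)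

lemma lip_aeE:
  assumes "lip_ae a b f f'"
  obtains N where "negligible N"
    "\<And>t. t \<in> {a..b} - N \<Longrightarrow> (f has_vector_derivative f' t) (at t within {a..b})"
  using assms unfolding lip_ae_def by (elim conjE exE) (rule that, assumption, erule bspec)

lemma lip_ae_deriv_bounded: "lip_ae a b f f' \<Longrightarrow> bounded (f' ` {a..b})"
  by (simp add: lip_ae_def)

lemma lipschitz_abs_cont_curve:
  assumes K: "\<And>x y. x \<in> {a..b} \<Longrightarrow> y \<in> {a..b} \<Longrightarrow> norm (f x - f y) \<le> K * \<bar>x - y\<bar>"
  shows "abs_cont_curve a b f"
  unfolding abs_cont_curve_def
proof (intro allI impI)
  fix e :: real assume e: "e > 0"
  define K' where "K' = max K 1"
  have K': "K' > 0" "K \<le> K'" by (auto simp: K'_def)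
  show "\<exists>\<delta>>0. \<forall>(m::nat) u v. (\<forall>i<m. a \<le> u i \<and> u i \<le> v i \<and> v i \<le> b) \<and>
        (\<forall>i<m. \<forall>j<m. i \<noteq> j \<longrightarrow> v i \<le> u j \<or> v j \<le> u i) \<and>
        (\<Sum>i<m. v i - u i) < \<delta> \<longrightarrow> (\<Sum>i<m. norm (f (v i) - f (u i))) < e"
  proof (intro exI[of _ "e / K'"] conjI allI impI)
    show "e / K' > 0" using e K' by simp
    fix m :: nat and u v
    assume A: "(\<forall>i<m. a \<le> u i \<and> u i \<le> v i \<and> v i \<le> b) \<and>
        (\<forall>i<m. \<forall>j<m. i \<noteq> j \<longrightarrow> v i \<le> u j \<or> v j \<le> u i) \<and> (\<Sum>i<m. v i - u i) < e / K'"
    have "(\<Sum>i<m. norm (f (v i) - f (u i))) \<le> (\<Sum>i<m. K' * (v i - u i))"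
    proof (rule sum_mono)
      fix i assume i: "i \<in> {..<m}"
      have uv: "a \<le> u i" "u i \<le> v i" "v i \<le> b" using A i by auto
      have "norm (f (v i) - f (u i)) \<le> K * \<bar>v i - u i\<bar>" using uv by (intro K) auto
      also have "\<dots> \<le> K' * (v i - u i)" using uv K' by (simp add: mult_right_mono)
      finally show "norm (f (v i) - f (u i)) \<le> K' * (v i - u i)" .
    qed
    also have "\<dots> < e" using A K' unfolding sum_distrib_left[symmetric] by (simp add: pos_less_divide_eq mult.commute)
    finally show "(\<Sum>i<m. norm (f (v i) - f (u i))) < e" .
  qed
qed

lemma lip_ae_lipschitz:
  assumes "lip_ae a b f f'"
  obtains K where "K \<ge> 0" "\<And>x y. x \<in> {a..b} \<Longrightarrow> y \<in> {a..b} \<Longrightarrow> norm (f x - f y) \<le> K * \<bar>x - y\<bar>"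
proof -
  from assms obtain K where K: "\<And>x y. x \<in> {a..b} \<Longrightarrow> y \<in> {a..b} \<Longrightarrow> norm (f x - f y) \<le> K * \<bar>x - y\<bar>"
    unfolding lip_ae_def by blast
  show ?thesis
  proof (rule that[of "max K 0"])
    fix x y assume "x \<in> {a..b}" "y \<in> {a..b}"
    then have "norm (f x - f y) \<le> K * \<bar>x - y\<bar>" by (rule K)
    also have "\<dots> \<le> max K 0 * \<bar>x - y\<bar>" by (intro mult_right_mono) auto
    finally show "norm (f x - f y) \<le> max K 0 * \<bar>x - y\<bar>" .
  qed simp
qed

lemma lip_ae_abs_cont: "lip_ae a b f f' \<Longrightarrow> abs_cont_curve a b f"
  by (elim lip_ae_lipschitz, rule lipschitz_abs_cont_curve)

lemma lip_ae_continuous: "lip_ae a b f f' \<Longrightarrow> continuous_on {a..b} f"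
proof (elim lip_ae_lipschitz)
  fix K assume K: "K \<ge> 0" "\<And>x y. x \<in> {a..b} \<Longrightarrow> y \<in> {a..b} \<Longrightarrow> norm (f x - f y) \<le> K * \<bar>x - y\<bar>"
  have "K-lipschitz_on {a..b} f" using K by (auto simp: lipschitz_on_def dist_norm)
  then show ?thesis by (rule lipschitz_on_continuous_on)
qed

lemma lip_ae_subinterval:
  assumes "lip_ae a b f f'" "a \<le> c" "d \<le> b"
  shows "lip_ae c d f f'"
proof -
  have sub: "{c..d} \<subseteq> {a..b}" using assms by auto
  obtain N where N: "negligible N" "\<And>t. t \<in> {a..b} - N \<Longrightarrow> (f has_vector_derivative f' t) (at t within {a..b})"
    using lip_aeE[OF assms(1)] by blast
  obtain K where K: "K \<ge> 0" "\<And>x y. x \<in> {a..b} \<Longrightarrow> y \<in> {a..b} \<Longrightarrow> norm (f x - f y) \<le> K * \<bar>x - y\<bar>"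
    using lip_ae_lipschitz[OF assms(1)] by blast
  show ?thesis
  proof (rule lip_aeI[OF _ _ N(1)])
    show "norm (f x - f y) \<le> K * \<bar>x - y\<bar>" if "x \<in> {c..d}" "y \<in> {c..d}" for x y
      using that sub by (intro K(2)) auto
    show "bounded (f' ` {c..d})"
      by (rule bounded_subset[OF lip_ae_deriv_bounded[OF assms(1)] image_mono[OF sub]])
    show "(f has_vector_derivative f' t) (at t within {c..d})" if "t \<in> {c..d} - N" for t
      using that sub by (intro has_vector_derivative_within_subset[OF N(2) sub]) auto
  qed
qed

lemma lip_ae_has_integral:
  assumes "lip_ae a b f f'" "a \<le> x" "x \<le> y" "y \<le> b"
  shows "(f' has_integral (f y - f x)) {x..y}"
proof -
  have l: "lip_ae x y f f'" by (rule lip_ae_subinterval[OF assms(1,2,4)])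
  then obtain N where N: "negligible N" "\<And>t. t \<in> {x..y} - N \<Longrightarrow> (f has_vector_derivative f' t) (at t within {x..y})"
    using lip_aeE by blast
  show ?thesis by (rule abs_cont_fundamental_theorem[OF assms(3) lip_ae_abs_cont[OF l] N])
qed

text \<open>Measurability of f' comes from its integrability, which the fundamental theorem
  supplies.\<close>

lemma lip_ae_measurable:
  assumes "lip_ae a b f f'"
  shows "f' \<in> borel_measurable (lebesgue_on {a..b})"
proof (cases "a \<le> b")
  case True
  have "f' integrable_on {a..b}" using lip_ae_has_integral[OF assms, of a b] True by auto
  then show ?thesis by (rule integrable_imp_measurable)
next
  case False
  then have "space (lebesgue_on {a..b}) = {}" by simp
  then show ?thesis by (auto simp: measurable_def)
qed

lemma bounded_imageE:
  assumes "bounded (f ` S)" obtains B where "B \<ge> 0" "\<And>x. x \<in> S \<Longrightarrow> norm (f x) \<le> B"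
proof -
  obtain B where "\<forall>y\<in>f ` S. norm y \<le> B" using assms by (auto simp: bounded_iff)
  then show ?thesis by (intro that[of "max B 0"]) (auto simp: max.coboundedI1)
qed

lemma bounded_measurable_integrable:
  fixes f :: "real \<Rightarrow> 'a::euclidean_space"
  assumes "f \<in> borel_measurable (lebesgue_on {a..b})" "bounded (f ` {a..b})"
  shows "f absolutely_integrable_on {a..b}"
proof -
  obtain B where B: "\<And>x. x \<in> {a..b} \<Longrightarrow> norm (f x) \<le> B" using bounded_imageE[OF assms(2)] by blast
  show ?thesis
    by (rule measurable_bounded_by_integrable_imp_absolutely_integrable[OF assms(1) _ integrable_const_ivl[of B]])
      (use B in auto)
qed

lemma bounded_bilinear_image:
  assumes h: "bounded_bilinear h" and "bounded (f ` S)" "bounded (g ` S)"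
  shows "bounded ((\<lambda>x. h (f x) (g x)) ` S)"
proof -
  obtain K where K: "K > 0" "\<And>a b. norm (h a b) \<le> norm a * norm b * K"
    using bounded_bilinear.pos_bounded[OF h] by blast
  obtain A where A: "A \<ge> 0" "\<And>x. x \<in> S \<Longrightarrow> norm (f x) \<le> A" using bounded_imageE[OF assms(2)] by blast
  obtain B where B: "B \<ge> 0" "\<And>x. x \<in> S \<Longrightarrow> norm (g x) \<le> B" using bounded_imageE[OF assms(3)] by blast
  have "norm (h (f x) (g x)) \<le> A * B * K" if "x \<in> S" for x
  proof -
    have "norm (h (f x) (g x)) \<le> norm (f x) * norm (g x) * K" by (rule K)
    also have "\<dots> \<le> A * B * K"
      using A(2)[OF that] B(2)[OF that] K(1) A(1) B(1) by (intro mult_mono) auto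
    finally show ?thesis .
  qed
  then show ?thesis by (auto simp: bounded_iff)
qed

lemma lip_ae_bounded: "lip_ae a b f f' \<Longrightarrow> bounded (f ` {a..b})"
  by (intro compact_imp_bounded compact_continuous_image lip_ae_continuous) auto

lemma measurable_bilinear:
  fixes f :: "real \<Rightarrow> 'a::euclidean_space" and g :: "real \<Rightarrow> 'b::euclidean_space"
    and h :: "'a \<Rightarrow> 'b \<Rightarrow> 'c::euclidean_space"
  assumes h: "bounded_bilinear h"
    and f: "f \<in> borel_measurable M" and g: "g \<in> borel_measurable M"
  shows "(\<lambda>x. h (f x) (g x)) \<in> borel_measurable M"
proof (rule borel_measurable_continuous_Pair[OF f g])
  show "continuous_on UNIV (\<lambda>x. h (fst x) (snd x))"
    by (intro bounded_bilinear.continuous_on[OF h] continuous_intros)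
qed

lemma lip_ae_bilinear:
  assumes h: "bounded_bilinear h" and f: "lip_ae a b f f'" and g: "lip_ae a b g g'"
  shows "lip_ae a b (\<lambda>t. h (f t) (g t)) (\<lambda>t. h (f t) (g' t) + h (f' t) (g t))"
proof -
  interpret bounded_bilinear h by fact
  obtain K where K: "K > 0" "\<And>a b. norm (h a b) \<le> norm a * norm b * K"
    using pos_bounded by blast
  obtain A where A: "A \<ge> 0" "\<And>x. x \<in> {a..b} \<Longrightarrow> norm (f x) \<le> A" using bounded_imageE[OF lip_ae_bounded[OF f]] by blast
  obtain B where B: "B \<ge> 0" "\<And>x. x \<in> {a..b} \<Longrightarrow> norm (g x) \<le> B" using bounded_imageE[OF lip_ae_bounded[OF g]] by blast
  obtain F where F: "F \<ge> 0" "\<And>x y. x \<in> {a..b} \<Longrightarrow> y \<in> {a..b} \<Longrightarrow> norm (f x - f y) \<le> F * \<bar>x - y\<bar>"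
    using lip_ae_lipschitz[OF f] by blast
  obtain G where G: "G \<ge> 0" "\<And>x y. x \<in> {a..b} \<Longrightarrow> y \<in> {a..b} \<Longrightarrow> norm (g x - g y) \<le> G * \<bar>x - y\<bar>"
    using lip_ae_lipschitz[OF g] by blast
  have 1: "norm (h (f x) (g x) - h (f y) (g y)) \<le> (F * B * K + A * G * K) * \<bar>x - y\<bar>"
    if xy: "x \<in> {a..b}" "y \<in> {a..b}" for x y
  proof -
    have "h (f x) (g x) - h (f y) (g y) = h (f x - f y) (g x) + h (f y) (g x - g y)"
      by (simp add: diff_left diff_right)
    then have "norm (h (f x) (g x) - h (f y) (g y)) \<le> norm (h (f x - f y) (g x)) + norm (h (f y) (g x - g y))"
      by (simp add: norm_triangle_ineq)
    also have "\<dots> \<le> norm (f x - f y) * norm (g x) * K + norm (f y) * norm (g x - g y) * K"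
      using K by (intro add_mono) auto
    also have "\<dots> \<le> (F * \<bar>x - y\<bar>) * B * K + A * (G * \<bar>x - y\<bar>) * K"
      using F G A B K(1) xy
      by (intro add_mono mult_mono mult_nonneg_nonneg) auto
    finally show ?thesis by (simp add: algebra_simps)
  qed
  have 2: "bounded ((\<lambda>t. h (f t) (g' t) + h (f' t) (g t)) ` {a..b})"
    using f g by (intro bounded_plus_comp bounded_bilinear_image[OF h] lip_ae_bounded[OF f] lip_ae_bounded[OF g])
      (simp_all add: lip_ae_deriv_bounded)
  obtain N1 where N1: "negligible N1" "\<And>t. t \<in> {a..b} - N1 \<Longrightarrow> (f has_vector_derivative f' t) (at t within {a..b})"
    using lip_aeE[OF f] by blast
  obtain N2 where N2: "negligible N2" "\<And>t. t \<in> {a..b} - N2 \<Longrightarrow> (g has_vector_derivative g' t) (at t within {a..b})"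
    using lip_aeE[OF g] by blast
  show ?thesis
    by (rule lip_aeI[OF 1 2 negligible_Un[OF N1(1) N2(1)]]) (auto intro!: has_vector_derivative N1(2) N2(2))
qed

lemma lip_ae_compose:
  fixes \<phi> :: "'a::euclidean_space \<Rightarrow> 'b::euclidean_space"
  assumes f: "lip_ae a b f f'"
    and lip: "\<And>R. \<exists>c\<ge>0. \<forall>x y. norm x \<le> R \<longrightarrow> norm y \<le> R \<longrightarrow> norm (\<phi> y - \<phi> x) \<le> c * norm (y - x)"
    and der: "\<And>x. (\<phi> has_derivative D x) (at x)"
    and bd: "bounded ((\<lambda>t. D (f t) (f' t)) ` {a..b})"
  shows "lip_ae a b (\<lambda>t. \<phi> (f t)) (\<lambda>t. D (f t) (f' t))"
proof -
  obtain R where R: "\<And>x. x \<in> {a..b} \<Longrightarrow> norm (f x) \<le> R"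
    using bounded_imageE[OF lip_ae_bounded[OF f]] by blast
  obtain c where c: "c \<ge> 0" "\<And>x y. norm x \<le> R \<Longrightarrow> norm y \<le> R \<Longrightarrow> norm (\<phi> y - \<phi> x) \<le> c * norm (y - x)"
    using lip[of R] by blast
  obtain F where F: "F \<ge> 0" "\<And>x y. x \<in> {a..b} \<Longrightarrow> y \<in> {a..b} \<Longrightarrow> norm (f x - f y) \<le> F * \<bar>x - y\<bar>"
    using lip_ae_lipschitz[OF f] by blast
  have 1: "norm (\<phi> (f x) - \<phi> (f y)) \<le> (c * F) * \<bar>x - y\<bar>" if "x \<in> {a..b}" "y \<in> {a..b}" for x y
  proof -
    have "norm (\<phi> (f x) - \<phi> (f y)) \<le> c * norm (f x - f y)" using R[OF that(1)] R[OF that(2)] by (intro c) auto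
    also have "\<dots> \<le> c * (F * \<bar>x - y\<bar>)" using F(2)[OF that] c(1) by (intro mult_left_mono) auto
    finally show ?thesis by (simp add: mult.assoc)
  qed
  obtain N where N: "negligible N" "\<And>t. t \<in> {a..b} - N \<Longrightarrow> (f has_vector_derivative f' t) (at t within {a..b})"
    using lip_aeE[OF f] by blast
  have 2: "((\<lambda>t. \<phi> (f t)) has_vector_derivative D (f t) (f' t)) (at t within {a..b})" if t: "t \<in> {a..b} - N" for t
    using vector_derivative_diff_chain_within[OF N(2)[OF t] has_derivative_at_withinI[OF der]] by (simp add: o_def)
  show ?thesis by (rule lip_aeI[OF 1 bd N(1) 2])
qed

lemma lip_ae_mexp:
  assumes f: "lip_ae a b f f'"
  shows "lip_ae a b (\<lambda>t. mexp (f t)) (\<lambda>t. mexp (f t) ** dexp (f t) (f' t))"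
proof (rule lip_ae_compose[OF f _ mexp_has_derivative])
  show "\<exists>c\<ge>0. \<forall>x y::'a^'b^'b. norm x \<le> R \<longrightarrow> norm y \<le> R \<longrightarrow> norm (mexp y - mexp x) \<le> c * norm (y - x)" for R
    by (rule mexp_lipschitz)
  obtain R where R: "\<And>x. x \<in> {a..b} \<Longrightarrow> norm (f x) \<le> R"
    using bounded_imageE[OF lip_ae_bounded[OF f]] by blast
  obtain K where K: "K > 0" "\<And>(X::'a^'b^'b) (V::'a^'b^'b). norm X \<le> R \<Longrightarrow> norm (dexp X V) \<le> K * norm V"
    using dexp_bounds[of R] by metis
  have "bounded (f' ` {a..b})" using f by (simp add: lip_ae_def)
  then obtain B where B: "\<And>t. t \<in> {a..b} \<Longrightarrow> norm (f' t) \<le> B" using bounded_imageE by blast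
  have "norm (dexp (f t) (f' t)) \<le> K * B" if t: "t \<in> {a..b}" for t
    using K(2)[OF R[OF t], of "f' t"] B[OF t] K(1) by (meson mult_left_mono less_imp_le order_trans)
  then have "bounded ((\<lambda>t. dexp (f t) (f' t)) ` {a..b})" unfolding bounded_iff by blast
  moreover have "bounded ((\<lambda>t. mexp (f t)) ` {a..b})"
    by (intro compact_imp_bounded compact_continuous_image continuous_intros lip_ae_continuous[OF f]) auto
  ultimately show "bounded ((\<lambda>t. mexp (f t) ** dexp (f t) (f' t)) ` {a..b})"
    by (rule bounded_bilinear_image[OF mm.bounded_bilinear_axioms, rotated])
qed

lemma lip_ae_const: "lip_ae a b (\<lambda>t. c) (\<lambda>t. 0)"
  unfolding lip_ae_def by (auto intro!: exI[of _ 0] exI[of _ "{}"] simp: image_constant_conv)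

lemma lip_ae_ident: "lip_ae a b (\<lambda>t. t) (\<lambda>t. 1)"
  unfolding lip_ae_def by (auto intro!: exI[of _ 1] exI[of _ "{}"] derivative_eq_intros simp: image_constant_conv)

lemma lip_ae_linear:
  fixes h :: "'a::euclidean_space \<Rightarrow> 'b::euclidean_space"
  assumes h: "bounded_linear h" and f: "lip_ae a b f f'"
  shows "lip_ae a b (\<lambda>t. h (f t)) (\<lambda>t. h (f' t))"
proof -
  interpret bounded_linear h by fact
  have "bounded_bilinear (\<lambda>(r::real) x. r *\<^sub>R h x)"
    by (rule bounded_bilinear.comp[OF bounded_bilinear_scaleR bounded_linear_ident h])
  from lip_ae_bilinear[OF this lip_ae_const[of a b 1] f] show ?thesis by simp
qed

lemma lip_ae_add:
  assumes f: "lip_ae a b f f'" and g: "lip_ae a b g g'"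
  shows "lip_ae a b (\<lambda>t. f t + g t) (\<lambda>t. f' t + g' t)"
proof -
  obtain F where F: "F \<ge> 0" "\<And>x y. x \<in> {a..b} \<Longrightarrow> y \<in> {a..b} \<Longrightarrow> norm (f x - f y) \<le> F * \<bar>x - y\<bar>"
    using lip_ae_lipschitz[OF f] by blast
  obtain G where G: "G \<ge> 0" "\<And>x y. x \<in> {a..b} \<Longrightarrow> y \<in> {a..b} \<Longrightarrow> norm (g x - g y) \<le> G * \<bar>x - y\<bar>"
    using lip_ae_lipschitz[OF g] by blast
  have 1: "norm ((f x + g x) - (f y + g y)) \<le> (F + G) * \<bar>x - y\<bar>" if "x \<in> {a..b}" "y \<in> {a..b}" for x y
  proof -
    have "norm ((f x + g x) - (f y + g y)) \<le> norm (f x - f y) + norm (g x - g y)"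
      using norm_triangle_ineq[of "f x - f y" "g x - g y"] by (simp add: algebra_simps)
    then show ?thesis using F(2)[OF that] G(2)[OF that] by (simp add: algebra_simps)
  qed
  have 2: "bounded ((\<lambda>t. f' t + g' t) ` {a..b})"
    using f g by (intro bounded_plus_comp lip_ae_deriv_bounded)
  obtain N1 where N1: "negligible N1" "\<And>t. t \<in> {a..b} - N1 \<Longrightarrow> (f has_vector_derivative f' t) (at t within {a..b})"
    using lip_aeE[OF f] by blast
  obtain N2 where N2: "negligible N2" "\<And>t. t \<in> {a..b} - N2 \<Longrightarrow> (g has_vector_derivative g' t) (at t within {a..b})"
    using lip_aeE[OF g] by blast
  show ?thesis
    by (rule lip_aeI[OF 1 2 negligible_Un[OF N1(1) N2(1)]]) (auto intro!: has_vector_derivative_add N1(2) N2(2))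
qed

text \<open>Passes from almost everywhere information to a single prescribed point: if the integrand
  is small near \<open>t\<close> off a null set, the increments of its primitive are small compared
  with the distance to \<open>t\<close>.\<close>

lemma has_vector_derivative_zeroI:
  fixes G :: "real \<Rightarrow> 'a::euclidean_space"
  assumes t: "t \<in> {a..b}" and N: "negligible N"
    and G: "\<And>x y. a \<le> x \<Longrightarrow> x \<le> y \<Longrightarrow> y \<le> b \<Longrightarrow> (g has_integral (G y - G x)) {x..y}"
    and small: "\<And>e. e > 0 \<Longrightarrow> \<exists>d>0. \<forall>s\<in>{a..b} - N. \<bar>s - t\<bar> < d \<longrightarrow> norm (g s) \<le> e"
  shows "(G has_vector_derivative 0) (at t within {a..b})"
  unfolding has_vector_derivative_def has_derivative_within_alt
proof (intro conjI allI impI)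
  show "bounded_linear (\<lambda>x. x *\<^sub>R (0::'a))" by simp
  fix e :: real assume e: "e > 0"
  obtain d where d: "d > 0" "\<And>s. s \<in> {a..b} - N \<Longrightarrow> \<bar>s - t\<bar> < d \<Longrightarrow> norm (g s) \<le> e"
    using small[OF e] by blast
  have *: "norm (G y - G x) \<le> e * (y - x)"
    if xy: "a \<le> x" "x \<le> y" "y \<le> b" "\<bar>x - t\<bar> < d" "\<bar>y - t\<bar> < d" for x y
  proof -
    have "((\<lambda>s. if s \<in> N then 0 else g s) has_integral (G y - G x)) (cbox x y)"
      using has_integral_spike[OF N, of "{x..y}" "\<lambda>s. if s \<in> N then 0 else g s" g] G[OF xy(1-3)] by simp
    then have "norm (G y - G x) \<le> e * measure lborel (cbox x y)"
    proof (rule has_integral_bound[rotated])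
      fix s assume "s \<in> cbox x y"
      then show "norm (if s \<in> N then 0 else g s) \<le> e" using d(2)[of s] xy e by auto
    qed (use e in simp)
    then show ?thesis using xy by simp
  qed
  show "\<exists>d>0. \<forall>y\<in>{a..b}. norm (y - t) < d \<longrightarrow> norm (G y - G t - (y - t) *\<^sub>R 0) \<le> e * norm (y - t)"
  proof (intro exI[of _ d] conjI ballI impI)
    fix y assume y: "y \<in> {a..b}" "norm (y - t) < d"
    show "norm (G y - G t - (y - t) *\<^sub>R 0) \<le> e * norm (y - t)"
    proof (cases "t \<le> y")
      case True
      then show ?thesis using *[of t y] y t d by simp
    next
      case False
      then show ?thesis using *[of y t] y t d by (simp add: norm_minus_commute)
    qed
  qed (use d in simp)
qed

lemma lip_ae_primitive:
  fixes h :: "'a::euclidean_space \<Rightarrow> 'b::euclidean_space \<Rightarrow> 'c::euclidean_space"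
  assumes h: "bounded_bilinear h" and c: "continuous_on {a..b} c" and f: "lip_ae a b f f'"
  shows "lip_ae a b (\<lambda>x. integral {a..x} (\<lambda>s. h (c s) (f' s))) (\<lambda>s. h (c s) (f' s))"
proof -
  interpret bounded_bilinear h by fact
  obtain K where K: "K > 0" "\<And>a b. norm (h a b) \<le> norm a * norm b * K"
    using pos_bounded by blast
  let ?\<phi> = "\<lambda>s. h (c s) (f' s)"
  let ?F = "\<lambda>x. integral {a..x} ?\<phi>"
  have bc: "bounded (c ` {a..b})" by (intro compact_imp_bounded compact_continuous_image c) auto
  have bf': "bounded (f' ` {a..b})" using f by (simp add: lip_ae_def)
  have b\<phi>: "bounded (?\<phi> ` {a..b})" by (rule bounded_bilinear_image[OF h bc bf'])
  have mc: "c \<in> borel_measurable (lebesgue_on {a..b})"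
    by (intro continuous_imp_measurable_on_sets_lebesgue c) auto
  have int: "?\<phi> integrable_on {a..b}"
    using bounded_measurable_integrable[OF measurable_bilinear[OF h mc lip_ae_measurable[OF f]] b\<phi>]
    by (simp add: absolutely_integrable_on_def)
  have F: "(?\<phi> has_integral (?F y - ?F x)) {x..y}" if "a \<le> x" "x \<le> y" "y \<le> b" for x y
  proof -
    have i1: "?\<phi> integrable_on {a..y}" using int that by (elim integrable_on_subinterval) auto
    then have i2: "?\<phi> integrable_on {x..y}" using that by (elim integrable_on_subinterval) auto
    have "?F x + integral {x..y} ?\<phi> = ?F y" by (rule Henstock_Kurzweil_Integration.integral_combine[OF that(1,2) i1])
    then show ?thesis using i2 by (metis add_diff_cancel_left' integrable_integral)
  qed
  obtain B where B: "B \<ge> 0" "\<And>s. s \<in> {a..b} \<Longrightarrow> norm (?\<phi> s) \<le> B" using bounded_imageE[OF b\<phi>] by blast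
  have lipF: "norm (?F y - ?F x) \<le> B * (y - x)" if "a \<le> x" "x \<le> y" "y \<le> b" for x y
    using has_integral_bound[OF B(1), of ?\<phi> "?F y - ?F x" x y] F[OF that] B(2) that by auto
  have 1: "norm (?F x - ?F y) \<le> B * \<bar>x - y\<bar>" if "x \<in> {a..b}" "y \<in> {a..b}" for x y
    using lipF[of x y] lipF[of y x] that by (cases "x \<le> y") (auto simp: norm_minus_commute)
  obtain N where N: "negligible N" "\<And>t. t \<in> {a..b} - N \<Longrightarrow> (f has_vector_derivative f' t) (at t within {a..b})"
    using lip_aeE[OF f] by blast
  have 2: "(?F has_vector_derivative ?\<phi> t) (at t within {a..b})" if t: "t \<in> {a..b} - N" for t
  proof -
    define G where "G = (\<lambda>x. ?F x - h (c t) (f x))"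
    have blt: "bounded_linear (h (c t))" by (rule bounded_linear_right)
    have G: "((\<lambda>s. h (c s - c t) (f' s)) has_integral (G y - G x)) {x..y}" if "a \<le> x" "x \<le> y" "y \<le> b" for x y
      using has_integral_diff[OF F[OF that] has_integral_linear[OF lip_ae_has_integral[OF f that] blt]]
      by (simp add: G_def diff_left diff_right o_def algebra_simps)
    obtain B' where B': "B' \<ge> 0" "\<And>s. s \<in> {a..b} \<Longrightarrow> norm (f' s) \<le> B'" using bounded_imageE[OF bf'] by blast
    have "(G has_vector_derivative 0) (at t within {a..b})"
    proof (rule has_vector_derivative_zeroI[OF _ negligible_empty G])
      show "t \<in> {a..b}" using t by simp
      fix e :: real assume e: "e > 0"
      define e' where "e' = e / (B' * K + 1)"
      have e': "e' > 0" using e B' K by (simp add: e'_def add_nonneg_pos)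
      obtain d where d: "d > 0" "\<And>s. s \<in> {a..b} \<Longrightarrow> \<bar>s - t\<bar> < d \<Longrightarrow> norm (c s - c t) < e'"
        using c t e' unfolding continuous_on_iff dist_norm by (metis DiffD1 real_norm_def)
      have "norm (h (c s - c t) (f' s)) \<le> e" if s: "s \<in> {a..b}" "\<bar>s - t\<bar> < d" for s
      proof -
        have "norm (h (c s - c t) (f' s)) \<le> norm (c s - c t) * norm (f' s) * K" by (rule K)
        also have "\<dots> \<le> e' * B' * K" using d(2)[OF s] B'(2)[OF s(1)] K(1) B'(1) e' by (intro mult_mono) auto
        also have "\<dots> \<le> e' * (B' * K + 1)" using e' by (simp add: algebra_simps)
        also have "\<dots> = e" using B' K by (simp add: e'_def add_nonneg_pos less_imp_neq[symmetric])
        finally show ?thesis .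
      qed
      then show "\<exists>d>0. \<forall>s\<in>{a..b} - {}. \<bar>s - t\<bar> < d \<longrightarrow> norm (h (c s - c t) (f' s)) \<le> e" using d(1) by blast
    qed
    from has_vector_derivative_add[OF this bounded_linear.has_vector_derivative[OF blt N(2)[OF t]]]
    show ?thesis by (simp add: G_def)
  qed
  show ?thesis by (rule lip_aeI[OF 1 b\<phi> N(1) 2])
qed

lemma lip_ae_integral_eq:
  assumes "lip_ae a b f f'" "x \<in> {a..b}"
  shows "integral {a..x} f' = f x - f a"
  using lip_ae_has_integral[OF assms(1), of a x] assms(2) by (auto intro: integral_unique)

lemma lip_ae_scaleR: "lip_ae a b f f' \<Longrightarrow> lip_ae a b (\<lambda>t. r *\<^sub>R f t) (\<lambda>t. r *\<^sub>R f' t)"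
  by (rule lip_ae_linear[OF bounded_linear_scaleR_right])

lemma lip_ae_diff:
  assumes "lip_ae a b f f'" "lip_ae a b g g'"
  shows "lip_ae a b (\<lambda>t. f t - g t) (\<lambda>t. f' t - g' t)"
  using lip_ae_add[OF assms(1) lip_ae_scaleR[OF assms(2), of "-1"]] by simp

lemma lip_ae_sum:
  assumes "finite I" "\<And>i. i \<in> I \<Longrightarrow> lip_ae a b (f i) (f' i)"
  shows "lip_ae a b (\<lambda>t. \<Sum>i\<in>I. f i t) (\<lambda>t. \<Sum>i\<in>I. f' i t)"
  using assms by (induction I rule: finite_induct) (simp_all add: lip_ae_const lip_ae_add)

lemma lip_ae_cong:
  assumes "lip_ae a b f f'" "\<And>t. t \<in> {a..b} \<Longrightarrow> f t = g t" "\<And>t. t \<in> {a..b} \<Longrightarrow> f' t = g' t"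
  shows "lip_ae a b g g'"
proof -
  obtain K where K: "K \<ge> 0" "\<And>x y. x \<in> {a..b} \<Longrightarrow> y \<in> {a..b} \<Longrightarrow> norm (f x - f y) \<le> K * \<bar>x - y\<bar>"
    using lip_ae_lipschitz[OF assms(1)] by blast
  obtain N where N: "negligible N" "\<And>t. t \<in> {a..b} - N \<Longrightarrow> (f has_vector_derivative f' t) (at t within {a..b})"
    using lip_aeE[OF assms(1)] by blast
  show ?thesis
  proof (rule lip_aeI[OF _ _ N(1)])
    show "norm (g x - g y) \<le> K * \<bar>x - y\<bar>" if "x \<in> {a..b}" "y \<in> {a..b}" for x y
      using K(2)[OF that] assms(2) that by simp
    have "g' ` {a..b} = f' ` {a..b}" using assms(3) by (intro image_cong) auto
    then show "bounded (g' ` {a..b})" using lip_ae_deriv_bounded[OF assms(1)] by simp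
    fix t assume t: "t \<in> {a..b} - N"
    have "(f has_vector_derivative f' t) (at t within {a..b})" by (rule N(2)[OF t])
    then have "(g has_vector_derivative f' t) (at t within {a..b})"
      by (rule has_vector_derivative_transform[rotated 2]) (use t assms(2) in auto)
    then show "(g has_vector_derivative g' t) (at t within {a..b})" using assms(3) t by simp
  qed
qed

lemma lip_ae_spike:
  assumes f: "lip_ae a b f f'" and N: "negligible N"
    and "\<And>t. t \<in> {a..b} - N \<Longrightarrow> g t = f' t" and bd: "bounded (g ` {a..b})"
  shows "lip_ae a b f g"
proof -
  obtain K where K: "K \<ge> 0" "\<And>x y. x \<in> {a..b} \<Longrightarrow> y \<in> {a..b} \<Longrightarrow> norm (f x - f y) \<le> K * \<bar>x - y\<bar>"
    using lip_ae_lipschitz[OF assms(1)] by blast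
  obtain N' where N': "negligible N'" "\<And>t. t \<in> {a..b} - N' \<Longrightarrow> (f has_vector_derivative f' t) (at t within {a..b})"
    using lip_aeE[OF assms(1)] by blast
  show ?thesis
    by (rule lip_aeI[OF K(2) bd negligible_Un[OF N N'(1)]]) (use N'(2) assms(3) in auto)
qed

text \<open>Expanding \<open>f' s\<close> in the standard basis reduces a continuous family of
  linear maps to finitely many primitives with a vector-valued coefficient
  \<open>A s i\<close>.\<close>

lemma lip_ae_primitive_linear:
  fixes A :: "real \<Rightarrow> 'a::euclidean_space \<Rightarrow> 'b::euclidean_space"
  assumes A: "\<And>s. linear (A s)" and cont: "\<And>v. continuous_on {a..b} (\<lambda>s. A s v)" and f: "lip_ae a b f f'"
  obtains F where "lip_ae a b F (\<lambda>s. A s (f' s))" "F a = 0"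
proof -
  have bb: "bounded_bilinear (\<lambda>(v::'b) (x::'a). (x \<bullet> i) *\<^sub>R v)" for i
    by (rule bounded_bilinear.flip[OF bounded_bilinear.comp[OF bounded_bilinear_scaleR bounded_linear_inner_left bounded_linear_ident]])
  have "lip_ae a b (\<lambda>x. integral {a..x} (\<lambda>s. (f' s \<bullet> i) *\<^sub>R A s i)) (\<lambda>s. (f' s \<bullet> i) *\<^sub>R A s i)" for i
    using lip_ae_primitive[OF bb cont f] .
  then have l: "lip_ae a b (\<lambda>x. \<Sum>i\<in>Basis. integral {a..x} (\<lambda>s. (f' s \<bullet> i) *\<^sub>R A s i)) (\<lambda>s. \<Sum>i\<in>Basis. (f' s \<bullet> i) *\<^sub>R A s i)"
    by (intro lip_ae_sum) auto
  have e: "(\<Sum>i\<in>Basis. (f' s \<bullet> i) *\<^sub>R A s i) = A s (f' s)" for s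
  proof -
    have "A s (f' s) = A s (\<Sum>i\<in>Basis. (f' s \<bullet> i) *\<^sub>R i)" by (simp add: euclidean_representation)
    then show ?thesis by (simp only: linear_sum[OF A] linear_scale[OF A])
  qed
  show ?thesis
  proof (rule that)
    show "lip_ae a b (\<lambda>x. \<Sum>i\<in>Basis. integral {a..x} (\<lambda>s. (f' s \<bullet> i) *\<^sub>R A s i)) (\<lambda>s. A s (f' s))"
      using l by (simp only: e)
  qed simp
qed

text \<open>The primitive of \<open>f\<close> vanishes because integrals ignore null sets, and by
  continuity its derivative is \<open>f\<close> at every point.\<close>

lemma continuous_ae_zero:
  fixes f :: "real \<Rightarrow> 'a::euclidean_space"
  assumes ab: "a < b" and f: "continuous_on {a..b} f" and N: "negligible N" "\<And>t. t \<in> {a..b} - N \<Longrightarrow> f t = 0"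
    and t: "t \<in> {a..b}"
  shows "f t = 0"
proof -
  have 1: "((\<lambda>x. integral {a..x} f) has_vector_derivative f t) (at t within {a..b})"
    by (rule integral_has_vector_derivative[OF f t])
  have z: "integral {a..x} f = 0" if "x \<in> {a..b}" for x
  proof -
    have "(f has_integral 0) {a..x}"
      by (rule has_integral_spike[OF N(1), where f = "\<lambda>_. 0"]) (use N(2) that in auto)
    then show ?thesis by (rule integral_unique)
  qed
  have 2: "((\<lambda>x. integral {a..x} f) has_vector_derivative 0) (at t within {a..b})"
    by (rule has_vector_derivative_transform[OF t _ has_vector_derivative_const[of 0]]) (use z in auto)
  show ?thesis
    by (rule vector_derivative_unique_within[OF _ 1 2]) (use ab t in \<open>simp add: trivial_limit_within islimpt_Icc\<close>)
qed

lemma lip_ae_unique_deriv: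
  assumes ab: "a < b" and "lip_ae a b f f'" "lip_ae a b f g'"
  obtains N where "negligible N" "\<And>t. t \<in> {a..b} - N \<Longrightarrow> f' t = g' t"
proof -
  obtain N where N: "negligible N" "\<And>t. t \<in> {a..b} - N \<Longrightarrow> (f has_vector_derivative f' t) (at t within {a..b})"
    using lip_aeE[OF assms(2)] by blast
  obtain N' where N': "negligible N'" "\<And>t. t \<in> {a..b} - N' \<Longrightarrow> (f has_vector_derivative g' t) (at t within {a..b})"
    using lip_aeE[OF assms(3)] by blast
  show ?thesis
  proof (rule that[OF negligible_Un[OF N(1) N'(1)]])
    fix t assume t: "t \<in> {a..b} - (N \<union> N')"
    have "(f has_vector_derivative f' t) (at t within {a..b})" "(f has_vector_derivative g' t) (at t within {a..b})"
      using N(2) N'(2) t by auto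
    then show "f' t = g' t"
      by (rule vector_derivative_unique_within[rotated]) (use ab t in \<open>simp add: trivial_limit_within islimpt_Icc\<close>)
  qed
qed

lemma lip_ae_of_continuous:
  assumes f: "continuous_on {a..b} (f :: real \<Rightarrow> 'a::euclidean_space)"
  shows "lip_ae a b (\<lambda>x. integral {a..x} f) f"
  using lip_ae_primitive[OF bounded_bilinear.flip[OF bounded_bilinear_scaleR] f lip_ae_ident] by simp

text \<open>Differentiation under the integral at the single point 0, which is all that the open
  mapping argument asks for: a remainder that is quadratic uniformly in \<open>t\<close> stays
  quadratic after integration.\<close>

lemma has_derivative_integral_quadratic:
  fixes g :: "'x::real_normed_vector \<Rightarrow> real \<Rightarrow> 'b::euclidean_space"
  assumes ab: "a \<le> b" and int: "\<And>x. norm x < 1 \<Longrightarrow> g x integrable_on {a..b}" and intD: "\<And>x. D x integrable_on {a..b}"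
    and bl: "bounded_linear (\<lambda>x. integral {a..b} (D x))"
    and K: "K \<ge> 0" "\<And>x t. norm x < 1 \<Longrightarrow> t \<in> {a..b} \<Longrightarrow> norm (g x t - g 0 t - D x t) \<le> K * (norm x)\<^sup>2"
  shows "((\<lambda>x. integral {a..b} (g x)) has_derivative (\<lambda>x. integral {a..b} (D x))) (at 0)"
proof (rule has_derivativeI[OF bl])
  have b: "norm (integral {a..b} (g x) - integral {a..b} (g 0) - integral {a..b} (D x)) \<le> K * (norm x)\<^sup>2 * (b - a)" if x: "norm x < 1" for x
  proof -
    have "((\<lambda>t. g x t - g 0 t - D x t) has_integral (integral {a..b} (g x) - integral {a..b} (g 0) - integral {a..b} (D x))) (cbox a b)"
      using int[OF x] int[of 0] intD[of x] by (intro has_integral_diff) (auto intro: integrable_integral)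
    then have "norm (integral {a..b} (g x) - integral {a..b} (g 0) - integral {a..b} (D x)) \<le> K * (norm x)\<^sup>2 * measure lborel (cbox a b)"
      by (rule has_integral_bound[rotated]) (use K x in auto)
    then show ?thesis using ab by simp
  qed
  have "((\<lambda>x. (integral {a..b} (g x) - integral {a..b} (g 0) - integral {a..b} (D x)) /\<^sub>R norm x) \<longlongrightarrow> 0) (at 0)"
  proof (rule Lim_null_comparison)
    show "\<forall>\<^sub>F x in at 0. norm ((integral {a..b} (g x) - integral {a..b} (g 0) - integral {a..b} (D x)) /\<^sub>R norm x) \<le> K * (b - a) * norm x"
      unfolding eventually_at
    proof (intro exI[of _ 1] conjI ballI impI)
      fix x :: 'x assume x: "x \<noteq> 0 \<and> dist x 0 < 1"
      then have "norm (integral {a..b} (g x) - integral {a..b} (g 0) - integral {a..b} (D x)) \<le> K * (norm x)\<^sup>2 * (b - a)" by (intro b) simp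
      then show "norm ((integral {a..b} (g x) - integral {a..b} (g 0) - integral {a..b} (D x)) /\<^sub>R norm x) \<le> K * (b - a) * norm x"
        using x by (simp only: norm_scaleR) (simp add: divide_simps power2_eq_square mult_ac)
    qed simp
    show "((\<lambda>x. K * (b - a) * norm x) \<longlongrightarrow> 0) (at (0::'x))" by (auto intro!: tendsto_eq_intros)
  qed
  then show "((\<lambda>x. (integral {a..b} (g x) - integral {a..b} (g 0) - integral {a..b} (D (x - 0))) /\<^sub>R norm (x - 0)) \<longlongrightarrow> 0) (at 0)"
    by simp
qed

lemma continuous_on_integral_dominated:
  fixes g :: "'x::metric_space \<Rightarrow> real \<Rightarrow> 'b::euclidean_space"
  assumes int: "\<And>x. x \<in> S \<Longrightarrow> g x integrable_on {a..b}"
    and bd: "\<And>x t. x \<in> S \<Longrightarrow> t \<in> {a..b} \<Longrightarrow> norm (g x t) \<le> K"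
    and cont: "\<And>t. t \<in> {a..b} \<Longrightarrow> continuous_on S (\<lambda>x. g x t)"
  shows "continuous_on S (\<lambda>x. integral {a..b} (g x))"
  unfolding continuous_on_sequentially
proof (intro allI ballI impI, unfold o_def)
  fix X :: "nat \<Rightarrow> 'x" and x assume x: "x \<in> S" and X: "(\<forall>n. X n \<in> S) \<and> X \<longlonglongrightarrow> x"
  show "(\<lambda>n. integral {a..b} (g (X n))) \<longlonglongrightarrow> integral {a..b} (g x)"
  proof (rule dominated_convergence(2))
    show "g (X n) integrable_on {a..b}" for n using X int by blast
    show "(\<lambda>t. K) integrable_on {a..b}" by (rule integrable_const_ivl)
    show "norm (g (X n) t) \<le> K" if "t \<in> {a..b}" for n t using X bd that by blast
    fix t assume "t \<in> {a..b}"
    from cont[OF this] X x show "(\<lambda>n. g (X n) t) \<longlonglongrightarrow> g x t"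
      unfolding continuous_on_sequentially o_def by blast
  qed
qed

lemma integral_nonneg_eq_0_ae:
  fixes f :: "real \<Rightarrow> real"
  assumes f: "f absolutely_integrable_on {a..b}" and nn: "\<And>t. t \<in> {a..b} \<Longrightarrow> 0 \<le> f t" and z: "integral {a..b} f = 0"
  shows "negligible {t \<in> {a..b}. f t \<noteq> 0}"
proof -
  have i: "integrable (lebesgue_on {a..b}) f" by (rule absolutely_integrable_imp_integrable[OF f]) simp
  have z0: "integral\<^sup>L (lebesgue_on {a..b}) f = 0" by (subst lebesgue_integral_eq_integral[OF i]) (simp_all add: z)
  have nn0: "AE t in lebesgue_on {a..b}. 0 \<le> f t" by (rule AE_I2) (use nn in simp)
  have "AE t in lebesgue_on {a..b}. f t = 0"
    by (rule integral_nonneg_eq_0_iff_AE[OF i nn0, THEN iffD1, OF z0])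
  then have "AE t in lebesgue. t \<in> {a..b} \<longrightarrow> f t = 0"
    by (subst (asm) AE_restrict_space_iff) simp_all
  then obtain N where N: "\<And>t. t \<in> space lebesgue - N \<Longrightarrow> t \<in> {a..b} \<longrightarrow> f t = 0" "N \<in> null_sets lebesgue"
    by (rule AE_E3) (rule that)
  have "{t \<in> {a..b}. f t \<noteq> 0} \<subseteq> N" using N(1) by fastforce
  then show ?thesis using N(2) negligible_subset negligible_iff_null_sets by metis
qed

section \<open>Left-invariant sub-Riemannian structures\<close>

lemma matrix_inv_mult:
  assumes "invertible (A :: ('k::{real_normed_field,euclidean_space})^'n^'n)"
  shows "matrix_inv A ** A = mat 1" "A ** matrix_inv A = mat 1"
  using someI_ex[OF assms[unfolded invertible_def]] by (auto simp: matrix_inv_def)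

lemma conj_mexp_commute:
  assumes "lie_bracket V X = 0" shows "conj_mexp X V = V"
  using conj_mexp_diff[of X V] assms linear_0[OF linear_dexp, of X] by simp

lemma lie_bracket_simps:
  "lie_bracket (X + Y) Z = lie_bracket X Z + lie_bracket Y Z" "lie_bracket Z (X + Y) = lie_bracket Z X + lie_bracket Z Y"
  "lie_bracket (X - Y) Z = lie_bracket X Z - lie_bracket Y Z" "lie_bracket Z (X - Y) = lie_bracket Z X - lie_bracket Z Y"
  "lie_bracket (r *\<^sub>R X) Z = r *\<^sub>R lie_bracket X Z" "lie_bracket Z (r *\<^sub>R X) = r *\<^sub>R lie_bracket Z X"
  "lie_bracket (- X) Z = - lie_bracket X Z" "lie_bracket Z (- X) = - lie_bracket Z X"
  "lie_bracket 0 Z = 0" "lie_bracket Z 0 = 0" "lie_bracket X X = 0"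
  by (simp_all add: lie_bracket_def mm.add_left mm.add_right mm.diff_left mm.diff_right mm.scaleR_left
      mm.scaleR_right mm.minus_left mm.minus_right scaleR_diff_right mm.zero_left mm.zero_right)

lemma lie_bracket_commute: "lie_bracket X Y = - lie_bracket Y X"
  by (simp add: lie_bracket_def)

lemma dexp_commute:
  assumes "lie_bracket V X = 0" shows "dexp X V = V"
proof -
  have "conj_mexp (s *\<^sub>R X) V = V" for s by (rule conj_mexp_commute) (simp add: lie_bracket_simps assms)
  then show ?thesis by (simp add: dexp_def)
qed

lemma jacobi:
  "lie_bracket X (lie_bracket Y Z) = lie_bracket (lie_bracket X Y) Z + lie_bracket Y (lie_bracket X Z)"
  by (simp add: lie_bracket_def mm.diff_left mm.diff_right matrix_mul_assoc)

lemma bounded_bilinear_lie_bracket: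
  "bounded_bilinear (lie_bracket :: ('k::{real_normed_field,euclidean_space})^'n^'n \<Rightarrow> _)"
proof -
  have "bilinear (lie_bracket :: 'k^'n^'n \<Rightarrow> _)"
    by (auto simp: bilinear_def linear_iff lie_bracket_simps)
  then show ?thesis by (simp add: bilinear_conv_bounded_bilinear)
qed

text \<open>The orthogonal projection onto \<open>V\<close> for the form \<open>B\<close>, written
  as a sum over a basis so that it is a linear map on the whole space.\<close>

definition bproj :: "('a::euclidean_space \<Rightarrow> 'a \<Rightarrow> real) \<Rightarrow> 'a set \<Rightarrow> 'a \<Rightarrow> 'a" where
  "bproj B V x = (\<Sum>e\<in>(SOME E. orthonormal_basis B V E). B x e *\<^sub>R e)"

lemma bproj:
  fixes B :: "'a::euclidean_space \<Rightarrow> 'a \<Rightarrow> real"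
  assumes V: "subspace V" and B: "bilinear B" and sym: "\<And>x y. B x y = B y x"
    and pos: "\<And>x. x \<in> V \<Longrightarrow> x \<noteq> 0 \<Longrightarrow> B x x > 0"
  shows "linear (bproj B V)" "bproj B V x \<in> V" "x \<in> V \<Longrightarrow> bproj B V x = x"
    "z \<in> V \<Longrightarrow> B (bproj B V x) z = B x z" "(\<And>z. z \<in> V \<Longrightarrow> B x z = 0) \<Longrightarrow> bproj B V x = 0"
proof -
  define E where "E = (SOME E. orthonormal_basis B V E)"
  have "orthonormal_basis B V E"
    unfolding E_def by (rule someI_ex) (use ex_orthonormal_basis[OF V B] sym pos in blast)
  then have E: "finite E" "span E = V" "\<And>e e'. e \<in> E \<Longrightarrow> e' \<in> E \<Longrightarrow> B e e' = (if e = e' then 1 else 0)"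
    by (auto simp: orthonormal_basis_def)
  have EV: "e \<in> V" if "e \<in> E" for e using E(2) that span_base by blast
  have p: "bproj B V x = (\<Sum>e\<in>E. B x e *\<^sub>R e)" for x by (simp add: bproj_def E_def)
  show "linear (bproj B V)"
    by (auto simp: linear_iff p bilinear_ladd[OF B] bilinear_lmul[OF B] scaleR_add_left sum.distrib scaleR_sum_right)
  show "bproj B V x \<in> V" unfolding p by (intro subspace_sum[OF V] subspace_scale[OF V] EV)
  show "bproj B V x = x" if "x \<in> V"
    unfolding p by (rule orthonormal_expansion[OF B E(1,3), symmetric]) (use that E in auto)
  show "B (bproj B V x) z = B x z" if "z \<in> V"
  proof -
    have z: "z = (\<Sum>e\<in>E. B z e *\<^sub>R e)" by (rule orthonormal_expansion[OF B E(1,3)]) (use that E in auto)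
    have "B x z = (\<Sum>e\<in>E. B z e * B x e)"
      by (subst z) (simp add: bilinear_sum_simps[OF B] bilinear_rmul[OF B])
    also have "\<dots> = (\<Sum>e\<in>E. B x e * B e z)" by (intro sum.cong refl) (simp add: sym mult.commute)
    also have "\<dots> = B (bproj B V x) z" by (simp add: p bilinear_sum_simps[OF B] bilinear_lmul[OF B])
    finally show ?thesis ..
  qed
  show "bproj B V x = 0" if "\<And>z. z \<in> V \<Longrightarrow> B x z = 0"
    unfolding p using that EV by simp
qed

text \<open>\<open>B\<close> extends \<open>ip\<close> bilinearly to all matrices: off \<open>L\<close>, \<open>killing_form L\<close> has junk values and is not bilinear.\<close>

locale sr_structure =
  fixes G L C H :: "(('k::{real_normed_field,euclidean_space})^'n^'n) set"
    and B ip :: "'k^'n^'n \<Rightarrow> 'k^'n^'n \<Rightarrow> real"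
  assumes G_invertible: "A \<in> G \<Longrightarrow> invertible A"
    and G_mult: "A \<in> G \<Longrightarrow> A' \<in> G \<Longrightarrow> A ** A' \<in> G"
    and G_inv: "A \<in> G \<Longrightarrow> matrix_inv A \<in> G"
    and G_compact: "compact G"
    and L_subspace: "subspace L"
    and L_bracket: "X \<in> L \<Longrightarrow> Y \<in> L \<Longrightarrow> lie_bracket X Y \<in> L"
    and L_exp: "X \<in> L \<Longrightarrow> mexp X \<in> G"
    and L_conj: "X \<in> L \<Longrightarrow> Y \<in> L \<Longrightarrow> conj_mexp X Y \<in> L"
    and B_bilinear: "bilinear B"
    and B_sym: "B X Y = B Y X"
    and B_pos: "X \<in> L \<Longrightarrow> X \<noteq> 0 \<Longrightarrow> B X X > 0"
    and B_conj: "X \<in> L \<Longrightarrow> Y \<in> L \<Longrightarrow> Z \<in> L \<Longrightarrow> B (conj_mexp X Y) (conj_mexp X Z) = B Y Z"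
    and ip_eq: "X \<in> L \<Longrightarrow> Y \<in> L \<Longrightarrow> ip X Y = B X Y"
    and C_subspace: "subspace C" and C_L: "C \<subseteq> L"
    and C_abelian: "X \<in> C \<Longrightarrow> Y \<in> C \<Longrightarrow> lie_bracket X Y = 0"
    and H_def: "H = orth_complement ip L C"
begin

lemma B_bounded: "bounded_bilinear B"
  using B_bilinear bilinear_conv_bounded_bilinear by blast

sublocale B: bounded_bilinear B by (rule B_bounded)

lemma in_L: "0 \<in> L" "X \<in> L \<Longrightarrow> Y \<in> L \<Longrightarrow> X + Y \<in> L" "X \<in> L \<Longrightarrow> Y \<in> L \<Longrightarrow> X - Y \<in> L"
  "X \<in> L \<Longrightarrow> r *\<^sub>R X \<in> L" "X \<in> L \<Longrightarrow> - X \<in> L"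
  using L_subspace by (auto simp: subspace_0 subspace_add subspace_diff subspace_scale subspace_neg)

lemma in_C: "0 \<in> C" "X \<in> C \<Longrightarrow> Y \<in> C \<Longrightarrow> X + Y \<in> C" "X \<in> C \<Longrightarrow> Y \<in> C \<Longrightarrow> X - Y \<in> C"
  "X \<in> C \<Longrightarrow> r *\<^sub>R X \<in> C" "X \<in> C \<Longrightarrow> - X \<in> C" "X \<in> C \<Longrightarrow> X \<in> L"
  using C_subspace C_L by (auto simp: subspace_0 subspace_add subspace_diff subspace_scale subspace_neg)

lemma H_iff: "Y \<in> H \<longleftrightarrow> Y \<in> L \<and> (\<forall>X\<in>C. B X Y = 0)"
  unfolding H_def orth_complement_def using ip_eq in_C(6) by auto

lemma H_L: "Y \<in> H \<Longrightarrow> Y \<in> L"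
  by (simp add: H_iff)

lemma H_subspace: "subspace H"
  using L_subspace by (auto simp: subspace_def H_iff B.zero_right B.add_right B.scaleR_right)

lemma dexp_L: "X \<in> L \<Longrightarrow> Y \<in> L \<Longrightarrow> dexp X Y \<in> L"
  by (intro dexp_in_subspace[OF L_subspace] L_conj in_L)

text \<open>The infinitesimal form of \<open>B_conj\<close>: differentiate the constant function s
  -> B(Ad(exp(-sX)) Y, Ad(exp(-sX)) Z) at 0.\<close>

lemma B_ad:
  assumes "X \<in> L" "Y \<in> L" "Z \<in> L"
  shows "B (lie_bracket Y X) Z = B Y (lie_bracket X Z)"
proof -
  have "((\<lambda>s. B (conj_mexp (s *\<^sub>R X) Y) (conj_mexp (s *\<^sub>R X) Z)) has_vector_derivative
      B (conj_mexp (0 *\<^sub>R X) Y) (conj_mexp (0 *\<^sub>R X) (lie_bracket Z X)) + B (conj_mexp (0 *\<^sub>R X) (lie_bracket Y X)) (conj_mexp (0 *\<^sub>R X) Z)) (at 0)"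
    by (rule B.has_vector_derivative) (rule conj_mexp_has_vector_derivative)+
  moreover have "(\<lambda>s. B (conj_mexp (s *\<^sub>R X) Y) (conj_mexp (s *\<^sub>R X) Z)) = (\<lambda>s. B Y Z)"
    using assms by (intro ext B_conj in_L)
  ultimately have "((\<lambda>s::real. B Y Z) has_vector_derivative B Y (lie_bracket Z X) + B (lie_bracket Y X) Z) (at 0)" by simp
  from vector_derivative_unique_at[OF this has_vector_derivative_const]
  have "B Y (lie_bracket Z X) + B (lie_bracket Y X) Z = 0" .
  then show ?thesis by (subst lie_bracket_commute[of X Z]) (simp add: B.minus_right)
qed

lemmas bproj_C = bproj[OF C_subspace B_bilinear B_sym B_pos[OF in_C(6)]]

definition PC :: "'k^'n^'n \<Rightarrow> 'k^'n^'n" where "PC = bproj B C"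

lemma PC: "linear PC" "PC X \<in> C" "X \<in> C \<Longrightarrow> PC X = X" "Z \<in> C \<Longrightarrow> B (PC X) Z = B X Z"
proof -
  show "linear PC" unfolding PC_def by (rule bproj_C(1))
  show "PC X \<in> C" unfolding PC_def by (rule bproj_C(2))
  show "PC X = X" if "X \<in> C" unfolding PC_def by (rule bproj_C(3)[OF _ _ that])
  show "B (PC X) Z = B X Z" if "Z \<in> C" unfolding PC_def by (rule bproj_C(4)[OF _ _ that])
qed

lemma PC_H: "X \<in> H \<Longrightarrow> PC X = 0"
  unfolding PC_def by (rule bproj_C(5)) (simp_all add: H_iff B_sym[of X])

lemma PC_bounded: "bounded_linear PC"
  using PC(1) linear_conv_bounded_linear by blast

lemma minus_PC_H: "X \<in> L \<Longrightarrow> X - PC X \<in> H"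
  using PC(2,4) in_C(6) in_L(3) by (auto simp: H_iff B.diff_right B_sym)

text \<open>Since \<open>C\<close> is abelian, conjugation by exp(\<theta>) fixes \<open>C\<close>
  pointwise; being isometric for \<open>B\<close> on \<open>L\<close>, it then preserves the
  orthogonal complement of \<open>C\<close>.\<close>

lemma conj_mexp_C_H:
  assumes "\<theta> \<in> C" "X \<in> H" shows "conj_mexp \<theta> X \<in> H"
proof -
  have "B Z (conj_mexp \<theta> X) = 0" if Z: "Z \<in> C" for Z
  proof -
    have "conj_mexp \<theta> Z = Z" by (rule conj_mexp_commute) (use C_abelian Z assms in auto)
    then show ?thesis using B_conj[of \<theta> Z X] assms Z in_C(6) by (simp add: H_iff)
  qed
  then show ?thesis using L_conj in_C(6) assms H_L by (auto simp: H_iff)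
qed

lemma inv_mult: "A \<in> G \<Longrightarrow> matrix_inv A ** A = mat 1" "A \<in> G \<Longrightarrow> A ** matrix_inv A = mat 1"
  by (simp_all add: matrix_inv_mult G_invertible)

lemma inv_cancel: "A \<in> G \<Longrightarrow> matrix_inv A ** (A ** X) = X" "A \<in> G \<Longrightarrow> A ** (matrix_inv A ** X) = X"
  by (simp_all add: matrix_mul_assoc inv_mult)

text \<open>The inverses belong to the bounded set \<open>G\<close> themselves, so the resolvent
  identity gives a Lipschitz constant.\<close>

lemma continuous_on_inv: "continuous_on G matrix_inv"
proof -
  obtain M where M: "M > 0" "\<And>(A::'k^'n^'n) (B::'k^'n^'n). norm (A ** B) \<le> norm A * norm B * M"
    using mm.pos_bounded by blast
  obtain R where R: "R > 0" "\<And>A. A \<in> G \<Longrightarrow> norm A \<le> R"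
    using compact_imp_bounded[OF G_compact] by (auto simp: bounded_pos)
  have "norm (matrix_inv A - matrix_inv A') \<le> (R * R * M * M) * norm (A - A')" if A: "A \<in> G" "A' \<in> G" for A A'
  proof -
    have "matrix_inv A - matrix_inv A' = matrix_inv A ** (A' - A) ** matrix_inv A'"
    proof -
      have "matrix_inv A ** A' ** matrix_inv A' = matrix_inv A"
        by (simp add: matrix_mul_assoc[symmetric] inv_mult A)
      then show ?thesis by (simp add: mm.diff_left mm.diff_right inv_mult A)
    qed
    then have "norm (matrix_inv A - matrix_inv A') \<le> norm (matrix_inv A ** (A' - A)) * norm (matrix_inv A') * M"
      using M(2) by simp
    also have "\<dots> \<le> (norm (matrix_inv A) * norm (A' - A) * M) * norm (matrix_inv A') * M"
      using M by (intro mult_right_mono) auto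
    also have "\<dots> \<le> (R * norm (A' - A) * M) * R * M"
      using R G_inv A M(1) by (intro mult_mono mult_nonneg_nonneg) (auto intro: less_imp_le)
    finally show ?thesis by (simp add: norm_minus_commute mult_ac)
  qed
  then have "(R * R * M * M)-lipschitz_on G matrix_inv"
    using R M by (auto simp: lipschitz_on_def dist_norm)
  then show ?thesis by (rule lipschitz_on_continuous_on)
qed

text \<open>A horizontal curve must have horizontal derivative wherever it is differentiable,
  whereas \<open>u\<close> describes the derivative only almost everywhere. For \<open>y\<close>
  orthogonal to \<open>H\<close>, the function s -> y . (\<gamma>(t)^(-1) \<gamma>(s)) has an
  integrand that tends to 0 as s tends to t, so its derivative at \<open>t\<close> is 0, also at
  exceptional points \<open>t\<close>.\<close>

lemma horizontalI:
  assumes cd: "c < d" and \<gamma>: "\<And>t. t \<in> {c..d} \<Longrightarrow> \<gamma> t \<in> G"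
    and lip: "lip_ae c d \<gamma> (\<lambda>t. \<gamma> t ** u t)" and u: "\<And>t. t \<in> {c..d} \<Longrightarrow> u t \<in> H"
    and bu: "bounded (u ` {c..d})"
  shows "horizontal_curve G H c d \<gamma>"
  unfolding horizontal_curve_def
proof (intro conjI ballI allI impI)
  show "c < d" "\<gamma> ` {c..d} \<subseteq> G" "abs_cont_curve c d \<gamma>" using cd \<gamma> lip_ae_abs_cont[OF lip] by auto
  fix t v assume t: "t \<in> {c..d}" and v: "(\<gamma> has_vector_derivative v) (at t within {c..d})"
  have "matrix_inv (\<gamma> t) ** v \<in> orthogonal_comp (orthogonal_comp H)"
    unfolding orthogonal_comp_def[of "orthogonal_comp H"]
  proof safe
    fix y assume y: "y \<in> orthogonal_comp H"
    have bl: "bounded_linear (\<lambda>x. y \<bullet> (matrix_inv (\<gamma> t) ** x))"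
      by (intro bounded_linear_compose[OF bounded_linear_inner_right mm.bounded_linear_right])
    let ?f = "\<lambda>s. y \<bullet> (matrix_inv (\<gamma> t) ** \<gamma> s)"
    have l: "lip_ae c d ?f (\<lambda>s. y \<bullet> (matrix_inv (\<gamma> t) ** (\<gamma> s ** u s)))"
      by (rule lip_ae_linear[OF bl lip])
    have d1: "(?f has_vector_derivative 0) (at t within {c..d})"
    proof (rule has_vector_derivative_zeroI[OF t negligible_empty lip_ae_has_integral[OF l]])
      fix e :: real assume e: "e > 0"
      obtain U where U: "U \<ge> 0" "\<And>s. s \<in> {c..d} \<Longrightarrow> norm (u s) \<le> U" using bounded_imageE[OF bu] by blast
      obtain M where M: "M > 0" "\<And>(A::'k^'n^'n) (B::'k^'n^'n). norm (A ** B) \<le> norm A * norm B * M"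
        using mm.pos_bounded by blast
      define e' where "e' = e / (norm y * U * M + 1)"
      have den: "norm y * U * M + 1 > 0" using U M by (simp add: add_nonneg_pos)
      have e': "e' > 0" using e den by (simp add: e'_def)
      have "continuous_on {c..d} (\<lambda>s. matrix_inv (\<gamma> t) ** \<gamma> s)"
        by (intro mm.continuous_on continuous_on_const lip_ae_continuous[OF lip])
      then obtain \<delta> where \<delta>: "\<delta> > 0" "\<And>s. s \<in> {c..d} \<Longrightarrow> dist s t < \<delta> \<Longrightarrow> dist (matrix_inv (\<gamma> t) ** \<gamma> s) (matrix_inv (\<gamma> t) ** \<gamma> t) < e'"
        unfolding continuous_on_iff using t e' by blast
      have "norm (y \<bullet> (matrix_inv (\<gamma> t) ** (\<gamma> s ** u s))) \<le> e" if s: "s \<in> {c..d}" "\<bar>s - t\<bar> < \<delta>" for s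
      proof -
        have 1: "norm (matrix_inv (\<gamma> t) ** \<gamma> s - mat 1) \<le> e'"
          using \<delta>(2)[OF s(1)] s(2) inv_mult(1)[OF \<gamma>[OF t]] by (simp add: dist_norm)
        have "y \<bullet> u s = 0" using y u[OF s(1)] by (auto simp: orthogonal_comp_def orthogonal_def inner_commute)
        then have "y \<bullet> (matrix_inv (\<gamma> t) ** (\<gamma> s ** u s)) = y \<bullet> ((matrix_inv (\<gamma> t) ** \<gamma> s - mat 1) ** u s)"
          by (simp add: mm.diff_left inner_diff_right matrix_mul_assoc)
        then have "norm (y \<bullet> (matrix_inv (\<gamma> t) ** (\<gamma> s ** u s))) \<le> norm y * norm ((matrix_inv (\<gamma> t) ** \<gamma> s - mat 1) ** u s)"
          by (simp add: Cauchy_Schwarz_ineq2)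
        also have "\<dots> \<le> norm y * (norm (matrix_inv (\<gamma> t) ** \<gamma> s - mat 1) * norm (u s) * M)"
          by (intro mult_left_mono M) auto
        also have "\<dots> \<le> norm y * (e' * U * M)"
          using 1 U(1) U(2)[OF s(1)] M(1) e' by (intro mult_left_mono mult_mono) auto
        also have "\<dots> \<le> e' * (norm y * U * M + 1)" using e' by (simp add: algebra_simps)
        also have "\<dots> = e" using den by (simp add: e'_def)
        finally show ?thesis .
      qed
      then show "\<exists>\<delta>>0. \<forall>s\<in>{c..d} - {}. \<bar>s - t\<bar> < \<delta> \<longrightarrow> norm (y \<bullet> (matrix_inv (\<gamma> t) ** (\<gamma> s ** u s))) \<le> e"
        using \<delta>(1) by blast
    qed
    have d2: "(?f has_vector_derivative (y \<bullet> (matrix_inv (\<gamma> t) ** v))) (at t within {c..d})"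
      by (rule bounded_linear.has_vector_derivative[OF bl v])
    have "y \<bullet> (matrix_inv (\<gamma> t) ** v) = 0"
      by (rule vector_derivative_unique_within[OF _ d2 d1]) (use cd t in \<open>simp add: trivial_limit_within islimpt_Icc\<close>)
    then show "orthogonal y (matrix_inv (\<gamma> t) ** v)" by (simp add: orthogonal_def)
  qed
  then have "matrix_inv (\<gamma> t) ** v \<in> H" using orthogonal_comp_self[OF H_subspace] by simp
  then show "v \<in> horizontal_at H (\<gamma> t)"
    unfolding horizontal_at_def using inv_cancel(2)[OF \<gamma>[OF t], of v] by (metis image_eqI)
qed

end

section \<open>Variations of a horizontal curve, their length and their energy\<close>

context sr_structure
begin

text \<open>
  The logarithmic derivative of \<open>\<gamma> e\<^sup>\<eta>\<close> is \<open>log_deriv u \<eta> \<eta>'\<close> if that of \<open>\<gamma>\<close> is \<open>u\<close>.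
\<close>

definition log_deriv :: "'k^'n^'n \<Rightarrow> 'k^'n^'n \<Rightarrow> 'k^'n^'n \<Rightarrow> 'k^'n^'n" where
  "log_deriv u \<eta> \<zeta> = u + dexp \<eta> (\<zeta> + lie_bracket u \<eta>)"

lemma log_deriv_eq: "log_deriv u \<eta> \<zeta> = conj_mexp \<eta> u + dexp \<eta> \<zeta>"
  using conj_mexp_diff[of \<eta> u] by (simp add: log_deriv_def linear_add[OF linear_dexp] algebra_simps)

lemma log_deriv_L: "u \<in> L \<Longrightarrow> \<eta> \<in> L \<Longrightarrow> \<zeta> \<in> L \<Longrightarrow> log_deriv u \<eta> \<zeta> \<in> L"
  unfolding log_deriv_eq by (intro in_L L_conj dexp_L)

text \<open>The primitive exhibits \<open>u\<close> as the derivative part of a Lipschitz curve,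
  which makes it bounded, measurable and integrable.\<close>

lemma control_primitive:
  assumes \<gamma>: "\<And>t. t \<in> {c..d} \<Longrightarrow> \<gamma> t \<in> G" and lip: "lip_ae c d \<gamma> (\<lambda>t. \<gamma> t ** u t)"
  obtains U where "lip_ae c d U u" "U c = 0"
proof -
  have cont: "continuous_on {c..d} (\<lambda>s. matrix_inv (\<gamma> s))"
    by (rule continuous_on_compose2[OF continuous_on_inv lip_ae_continuous[OF lip]]) (use \<gamma> in auto)
  have l: "linear (\<lambda>x. matrix_inv (\<gamma> s) ** x)" for s
    by (rule bounded_linear.linear[OF mm.bounded_linear_right])
  obtain U where "lip_ae c d U (\<lambda>s. matrix_inv (\<gamma> s) ** (\<gamma> s ** u s))" "U c = 0"
    by (rule lip_ae_primitive_linear[OF l _ lip]) (auto intro!: mm.continuous_on cont)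
  then show ?thesis by (intro that[of U]) (auto intro: lip_ae_cong simp: inv_cancel \<gamma>)
qed

lemma log_deriv_primitive:
  assumes U: "lip_ae c d U u" and \<eta>: "lip_ae c d \<eta> \<zeta>"
  obtains W where "lip_ae c d W (\<lambda>t. log_deriv (u t) (\<eta> t) (\<zeta> t))" "W c = 0"
proof -
  have cont: "continuous_on {c..d} \<eta>" by (rule lip_ae_continuous[OF \<eta>])
  obtain W1 where W1: "lip_ae c d W1 (\<lambda>t. conj_mexp (\<eta> t) (u t))" "W1 c = 0"
    by (rule lip_ae_primitive_linear[OF linear_conj_mexp _ U, of \<eta>]) (intro continuous_intros cont, blast)
  obtain W2 where W2: "lip_ae c d W2 (\<lambda>t. dexp (\<eta> t) (\<zeta> t))" "W2 c = 0"
    by (rule lip_ae_primitive_linear[OF linear_dexp _ \<eta>, of \<eta>]) (intro continuous_intros cont, blast)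
  show ?thesis
    by (rule that[of "\<lambda>t. W1 t + W2 t"]) (use lip_ae_add[OF W1(1) W2(1)] W1(2) W2(2) in \<open>simp_all add: log_deriv_eq\<close>)
qed

text \<open>The control of the corrected curve is the conjugate of \<open>w - PC w\<close> by an
  element of the torus direction. Conjugation preserves \<open>B\<close>, so the length of the curve
  is an explicit functional of the variation in which \<theta> no longer occurs.\<close>

lemma comparison_curve:
  assumes cd: "c < d" and \<gamma>: "\<And>t. t \<in> {c..d} \<Longrightarrow> \<gamma> t \<in> G"
    and lip: "lip_ae c d \<gamma> (\<lambda>t. \<gamma> t ** u t)" and u: "\<And>t. t \<in> {c..d} \<Longrightarrow> u t \<in> H"
    and \<eta>: "lip_ae c d \<eta> \<zeta>" "\<And>t. t \<in> {c..d} \<Longrightarrow> \<eta> t \<in> L" "\<And>t. t \<in> {c..d} \<Longrightarrow> \<zeta> t \<in> L" "\<eta> c = 0" "\<eta> d = 0"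
    and closing: "PC (integral {c..d} (\<lambda>t. log_deriv (u t) (\<eta> t) (\<zeta> t))) = 0"
  obtains \<sigma> where "horizontal_curve G H c d \<sigma>" "\<sigma> c = \<gamma> c" "\<sigma> d = \<gamma> d"
    "curve_length ip c d \<sigma> = integral {c..d} (\<lambda>t. sqrt (B (log_deriv (u t) (\<eta> t) (\<zeta> t) - PC (log_deriv (u t) (\<eta> t) (\<zeta> t)))
       (log_deriv (u t) (\<eta> t) (\<zeta> t) - PC (log_deriv (u t) (\<eta> t) (\<zeta> t)))))"
proof -
  define w where "w = (\<lambda>t. log_deriv (u t) (\<eta> t) (\<zeta> t))"
  obtain U where U: "lip_ae c d U u" "U c = 0" by (rule control_primitive[OF \<gamma> lip])
  obtain W where W: "lip_ae c d W w" "W c = 0" unfolding w_def by (rule log_deriv_primitive[OF U(1) \<eta>(1)])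
  have wL: "w t \<in> L" if "t \<in> {c..d}" for t unfolding w_def using that u \<eta> H_L by (intro log_deriv_L) auto
  define \<theta> where "\<theta> = (\<lambda>t. PC (W t))"
  have \<theta>: "lip_ae c d \<theta> (\<lambda>t. PC (w t))" unfolding \<theta>_def by (rule lip_ae_linear[OF PC_bounded W(1)])
  have \<theta>C: "\<theta> t \<in> C" for t unfolding \<theta>_def by (rule PC(2))
  have \<theta>0: "\<theta> c = 0" unfolding \<theta>_def W(2) by (rule linear_0[OF PC(1)])
  have \<theta>d: "\<theta> d = 0"
    using closing lip_ae_integral_eq[OF W(1), of d] cd unfolding \<theta>_def w_def[symmetric] by (simp add: W(2))
  define \<sigma> where "\<sigma> = (\<lambda>t. \<gamma> t ** mexp (\<eta> t) ** mexp (- \<theta> t))"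
  define v where "v = (\<lambda>t. conj_mexp (- \<theta> t) (w t - PC (w t)))"
  have \<sigma>G: "\<sigma> t \<in> G" if "t \<in> {c..d}" for t
    unfolding \<sigma>_def using that by (intro G_mult \<gamma> L_exp \<eta>(2) in_L(5) in_C(6) \<theta>C)
  have vH: "v t \<in> H" if "t \<in> {c..d}" for t
    unfolding v_def by (intro conj_mexp_C_H in_C(5) \<theta>C minus_PC_H wL that)
  have lip1: "lip_ae c d (\<lambda>t. \<gamma> t ** mexp (\<eta> t)) (\<lambda>t. (\<gamma> t ** mexp (\<eta> t)) ** w t)"
  proof (rule lip_ae_cong[OF lip_ae_bilinear[OF mm.bounded_bilinear_axioms lip lip_ae_mexp[OF \<eta>(1)]] refl])
    fix t
    have "mexp (\<eta> t) ** conj_mexp (\<eta> t) (u t) = u t ** mexp (\<eta> t)"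
      by (simp add: conj_mexp_def matrix_mul_assoc)
    then have "\<gamma> t ** mexp (\<eta> t) ** conj_mexp (\<eta> t) (u t) = \<gamma> t ** u t ** mexp (\<eta> t)"
      by (simp add: matrix_mul_assoc[symmetric])
    then show "\<gamma> t ** (mexp (\<eta> t) ** dexp (\<eta> t) (\<zeta> t)) + \<gamma> t ** u t ** mexp (\<eta> t) = \<gamma> t ** mexp (\<eta> t) ** w t"
      by (simp add: w_def log_deriv_eq mm.add_right matrix_mul_assoc)
  qed
  have "lip_ae c d (\<lambda>t. - \<theta> t) (\<lambda>t. - PC (w t))"
    using lip_ae_scaleR[OF \<theta>, of "-1"] by simp
  from lip_ae_bilinear[OF mm.bounded_bilinear_axioms lip1 lip_ae_mexp[OF this]]
  have lip2: "lip_ae c d \<sigma> (\<lambda>t. \<sigma> t ** v t)"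
  proof (rule lip_ae_cong)
    fix t
    \<comment> \<open>All of this happens inside the abelian \<open>C\<close>: \<open>dexp\<close>
      and conjugation act trivially there, so the factor exp(-\<theta>) contributes exactly
      \<open>- PC (w t)\<close> to the control.\<close>
    have PCw: "lie_bracket (PC (w t)) (- \<theta> t) = 0" by (intro C_abelian PC(2) in_C(5) \<theta>C)
    have "lie_bracket (- PC (w t)) (- \<theta> t) = 0" by (intro C_abelian PC(2) in_C(5) \<theta>C)
    then have "dexp (- \<theta> t) (- PC (w t)) = - PC (w t)" by (rule dexp_commute)
    moreover have "v t = conj_mexp (- \<theta> t) (w t) - PC (w t)"
      unfolding v_def linear_diff[OF linear_conj_mexp] conj_mexp_commute[OF PCw] ..
    moreover have "mexp (- \<theta> t) ** conj_mexp (- \<theta> t) (w t) = w t ** mexp (- \<theta> t)"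
      by (simp add: conj_mexp_def matrix_mul_assoc)
    then have "\<sigma> t ** conj_mexp (- \<theta> t) (w t) = \<gamma> t ** mexp (\<eta> t) ** w t ** mexp (- \<theta> t)"
      by (simp add: \<sigma>_def matrix_mul_assoc[symmetric])
    ultimately show "\<gamma> t ** mexp (\<eta> t) ** (mexp (- \<theta> t) ** dexp (- \<theta> t) (- PC (w t))) + \<gamma> t ** mexp (\<eta> t) ** w t ** mexp (- \<theta> t) = \<sigma> t ** v t"
      by (simp add: mm.diff_right mm.minus_right \<sigma>_def matrix_mul_assoc)
  qed (simp add: \<sigma>_def)
  obtain V where "lip_ae c d V v" by (rule control_primitive[OF \<sigma>G lip2])
  then have bv: "bounded (v ` {c..d})" by (rule lip_ae_deriv_bounded)
  have hor: "horizontal_curve G H c d \<sigma>" by (rule horizontalI[OF cd \<sigma>G lip2 vH bv])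
  have Bv: "B (v t) (v t) = B (w t - PC (w t)) (w t - PC (w t))" if "t \<in> {c..d}" for t
    unfolding v_def by (intro B_conj in_L(5) in_C(6) \<theta>C H_L minus_PC_H wL that)
  obtain N where N: "negligible N" "\<And>t. t \<in> {c..d} - N \<Longrightarrow> (\<sigma> has_vector_derivative \<sigma> t ** v t) (at t within {c..d})"
    using lip_aeE[OF lip2] by blast
  have len: "curve_length ip c d \<sigma> = integral {c..d} (\<lambda>t. sqrt (B (w t - PC (w t)) (w t - PC (w t))))"
    unfolding curve_length_def
  proof (rule integral_spike[OF N(1)])
    fix t assume t: "t \<in> {c..d} - N"
    have "vector_derivative \<sigma> (at t within {c..d}) = \<sigma> t ** v t"
      by (rule vector_derivative_within_cbox[OF cd _ N(2)[OF t, folded cbox_interval], unfolded cbox_interval]) (use t in auto)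
    then have "tangent_norm ip (\<sigma> t) (vector_derivative \<sigma> (at t within {c..d})) = sqrt (ip (v t) (v t))"
      using t by (simp add: tangent_norm_def inv_cancel \<sigma>G)
    also have "ip (v t) (v t) = B (v t) (v t)" using t by (intro ip_eq H_L vH) auto
    also have "\<dots> = B (w t - PC (w t)) (w t - PC (w t))" using t by (intro Bv) auto
    finally show "sqrt (B (w t - PC (w t)) (w t - PC (w t))) = tangent_norm ip (\<sigma> t) (vector_derivative \<sigma> (at t within {c..d}))" ..
  qed
  have "\<sigma> c = \<gamma> c" "\<sigma> d = \<gamma> d" by (simp_all add: \<sigma>_def \<eta> \<theta>0 \<theta>d)
  from that[OF hor this] len show ?thesis unfolding w_def by blast
qed

text \<open>
  Length is compared with energy through \<open>2 s x \<le> s\<^sup>2 + x\<^sup>2\<close>, with equality for speed \<open>x = s\<close>.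
\<close>

lemma energy_minimal:
  assumes min: "length_minimizer G ip H c d \<gamma>"
    and lip: "lip_ae c d \<gamma> (\<lambda>t. \<gamma> t ** u t)" and u: "\<And>t. t \<in> {c..d} \<Longrightarrow> u t \<in> H"
    and speed: "negligible {t \<in> {c..d}. sqrt (B (u t) (u t)) \<noteq> s}"
    and \<eta>: "lip_ae c d \<eta> \<zeta>" "\<And>t. t \<in> {c..d} \<Longrightarrow> \<eta> t \<in> L" "\<And>t. t \<in> {c..d} \<Longrightarrow> \<zeta> t \<in> L" "\<eta> c = 0" "\<eta> d = 0"
    and closing: "PC (integral {c..d} (\<lambda>t. log_deriv (u t) (\<eta> t) (\<zeta> t))) = 0"
  shows "s\<^sup>2 * (d - c) \<le> integral {c..d} (\<lambda>t. B (log_deriv (u t) (\<eta> t) (\<zeta> t) - PC (log_deriv (u t) (\<eta> t) (\<zeta> t)))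
       (log_deriv (u t) (\<eta> t) (\<zeta> t) - PC (log_deriv (u t) (\<eta> t) (\<zeta> t))))"
proof -
  have hor: "horizontal_curve G H c d \<gamma>" using min by (simp add: length_minimizer_def)
  then have cd: "c < d" and \<gamma>: "\<gamma> t \<in> G" if "t \<in> {c..d}" for t using that by (auto simp: horizontal_curve_def)
  have cd: "c < d" using hor by (auto simp: horizontal_curve_def)
  define w where "w = (\<lambda>t. log_deriv (u t) (\<eta> t) (\<zeta> t))"
  define n where "n = (\<lambda>t. sqrt (B (w t - PC (w t)) (w t - PC (w t))))"
  obtain \<sigma> where \<sigma>: "horizontal_curve G H c d \<sigma>" "\<sigma> c = \<gamma> c" "\<sigma> d = \<gamma> d" "curve_length ip c d \<sigma> = integral {c..d} n"
    using comparison_curve[OF cd \<gamma> lip u \<eta> closing] unfolding n_def w_def by blast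
  obtain U where U: "lip_ae c d U u" "U c = 0" by (rule control_primitive[OF \<gamma> lip])
  obtain W where W: "lip_ae c d W w" "W c = 0" unfolding w_def by (rule log_deriv_primitive[OF U(1) \<eta>(1)])
  have wL: "w t \<in> L" if "t \<in> {c..d}" for t unfolding w_def using that u \<eta> H_L by (intro log_deriv_L) auto
  have W': "lip_ae c d (\<lambda>t. W t - PC (W t)) (\<lambda>t. w t - PC (w t))"
    by (intro lip_ae_diff lip_ae_linear[OF PC_bounded] W)
  have B0: "B (w t - PC (w t)) (w t - PC (w t)) \<ge> 0" if "t \<in> {c..d}" for t
    using B_pos[OF H_L[OF minus_PC_H[OF wL[OF that]]]] by (cases "w t - PC (w t) = 0") (auto simp: B.zero_left)
  have m1: "(\<lambda>t. B (w t - PC (w t)) (w t - PC (w t))) \<in> borel_measurable (lebesgue_on {c..d})"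
    by (rule measurable_bilinear[OF B_bounded lip_ae_measurable[OF W'] lip_ae_measurable[OF W']])
  have b1: "bounded ((\<lambda>t. B (w t - PC (w t)) (w t - PC (w t))) ` {c..d})"
    by (rule bounded_bilinear_image[OF B_bounded lip_ae_deriv_bounded[OF W'] lip_ae_deriv_bounded[OF W']])
  have i1: "(\<lambda>t. B (w t - PC (w t)) (w t - PC (w t))) integrable_on {c..d}"
    using bounded_measurable_integrable[OF m1 b1] by (simp add: absolutely_integrable_on_def)
  have m2: "n \<in> borel_measurable (lebesgue_on {c..d})"
    unfolding n_def using m1 by measurable
  have b2: "bounded (n ` {c..d})"
  proof -
    obtain b where b: "b \<ge> 0" "\<And>t. t \<in> {c..d} \<Longrightarrow> norm (B (w t - PC (w t)) (w t - PC (w t))) \<le> b"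
      using bounded_imageE[OF b1] by blast
    have "norm (n t) \<le> sqrt b" if "t \<in> {c..d}" for t
      using b(2)[OF that] B0[OF that] by (simp add: n_def)
    then show ?thesis unfolding bounded_iff by blast
  qed
  have i2: "n integrable_on {c..d}"
    using bounded_measurable_integrable[OF m2 b2] by (simp add: absolutely_integrable_on_def)
  obtain N where N: "negligible N" "\<And>t. t \<in> {c..d} - N \<Longrightarrow> (\<gamma> has_vector_derivative \<gamma> t ** u t) (at t within {c..d})"
    using lip_aeE[OF lip] by blast
  have len: "curve_length ip c d \<gamma> = integral {c..d} (\<lambda>t. s)"
    unfolding curve_length_def
  proof (rule integral_spike[OF negligible_Un[OF N(1) speed]])
    fix t assume t: "t \<in> {c..d} - (N \<union> {t \<in> {c..d}. sqrt (B (u t) (u t)) \<noteq> s})"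
    have "(\<gamma> has_vector_derivative \<gamma> t ** u t) (at t within cbox c d)" using N(2) t by simp
    then have "vector_derivative \<gamma> (at t within {c..d}) = \<gamma> t ** u t"
      by (subst vector_derivative_within_cbox[OF cd, of t \<gamma>, unfolded cbox_interval]) (use t in auto)
    then have "tangent_norm ip (\<gamma> t) (vector_derivative \<gamma> (at t within {c..d})) = sqrt (ip (u t) (u t))"
      using t by (simp add: tangent_norm_def inv_cancel \<gamma>)
    also have "ip (u t) (u t) = B (u t) (u t)" using t by (intro ip_eq H_L u) auto
    also have "sqrt \<dots> = s" using t by auto
    finally show "s = tangent_norm ip (\<gamma> t) (vector_derivative \<gamma> (at t within {c..d}))" ..
  qed
  \<comment> \<open>A speed below 0 would be violated at every point of the interval, which is not a
    null set. The sign is needed to multiply the length inequality by 2s.\<close>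
  have s0: "s \<ge> 0"
  proof (rule ccontr)
    assume "\<not> s \<ge> 0"
    then have "sqrt (B (u t) (u t)) \<noteq> s" if "t \<in> {c..d}" for t
      using B_pos[OF H_L[OF u[OF that]]] by (cases "u t = 0") (auto simp: B.zero_left)
    then have "{c..d} \<subseteq> {t \<in> {c..d}. sqrt (B (u t) (u t)) \<noteq> s}" by blast
    then have "negligible {c..d}" using speed negligible_subset by blast
    then show False using cd by (simp add: negligible_interval(1)[of c d, unfolded cbox_interval])
  qed
  have "s * (d - c) \<le> integral {c..d} n"
    using min \<sigma> len cd unfolding length_minimizer_def by (metis content_real integral_const_real less_imp_le mult.commute real_scaleR_def)
  then have "2 * s * (s * (d - c)) \<le> 2 * s * integral {c..d} n" using s0 by (intro mult_left_mono) auto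
  also have "\<dots> = integral {c..d} (\<lambda>t. 2 * s * n t)" by simp
  also have "\<dots> \<le> integral {c..d} (\<lambda>t. B (w t - PC (w t)) (w t - PC (w t)) + s\<^sup>2)"
  proof (rule integral_le)
    fix t assume t: "t \<in> {c..d}"
    have "0 \<le> (n t - s)\<^sup>2" by simp
    also have "\<dots> = (n t)\<^sup>2 - 2 * s * n t + s\<^sup>2" by (simp add: power2_diff)
    also have "(n t)\<^sup>2 = B (w t - PC (w t)) (w t - PC (w t))" using B0[OF t] by (simp add: n_def)
    finally show "2 * s * n t \<le> B (w t - PC (w t)) (w t - PC (w t)) + s\<^sup>2" by simp
  next
    show "(\<lambda>t. 2 * s * n t) integrable_on {c..d}"
      using integrable_on_cmult_left[OF i2, of "2 * s"] by simp
    show "(\<lambda>t. B (w t - PC (w t)) (w t - PC (w t)) + s\<^sup>2) integrable_on {c..d}"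
      by (intro integrable_add i1 integrable_const_ivl)
  qed
  also have "\<dots> = integral {c..d} (\<lambda>t. B (w t - PC (w t)) (w t - PC (w t))) + s\<^sup>2 * (d - c)"
    using integral_add[OF i1 integrable_const_ivl[of "s\<^sup>2" c d]] cd by simp
  finally show ?thesis by (simp add: w_def power2_eq_square algebra_simps)
qed

end

text \<open>Since \<open>f\<close> is a primitive of f', it is a primitive of the continuous
  \<open>g\<close> too; this upgrades an equation that holds almost everywhere to one that holds at
  every point.\<close>

lemma lip_ae_continuous_deriv:
  assumes f: "lip_ae a b f f'" and g: "continuous_on {a..b} g"
    and N: "negligible N" "\<And>t. t \<in> {a..b} - N \<Longrightarrow> f' t = g t" and t: "t \<in> {a..b}"
  shows "(f has_vector_derivative g t) (at t within {a..b})"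
proof -
  have "((\<lambda>x. f a + integral {a..x} g) has_vector_derivative g t) (at t within {a..b})"
    using has_vector_derivative_add[OF has_vector_derivative_const integral_has_vector_derivative[OF g t]] by simp
  then show ?thesis
  proof (rule has_vector_derivative_transform[OF t, rotated])
    fix x assume x: "x \<in> {a..b}"
    have "integral {a..x} g = integral {a..x} f'"
      by (rule integral_spike[OF N(1)]) (use N(2) x in auto)
    then show "f x = f a + integral {a..x} g" using lip_ae_integral_eq[OF f x] by simp
  qed
qed

lemma riesz_on_subspace:
  fixes B :: "'a::euclidean_space \<Rightarrow> 'a \<Rightarrow> real"
  assumes V: "subspace V" and B: "bilinear B" and sym: "\<And>x y. B x y = B y x"
    and pos: "\<And>x. x \<in> V \<Longrightarrow> x \<noteq> 0 \<Longrightarrow> B x x > 0" and \<phi>: "linear \<phi>"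
  obtains Z where "Z \<in> V" "\<And>y. y \<in> V \<Longrightarrow> \<phi> y = B Z y"
proof -
  obtain E where "orthonormal_basis B V E" using ex_orthonormal_basis[OF V B] sym pos by blast
  then have E: "finite E" "span E = V" "\<And>e e'. e \<in> E \<Longrightarrow> e' \<in> E \<Longrightarrow> B e e' = (if e = e' then 1 else 0)"
    by (auto simp: orthonormal_basis_def)
  show ?thesis
  proof (rule that[of "\<Sum>e\<in>E. \<phi> e *\<^sub>R e"])
    show "(\<Sum>e\<in>E. \<phi> e *\<^sub>R e) \<in> V"
      using E(2) by (intro subspace_sum[OF V] subspace_scale[OF V]) (use span_base in blast)
    fix y assume "y \<in> V"
    then have y: "y = (\<Sum>e\<in>E. B y e *\<^sub>R e)" using E(2) by (intro orthonormal_expansion[OF B E(1,3)]) auto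
    have "\<phi> y = (\<Sum>e\<in>E. B y e * \<phi> e)"
      by (subst y) (simp add: linear_sum[OF \<phi>] linear_scale[OF \<phi>])
    also have "\<dots> = B (\<Sum>e\<in>E. \<phi> e *\<^sub>R e) y"
      by (simp add: bilinear_sum_simps[OF B] bilinear_lmul[OF B] sym[of y] mult.commute)
    finally show "\<phi> y = B (\<Sum>e\<in>E. \<phi> e *\<^sub>R e) y" .
  qed
qed

context sr_structure
begin

sublocale lb: bounded_bilinear "lie_bracket :: 'k^'n^'n \<Rightarrow> 'k^'n^'n \<Rightarrow> 'k^'n^'n"
  by (rule bounded_bilinear_lie_bracket)

text \<open>
  The set \<open>A\<close> of annihilators collects the multipliers that make the curve abnormal. Restricting the
  variations to the centralizer \<open>kk\<close> of \<open>A\<close> keeps the holonomy in \<open>V\<close>, where the constraint is regular.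
\<close>

lemma energy_constraint_not_onto:
  assumes min: "length_minimizer G ip H c d \<gamma>"
    and lip: "lip_ae c d \<gamma> (\<lambda>t. \<gamma> t ** u t)" and u: "\<And>t. t \<in> {c..d} \<Longrightarrow> u t \<in> H"
    and speed: "negligible {t \<in> {c..d}. sqrt (B (u t) (u t)) \<noteq> s}"
    and A_def: "A = {Z \<in> C. \<forall>t\<in>{c..d}. lie_bracket Z (u t) = 0}"
    and kk_def: "kk = {Y \<in> L. \<forall>Z\<in>A. lie_bracket Z Y = 0}"
    and V_def: "V = {Y \<in> C. \<forall>Z\<in>A. B Z Y = 0}"
    and surj: "\<And>r y. y \<in> V \<Longrightarrow> \<exists>\<eta> \<zeta>. lip_ae c d \<eta> \<zeta> \<and> (\<forall>t\<in>{c..d}. \<eta> t \<in> kk \<and> \<zeta> t \<in> kk) \<and> \<eta> c = 0 \<and> \<eta> d = 0 \<and>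
        2 * integral {c..d} (\<lambda>t. B (u t) (\<zeta> t)) = r \<and> PC (integral {c..d} (\<lambda>t. \<zeta> t + lie_bracket (u t) (\<eta> t))) = y"
  shows False
proof -
  have hor: "horizontal_curve G H c d \<gamma>" using min by (simp add: length_minimizer_def)
  then have \<gamma>: "\<gamma> t \<in> G" if "t \<in> {c..d}" for t using that by (auto simp: horizontal_curve_def)
  have cd: "c < d" using hor by (auto simp: horizontal_curve_def)
  obtain U where U: "lip_ae c d U u" "U c = 0" by (rule control_primitive[OF \<gamma> lip])
  have kkL: "Y \<in> L" if "Y \<in> kk" for Y using that by (simp add: kk_def)
  have AC: "Z \<in> C" if "Z \<in> A" for Z using that by (simp add: A_def)
  have Vsub: "subspace V" using C_subspace by (auto simp: subspace_def V_def B.zero_right B.add_right B.scaleR_right)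
  have VC: "Y \<in> C" if "Y \<in> V" for Y using that by (simp add: V_def)
  define \<pi> where "\<pi> = bproj B V"
  have Vpos: "B x x > 0" if "x \<in> V" "x \<noteq> 0" for x using that B_pos in_C(6) VC by blast
  note bp = bproj[OF Vsub B_bilinear B_sym Vpos]
  have \<pi>: "linear \<pi>" "\<pi> x \<in> V" "x \<in> V \<Longrightarrow> \<pi> x = x" for x
    unfolding \<pi>_def by (rule bp(1), assumption+, rule bp(2), assumption+, rule bp(3), assumption+)
  define test where "test = (\<lambda>\<eta> \<zeta>. lip_ae c d \<eta> \<zeta> \<and> (\<forall>t\<in>{c..d}. \<eta> t \<in> kk \<and> \<zeta> t \<in> kk) \<and> \<eta> c = 0 \<and> \<eta> d = 0)"
  \<comment> \<open>First variations are prescribed for all pairs \<open>b\<close>, also those with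
    \<open>snd b\<close> outside \<open>V\<close>; \<pi> moves the second component into
    \<open>V\<close>, where \<open>surj\<close> applies.\<close>
  define Q where "Q = (\<lambda>(b::real \<times> ('k^'n^'n)) \<eta> \<zeta>. test \<eta> \<zeta> \<and> 2 * integral {c..d} (\<lambda>t. B (u t) (\<zeta> t)) = fst b \<and>
      PC (integral {c..d} (\<lambda>t. \<zeta> t + lie_bracket (u t) (\<eta> t))) = \<pi> (snd b))"
  have "\<forall>b. \<exists>\<eta> \<zeta>. Q b \<eta> \<zeta>"
    unfolding Q_def test_def conj_assoc using surj[OF \<pi>(2)] by (intro allI)
  from choice[OF this] obtain \<eta>b where "\<forall>b. \<exists>\<zeta>. Q b (\<eta>b b) \<zeta>" ..
  from choice[OF this] obtain \<zeta>b where Qb: "\<forall>b. Q b (\<eta>b b) (\<zeta>b b)" ..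
  have b: "test (\<eta>b b) (\<zeta>b b)" "2 * integral {c..d} (\<lambda>t. B (u t) (\<zeta>b b t)) = fst b"
    "PC (integral {c..d} (\<lambda>t. \<zeta>b b t + lie_bracket (u t) (\<eta>b b t))) = \<pi> (snd b)" for b
    using Qb[unfolded Q_def, rule_format, of b] by (rule conjunct1, rule conjunct1[OF conjunct2], rule conjunct2[OF conjunct2])
  have bl: "lip_ae c d (\<eta>b b) (\<zeta>b b)" "t \<in> {c..d} \<Longrightarrow> \<eta>b b t \<in> kk" "t \<in> {c..d} \<Longrightarrow> \<zeta>b b t \<in> kk" "\<eta>b b c = 0" "\<eta>b b d = 0" for b t
    using b(1)[of b] by (auto simp: test_def)
  \<comment> \<open>The family is linear in the finitely many parameters \<open>x\<close>, so its
    first variations at 0 are \<open>fst x\<close> for the energy and \<open>\<pi> (snd x)\<close>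
    for the constraint.\<close>
  define \<eta> where "\<eta> = (\<lambda>(x::real \<times> ('k^'n^'n)) t. \<Sum>b\<in>Basis. (x \<bullet> b) *\<^sub>R \<eta>b b t)"
  define \<zeta> where "\<zeta> = (\<lambda>(x::real \<times> ('k^'n^'n)) t. \<Sum>b\<in>Basis. (x \<bullet> b) *\<^sub>R \<zeta>b b t)"
  define q where "q = (\<lambda>x t. \<zeta> x t + lie_bracket (u t) (\<eta> x t))"
  define w where "w = (\<lambda>x t. log_deriv (u t) (\<eta> x t) (\<zeta> x t))"
  have w_eq: "w x t = u t + dexp (\<eta> x t) (q x t)" for x t by (simp add: w_def q_def log_deriv_def)
  have lipx: "lip_ae c d (\<eta> x) (\<zeta> x)" for x
    unfolding \<eta>_def \<zeta>_def by (intro lip_ae_sum lip_ae_scaleR bl) auto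
  have kksub: "subspace kk"
    using L_subspace by (auto simp: subspace_def kk_def lb.zero_right lb.add_right lb.scaleR_right)
  have \<eta>kk: "\<eta> x t \<in> kk" and \<zeta>kk: "\<zeta> x t \<in> kk" if "t \<in> {c..d}" for x t
    unfolding \<eta>_def \<zeta>_def using that by (auto intro!: subspace_sum subspace_scale kksub bl)
  have \<eta>end: "\<eta> x c = 0" "\<eta> x d = 0" for x by (simp_all add: \<eta>_def bl)
  have "\<exists>W. \<forall>x. lip_ae c d (W x) (w x) \<and> W x c = 0"
  proof (rule choice, rule allI)
    fix x
    obtain W where "lip_ae c d W (w x)" "W c = 0" unfolding w_def by (rule log_deriv_primitive[OF U(1) lipx[of x]])
    then show "\<exists>W. lip_ae c d W (w x) \<and> W c = 0" by blast
  qed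
  then obtain W where W: "\<And>x. lip_ae c d (W x) (w x)" by blast
  have uq: "lip_ae c d (\<lambda>t. integral {c..t} (\<lambda>s. lie_bracket (u s) (\<eta> x s))) (\<lambda>t. lie_bracket (u t) (\<eta> x t))" for x
    using lip_ae_primitive[OF lb.flip lip_ae_continuous[OF lipx[of x]] U(1)] .
  have qint: "q x integrable_on {c..d}" for x
    unfolding q_def using lip_ae_has_integral[OF lip_ae_add[OF lipx[of x] uq[of x]] order_refl _ order_refl] cd by auto
  have wint: "w x integrable_on {c..d}" for x
    using lip_ae_has_integral[OF W(1)[of x] order_refl _ order_refl] cd by auto
  have wL: "w x t \<in> L" if "t \<in> {c..d}" for x t
    unfolding w_def using that by (intro log_deriv_L H_L u kkL \<eta>kk \<zeta>kk)
  obtain Mu where Mu: "Mu \<ge> 0" "\<And>t. t \<in> {c..d} \<Longrightarrow> norm (u t) \<le> Mu"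
    using bounded_imageE[OF lip_ae_deriv_bounded[OF U(1)]] by blast
  have "\<exists>M\<ge>0. \<forall>t\<in>{c..d}. norm (\<eta>b b t) \<le> M \<and> norm (\<zeta>b b t) \<le> M" for b
  proof -
    obtain M1 where M1: "M1 \<ge> 0" "\<And>t. t \<in> {c..d} \<Longrightarrow> norm (\<eta>b b t) \<le> M1"
      using bounded_imageE[OF lip_ae_bounded[OF bl(1)[of b]]] by blast
    obtain M2 where M2: "M2 \<ge> 0" "\<And>t. t \<in> {c..d} \<Longrightarrow> norm (\<zeta>b b t) \<le> M2"
      using bounded_imageE[OF lip_ae_deriv_bounded[OF bl(1)[of b]]] by blast
    show ?thesis using M1 M2 by (intro exI[of _ "max M1 M2"]) (auto intro: max.coboundedI1 max.coboundedI2)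
  qed
  then obtain Mb where Mb: "\<And>b. Mb b \<ge> 0" "\<And>b t. t \<in> {c..d} \<Longrightarrow> norm (\<eta>b b t) \<le> Mb b" "\<And>b t. t \<in> {c..d} \<Longrightarrow> norm (\<zeta>b b t) \<le> Mb b"
    by metis
  define M where "M = (\<Sum>b\<in>Basis. Mb b)"
  have M0: "M \<ge> 0" unfolding M_def by (intro sum_nonneg Mb)
  have comb: "norm (\<Sum>b\<in>Basis. (x \<bullet> b) *\<^sub>R f b) \<le> M * norm x" if "\<And>b. norm (f b) \<le> Mb b" for x :: "real \<times> ('k^'n^'n)" and f :: "_ \<Rightarrow> 'k^'n^'n"
  proof -
    have "norm (\<Sum>b\<in>Basis. (x \<bullet> b) *\<^sub>R f b) \<le> (\<Sum>b\<in>Basis. norm x * Mb b)"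
    proof (rule sum_norm_le)
      fix b :: "real \<times> ('k^'n^'n)" assume "b \<in> Basis"
      then have "\<bar>x \<bullet> b\<bar> \<le> norm x" by (rule Basis_le_norm)
      then show "norm ((x \<bullet> b) *\<^sub>R f b) \<le> norm x * Mb b" using that[of b] by (simp add: mult_mono)
    qed
    then show ?thesis by (simp add: M_def sum_distrib_left mult.commute)
  qed
  have \<eta>M: "norm (\<eta> x t) \<le> M * norm x" and \<zeta>M: "norm (\<zeta> x t) \<le> M * norm x" if "t \<in> {c..d}" for x t
    unfolding \<eta>_def \<zeta>_def using Mb(2,3)[OF that] by (auto intro: comb)
  obtain Kl where Kl: "Kl > 0" "\<And>X Y::'k^'n^'n. norm (lie_bracket X Y) \<le> norm X * norm Y * Kl"
    using lb.pos_bounded by blast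
  obtain KB where KB: "KB > 0" "\<And>X Y. norm (B X Y) \<le> norm X * norm Y * KB"
    using B.pos_bounded by blast
  obtain KP where KP: "KP > 0" "\<And>X. norm (PC X) \<le> norm X * KP"
    using bounded_linear.pos_bounded[OF PC_bounded] by blast
  define Mq where "Mq = M + Mu * M * Kl"
  have Mq0: "Mq \<ge> 0" using M0 Mu Kl by (simp add: Mq_def)
  have qM: "norm (q x t) \<le> Mq * norm x" if t: "t \<in> {c..d}" for x t
  proof -
    have "norm (lie_bracket (u t) (\<eta> x t)) \<le> norm (u t) * norm (\<eta> x t) * Kl" by (rule Kl)
    also have "\<dots> \<le> Mu * (M * norm x) * Kl"
      using Mu \<eta>M[OF t, of x] t Kl(1) M0 by (intro mult_mono mult_nonneg_nonneg) auto
    finally show ?thesis using \<zeta>M[OF t, of x] norm_triangle_ineq[of "\<zeta> x t" "lie_bracket (u t) (\<eta> x t)"]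
      by (simp add: q_def Mq_def algebra_simps)
  qed
  obtain K0 where K0: "K0 > 0"
    "\<And>(X::'k^'n^'n) (V::'k^'n^'n). norm X \<le> M \<Longrightarrow> norm (dexp X V) \<le> K0 * norm V"
    "\<And>(X::'k^'n^'n) (V::'k^'n^'n). norm X \<le> M \<Longrightarrow> norm (dexp X V - V) \<le> K0 * norm X * norm V"
    using dexp_bounds[of M] by metis
  define r where "r = (\<lambda>x t. dexp (\<eta> x t) (q x t) - q x t)"
  define K1 where "K1 = K0 * M * Mq"
  have K10: "K1 \<ge> 0" using K0 M0 Mq0 by (simp add: K1_def)
  have nx: "norm (\<eta> x t) \<le> M" if "t \<in> {c..d}" "norm x < 1" for x t
    using \<eta>M[OF that(1), of x] that(2) M0 by (meson less_imp_le mult_left_le order_trans)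
  have rM: "norm (r x t) \<le> K1 * (norm x)\<^sup>2" if t: "t \<in> {c..d}" and x: "norm x < 1" for x t
  proof -
    have "norm (r x t) \<le> K0 * norm (\<eta> x t) * norm (q x t)" unfolding r_def by (rule K0(3)[OF nx[OF t x]])
    also have "\<dots> \<le> K0 * (M * norm x) * (Mq * norm x)"
      using \<eta>M[OF t, of x] qM[OF t, of x] K0(1) M0 by (intro mult_mono mult_nonneg_nonneg) auto
    finally show ?thesis by (simp add: K1_def power2_eq_square mult_ac)
  qed
  define P where "P = (\<lambda>X. X - PC X)"
  have P: "bounded_linear P" unfolding P_def by (intro bounded_linear_sub bounded_linear_ident PC_bounded)
  interpret P: bounded_linear P by fact
  obtain KQ where KQ: "KQ > 0" "\<And>X. norm (P X) \<le> norm X * KQ"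
    using P.pos_bounded by blast
  define j where "j = (\<lambda>x t. B (P (w x t)) (P (w x t)))"
  have LP: "lip_ae c d (\<lambda>t. P (W x t)) (\<lambda>t. P (w x t))" for x by (rule lip_ae_linear[OF P W(1)])
  have jint: "j x integrable_on {c..d}" for x
    using bounded_measurable_integrable[OF measurable_bilinear[OF B_bounded lip_ae_measurable[OF LP] lip_ae_measurable[OF LP]]
       bounded_bilinear_image[OF B_bounded lip_ae_deriv_bounded[OF LP] lip_ae_deriv_bounded[OF LP]], of x x]
    by (simp add: j_def absolutely_integrable_on_def)
  have Bu\<zeta>int: "(\<lambda>t. 2 * B (u t) (\<zeta>' t)) integrable_on {c..d}" if "lip_ae c d \<eta>' \<zeta>'" for \<eta>' \<zeta>'
    using bounded_measurable_integrable[OF measurable_bilinear[OF B_bounded lip_ae_measurable[OF U(1)] lip_ae_measurable[OF that]]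
       bounded_bilinear_image[OF B_bounded lip_ae_deriv_bounded[OF U(1)] lip_ae_deriv_bounded[OF that]]]
      integrable_on_cmult_left[of "\<lambda>t. B (u t) (\<zeta>' t)" "{c..d}" 2]
    by (simp add: absolutely_integrable_on_def)
  have Pu: "P (u t) = u t" if "t \<in> {c..d}" for t using PC_H[OF u[OF that]] by (simp add: P_def)
  have \<eta>0: "\<eta> 0 t = 0" "\<zeta> 0 t = 0" "q 0 t = 0" for t by (simp_all add: \<eta>_def \<zeta>_def q_def lb.zero_right)
  have w0: "w 0 t = u t" for t by (simp add: w_eq \<eta>0)
  have BuP: "B (u t) (P X) = B (u t) X" if "t \<in> {c..d}" for t X
    using u[OF that] PC(2)[of X] by (simp add: P_def B.diff_right H_iff B_sym[of "u t" "PC X"])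
  \<comment> \<open>By the skewness of ad, the bracket term drops out of the first variation of the
    energy, which is left with the pairing of \<open>u\<close> and \<zeta>.\<close>
  have ortho: "B (u t) (lie_bracket (u t) (\<eta> x t)) = 0" if t: "t \<in> {c..d}" for x t
    using B_ad[of "u t" "u t" "\<eta> x t"] H_L[OF u[OF t]] kkL[OF \<eta>kk[OF t]] by (simp add: lie_bracket_simps B.zero_left)
  define KJ where "KJ = 2 * (Mu * K1 * KB) + ((Mq + K1) * KQ) * ((Mq + K1) * KQ) * KB"
  have jquad: "norm (j x t - j 0 t - 2 * B (u t) (\<zeta> x t)) \<le> KJ * (norm x)\<^sup>2" if x: "norm x < 1" and t: "t \<in> {c..d}" for x t
  proof -
    have w1: "w x t = u t + (q x t + r x t)" by (simp add: w_eq r_def)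
    have "j x t = B (u t) (u t) + 2 * B (u t) (P (q x t + r x t)) + B (P (q x t + r x t)) (P (q x t + r x t))"
      unfolding j_def w1 P.add[of "u t"] Pu[OF t] B.add_left B.add_right
      by (simp add: B_sym[of "P (q x t + r x t)" "u t"])
    also have "B (u t) (P (q x t + r x t)) = B (u t) (\<zeta> x t) + B (u t) (r x t)"
      by (simp add: BuP[OF t] q_def B.add_right ortho[OF t])
    finally have e: "j x t - j 0 t - 2 * B (u t) (\<zeta> x t) = 2 * B (u t) (r x t) + B (P (q x t + r x t)) (P (q x t + r x t))"
      by (simp add: j_def w0 Pu[OF t])
    have "norm (B (u t) (r x t)) \<le> norm (u t) * norm (r x t) * KB" by (rule KB)
    also have "\<dots> \<le> Mu * (K1 * (norm x)\<^sup>2) * KB"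
      using Mu rM[OF t x] t KB(1) K10 by (intro mult_mono mult_nonneg_nonneg) auto
    finally have 1: "norm (B (u t) (r x t)) \<le> Mu * (K1 * (norm x)\<^sup>2) * KB" .
    have "norm (q x t + r x t) \<le> Mq * norm x + K1 * (norm x)\<^sup>2"
      using norm_triangle_ineq[of "q x t" "r x t"] qM[OF t, of x] rM[OF t x] by simp
    also have "\<dots> \<le> (Mq + K1) * norm x"
    proof -
      have "(norm x)\<^sup>2 \<le> norm x" using x by (simp add: power2_eq_square mult_left_le_one_le)
      then have "K1 * (norm x)\<^sup>2 \<le> K1 * norm x" using K10 by (rule mult_left_mono)
      then show ?thesis by (simp add: algebra_simps)
    qed
    finally have "norm (q x t + r x t) * KQ \<le> (Mq + K1) * norm x * KQ" using KQ(1) by (intro mult_right_mono) auto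
    then have 2: "norm (P (q x t + r x t)) \<le> (Mq + K1) * norm x * KQ" by (rule order_trans[OF KQ(2)])
    have "norm (B (P (q x t + r x t)) (P (q x t + r x t))) \<le> norm (P (q x t + r x t)) * norm (P (q x t + r x t)) * KB" by (rule KB)
    also have "\<dots> \<le> ((Mq + K1) * norm x * KQ) * ((Mq + K1) * norm x * KQ) * KB"
      using 2 KB(1) Mq0 K10 KQ(1) by (intro mult_mono mult_nonneg_nonneg) auto
    finally have 3: "norm (B (P (q x t + r x t)) (P (q x t + r x t))) \<le> ((Mq + K1) * norm x * KQ) * ((Mq + K1) * norm x * KQ) * KB" .
    have "norm (j x t - j 0 t - 2 * B (u t) (\<zeta> x t)) \<le> 2 * norm (B (u t) (r x t)) + norm (B (P (q x t + r x t)) (P (q x t + r x t)))"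
      unfolding e by (rule order_trans[OF norm_triangle_ineq]) simp
    also have "\<dots> \<le> KJ * (norm x)\<^sup>2" using 1 3 by (simp add: KJ_def power2_eq_square algebra_simps)
    finally show ?thesis .
  qed
  have KJ0: "KJ \<ge> 0" using Mu K10 KB KQ Mq0 by (simp add: KJ_def)
  define J where "J = (\<lambda>x. integral {c..d} (j x))"
  define F where "F = (\<lambda>x. PC (integral {c..d} (w x)))"
  have intJ: "integral {c..d} (\<lambda>t. 2 * B (u t) (\<zeta> x t)) = fst x" for x
  proof -
    have "integral {c..d} (\<lambda>t. 2 * B (u t) (\<zeta> x t)) = integral {c..d} (\<lambda>t. \<Sum>b\<in>Basis. (x \<bullet> b) * (2 * B (u t) (\<zeta>b b t)))"
      by (simp add: \<zeta>_def B.sum_right B.scaleR_right sum_distrib_left mult_ac)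
    also have "\<dots> = (\<Sum>b\<in>Basis. integral {c..d} (\<lambda>t. (x \<bullet> b) * (2 * B (u t) (\<zeta>b b t))))"
    proof (rule integral_sum)
      show "(\<lambda>t. (x \<bullet> b) * (2 * B (u t) (\<zeta>b b t))) integrable_on {c..d}" for b
        using integrable_on_cmult_left[OF Bu\<zeta>int[OF bl(1)[of b]], of "x \<bullet> b"] by simp
    qed simp
    also have "\<dots> = (\<Sum>b\<in>Basis. (x \<bullet> b) * fst b)"
      by (intro sum.cong refl) (simp add: b(2))
    also have "\<dots> = fst (\<Sum>b\<in>Basis. (x \<bullet> b) *\<^sub>R b)" by (simp add: fst_sum)
    finally show ?thesis by (simp add: euclidean_representation)
  qed
  have intF: "PC (integral {c..d} (q x)) = \<pi> (snd x)" for x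
  proof -
    have qb: "(\<lambda>t. \<zeta>b b t + lie_bracket (u t) (\<eta>b b t)) integrable_on {c..d}" for b
    proof -
      have "lip_ae c d (\<lambda>t. integral {c..t} (\<lambda>s. lie_bracket (u s) (\<eta>b b s))) (\<lambda>t. lie_bracket (u t) (\<eta>b b t))"
        using lip_ae_primitive[OF lb.flip lip_ae_continuous[OF bl(1)[of b]] U(1)] .
      from lip_ae_has_integral[OF lip_ae_add[OF bl(1)[of b] this] order_refl _ order_refl] show ?thesis using cd by auto
    qed
    have "q x = (\<lambda>t. \<Sum>b\<in>Basis. (x \<bullet> b) *\<^sub>R (\<zeta>b b t + lie_bracket (u t) (\<eta>b b t)))"
      by (simp add: q_def \<zeta>_def \<eta>_def lb.sum_right lb.scaleR_right scaleR_add_right sum.distrib fun_eq_iff)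
    then have "integral {c..d} (q x) = (\<Sum>b\<in>Basis. integral {c..d} (\<lambda>t. (x \<bullet> b) *\<^sub>R (\<zeta>b b t + lie_bracket (u t) (\<eta>b b t))))"
      by (simp only:) (rule integral_sum, auto intro!: integrable_cmul qb)
    also have "\<dots> = (\<Sum>b\<in>Basis. (x \<bullet> b) *\<^sub>R integral {c..d} (\<lambda>t. \<zeta>b b t + lie_bracket (u t) (\<eta>b b t)))"
      by simp
    finally have "PC (integral {c..d} (q x)) = (\<Sum>b\<in>Basis. (x \<bullet> b) *\<^sub>R \<pi> (snd b))"
      by (simp add: linear_sum[OF PC(1)] linear_scale[OF PC(1)] b(3))
    also have "\<dots> = \<pi> (snd (\<Sum>b\<in>Basis. (x \<bullet> b) *\<^sub>R b))"
      by (simp add: snd_sum linear_sum[OF \<pi>(1)] linear_scale[OF \<pi>(1)])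
    finally show ?thesis by (simp add: euclidean_representation)
  qed
  have derJ: "(J has_derivative fst) (at 0)"
  proof -
    have "((\<lambda>x. integral {c..d} (j x)) has_derivative (\<lambda>x. integral {c..d} (\<lambda>t. 2 * B (u t) (\<zeta> x t)))) (at 0)"
      by (rule has_derivative_integral_quadratic[OF less_imp_le[OF cd] jint Bu\<zeta>int[OF lipx] _ KJ0 jquad])
        (simp only: intJ bounded_linear_fst)
    then show ?thesis by (simp only: intJ J_def)
  qed
  have blq: "bounded_linear (\<lambda>x. integral {c..d} (q x))"
  proof -
    have lq: "q (x + y) t = q x t + q y t" "q (k *\<^sub>R x) t = k *\<^sub>R q x t" for x y k t
      by (simp_all add: q_def \<zeta>_def \<eta>_def inner_add_left scaleR_add_left sum.distrib lb.add_right
          scaleR_sum_right[symmetric] lb.scaleR_right scaleR_add_right flip: scaleR_scaleR)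
    have "linear (\<lambda>x. integral {c..d} (q x))"
    proof (rule linearI)
      show "integral {c..d} (q (x + y)) = integral {c..d} (q x) + integral {c..d} (q y)" for x y
        using integral_add[OF qint[of x] qint[of y]] lq(1)[of x y] by (simp add: fun_eq_iff[symmetric] cong: integral_cong)
      show "integral {c..d} (q (k *\<^sub>R x)) = k *\<^sub>R integral {c..d} (q x)" for k x
        using lq(2)[of k x] by (simp cong: integral_cong)
    qed
    then show ?thesis by (simp add: linear_conv_bounded_linear)
  qed
  have derW: "((\<lambda>x. integral {c..d} (w x)) has_derivative (\<lambda>x. integral {c..d} (q x))) (at 0)"
  proof (rule has_derivative_integral_quadratic[OF less_imp_le[OF cd] wint qint blq K10])
    show "norm (w x t - w 0 t - q x t) \<le> K1 * (norm x)\<^sup>2" if "norm x < 1" "t \<in> {c..d}" for x t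
      using rM[OF that(2,1)] by (simp add: w_eq \<eta>0 r_def)
  qed
  have derF: "(F has_derivative (\<lambda>x. \<pi> (snd x))) (at 0)"
    using bounded_linear.has_derivative[OF PC_bounded derW] by (simp add: F_def intF)
  \<comment> \<open>The constraint moves only within \<open>V\<close> to first order. The extra
    summand \<open>snd x - \<pi> (snd x)\<close> supplies the missing directions, so the derivative
    of \<Phi> at 0 is the identity of the full parameter space.\<close>
  define \<Phi> where "\<Phi> = (\<lambda>x. (J x, F x + (snd x - \<pi> (snd x))))"
  have \<pi>b: "bounded_linear \<pi>" using \<pi>(1) by (simp add: linear_conv_bounded_linear)
  have der\<Phi>: "(\<Phi> has_derivative (\<lambda>x. (fst x, \<pi> (snd x) + (snd x - \<pi> (snd x))))) (at 0)"
    unfolding \<Phi>_def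
    by (intro has_derivative_Pair derJ has_derivative_add derF has_derivative_diff
        bounded_linear_imp_has_derivative bounded_linear_snd bounded_linear_compose[OF \<pi>b])
  have contx: "continuous_on S (\<lambda>x. w x t)" for S t
    unfolding w_eq q_def \<eta>_def \<zeta>_def by (intro continuous_intros lb.continuous_on)
  have wbd: "norm (w x t) \<le> Mu + K0 * Mq" if x: "x \<in> ball 0 1" and t: "t \<in> {c..d}" for x t
  proof -
    have x1: "norm x < 1" using x by simp
    have "norm (dexp (\<eta> x t) (q x t)) \<le> K0 * norm (q x t)" by (rule K0(2)[OF nx[OF t x1]])
    also have "\<dots> \<le> K0 * Mq"
      using qM[OF t, of x] x1 Mq0 K0(1) by (intro mult_left_mono) (auto intro: order_trans[OF _ mult_left_le])
    finally show ?thesis using norm_triangle_ineq[of "u t" "dexp (\<eta> x t) (q x t)"] Mu(2)[OF t] by (simp add: w_eq)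
  qed
  have contW: "continuous_on (ball 0 1) (\<lambda>x. integral {c..d} (w x))"
    by (rule continuous_on_integral_dominated[OF wint wbd contx])
  define Mj where "Mj = ((Mu + K0 * Mq) * KQ) * ((Mu + K0 * Mq) * KQ) * KB"
  have contJ: "continuous_on (ball 0 1) J"
    unfolding J_def
  proof (rule continuous_on_integral_dominated[OF jint])
    show "continuous_on (ball 0 1) (\<lambda>x. j x t)" for t
      unfolding j_def by (intro B.continuous_on P.continuous_on contx)
    fix x t assume x: "x \<in> ball (0::real \<times> ('k^'n^'n)) 1" and t: "t \<in> {c..d}"
    have 1: "norm (P (w x t)) \<le> (Mu + K0 * Mq) * KQ"
      by (rule order_trans[OF KQ(2) mult_right_mono[OF wbd[OF x t]]]) (use KQ(1) in simp)
    have "norm (j x t) \<le> norm (P (w x t)) * norm (P (w x t)) * KB" unfolding j_def by (rule KB)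
    also have "\<dots> \<le> Mj"
      unfolding Mj_def using 1 KB(1) order_trans[OF norm_ge_zero 1] by (intro mult_mono) auto
    finally show "norm (j x t) \<le> Mj" .
  qed
  have cont\<Phi>: "continuous_on (ball 0 1) \<Phi>"
    unfolding \<Phi>_def F_def
    by (intro continuous_intros contJ bounded_linear.continuous_on[OF PC_bounded] contW bounded_linear.continuous_on[OF \<pi>b])
  have int\<Phi>: "\<Phi> 0 \<in> interior (\<Phi> ` ball 0 1)"
    by (rule sussmann_open_mapping[OF open_ball cont\<Phi> _ der\<Phi> bounded_linear_ident]) (auto simp: fun_eq_iff)
  have J0: "J 0 = s\<^sup>2 * (d - c)"
  proof -
    have "J 0 = integral {c..d} (\<lambda>t. s\<^sup>2)"
      unfolding J_def
    proof (rule integral_spike[OF speed])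
      fix t assume t: "t \<in> {c..d} - {t \<in> {c..d}. sqrt (B (u t) (u t)) \<noteq> s}"
      have "B (u t) (u t) \<ge> 0" using B_pos[OF H_L[OF u]] t by (cases "u t = 0") (auto simp: B.zero_left intro: less_imp_le)
      then have "s\<^sup>2 = B (u t) (u t)" using t by auto
      then show "s\<^sup>2 = j 0 t" using t by (simp add: j_def w0 Pu)
    qed
    then show ?thesis using cd by simp
  qed
  have F0: "F 0 = 0"
  proof -
    have "integral {c..d} u \<in> H" by (rule integral_in_subspace[OF H_subspace u])
    moreover have "w 0 = u" by (rule ext) (rule w0)
    ultimately show ?thesis by (simp add: F_def PC_H)
  qed
  have "\<Phi> 0 = (s\<^sup>2 * (d - c), 0)" by (simp add: \<Phi>_def J0 F0 linear_0[OF \<pi>(1)])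
  with int\<Phi> obtain e where e: "e > 0" "ball (s\<^sup>2 * (d - c), 0) e \<subseteq> \<Phi> ` ball 0 1"
    unfolding mem_interior by auto
  have "(s\<^sup>2 * (d - c) - e / 2, 0) \<in> ball (s\<^sup>2 * (d - c), 0 :: 'k^'n^'n) e"
    using e(1) by (simp add: dist_Pair_Pair dist_real_def)
  \<comment> \<open>The image of \<open>x\<close> has second component 0 and an energy that is
    smaller by e/2. What remains is to see that the true constraint \<open>F x\<close> vanishes,
    although only its sum with the extra summand is known to be 0.\<close>
  then obtain x where x: "\<Phi> x = (s\<^sup>2 * (d - c) - e / 2, 0)" using e(2) by force
  \<comment> \<open>The values of the variation commute with each Z in \<open>A\<close>, so by
    invariance of \<open>B\<close> the operator \<open>dexp\<close> does not change the pairing with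
    Z. The bracket with \<open>u\<close> pairs to 0 because Z commutes with \<open>u\<close>, and
    \<zeta> integrates to 0 because the variation vanishes at both ends.\<close>
  have FV: "F x \<in> V"
    unfolding V_def
  proof (intro CollectI conjI ballI)
    show "F x \<in> C" unfolding F_def by (rule PC(2))
    fix Z assume Z: "Z \<in> A"
    have ZL: "Z \<in> L" using Z AC in_C(6) by blast
    have ZH: "B Z Y = 0" if "Y \<in> H" for Y using that Z AC by (auto simp: H_iff)
    have pt: "B Z (w x t) = B Z (\<zeta> x t)" if t: "t \<in> {c..d}" for t
    proof -
      have L': "q x t \<in> L" unfolding q_def using t by (intro in_L L_bracket H_L u kkL \<eta>kk \<zeta>kk)
      have cj: "B Z (conj_mexp (s *\<^sub>R \<eta> x t) (q x t)) = B Z (q x t)" for s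
      proof -
        have "lie_bracket Z (s *\<^sub>R \<eta> x t) = 0" using \<eta>kk[OF t, of x] Z by (simp add: kk_def lie_bracket_simps)
        then have "conj_mexp (s *\<^sub>R \<eta> x t) Z = Z" by (rule conj_mexp_commute)
        then show ?thesis using B_conj[of "s *\<^sub>R \<eta> x t" Z "q x t"] ZL L' kkL[OF \<eta>kk[OF t]] in_L(4) by simp
      qed
      have "B Z (dexp (\<eta> x t) (q x t)) = integral {0..1} (\<lambda>s. B Z (conj_mexp (s *\<^sub>R \<eta> x t) (q x t)))"
        using integral_linear[OF conj_mexp_integrable B.bounded_linear_right[of Z]] by (simp add: dexp_def o_def)
      also have "\<dots> = B Z (q x t)" by (simp add: cj)
      also have "\<dots> = B Z (\<zeta> x t)"
      proof -
        have "B Z (lie_bracket (u t) (\<eta> x t)) = B (lie_bracket Z (u t)) (\<eta> x t)"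
          using B_ad[of "u t" Z "\<eta> x t"] ZL H_L[OF u[OF t]] kkL[OF \<eta>kk[OF t]] by simp
        also have "\<dots> = 0" using Z t by (simp add: A_def B.zero_left)
        finally show ?thesis by (simp add: q_def B.add_right)
      qed
      finally show ?thesis using ZH[OF u[OF t]] by (simp add: w_eq B.add_right)
    qed
    have "B Z (F x) = B Z (integral {c..d} (w x))"
      unfolding F_def using PC(4)[of Z] Z AC by (simp add: B_sym[of Z])
    also have "\<dots> = integral {c..d} (\<lambda>t. B Z (w x t))"
      using integral_linear[OF wint B.bounded_linear_right[of Z], of x] by (simp add: o_def)
    also have "\<dots> = integral {c..d} (\<lambda>t. B Z (\<zeta> x t))" by (rule integral_cong) (rule pt)
    also have "\<dots> = B Z (integral {c..d} (\<zeta> x))"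
    proof -
      have "\<zeta> x integrable_on {c..d}" using lip_ae_has_integral[OF lipx[of x] order_refl _ order_refl] cd by auto
      from integral_linear[OF this B.bounded_linear_right[of Z]] show ?thesis by (simp add: o_def)
    qed
    also have "integral {c..d} (\<zeta> x) = 0" using lip_ae_integral_eq[OF lipx[of x], of d] cd by (simp add: \<eta>end)
    finally show "B Z (F x) = 0" by (simp add: B.zero_right)
  qed
  have eq: "F x + (snd x - \<pi> (snd x)) = 0" using x by (simp add: \<Phi>_def)
  \<comment> \<open>The map \<pi> fixes \<open>F x\<close> and kills the extra summand, which
    separates the two.\<close>
  have "\<pi> (F x + (snd x - \<pi> (snd x))) = F x"
    using \<pi>(3)[OF FV] \<pi>(3)[OF \<pi>(2)] by (simp add: linear_add[OF \<pi>(1)] linear_diff[OF \<pi>(1)])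
  then have "F x = 0" unfolding eq by (simp add: linear_0[OF \<pi>(1)])
  then have closing: "PC (integral {c..d} (\<lambda>t. log_deriv (u t) (\<eta> x t) (\<zeta> x t))) = 0" by (simp add: F_def w_def)
  have "s\<^sup>2 * (d - c) \<le> J x"
    using energy_minimal[OF min lip u speed lipx kkL[OF \<eta>kk] kkL[OF \<zeta>kk] \<eta>end closing]
    by (simp add: J_def j_def P_def w_def)
  then show False using x e(1) by (simp add: \<Phi>_def)
qed

end

section \<open>The multiplier and the Euler-Lagrange equation\<close>

context sr_structure
begin

text \<open>The attainable pairs of first variations form a subspace \<open>S\<close> of
  \<open>T\<close>, and a proper one by \<open>energy_constraint_not_onto\<close>; a vector of
  \<open>T\<close> orthogonal to \<open>S\<close> is the multiplier. The assumption
  \<open>ann\<close> is what allows an annihilator found only almost everywhere to be counted in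
  \<open>A\<close>, whose definition is pointwise.\<close>

lemma normal_equation_aux:
  assumes min: "length_minimizer G ip H c d \<gamma>"
    and lip: "lip_ae c d \<gamma> (\<lambda>t. \<gamma> t ** u t)" and u: "\<And>t. t \<in> {c..d} \<Longrightarrow> u t \<in> H"
    and speed: "negligible {t \<in> {c..d}. sqrt (B (u t) (u t)) \<noteq> s}"
    and ann: "\<And>Z. Z \<in> C \<Longrightarrow> negligible {t \<in> {c..d}. lie_bracket Z (u t) \<noteq> 0} \<Longrightarrow> \<forall>t\<in>{c..d}. lie_bracket Z (u t) = 0"
  shows "\<exists>Z\<in>C. \<exists>v. \<forall>t\<in>{c..d}. v t \<in> H \<and> (\<gamma> has_vector_derivative \<gamma> t ** v t) (at t within {c..d}) \<and>
     (v has_vector_derivative lie_bracket Z (v t)) (at t within {c..d})"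
proof -
  have hor: "horizontal_curve G H c d \<gamma>" using min by (simp add: length_minimizer_def)
  then have \<gamma>: "\<gamma> t \<in> G" if "t \<in> {c..d}" for t using that by (auto simp: horizontal_curve_def)
  have cd: "c < d" using hor by (auto simp: horizontal_curve_def)
  obtain U where U: "lip_ae c d U u" "U c = 0" by (rule control_primitive[OF \<gamma> lip])
  define A where "A = {Z \<in> C. \<forall>t\<in>{c..d}. lie_bracket Z (u t) = 0}"
  define kk where "kk = {Y \<in> L. \<forall>Z\<in>A. lie_bracket Z Y = 0}"
  define V where "V = {Y \<in> C. \<forall>Z\<in>A. B Z Y = 0}"
  have kkL: "Y \<in> L" if "Y \<in> kk" for Y using that by (simp add: kk_def)
  have AC: "Z \<in> C" if "Z \<in> A" for Z using that by (simp add: A_def)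
  have VC: "Y \<in> C" if "Y \<in> V" for Y using that by (simp add: V_def)
  have Vsub: "subspace V" using C_subspace by (auto simp: subspace_def V_def B.zero_right B.add_right B.scaleR_right)
  have kksub: "subspace kk"
    using L_subspace by (auto simp: subspace_def kk_def lb.zero_right lb.add_right lb.scaleR_right)
  have ukk: "u t \<in> kk" if "t \<in> {c..d}" for t using H_L[OF u[OF that]] that by (auto simp: kk_def A_def)
  have Ckk: "Z \<in> kk" if "Z \<in> C" for Z using that in_C(6) AC C_abelian by (auto simp: kk_def)
  have kkb: "lie_bracket X Y \<in> kk" if "X \<in> kk" "Y \<in> kk" for X Y
    using that L_bracket jacobi[of _ X Y] by (auto simp: kk_def lb.zero_left lb.zero_right)
  define test where "test = (\<lambda>\<eta> \<zeta>. lip_ae c d \<eta> \<zeta> \<and> (\<forall>t\<in>{c..d}. \<eta> t \<in> kk \<and> \<zeta> t \<in> kk) \<and> \<eta> c = 0 \<and> \<eta> d = 0)"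
  define r where "r = (\<lambda>\<zeta>. 2 * integral {c..d} (\<lambda>t. B (u t) (\<zeta> t)))"
  define y where "y = (\<lambda>\<eta> \<zeta>. PC (integral {c..d} (\<lambda>t. \<zeta> t + lie_bracket (u t) (\<eta> t))))"
  define S where "S = {(r \<zeta>, y \<eta> \<zeta>) | \<eta> \<zeta>. test \<eta> \<zeta>}"
  define T where "T = {p :: real \<times> ('k^'n^'n). snd p \<in> V}"
  have Tsub: "subspace T" using Vsub by (auto simp: T_def subspace_def)
  have int1: "(\<lambda>t. B (u t) (\<zeta> t)) integrable_on {c..d}" if "lip_ae c d \<eta> \<zeta>" for \<eta> \<zeta>
    using bounded_measurable_integrable[OF measurable_bilinear[OF B_bounded lip_ae_measurable[OF U(1)] lip_ae_measurable[OF that]]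
       bounded_bilinear_image[OF B_bounded lip_ae_deriv_bounded[OF U(1)] lip_ae_deriv_bounded[OF that]]]
    by (simp add: absolutely_integrable_on_def)
  have int2: "lip_ae c d (\<lambda>t. \<eta> t + integral {c..t} (\<lambda>s. lie_bracket (u s) (\<eta> s))) (\<lambda>t. \<zeta> t + lie_bracket (u t) (\<eta> t))"
    if "lip_ae c d \<eta> \<zeta>" for \<eta> \<zeta>
    by (rule lip_ae_add[OF that lip_ae_primitive[OF lb.flip lip_ae_continuous[OF that] U(1)]])
  have int2': "(\<lambda>t. \<zeta> t + lie_bracket (u t) (\<eta> t)) integrable_on {c..d}" if "lip_ae c d \<eta> \<zeta>" for \<eta> \<zeta>
    using lip_ae_has_integral[OF int2[OF that] order_refl less_imp_le[OF cd] order_refl] by blast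
  have int3: "\<zeta> integrable_on {c..d}" if "lip_ae c d \<eta> \<zeta>" for \<eta> \<zeta> :: "real \<Rightarrow> 'k^'n^'n"
    using lip_ae_has_integral[OF that order_refl less_imp_le[OF cd] order_refl] by blast
  have testD: "lip_ae c d \<eta> \<zeta>" "t \<in> {c..d} \<Longrightarrow> \<eta> t \<in> kk" "t \<in> {c..d} \<Longrightarrow> \<zeta> t \<in> kk" "\<eta> c = 0" "\<eta> d = 0"
    if "test \<eta> \<zeta>" for \<eta> \<zeta> t using that by (auto simp: test_def)
  have test0: "test (\<lambda>_. 0) (\<lambda>_. 0)" using lip_ae_const[of c d 0] subspace_0[OF kksub] by (simp add: test_def)
  have testadd: "test (\<lambda>t. \<eta> t + \<eta>' t) (\<lambda>t. \<zeta> t + \<zeta>' t)" if "test \<eta> \<zeta>" "test \<eta>' \<zeta>'" for \<eta> \<zeta> \<eta>' \<zeta>'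
    using lip_ae_add[OF testD(1)[OF that(1)] testD(1)[OF that(2)]] that subspace_add[OF kksub] by (simp add: test_def)
  have testsc: "test (\<lambda>t. k *\<^sub>R \<eta> t) (\<lambda>t. k *\<^sub>R \<zeta> t)" if "test \<eta> \<zeta>" for k \<eta> \<zeta>
    using lip_ae_scaleR[OF testD(1)[OF that]] that subspace_scale[OF kksub] by (simp add: test_def)
  have radd: "r (\<lambda>t. \<zeta> t + \<zeta>' t) = r \<zeta> + r \<zeta>'" if "test \<eta> \<zeta>" "test \<eta>' \<zeta>'" for \<eta> \<zeta> \<eta>' \<zeta>'
    using integral_add[OF int1[OF testD(1)[OF that(1)]] int1[OF testD(1)[OF that(2)]]] by (simp add: r_def B.add_right)
  have rsc: "r (\<lambda>t. k *\<^sub>R \<zeta> t) = k * r \<zeta>" for k \<zeta> by (simp add: r_def B.scaleR_right)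
  have yadd: "y (\<lambda>t. \<eta> t + \<eta>' t) (\<lambda>t. \<zeta> t + \<zeta>' t) = y \<eta> \<zeta> + y \<eta>' \<zeta>'" if "test \<eta> \<zeta>" "test \<eta>' \<zeta>'" for \<eta> \<zeta> \<eta>' \<zeta>'
  proof -
    have "(\<lambda>t. \<zeta> t + \<zeta>' t + lie_bracket (u t) (\<eta> t + \<eta>' t)) = (\<lambda>t. (\<zeta> t + lie_bracket (u t) (\<eta> t)) + (\<zeta>' t + lie_bracket (u t) (\<eta>' t)))"
      by (simp add: lb.add_right algebra_simps)
    then show ?thesis
      using integral_add[OF int2'[OF testD(1)[OF that(1)]] int2'[OF testD(1)[OF that(2)]]] by (simp add: y_def linear_add[OF PC(1)])
  qed
  have ysc: "y (\<lambda>t. k *\<^sub>R \<eta> t) (\<lambda>t. k *\<^sub>R \<zeta> t) = k *\<^sub>R y \<eta> \<zeta>" for k \<eta> \<zeta>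
    by (simp add: y_def lb.scaleR_right scaleR_add_right[symmetric] linear_scale[OF PC(1)])
  have Ssub: "subspace S"
    unfolding subspace_def
  proof (intro conjI ballI allI)
    have "(0, 0) = (r (\<lambda>_. 0), y (\<lambda>_. 0) (\<lambda>_. 0))" by (simp add: r_def y_def B.zero_right lb.zero_right linear_0[OF PC(1)])
    then show "0 \<in> S" unfolding S_def zero_prod_def using test0 by blast
    fix p q assume "p \<in> S" "q \<in> S"
    then obtain \<eta> \<zeta> \<eta>' \<zeta>' where pq: "p = (r \<zeta>, y \<eta> \<zeta>)" "test \<eta> \<zeta>" "q = (r \<zeta>', y \<eta>' \<zeta>')" "test \<eta>' \<zeta>'"
      unfolding S_def by auto
    then have "p + q = (r (\<lambda>t. \<zeta> t + \<zeta>' t), y (\<lambda>t. \<eta> t + \<eta>' t) (\<lambda>t. \<zeta> t + \<zeta>' t))"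
      by (simp add: radd yadd)
    then show "p + q \<in> S" unfolding S_def using testadd[OF pq(2,4)] by blast
  next
    fix k p assume "p \<in> S"
    then obtain \<eta> \<zeta> where p: "p = (r \<zeta>, y \<eta> \<zeta>)" "test \<eta> \<zeta>" unfolding S_def by auto
    then have "k *\<^sub>R p = (r (\<lambda>t. k *\<^sub>R \<zeta> t), y (\<lambda>t. k *\<^sub>R \<eta> t) (\<lambda>t. k *\<^sub>R \<zeta> t))"
      by (simp add: rsc ysc)
    then show "k *\<^sub>R p \<in> S" unfolding S_def using testsc[OF p(2)] by blast
  qed
  have \<zeta>0: "integral {c..d} \<zeta> = 0" if "test \<eta> \<zeta>" for \<eta> \<zeta>
    using lip_ae_integral_eq[OF testD(1)[OF that], of d] testD(4,5)[OF that] cd by simp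
  have Binty: "B Z (y \<eta> \<zeta>) = integral {c..d} (\<lambda>t. B (lie_bracket Z (u t)) (\<eta> t))" if Z: "Z \<in> C" and t: "test \<eta> \<zeta>" for Z \<eta> \<zeta>
  proof -
    have "B Z (y \<eta> \<zeta>) = B Z (integral {c..d} (\<lambda>t. \<zeta> t + lie_bracket (u t) (\<eta> t)))"
      unfolding y_def using PC(4)[OF Z] by (simp add: B_sym[of Z])
    also have "\<dots> = integral {c..d} (\<lambda>t. B Z (\<zeta> t + lie_bracket (u t) (\<eta> t)))"
      using integral_linear[OF int2'[OF testD(1)[OF t]] B.bounded_linear_right[of Z]] by (simp add: o_def)
    also have "\<dots> = integral {c..d} (\<lambda>t. B Z (\<zeta> t) + B (lie_bracket Z (u t)) (\<eta> t))"
      by (rule integral_cong) (simp add: B.add_right B_ad[OF H_L[OF u] in_C(6)[OF Z] kkL[OF testD(2)[OF t]]])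
    also have "\<dots> = integral {c..d} (\<lambda>t. B Z (\<zeta> t)) + integral {c..d} (\<lambda>t. B (lie_bracket Z (u t)) (\<eta> t))"
    proof (rule integral_add)
      show "(\<lambda>t. B Z (\<zeta> t)) integrable_on {c..d}"
        using integrable_linear[OF int3[OF testD(1)[OF t]] B.bounded_linear_right[of Z]] by (simp add: o_def)
      have "lip_ae c d (\<lambda>t. lie_bracket Z (U t)) (\<lambda>t. lie_bracket Z (u t))" by (rule lip_ae_linear[OF lb.bounded_linear_right U(1)])
      from lip_ae_primitive[OF B.flip lip_ae_continuous[OF testD(1)[OF t]] this]
      show "(\<lambda>t. B (lie_bracket Z (u t)) (\<eta> t)) integrable_on {c..d}"
        using lip_ae_has_integral[OF _ order_refl less_imp_le[OF cd] order_refl] by blast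
    qed
    also have "integral {c..d} (\<lambda>t. B Z (\<zeta> t)) = B Z (integral {c..d} \<zeta>)"
      using integral_linear[OF int3[OF testD(1)[OF t]] B.bounded_linear_right[of Z]] by (simp add: o_def)
    finally show ?thesis using \<zeta>0[OF t] by (simp add: B.zero_right)
  qed
  have yV: "y \<eta> \<zeta> \<in> V" if t: "test \<eta> \<zeta>" for \<eta> \<zeta>
    unfolding V_def
  proof (intro CollectI conjI ballI)
    show "y \<eta> \<zeta> \<in> C" unfolding y_def by (rule PC(2))
    fix Z assume Z: "Z \<in> A"
    have "integral {c..d} (\<lambda>t. B (lie_bracket Z (u t)) (\<eta> t)) = integral {c..d} (\<lambda>t. 0)"
      by (rule integral_cong) (use Z in \<open>simp add: A_def B.zero_left\<close>)
    then show "B Z (y \<eta> \<zeta>) = 0" using Binty[OF AC[OF Z] t] by simp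
  qed
  have "S \<subseteq> T" using yV by (auto simp: S_def T_def)
  moreover have "S \<noteq> T"
  proof
    assume ST: "S = T"
    show False
    proof (rule energy_constraint_not_onto[OF min lip u speed A_def kk_def V_def])
      fix a b assume b: "b \<in> V"
      then have "(a, b) \<in> S" unfolding ST by (simp add: T_def)
      then obtain \<eta> \<zeta> where "test \<eta> \<zeta>" "r \<zeta> = a" "y \<eta> \<zeta> = b" unfolding S_def by blast
      then show "\<exists>\<eta> \<zeta>. lip_ae c d \<eta> \<zeta> \<and> (\<forall>t\<in>{c..d}. \<eta> t \<in> kk \<and> \<zeta> t \<in> kk) \<and> \<eta> c = 0 \<and> \<eta> d = 0 \<and>
          2 * integral {c..d} (\<lambda>t. B (u t) (\<zeta> t)) = a \<and> PC (integral {c..d} (\<lambda>t. \<zeta> t + lie_bracket (u t) (\<eta> t))) = b"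
        unfolding test_def r_def y_def by (intro exI[of _ \<eta>] exI[of _ \<zeta>]) simp
    qed
  qed
  moreover have sp: "span S = S" "span T = T" using span_eq_iff Ssub Tsub by blast+
  ultimately have "span S \<subset> span T" by (simp add: sp psubset_eq)
  then obtain p where p: "p \<noteq> 0" "p \<in> span T" "\<And>q. q \<in> span S \<Longrightarrow> orthogonal p q"
    using orthogonal_to_subspace_exists_gen by metis
  obtain \<mu> y0 where p': "p = (\<mu>, y0)" by (cases p)
  have y0V: "y0 \<in> V" using p(2) p' unfolding sp(2) by (simp add: T_def)
  have Vpos: "B x x > 0" if "x \<in> V" "x \<noteq> 0" for x using that B_pos in_C(6) VC by blast
  \<comment> \<open>The Euclidean component \<open>y0\<close> of the multiplier is represented
    through \<open>B\<close> instead, because invariance of the pairing is available for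
    \<open>B\<close> only.\<close>
  obtain Z where Z: "Z \<in> V" "\<And>y. y \<in> V \<Longrightarrow> y0 \<bullet> y = B Z y"
    using riesz_on_subspace[OF Vsub B_bilinear B_sym Vpos, of "\<lambda>x. y0 \<bullet> x"]
    by (metis bounded_linear.linear bounded_linear_inner_right)
  have ZC: "Z \<in> C" by (rule VC[OF Z(1)])
  have nz: "\<mu> \<noteq> 0 \<or> Z \<noteq> 0"
  proof (rule ccontr)
    assume "\<not> (\<mu> \<noteq> 0 \<or> Z \<noteq> 0)"
    then have "\<mu> = 0" "y0 \<bullet> y0 = 0" using Z(2)[OF y0V] by (auto simp: B.zero_left)
    then show False using p(1) p' by (simp add: zero_prod_def)
  qed
  define W where "W = (\<lambda>t. lie_bracket Z (U t))"
  have W: "lip_ae c d W (\<lambda>t. lie_bracket Z (u t))" unfolding W_def by (rule lip_ae_linear[OF lb.bounded_linear_right U(1)])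
  have Wc: "W c = 0" by (simp add: W_def U(2) lb.zero_right)
  \<comment> \<open>Integration by parts moves the term with the variation itself onto \<zeta>, with
    \<open>W\<close> as the primitive of [Z, u]; the boundary terms vanish with the
    variation.\<close>
  have first: "integral {c..d} (\<lambda>t. B ((2 * \<mu>) *\<^sub>R u t - W t) (\<zeta> t)) = 0" if t: "test \<eta> \<zeta>" for \<eta> \<zeta>
  proof -
    have "(r \<zeta>, y \<eta> \<zeta>) \<in> span S" using t by (intro span_base) (auto simp: S_def)
    from p(3)[OF this] have "\<mu> * r \<zeta> + y0 \<bullet> y \<eta> \<zeta> = 0" by (simp add: p' orthogonal_def inner_Pair)
    then have 1: "\<mu> * r \<zeta> + integral {c..d} (\<lambda>t. B (lie_bracket Z (u t)) (\<eta> t)) = 0"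
      using Z(2)[OF yV[OF t]] Binty[OF ZC t] by simp
    have BW: "lip_ae c d (\<lambda>t. B (W t) (\<eta> t)) (\<lambda>t. B (W t) (\<zeta> t) + B (lie_bracket Z (u t)) (\<eta> t))"
      by (rule lip_ae_bilinear[OF B_bounded W testD(1)[OF t]])
    have i1: "(\<lambda>t. B (W t) (\<zeta> t)) integrable_on {c..d}"
      using lip_ae_has_integral[OF lip_ae_primitive[OF B_bounded lip_ae_continuous[OF W] testD(1)[OF t]] order_refl less_imp_le[OF cd] order_refl] by blast
    have i2: "(\<lambda>t. B (lie_bracket Z (u t)) (\<eta> t)) integrable_on {c..d}"
      using lip_ae_has_integral[OF lip_ae_primitive[OF B.flip lip_ae_continuous[OF testD(1)[OF t]] W] order_refl less_imp_le[OF cd] order_refl] by blast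
    have "integral {c..d} (\<lambda>t. B (W t) (\<zeta> t) + B (lie_bracket Z (u t)) (\<eta> t)) = 0"
      using lip_ae_integral_eq[OF BW, of d] cd testD(4,5)[OF t] by (simp add: B.zero_right)
    then have 2: "integral {c..d} (\<lambda>t. B (W t) (\<zeta> t)) + integral {c..d} (\<lambda>t. B (lie_bracket Z (u t)) (\<eta> t)) = 0"
      using integral_add[OF i1 i2] by simp
    have "integral {c..d} (\<lambda>t. B ((2 * \<mu>) *\<^sub>R u t - W t) (\<zeta> t)) = integral {c..d} (\<lambda>t. (2 * \<mu>) *\<^sub>R B (u t) (\<zeta> t) - B (W t) (\<zeta> t))"
      by (simp add: B.diff_left B.scaleR_left)
    also have "\<dots> = integral {c..d} (\<lambda>t. (2 * \<mu>) *\<^sub>R B (u t) (\<zeta> t)) - integral {c..d} (\<lambda>t. B (W t) (\<zeta> t))"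
      by (rule integral_diff[OF integrable_cmul[OF int1[OF testD(1)[OF t]]] i1])
    also have "integral {c..d} (\<lambda>t. (2 * \<mu>) *\<^sub>R B (u t) (\<zeta> t)) = \<mu> * r \<zeta>" by (simp add: r_def)
    finally show ?thesis using 1 2 by simp
  qed
  have Ukk: "U t \<in> kk" if t: "t \<in> {c..d}" for t
  proof -
    have "integral {c..t} u \<in> kk" by (rule integral_in_subspace[OF kksub ukk]) (use t in auto)
    then show ?thesis using lip_ae_integral_eq[OF U(1) t] U(2) by simp
  qed
  have Wkk: "W t \<in> kk" if "t \<in> {c..d}" for t unfolding W_def by (intro kkb Ckk ZC Ukk that)
  define h where "h = (\<lambda>t. (2 * \<mu>) *\<^sub>R u t - W t)"
  define HH where "HH = (\<lambda>t. (2 * \<mu>) *\<^sub>R U t - integral {c..t} W)"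
  have HH: "lip_ae c d HH h" unfolding HH_def h_def
    by (intro lip_ae_diff lip_ae_scaleR U(1) lip_ae_of_continuous lip_ae_continuous[OF W])
  have HHc: "HH c = 0" by (simp add: HH_def U(2))
  \<comment> \<open>\<open>m\<close> is the mean of \<open>h\<close>. Subtracting it makes the
    primitive of \<open>h - m\<close> vanish at both ends, so \<open>h - m\<close> is itself an
    admissible test direction. Testing with it shows that the integral of
    \<open>B (\<zeta> t) (\<zeta> t)\<close> is 0, hence that \<open>h\<close> is constant almost
    everywhere: the du Bois-Reymond argument.\<close>
  define m where "m = (1 / (d - c)) *\<^sub>R HH d"
  define \<zeta> where "\<zeta> = (\<lambda>t. h t - m)"
  define \<eta> where "\<eta> = (\<lambda>t. HH t - (t - c) *\<^sub>R m)"
  have hkk: "h t \<in> kk" if "t \<in> {c..d}" for t unfolding h_def using that ukk Wkk kksub by (simp add: subspace_diff subspace_scale)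
  have HHkk: "HH t \<in> kk" if t: "t \<in> {c..d}" for t
  proof -
    have "integral {c..t} h \<in> kk" by (rule integral_in_subspace[OF kksub hkk]) (use t in auto)
    then show ?thesis using lip_ae_integral_eq[OF HH t] HHc by simp
  qed
  have mkk: "m \<in> kk" unfolding m_def using HHkk[of d] cd kksub by (simp add: subspace_scale)
  have "lip_ae c d (\<lambda>t. (t - c) *\<^sub>R m) (\<lambda>t. m)"
    using lip_ae_linear[OF bounded_linear_scaleR_left lip_ae_diff[OF lip_ae_ident lip_ae_const], of c d c m] by simp
  then have lip\<eta>: "lip_ae c d \<eta> \<zeta>" unfolding \<eta>_def \<zeta>_def by (rule lip_ae_diff[OF HH])
  have ends: "\<eta> c = 0" "\<eta> d = 0" using cd by (simp_all add: \<eta>_def HHc m_def)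
  have test\<zeta>: "test \<eta> \<zeta>"
    unfolding test_def using lip\<eta> ends hkk HHkk mkk kksub by (simp add: \<eta>_def \<zeta>_def subspace_diff subspace_scale)
  have B\<zeta>0: "0 \<le> B (\<zeta> t) (\<zeta> t)" if "t \<in> {c..d}" for t
    using B_pos[OF kkL[OF testD(3)[OF test\<zeta> that]]] by (cases "\<zeta> t = 0") (auto simp: B.zero_left)
  have abs\<zeta>: "(\<lambda>t. B (\<zeta> t) (\<zeta> t)) absolutely_integrable_on {c..d}"
    by (rule bounded_measurable_integrable[OF measurable_bilinear[OF B_bounded lip_ae_measurable[OF lip\<eta>] lip_ae_measurable[OF lip\<eta>]]
          bounded_bilinear_image[OF B_bounded lip_ae_deriv_bounded[OF lip\<eta>] lip_ae_deriv_bounded[OF lip\<eta>]]])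
  have "integral {c..d} (\<lambda>t. B (\<zeta> t) (\<zeta> t)) = integral {c..d} (\<lambda>t. B (h t) (\<zeta> t) - B m (\<zeta> t))"
    by (rule integral_cong) (simp add: \<zeta>_def B.diff_left)
  also have "\<dots> = integral {c..d} (\<lambda>t. B (h t) (\<zeta> t)) - integral {c..d} (\<lambda>t. B m (\<zeta> t))"
  proof (rule integral_diff)
    show i: "(\<lambda>t. B m (\<zeta> t)) integrable_on {c..d}"
      using integrable_linear[OF int3[OF lip\<eta>] B.bounded_linear_right[of m]] by (simp add: o_def)
    have "(\<lambda>t. B (\<zeta> t) (\<zeta> t) + B m (\<zeta> t)) integrable_on {c..d}"
      using abs\<zeta> i by (intro integrable_add) (auto simp: absolutely_integrable_on_def)
    then show "(\<lambda>t. B (h t) (\<zeta> t)) integrable_on {c..d}" by (simp add: \<zeta>_def B.diff_left)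
  qed
  also have "integral {c..d} (\<lambda>t. B (h t) (\<zeta> t)) = 0" unfolding h_def by (rule first[OF test\<zeta>])
  also have "integral {c..d} (\<lambda>t. B m (\<zeta> t)) = B m (integral {c..d} \<zeta>)"
    using integral_linear[OF int3[OF lip\<eta>] B.bounded_linear_right[of m]] by (simp add: o_def)
  finally have "integral {c..d} (\<lambda>t. B (\<zeta> t) (\<zeta> t)) = 0" using \<zeta>0[OF test\<zeta>] by (simp add: B.zero_right)
  from integral_nonneg_eq_0_ae[OF abs\<zeta> B\<zeta>0 this] have N: "negligible {t \<in> {c..d}. B (\<zeta> t) (\<zeta> t) \<noteq> 0}" .
  define N where "N = {t \<in> {c..d}. B (\<zeta> t) (\<zeta> t) \<noteq> 0}"
  have N: "negligible N" using N by (simp add: N_def)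
  have off: "(2 * \<mu>) *\<^sub>R u t = W t + m" if t: "t \<in> {c..d} - N" for t
  proof -
    have "B (\<zeta> t) (\<zeta> t) = 0" using t by (simp add: N_def)
    then have "\<zeta> t = 0" using B_pos[OF kkL[OF testD(3)[OF test\<zeta>, of t]]] t by fastforce
    then show ?thesis by (simp add: \<zeta>_def h_def algebra_simps)
  qed
  have contWm: "continuous_on {c..d} (\<lambda>t. W t + m)" by (intro continuous_intros lip_ae_continuous[OF W])
  \<comment> \<open>If the energy component vanished, the bracket of Z with \<open>u\<close> would
    be 0 almost everywhere and Z would lie in \<open>A\<close>. But Z is in \<open>V\<close>,
    orthogonal to \<open>A\<close>, so Z would be 0 and with it the whole multiplier.\<close>
  have \<mu>: "\<mu> \<noteq> 0"
  proof
    assume \<mu>0: "\<mu> = 0"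
    have Wm: "W t + m = 0" if "t \<in> {c..d}" for t
      by (rule continuous_ae_zero[OF cd contWm N _ that]) (use off \<mu>0 in simp)
    from Wm[of c] Wc cd have "m = 0" by simp
    then have W0: "W t = 0" if "t \<in> {c..d}" for t using Wm[OF that] by simp
    have "lip_ae c d W (\<lambda>t. 0)" by (rule lip_ae_cong[OF lip_ae_const[of c d 0]]) (simp_all add: W0)
    then obtain N' where N': "negligible N'" "\<And>t. t \<in> {c..d} - N' \<Longrightarrow> lie_bracket Z (u t) = 0"
      using lip_ae_unique_deriv[OF cd W] by blast
    have "{t \<in> {c..d}. lie_bracket Z (u t) \<noteq> 0} \<subseteq> N'" using N'(2) by blast
    then have "Z \<in> A" unfolding A_def using ann[OF ZC negligible_subset[OF N'(1)]] ZC by blast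
    then have "B Z Z = 0" using Z(1) by (simp add: V_def)
    then have "Z = 0" using Vpos[OF Z(1)] by force
    then show False using nz \<mu>0 by simp
  qed
  \<comment> \<open>The continuous representative of the control: \<open>u\<close> equals
    \<open>v\<close> off a null set. As \<open>W\<close> is the bracket of Z with a primitive of
    \<open>u\<close>, this \<open>v\<close> is differentiable with derivative [Z', v], where Z' is Z
    divided by the factor 2\<mu>.\<close>
  define v where "v = (\<lambda>t. (1 / (2 * \<mu>)) *\<^sub>R (W t + m))"
  have contv: "continuous_on {c..d} v" unfolding v_def by (intro continuous_intros contWm)
  have uv: "u t = v t" if "t \<in> {c..d} - N" for t
    unfolding v_def off[OF that, symmetric] using \<mu> by simp
  have vL: "v t \<in> L" if "t \<in> {c..d}" for t
    unfolding v_def using kkL[OF Wkk[OF that]] kkL[OF mkk] by (intro in_L)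
  have vH: "v t \<in> H" if t: "t \<in> {c..d}" for t
  proof -
    have "PC (v t) = 0"
      by (rule continuous_ae_zero[OF cd bounded_linear.continuous_on[OF PC_bounded contv] N _ t])
        (use PC_H u uv in force)
    then show ?thesis using minus_PC_H[OF vL[OF t]] by simp
  qed
  have v1: "(\<gamma> has_vector_derivative \<gamma> t ** v t) (at t within {c..d})" if t: "t \<in> {c..d}" for t
    by (rule lip_ae_continuous_deriv[OF lip _ N _ t])
      (use uv in \<open>auto intro!: mm.continuous_on lip_ae_continuous[OF lip] contv\<close>)
  define Z' where "Z' = (1 / (2 * \<mu>)) *\<^sub>R Z"
  have v2: "(v has_vector_derivative lie_bracket Z' (v t)) (at t within {c..d})" if t: "t \<in> {c..d}" for t
  proof -
    have "(U has_vector_derivative v t) (at t within {c..d})"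
      by (rule lip_ae_continuous_deriv[OF U(1) contv N uv t])
    from has_vector_derivative_add[OF bounded_linear.has_vector_derivative[OF lb.bounded_linear_right[of Z'] this]
        has_vector_derivative_const[of "(1 / (2 * \<mu>)) *\<^sub>R m"]]
    have "((\<lambda>t. lie_bracket Z' (U t) + (1 / (2 * \<mu>)) *\<^sub>R m) has_vector_derivative lie_bracket Z' (v t)) (at t within {c..d})" by simp
    moreover have "(\<lambda>t. lie_bracket Z' (U t) + (1 / (2 * \<mu>)) *\<^sub>R m) = v"
      by (simp add: v_def Z'_def W_def lb.scaleR_left scaleR_add_right)
    ultimately show ?thesis by simp
  qed
  have "Z' \<in> C" unfolding Z'_def by (intro in_C ZC)
  then show ?thesis using vH v1 v2 by blast
qed

end

section \<open>Minimizers of constant speed and the explicit form of their equation\<close>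

lemma abs_cont_subinterval:
  assumes "abs_cont_curve a b f" "a \<le> x" "y \<le> b"
  shows "abs_cont_curve x y f"
  unfolding abs_cont_curve_def
proof (intro allI impI)
  fix e :: real assume "e > 0"
  from mp[OF spec[OF assms(1)[unfolded abs_cont_curve_def]] this]
  obtain \<delta> where \<delta>: "\<delta> > 0" "\<forall>(m::nat) u v.
        (\<forall>i<m. a \<le> u i \<and> u i \<le> v i \<and> v i \<le> b) \<and>
        (\<forall>i<m. \<forall>j<m. i \<noteq> j \<longrightarrow> v i \<le> u j \<or> v j \<le> u i) \<and>
        (\<Sum>i<m. v i - u i) < \<delta> \<longrightarrow> (\<Sum>i<m. norm (f (v i) - f (u i))) < e" by (elim exE conjE) (rule that)
  show "\<exists>\<delta>>0. \<forall>(m::nat) u v.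
        (\<forall>i<m. x \<le> u i \<and> u i \<le> v i \<and> v i \<le> y) \<and>
        (\<forall>i<m. \<forall>j<m. i \<noteq> j \<longrightarrow> v i \<le> u j \<or> v j \<le> u i) \<and>
        (\<Sum>i<m. v i - u i) < \<delta> \<longrightarrow> (\<Sum>i<m. norm (f (v i) - f (u i))) < e"
  proof (intro exI[of _ \<delta>] conjI allI impI)
    fix m :: nat and u v
    assume h: "(\<forall>i<m. x \<le> u i \<and> u i \<le> v i \<and> v i \<le> y) \<and>
        (\<forall>i<m. \<forall>j<m. i \<noteq> j \<longrightarrow> v i \<le> u j \<or> v j \<le> u i) \<and> (\<Sum>i<m. v i - u i) < \<delta>"
    have "\<forall>i<m. a \<le> u i \<and> u i \<le> v i \<and> v i \<le> b"
    proof (intro allI impI)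
      fix i assume "i < m"
      then have "x \<le> u i \<and> u i \<le> v i \<and> v i \<le> y" using h by blast
      then show "a \<le> u i \<and> u i \<le> v i \<and> v i \<le> b" using assms(2,3) by linarith
    qed
    then show "(\<Sum>i<m. norm (f (v i) - f (u i))) < e" using h by (intro \<delta>(2)[rule_format]) simp
  qed (rule \<delta>(1))
qed

lemma mexp_shift_has_vector_derivative:
  "((\<lambda>t. mexp ((t - p) *\<^sub>R A)) has_vector_derivative mexp ((t - p) *\<^sub>R A) ** A) (at t within S)"
  "((\<lambda>t. mexp ((t - p) *\<^sub>R A)) has_vector_derivative A ** mexp ((t - p) *\<^sub>R A)) (at t within S)"
proof -
  have s: "((\<lambda>t::real. t - p) has_vector_derivative 1) (at t within S)"
    by (auto intro!: derivative_eq_intros)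
  show "((\<lambda>t. mexp ((t - p) *\<^sub>R A)) has_vector_derivative mexp ((t - p) *\<^sub>R A) ** A) (at t within S)"
    using vector_diff_chain_within[OF s mexp_scaleR_has_vector_derivative_right] by (simp add: o_def)
  show "((\<lambda>t. mexp ((t - p) *\<^sub>R A)) has_vector_derivative A ** mexp ((t - p) *\<^sub>R A)) (at t within S)"
    using vector_diff_chain_within[OF s mexp_scaleR_has_vector_derivative_left] by (simp add: o_def)
qed

context sr_structure
begin

text \<open>Converts the prescribed speed, which is a length for \<open>B\<close>, into a norm bound
  on the control.\<close>

lemma B_coercive:
  obtains K where "K \<ge> 0" "\<And>X. X \<in> L \<Longrightarrow> norm X \<le> K * sqrt (B X X)"
proof -
  obtain E where "orthonormal_basis B L E" using ex_orthonormal_basis[OF L_subspace B_bilinear B_sym B_pos] by blast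
  then have E: "finite E" "span E = L" "\<And>e e'. e \<in> E \<Longrightarrow> e' \<in> E \<Longrightarrow> B e e' = (if e = e' then 1 else 0)"
    by (auto simp: orthonormal_basis_def)
  show ?thesis
  proof (rule that[of "\<Sum>e\<in>E. norm e"])
    show "0 \<le> (\<Sum>e\<in>E. norm e)" by (intro sum_nonneg) auto
    fix X assume X: "X \<in> L"
    then have X': "X = (\<Sum>e\<in>E. B X e *\<^sub>R e)" using E(2) by (intro orthonormal_expansion[OF B_bilinear E(1,3)]) auto
    have "B X X = (\<Sum>e\<in>E. B X e * B X e)"
      by (subst (2) X') (simp add: B.sum_right B.scaleR_right)
    then have le: "(B X e)\<^sup>2 \<le> B X X" if "e \<in> E" for e
      using member_le_sum[OF that, of "\<lambda>e. B X e * B X e"] E(1) by (simp add: power2_eq_square)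
    have "norm X \<le> (\<Sum>e\<in>E. norm (B X e *\<^sub>R e))" by (subst X') (rule norm_sum)
    also have "\<dots> \<le> (\<Sum>e\<in>E. sqrt (B X X) * norm e)"
    proof (rule sum_mono)
      fix e assume e: "e \<in> E"
      have "\<bar>B X e\<bar> \<le> sqrt (B X X)" using real_sqrt_le_mono[OF le[OF e]] by simp
      then show "norm (B X e *\<^sub>R e) \<le> sqrt (B X X) * norm e" by (simp add: mult_right_mono)
    qed
    finally show "norm X \<le> (\<Sum>e\<in>E. norm e) * sqrt (B X X)" by (simp add: sum_distrib_right mult.commute)
  qed
qed

text \<open>Constant speed bounds the control, so the absolutely continuous minimizer is Lipschitz.
  The control is then changed on a null set so that every element of \<open>C\<close> commuting with
  it almost everywhere commutes with it everywhere, as \<open>normal_equation_aux\<close>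
  requires.\<close>

lemma normal_equation:
  assumes min: "length_minimizer G ip H c d \<gamma>" and N: "negligible N"
    and deriv: "\<And>t. t \<in> {c..d} - N \<Longrightarrow> \<exists>v. (\<gamma> has_vector_derivative v) (at t within {c..d}) \<and> tangent_norm ip (\<gamma> t) v = s"
  shows "\<exists>Z\<in>C. \<exists>v. \<forall>t\<in>{c..d}. v t \<in> H \<and> (\<gamma> has_vector_derivative \<gamma> t ** v t) (at t within {c..d}) \<and>
     (v has_vector_derivative lie_bracket Z (v t)) (at t within {c..d})"
proof -
  have hor: "horizontal_curve G H c d \<gamma>" using min by (simp add: length_minimizer_def)
  then have \<gamma>: "\<gamma> t \<in> G" if "t \<in> {c..d}" for t using that by (auto simp: horizontal_curve_def)
  have cd: "c < d" and ac: "abs_cont_curve c d \<gamma>" using hor by (auto simp: horizontal_curve_def)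
  \<comment> \<open>The default 0 at the exceptional points keeps the control in \<open>H\<close>
    and bounded at every time.\<close>
  define u0 where "u0 = (\<lambda>t. if t \<in> {c..d} - N then matrix_inv (\<gamma> t) ** vector_derivative \<gamma> (at t within {c..d}) else 0)"
  have good: "(\<gamma> has_vector_derivative \<gamma> t ** u0 t) (at t within {c..d}) \<and> u0 t \<in> H \<and> sqrt (B (u0 t) (u0 t)) = s" if t: "t \<in> {c..d} - N" for t
  proof -
    have tc: "t \<in> {c..d}" using t by simp
    obtain v where v: "(\<gamma> has_vector_derivative v) (at t within {c..d})" "tangent_norm ip (\<gamma> t) v = s" using deriv[OF t] by blast
    have "vector_derivative \<gamma> (at t within {c..d}) = v"
      by (rule vector_derivative_within_cbox[OF cd _ v(1)[folded cbox_interval], unfolded cbox_interval]) (use t in auto)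
    then have u0: "u0 t = matrix_inv (\<gamma> t) ** v" using t by (simp add: u0_def)
    have "v \<in> horizontal_at H (\<gamma> t)" using hor v(1) t unfolding horizontal_curve_def by blast
    then obtain X where X: "v = \<gamma> t ** X" "X \<in> H" unfolding horizontal_at_def by blast
    then have "u0 t = X" using u0 inv_cancel(1)[OF \<gamma>[OF tc]] by simp
    moreover have "sqrt (ip X X) = s" using v(2) X(1) by (simp add: tangent_norm_def inv_cancel(1)[OF \<gamma>[OF tc]])
    ultimately show ?thesis using v(1) X ip_eq[OF H_L H_L] by simp
  qed
  have u0H: "u0 t \<in> H" for t using good[of t] subspace_0[OF H_subspace] by (auto simp: u0_def)
  obtain K where K: "K \<ge> 0" "\<And>X. X \<in> L \<Longrightarrow> norm X \<le> K * sqrt (B X X)" using B_coercive by blast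
  have u0b: "norm (u0 t) \<le> K * \<bar>s\<bar>" for t
  proof (cases "t \<in> {c..d} - N")
    case True
    have "norm (u0 t) \<le> K * s" using K(2)[OF H_L[OF u0H], of t] good[OF True] by simp
    also have "\<dots> \<le> K * \<bar>s\<bar>" using K(1) by (simp add: mult_left_mono)
    finally show ?thesis .
  next
    case False
    then have "u0 t = 0" unfolding u0_def by (rule if_not_P)
    then show ?thesis using K(1) by simp
  qed
  have bd: "bounded ((\<lambda>t. \<gamma> t ** u0 t) ` {c..d})"
  proof (rule bounded_bilinear_image[OF mm.bounded_bilinear_axioms])
    show "bounded (\<gamma> ` {c..d})" by (rule bounded_subset[OF compact_imp_bounded[OF G_compact]]) (use \<gamma> in auto)
    show "bounded (u0 ` {c..d})" unfolding bounded_iff using u0b by blast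
  qed
  obtain b where b: "b \<ge> 0" "\<And>t. t \<in> {c..d} \<Longrightarrow> norm (\<gamma> t ** u0 t) \<le> b" using bounded_imageE[OF bd] by blast
  have le: "norm (\<gamma> y - \<gamma> x) \<le> b * (y - x)" if xy: "c \<le> x" "x \<le> y" "y \<le> d" for x y
  proof -
    have "((\<lambda>t. \<gamma> t ** u0 t) has_integral (\<gamma> y - \<gamma> x)) {x..y}"
    proof (rule abs_cont_fundamental_theorem[OF xy(2) abs_cont_subinterval[OF ac xy(1,3)] N])
      fix t assume "t \<in> {x..y} - N"
      then have t: "t \<in> {c..d} - N" using xy by auto
      show "(\<gamma> has_vector_derivative \<gamma> t ** u0 t) (at t within {x..y})"
        by (rule has_vector_derivative_within_subset[OF conjunct1[OF good[OF t]]]) (use xy in auto)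
    qed
    then have "norm (\<gamma> y - \<gamma> x) \<le> b * measure lborel (cbox x y)"
      by (intro has_integral_bound[OF b(1)]) (use b(2) xy in auto)
    then show ?thesis using xy by simp
  qed
  have lip0: "lip_ae c d \<gamma> (\<lambda>t. \<gamma> t ** u0 t)"
  proof (rule lip_aeI[OF _ bd N conjunct1[OF good]])
    show "norm (\<gamma> x - \<gamma> y) \<le> b * \<bar>x - y\<bar>" if "x \<in> {c..d}" "y \<in> {c..d}" for x y
      using le[of x y] le[of y x] that by (cases "x \<le> y") (auto simp: norm_minus_commute)
  qed
  define A where "A = {Z \<in> C. negligible {t \<in> {c..d}. lie_bracket Z (u0 t) \<noteq> 0}}"
  obtain E where E: "E \<subseteq> A" "independent E" "A \<subseteq> span E" using basis_exists[of A] by metis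
  have finE: "finite E" using E(2) independent_bound by blast
  \<comment> \<open>One null set serves for all annihilators because they are spanned by the
    finitely many elements of \<open>E\<close>; the control is set to 0 on it.\<close>
  define NA where "NA = (\<Union>Z\<in>E. {t \<in> {c..d}. lie_bracket Z (u0 t) \<noteq> 0})"
  have NA: "negligible NA" unfolding NA_def using finE E(1) by (intro negligible_Union) (auto simp: A_def)
  define u where "u = (\<lambda>t. if t \<in> NA then 0 else u0 t)"
  have uu: "u t = u0 t" if "t \<notin> NA" for t using that by (simp add: u_def)
  have uH: "u t \<in> H" for t using u0H[of t] subspace_0[OF H_subspace] by (simp add: u_def)
  have bdu: "bounded ((\<lambda>t. \<gamma> t ** u t) ` {c..d})"
    unfolding bounded_iff by (rule exI[of _ b]) (use b in \<open>auto simp: u_def mm.zero_right\<close>)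
  have lip: "lip_ae c d \<gamma> (\<lambda>t. \<gamma> t ** u t)"
    by (rule lip_ae_spike[OF lip0 NA _ bdu]) (simp add: uu)
  have ann: "\<forall>t\<in>{c..d}. lie_bracket Z (u t) = 0" if Z: "Z \<in> C" "negligible {t \<in> {c..d}. lie_bracket Z (u t) \<noteq> 0}" for Z
  proof
    fix t assume t: "t \<in> {c..d}"
    have "{t \<in> {c..d}. lie_bracket Z (u0 t) \<noteq> 0} \<subseteq> {t \<in> {c..d}. lie_bracket Z (u t) \<noteq> 0} \<union> NA" using uu by auto
    then have "Z \<in> A" unfolding A_def using Z negligible_subset[OF negligible_Un[OF Z(2) NA]] by blast
    then have ZE: "Z \<in> span E" using E(3) by blast
    have "span E \<subseteq> {Z. lie_bracket Z (u t) = 0}"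
    proof (rule span_minimal)
      show "subspace {Z. lie_bracket Z (u t) = 0}" by (auto simp: subspace_def lie_bracket_simps)
      show "E \<subseteq> {Z. lie_bracket Z (u t) = 0}" using t by (auto simp: u_def NA_def lie_bracket_simps)
    qed
    then show "lie_bracket Z (u t) = 0" using ZE by blast
  qed
  have "{t \<in> {c..d}. sqrt (B (u t) (u t)) \<noteq> s} \<subseteq> N \<union> NA" using good uu by force
  then have speed: "negligible {t \<in> {c..d}. sqrt (B (u t) (u t)) \<noteq> s}"
    by (rule negligible_subset[OF negligible_Un[OF N NA]])
  show ?thesis by (rule normal_equation_aux[OF min lip uH speed ann])
qed

text \<open>Here \<open>U + Z\<close> is the vector \<open>X\<close> of the theorem, with \<open>U \<in> H\<close> and \<open>X\<^sup>\<bottom> = Z \<in> C\<close>.\<close>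

definition geo_form :: "(real \<Rightarrow> 'k^'n^'n) \<Rightarrow> real set \<Rightarrow> real \<Rightarrow> 'k^'n^'n \<Rightarrow> 'k^'n^'n \<Rightarrow> bool" where
  "geo_form \<gamma> S p U Z \<longleftrightarrow> (\<forall>t\<in>S. \<gamma> t = \<gamma> p ** mexp ((t - p) *\<^sub>R (U + Z)) ** mexp ((t - p) *\<^sub>R (- Z)))"

text \<open>The control of the curve in \<open>geo_form\<close>: the initial control
  \<open>U\<close> moved by Ad(exp((t - p) Z)).\<close>

definition geo_control :: "real \<Rightarrow> 'k^'n^'n \<Rightarrow> 'k^'n^'n \<Rightarrow> real \<Rightarrow> 'k^'n^'n" where
  "geo_control p U Z t = conj_mexp ((t - p) *\<^sub>R (- Z)) U"

lemma geo_control_H: "U \<in> H \<Longrightarrow> Z \<in> C \<Longrightarrow> geo_control p U Z t \<in> H"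
  unfolding geo_control_def by (intro conj_mexp_C_H in_C)

lemma geo_control_deriv:
  "(geo_control p U Z has_vector_derivative lie_bracket Z (geo_control p U Z t)) (at t within S)"
proof -
  have s: "((\<lambda>t::real. t - p) has_vector_derivative 1) (at t within S)"
    by (auto intro!: derivative_eq_intros)
  have "(geo_control p U Z has_vector_derivative conj_mexp ((t - p) *\<^sub>R (- Z)) (lie_bracket U (- Z))) (at t within S)"
    using vector_diff_chain_within[OF s conj_mexp_has_vector_derivative[of "- Z" U]]
    unfolding geo_control_def[abs_def] by (simp add: o_def)
  moreover have "conj_mexp ((t - p) *\<^sub>R (- Z)) (lie_bracket U (- Z)) = lie_bracket Z (geo_control p U Z t)"
  proof -
    have "conj_mexp ((t - p) *\<^sub>R (- Z)) (- Z) = - Z" by (rule conj_mexp_commute) (simp add: lie_bracket_simps)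
    then show ?thesis
      unfolding conj_mexp_bracket geo_control_def using lie_bracket_commute[of _ "- Z"] by (simp add: lie_bracket_simps)
  qed
  ultimately show ?thesis by simp
qed

lemma geo_form_deriv:
  assumes f: "geo_form \<gamma> S p U Z" and t: "t \<in> S"
  shows "(\<gamma> has_vector_derivative \<gamma> t ** geo_control p U Z t) (at t within S)"
proof -
  let ?g = "\<lambda>t. \<gamma> p ** mexp ((t - p) *\<^sub>R (U + Z)) ** mexp ((t - p) *\<^sub>R (- Z))"
  let ?E = "mexp ((t - p) *\<^sub>R (U + Z))" and ?F = "mexp ((t - p) *\<^sub>R (- Z))" and ?F' = "mexp ((t - p) *\<^sub>R Z)"
  have "((\<lambda>t. \<gamma> p ** mexp ((t - p) *\<^sub>R (U + Z))) has_vector_derivative \<gamma> p ** (?E ** (U + Z))) (at t within S)"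
    by (rule bounded_linear.has_vector_derivative[OF mm.bounded_linear_right mexp_shift_has_vector_derivative(1)])
  from mm.has_vector_derivative[OF this mexp_shift_has_vector_derivative(2)[of p "- Z" t S]]
  have "(?g has_vector_derivative \<gamma> p ** ?E ** (- Z ** ?F) + \<gamma> p ** (?E ** (U + Z)) ** ?F) (at t within S)" .
  moreover have "\<gamma> p ** ?E ** (- Z ** ?F) + \<gamma> p ** (?E ** (U + Z)) ** ?F = ?g t ** geo_control p U Z t"
  proof -
    have "?F ** geo_control p U Z t = U ** ?F"
      by (simp add: geo_control_def conj_mexp_def matrix_mul_assoc)
    then have "?g t ** geo_control p U Z t = \<gamma> p ** ?E ** (U ** ?F)"
      by (simp add: matrix_mul_assoc[symmetric])
    then show ?thesis by (simp add: mm.add_right mm.add_left mm.minus_left mm.minus_right matrix_mul_assoc)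
  qed
  ultimately have "(?g has_vector_derivative \<gamma> t ** geo_control p U Z t) (at t within S)"
    using f t by (simp add: geo_form_def)
  then show ?thesis
    by (rule has_vector_derivative_transform[OF t, rotated]) (use f in \<open>simp add: geo_form_def\<close>)
qed

text \<open>Two conserved quantities solve the system. Conjugating \<open>v\<close> back by exp((t -
  p) Z) gives a constant, so in this moving frame the control is constant; consequently \<gamma>(t)
  exp((t - p) Z) exp(-(t - p)(v p + Z)) is constant as well.\<close>

lemma geo_form_of_ode:
  assumes ode: "\<And>t. t \<in> {c..d} \<Longrightarrow> (\<gamma> has_vector_derivative \<gamma> t ** v t) (at t within {c..d})"
    "\<And>t. t \<in> {c..d} \<Longrightarrow> (v has_vector_derivative lie_bracket Z (v t)) (at t within {c..d})"
    and p: "p \<in> {c..d}"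
  shows "geo_form \<gamma> {c..d} p (v p) Z"
proof -
  let ?e = "\<lambda>t. mexp ((t - p) *\<^sub>R Z)" and ?f = "\<lambda>t. mexp ((t - p) *\<^sub>R (- Z))"
  have fe: "?f t ** ?e t = mat 1" "?e t ** ?f t = mat 1" for t by simp_all
  have cv: "?f t ** v t ** ?e t = v p" if t: "t \<in> {c..d}" for t
  proof -
    have "((\<lambda>t. ?f t ** v t ** ?e t) has_vector_derivative 0) (at t within {c..d})" if t: "t \<in> {c..d}" for t
    proof -
      have "((\<lambda>t. ?f t ** v t ** ?e t) has_vector_derivative
         ?f t ** v t ** (Z ** ?e t) + (?f t ** lie_bracket Z (v t) + (?f t ** (- Z)) ** v t) ** ?e t) (at t within {c..d})"
        by (intro mm.has_vector_derivative mexp_shift_has_vector_derivative ode(2)[OF t])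
      then show ?thesis
        by (simp add: lie_bracket_def mm.diff_right mm.diff_left mm.add_left mm.minus_left mm.minus_right matrix_mul_assoc)
    qed
    then obtain k where "\<And>t. t \<in> {c..d} \<Longrightarrow> ?f t ** v t ** ?e t = k"
      using has_vector_derivative_zero_constant[of "{c..d}" "\<lambda>t. ?f t ** v t ** ?e t"] by auto
    from this[OF t] this[OF p] show ?thesis by simp
  qed
  have vZ: "v t ** ?e t = ?e t ** v p" if "t \<in> {c..d}" for t
  proof -
    have "?e t ** (?f t ** v t ** ?e t) = (?e t ** ?f t) ** v t ** ?e t" by (simp only: matrix_mul_assoc)
    then show ?thesis unfolding cv[OF that] fe by simp
  qed
  define X where "X = v p + Z"
  let ?x = "\<lambda>t. mexp ((t - p) *\<^sub>R (- X))"
  have cy: "\<gamma> t ** ?e t ** ?x t = \<gamma> p" if t: "t \<in> {c..d}" for t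
  proof -
    have "((\<lambda>t. \<gamma> t ** ?e t ** ?x t) has_vector_derivative 0) (at t within {c..d})" if t: "t \<in> {c..d}" for t
    proof -
      have "((\<lambda>t. \<gamma> t ** ?e t ** ?x t) has_vector_derivative
         \<gamma> t ** ?e t ** (- X ** ?x t) + (\<gamma> t ** (?e t ** Z) + (\<gamma> t ** v t) ** ?e t) ** ?x t) (at t within {c..d})"
        by (intro mm.has_vector_derivative mexp_shift_has_vector_derivative ode(1)[OF t])
      moreover have "\<gamma> t ** (?e t ** Z) + (\<gamma> t ** v t) ** ?e t = \<gamma> t ** ?e t ** X"
        by (simp add: X_def mm.add_right matrix_mul_assoc[symmetric] vZ[OF t])
      ultimately show ?thesis by (simp add: mm.minus_left mm.minus_right matrix_mul_assoc)
    qed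
    then obtain k where "\<And>t. t \<in> {c..d} \<Longrightarrow> \<gamma> t ** ?e t ** ?x t = k"
      using has_vector_derivative_zero_constant[of "{c..d}" "\<lambda>t. \<gamma> t ** ?e t ** ?x t"] by auto
    from this[OF t] this[OF p] show ?thesis by simp
  qed
  show ?thesis
    unfolding geo_form_def
  proof
    fix t assume t: "t \<in> {c..d}"
    have xx: "?x t ** mexp ((t - p) *\<^sub>R X) = mat 1" by simp
    have "\<gamma> p ** mexp ((t - p) *\<^sub>R X) ** ?f t = \<gamma> t ** (?e t ** (?x t ** mexp ((t - p) *\<^sub>R X)) ** ?f t)"
      unfolding cy[OF t, symmetric] by (simp only: matrix_mul_assoc)
    also have "\<dots> = \<gamma> t" unfolding xx by simp
    finally show "\<gamma> t = \<gamma> p ** mexp ((t - p) *\<^sub>R (v p + Z)) ** mexp ((t - p) *\<^sub>R - Z)" by (simp add: X_def)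
  qed
qed

text \<open>The differential equations do not mention the base point, so the formula can be solved
  afresh from any other time.\<close>

lemma geo_form_rebase:
  assumes "geo_form \<gamma> {c..d} p U Z" "q \<in> {c..d}"
  shows "geo_form \<gamma> {c..d} q (geo_control p U Z q) Z"
  by (rule geo_form_of_ode[OF geo_form_deriv[OF assms(1)] geo_control_deriv assms(2)])

lemma geo_form_merge:
  assumes f1: "geo_form \<gamma> {c1..d1} p1 U1 Z1" and f2: "geo_form \<gamma> {c2..d2} p2 U2 Z2"
    and Z: "Z1 \<in> C" "Z2 \<in> C" and O: "o1 < o2" "{o1..o2} \<subseteq> {c1..d1}" "{o1..o2} \<subseteq> {c2..d2}" and y: "y \<in> {o1..o2}"
    and G: "\<And>t. t \<in> {o1..o2} \<Longrightarrow> \<gamma> t \<in> G" and S: "S \<subseteq> {c1..d1} \<union> {c2..d2}"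
  shows "geo_form \<gamma> S y (geo_control p1 U1 Z1 y) Z1"
proof -
  let ?v1 = "geo_control p1 U1 Z1" and ?v2 = "geo_control p2 U2 Z2"
  have uni: "f = g" if "(h has_vector_derivative f) (at t within {o1..o2})" "(h has_vector_derivative g) (at t within {o1..o2})" "t \<in> {o1..o2}"
    for t and h :: "real \<Rightarrow> 'k^'n^'n" and f g
    by (rule vector_derivative_unique_within[OF _ that(1,2)]) (use O that(3) in \<open>simp add: trivial_limit_within islimpt_Icc\<close>)
  have v12: "?v1 t = ?v2 t" if t: "t \<in> {o1..o2}" for t
  proof -
    have "(\<gamma> has_vector_derivative \<gamma> t ** ?v1 t) (at t within {o1..o2})"
      by (rule has_vector_derivative_within_subset[OF geo_form_deriv[OF f1] O(2)]) (use t O in auto)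
    moreover have "(\<gamma> has_vector_derivative \<gamma> t ** ?v2 t) (at t within {o1..o2})"
      by (rule has_vector_derivative_within_subset[OF geo_form_deriv[OF f2] O(3)]) (use t O in auto)
    ultimately have "\<gamma> t ** ?v1 t = \<gamma> t ** ?v2 t" by (rule uni[OF _ _ t])
    then have "matrix_inv (\<gamma> t) ** (\<gamma> t ** ?v1 t) = matrix_inv (\<gamma> t) ** (\<gamma> t ** ?v2 t)" by simp
    then show ?thesis by (simp only: inv_cancel(1)[OF G[OF t]])
  qed
  define U where "U = ?v1 y"
  \<comment> \<open>Both control formulas agree on the overlap, hence so do their derivatives; at
    \<open>y\<close> this says that Z1 and Z2 have the same bracket with \<open>U\<close>.\<close>
  have "(?v1 has_vector_derivative lie_bracket Z2 (?v2 y)) (at y within {o1..o2})"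
    by (rule has_vector_derivative_transform[OF y _ geo_control_deriv]) (use v12 in auto)
  from uni[OF this geo_control_deriv y] have "lie_bracket Z2 U = lie_bracket Z1 U" by (simp add: U_def v12[OF y])
  have g1: "geo_form \<gamma> {c1..d1} y U Z1" unfolding U_def by (rule geo_form_rebase[OF f1]) (use y O in auto)
  have g2: "geo_form \<gamma> {c2..d2} y U Z2" unfolding U_def v12[OF y] by (rule geo_form_rebase[OF f2]) (use y O in auto)
  \<comment> \<open>\<open>W\<close> commutes with \<open>U + Z2\<close> and with Z2. Passing from
    Z2 to Z1 therefore inserts exp(rW) and exp(-rW), with r = t - y, next to each other in the
    product, where they cancel.\<close>
  define W where "W = Z1 - Z2"
  have "lie_bracket (U + Z2) W = 0"
    using \<open>lie_bracket Z2 U = lie_bracket Z1 U\<close> C_abelian[OF Z(2,1)] lie_bracket_commute[of U]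
    by (simp add: W_def lie_bracket_simps)
  then have cm: "(U + Z2) ** W = W ** (U + Z2)" by (simp add: lie_bracket_def)
  have "lie_bracket Z2 W = 0" using C_abelian[OF Z(2,1)] by (simp add: W_def lie_bracket_simps)
  then have cm': "Z2 ** W = W ** Z2" by (simp add: lie_bracket_def)
  show ?thesis
    unfolding geo_form_def U_def[symmetric]
  proof
    fix t assume "t \<in> S"
    then consider "t \<in> {c1..d1}" | "t \<in> {c2..d2}" using S by blast
    then show "\<gamma> t = \<gamma> y ** mexp ((t - y) *\<^sub>R (U + Z1)) ** mexp ((t - y) *\<^sub>R (- Z1))"
    proof cases
      case 1
      then show ?thesis using g1 by (simp add: geo_form_def)
    next
      case 2
      let ?r = "t - y"
      have "mexp (?r *\<^sub>R (U + Z2) + ?r *\<^sub>R W) = mexp (?r *\<^sub>R (U + Z2)) ** mexp (?r *\<^sub>R W)"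
        by (rule mexp_add_commuting) (simp only: mm.scaleR_left mm.scaleR_right cm)
      moreover have "?r *\<^sub>R (U + Z2) + ?r *\<^sub>R W = ?r *\<^sub>R (U + Z1)"
        by (simp add: W_def algebra_simps)
      ultimately have e1: "mexp (?r *\<^sub>R (U + Z1)) = mexp (?r *\<^sub>R (U + Z2)) ** mexp (?r *\<^sub>R W)" by simp
      have "mexp (- (?r *\<^sub>R W) + ?r *\<^sub>R (- Z2)) = mexp (- (?r *\<^sub>R W)) ** mexp (?r *\<^sub>R (- Z2))"
        by (rule mexp_add_commuting) (simp add: mm.scaleR_left mm.scaleR_right mm.minus_left mm.minus_right cm')
      moreover have "- (?r *\<^sub>R W) + ?r *\<^sub>R (- Z2) = ?r *\<^sub>R (- Z1)"
        by (simp add: W_def algebra_simps)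
      ultimately have e2: "mexp (?r *\<^sub>R (- Z1)) = mexp (- (?r *\<^sub>R W)) ** mexp (?r *\<^sub>R (- Z2))" by simp
      have "\<gamma> y ** mexp (?r *\<^sub>R (U + Z1)) ** mexp (?r *\<^sub>R (- Z1))
         = \<gamma> y ** mexp (?r *\<^sub>R (U + Z2)) ** (mexp (?r *\<^sub>R W) ** mexp (- (?r *\<^sub>R W))) ** mexp (?r *\<^sub>R (- Z2))"
        unfolding e1 e2 by (simp only: matrix_mul_assoc)
      also have "\<dots> = \<gamma> t" using g2 2 by (simp add: geo_form_def)
      finally show ?thesis ..
    qed
  qed
qed

text \<open>Minimality is only local, so the formula is spread over the interval by bisection. The
  property \<open>P\<close> speaks of an interval enlarged on both sides within [a,b]: two adjacent
  intervals then overlap in more than a point, and on that overlap derivatives can be compared and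
  the formulas merged.\<close>

theorem geodesic_form:
  assumes geo: "sr_geodesic G ip H a b \<gamma>" and sp: "constant_speed ip a b \<gamma>"
  shows "\<exists>Z\<in>C. \<exists>U\<in>H. \<exists>p\<in>{a..b}. geo_form \<gamma> {a..b} p U Z"
proof -
  have hor: "horizontal_curve G H a b \<gamma>" using geo by (simp add: sr_geodesic_def)
  then have ab: "a < b" and \<gamma>: "\<And>t. t \<in> {a..b} \<Longrightarrow> \<gamma> t \<in> G" by (auto simp: horizontal_curve_def)
  obtain s where s: "negligible {t \<in> {a..b}. \<not> (\<exists>v. (\<gamma> has_vector_derivative v) (at t within {a..b}) \<and> tangent_norm ip (\<gamma> t) v = s)}"
    using sp by (auto simp: constant_speed_def)
  define N where "N = {t \<in> {a..b}. \<not> (\<exists>v. (\<gamma> has_vector_derivative v) (at t within {a..b}) \<and> tangent_norm ip (\<gamma> t) v = s)}"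
  define I where "I = (\<lambda>x y \<delta>. {max a (x - \<delta>)..min b (y + \<delta>)})"
  define P where "P = (\<lambda>x y. a \<le> x \<longrightarrow> x \<le> y \<longrightarrow> y \<le> b \<longrightarrow>
     (\<exists>\<delta>>0. \<exists>Z\<in>C. \<exists>U\<in>H. \<exists>p. p \<in> I x y \<delta> \<and> geo_form \<gamma> (I x y \<delta>) p U Z))"
  have "P a b"
  proof (rule Bolzano)
    show "a \<le> b" using ab by simp
  next
    fix x y z assume xyz: "P x y" "P y z" "x \<le> y" "y \<le> z"
    show "P x z"
      unfolding P_def
    proof (intro impI)
      assume xz: "a \<le> x" "x \<le> z" "z \<le> b"
      obtain \<delta>1 Z1 U1 p1 where 1: "\<delta>1 > 0" "Z1 \<in> C" "U1 \<in> H" "p1 \<in> I x y \<delta>1" "geo_form \<gamma> (I x y \<delta>1) p1 U1 Z1"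
        using xyz xz unfolding P_def by auto
      obtain \<delta>2 Z2 U2 p2 where 2: "\<delta>2 > 0" "Z2 \<in> C" "U2 \<in> H" "p2 \<in> I y z \<delta>2" "geo_form \<gamma> (I y z \<delta>2) p2 U2 Z2"
        using xyz xz unfolding P_def by auto
      define \<delta> where "\<delta> = min \<delta>1 \<delta>2"
      have \<delta>: "\<delta> > 0" using 1 2 by (simp add: \<delta>_def)
      have "geo_form \<gamma> (I x z \<delta>) y (geo_control p1 U1 Z1 y) Z1"
      proof (rule geo_form_merge[OF 1(5)[unfolded I_def] 2(5)[unfolded I_def] 1(2) 2(2)])
        show "max a (y - \<delta>) < min b (y + \<delta>)" using xyz xz ab \<delta> by auto
        show "{max a (y - \<delta>)..min b (y + \<delta>)} \<subseteq> {max a (x - \<delta>1)..min b (y + \<delta>1)}"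
          "{max a (y - \<delta>)..min b (y + \<delta>)} \<subseteq> {max a (y - \<delta>2)..min b (z + \<delta>2)}"
          using xyz by (auto simp: \<delta>_def)
        show "y \<in> {max a (y - \<delta>)..min b (y + \<delta>)}" using xyz xz \<delta> by auto
        show "\<gamma> t \<in> G" if "t \<in> {max a (y - \<delta>)..min b (y + \<delta>)}" for t using that by (intro \<gamma>) auto
        show "I x z \<delta> \<subseteq> {max a (x - \<delta>1)..min b (y + \<delta>1)} \<union> {max a (y - \<delta>2)..min b (z + \<delta>2)}"
          using 1(1) 2(1) by (auto simp: I_def \<delta>_def)
      qed
      moreover have "y \<in> I x z \<delta>" using xyz xz \<delta> by (auto simp: I_def)
      ultimately show "\<exists>\<delta>>0. \<exists>Z\<in>C. \<exists>U\<in>H. \<exists>p. p \<in> I x z \<delta> \<and> geo_form \<gamma> (I x z \<delta>) p U Z"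
        using \<delta> 1(2) geo_control_H[OF 1(3,2)] by blast
    qed
  next
    fix x assume x: "a \<le> x" "x \<le> b"
    then obtain \<delta>0 where \<delta>0: "\<delta>0 > 0" "\<And>c d. c < d \<Longrightarrow> {c..d} \<subseteq> {a..b} \<inter> {x - \<delta>0<..<x + \<delta>0} \<Longrightarrow> length_minimizer G ip H c d \<gamma>"
      using geo unfolding sr_geodesic_def by (metis atLeastAtMost_iff)
    show "\<exists>e>0. \<forall>y z. y \<le> x \<and> x \<le> z \<and> z - y < e \<longrightarrow> P y z"
    \<comment> \<open>An interval around \<open>x\<close> of length below \<delta>0/4, enlarged by
      \<delta>0/4 at both ends, stays within distance \<delta>0/2 of \<open>x\<close>, where the
      curve is minimizing.\<close>
    proof (intro exI[of _ "\<delta>0 / 4"] conjI allI impI)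
      show "\<delta>0 / 4 > 0" using \<delta>0 by simp
      fix y z assume yz: "y \<le> x \<and> x \<le> z \<and> z - y < \<delta>0 / 4"
      show "P y z"
        unfolding P_def
      proof (intro impI)
        assume a: "a \<le> y" "y \<le> z" "z \<le> b"
        define c where "c = max a (y - \<delta>0 / 4)"
        define d where "d = min b (z + \<delta>0 / 4)"
        have cd: "c < d" using yz a ab \<delta>0(1) by (auto simp: c_def d_def)
        have sub: "{c..d} \<subseteq> {a..b} \<inter> {x - \<delta>0<..<x + \<delta>0}" using yz \<delta>0(1) by (auto simp: c_def d_def)
        have "\<exists>Z\<in>C. \<exists>v. \<forall>t\<in>{c..d}. v t \<in> H \<and> (\<gamma> has_vector_derivative \<gamma> t ** v t) (at t within {c..d}) \<and>
            (v has_vector_derivative lie_bracket Z (v t)) (at t within {c..d})"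
        proof (rule normal_equation[OF \<delta>0(2)[OF cd sub]])
          show "negligible N" using s by (simp add: N_def)
          fix t assume t: "t \<in> {c..d} - N"
          then obtain v where v: "(\<gamma> has_vector_derivative v) (at t within {a..b})" "tangent_norm ip (\<gamma> t) v = s"
            using sub by (auto simp: N_def)
          have "(\<gamma> has_vector_derivative v) (at t within {c..d})"
            by (rule has_vector_derivative_within_subset[OF v(1)]) (use sub in auto)
          then show "\<exists>v. (\<gamma> has_vector_derivative v) (at t within {c..d}) \<and> tangent_norm ip (\<gamma> t) v = s" using v(2) by blast
        qed
        then obtain Z v where Zv: "Z \<in> C" "\<And>t. t \<in> {c..d} \<Longrightarrow> v t \<in> H"
          "\<And>t. t \<in> {c..d} \<Longrightarrow> (\<gamma> has_vector_derivative \<gamma> t ** v t) (at t within {c..d})"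
          "\<And>t. t \<in> {c..d} \<Longrightarrow> (v has_vector_derivative lie_bracket Z (v t)) (at t within {c..d})" by blast
        have cI: "c \<in> {c..d}" using cd by simp
        have "geo_form \<gamma> {c..d} c (v c) Z" by (rule geo_form_of_ode[OF Zv(3,4) cI])
        moreover have "I y z (\<delta>0 / 4) = {c..d}" by (simp add: I_def c_def d_def)
        moreover have "\<delta>0 / 4 > 0" using \<delta>0(1) by simp
        ultimately show "\<exists>\<delta>>0. \<exists>Z\<in>C. \<exists>U\<in>H. \<exists>p. p \<in> I y z \<delta> \<and> geo_form \<gamma> (I y z \<delta>) p U Z"
          using Zv(1) Zv(2)[OF cI] cI by (intro exI[of _ "\<delta>0 / 4"]) auto
      qed
    qed
  qed
  then obtain \<delta> Z U p where f: "\<delta> > 0" "Z \<in> C" "U \<in> H" "p \<in> I a b \<delta>" "geo_form \<gamma> (I a b \<delta>) p U Z"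
    using ab unfolding P_def by auto
  have I: "I a b \<delta> = {a..b}" using f(1) by (simp add: I_def)
  show ?thesis using f(2,3) f(4,5)[unfolded I] by blast
qed

end

section \<open>Hamilton's equations\<close>

lemma has_derivative_quadratic_0:
  fixes f :: "'a::real_normed_vector \<Rightarrow> 'b::real_normed_vector"
  assumes bl: "bounded_linear D" and d: "d > 0" and C: "\<And>x. norm x < d \<Longrightarrow> norm (f x - f 0 - D x) \<le> C * (norm x)\<^sup>2"
  shows "(f has_derivative D) (at 0)"
  unfolding has_derivative_at_alt
proof (intro conjI allI impI)
  fix e :: real assume e: "e > 0"
  define C' where "C' = max C 1"
  have C': "C' > 0" "C \<le> C'" by (auto simp: C'_def)
  show "\<exists>d>0. \<forall>y. norm (y - 0) < d \<longrightarrow> norm (f y - f 0 - D (y - 0)) \<le> e * norm (y - 0)"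
  proof (intro exI[of _ "min d (e / C')"] conjI allI impI)
    show "min d (e / C') > 0" using d e C' by simp
    fix y :: 'a assume "norm (y - 0) < min d (e / C')"
    then have y: "norm y < d" "norm y * C' \<le> e" using C' by (auto simp: pos_less_divide_eq)
    have "norm (f y - f 0 - D y) \<le> C * (norm y)\<^sup>2" by (rule C[OF y(1)])
    also have "\<dots> \<le> C' * (norm y)\<^sup>2" using C' by (intro mult_right_mono) auto
    also have "\<dots> = (norm y * C') * norm y" by (simp add: power2_eq_square mult_ac)
    also have "\<dots> \<le> e * norm y" using y(2) by (intro mult_right_mono) auto
    finally show "norm (f y - f 0 - D (y - 0)) \<le> e * norm (y - 0)" by simp
  qed
qed (rule bl)

lemma dexp_has_derivative_0:
  "((\<lambda>X. dexp X Y) has_derivative (\<lambda>X. (1/2) *\<^sub>R lie_bracket Y X)) (at (0 :: ('k::{real_normed_field,euclidean_space})^'n^'n))"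
proof -
  obtain K where K: "K > 0" "\<And>X V::'k^'n^'n. norm X \<le> 1 \<Longrightarrow> norm (dexp X V - V - (1/2) *\<^sub>R lie_bracket V X) \<le> K * (norm X)\<^sup>2 * norm V"
    using dexp_bounds[of 1] by metis
  have "bounded_linear (\<lambda>X. (1/2) *\<^sub>R lie_bracket Y X)"
    by (intro bounded_linear_compose[OF bounded_linear_scaleR_right] bounded_bilinear.bounded_linear_right[OF bounded_bilinear_lie_bracket])
  then show ?thesis
    by (rule has_derivative_quadratic_0[of _ 1 _ "K * norm Y"]) (use K in \<open>auto simp: mult_ac less_imp_le\<close>)
qed

lemma exp_chart_deriv: "chart_deriv g X V = g ** (mexp X ** dexp X V)"
proof -
  have "(exp_chart g has_derivative (\<lambda>V. g ** (mexp X ** dexp X V))) (at X)"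
    unfolding exp_chart_def[abs_def]
    by (rule bounded_linear.has_derivative[OF mm.bounded_linear_right mexp_has_derivative])
  then show ?thesis unfolding chart_deriv_def by (metis frechet_derivative_at)
qed

lemma linear_inj_surj_on_subspace:
  fixes f :: "'a::euclidean_space \<Rightarrow> 'a"
  assumes L: "subspace L" and f: "linear f" "inj_on f L" "f ` L \<subseteq> L"
  shows "f ` L = L"
proof (rule subspace_dim_equal)
  show "subspace (f ` L)" by (rule linear_subspace_image[OF f(1) L])
  have sp: "span L = L" using L by (simp add: span_eq_iff)
  have "dim (f ` L) = dim L" by (rule dim_image_eq[OF f(1)]) (simp add: sp f(2))
  then show "dim L \<le> dim (f ` L)" by simp
qed (use L f in auto)

context sr_structure
begin

text \<open>For small \<open>X\<close> the map \<open>dexp X\<close> deviates from the identity by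
  at most one half, which is what the choice of \<open>r\<close> ensures, so it is a bijection of
  \<open>L\<close>. The expansion of its inverse to first order is what the derivative of the
  Hamiltonian in the position variable needs; the last conjunct identifies this inverse with the
  \<open>inv_into\<close> of \<open>coord_hamiltonian\<close>.\<close>

lemma dexp_inverse:
  obtains r K where "r > 0" "K > 0"
    "\<And>X e. X \<in> L \<Longrightarrow> norm X \<le> r \<Longrightarrow> e \<in> L \<Longrightarrow> \<exists>z\<in>L. dexp X z = e \<and>
       norm (z - e - (- (1/2) *\<^sub>R lie_bracket e X)) \<le> K * (norm X)\<^sup>2 * norm e \<and>
       (\<forall>g\<in>G. inv_into L (chart_deriv g X) (exp_chart g X ** e) = z)"
proof -
  obtain K where K: "K > 0"
    "\<And>X V::'k^'n^'n. norm X \<le> 1 \<Longrightarrow> norm (dexp X V - V) \<le> K * norm X * norm V"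
    "\<And>X V::'k^'n^'n. norm X \<le> 1 \<Longrightarrow> norm (dexp X V - V - (1/2) *\<^sub>R lie_bracket V X) \<le> K * (norm X)\<^sup>2 * norm V"
    using dexp_bounds[of 1] by metis
  obtain Kl where Kl: "Kl > 0" "\<And>X Y::'k^'n^'n. norm (lie_bracket X Y) \<le> norm X * norm Y * Kl"
    using lb.pos_bounded by blast
  define r where "r = min 1 (1 / (2 * K))"
  have r: "r > 0" "r \<le> 1" "K * r \<le> 1/2" using K(1) by (auto simp: r_def min_def field_simps)
  show ?thesis
  proof (rule that[OF r(1)])
    show "2 * K + K * Kl > 0" using K Kl by (simp add: add_pos_pos)
    fix X e assume X: "X \<in> L" "norm X \<le> r" and e: "e \<in> L"
    have half: "norm (dexp X V - V) \<le> (1/2) * norm V" for V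
    proof -
      have "norm (dexp X V - V) \<le> K * norm X * norm V" using X r by (intro K) simp
      also have "\<dots> \<le> (1/2) * norm V"
      proof (rule mult_right_mono)
        have "K * norm X \<le> K * r" using X(2) K(1) by (intro mult_left_mono) auto
        then show "K * norm X \<le> 1/2" using r(3) by simp
      qed simp
      finally show ?thesis .
    qed
    have low: "norm V \<le> 2 * norm (dexp X V)" for V
      using half[of V] norm_triangle_ineq2[of V "dexp X V"] by (simp add: norm_minus_commute)
    have inj: "inj_on (dexp X) L"
    proof (rule inj_onI)
      fix x y assume "dexp X x = dexp X y"
      then have "dexp X (x - y) = 0" by (simp add: linear_diff[OF linear_dexp])
      then show "x = y" using low[of "x - y"] by simp
    qed
    have "dexp X ` L = L"
      by (rule linear_inj_surj_on_subspace[OF L_subspace linear_dexp inj]) (use dexp_L X in auto)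
    then obtain z where z: "z \<in> L" "dexp X z = e" using e by (metis imageE)
    have zn: "norm z \<le> 2 * norm e" using low[of z] z by simp
    have ze: "norm (z - e) \<le> K * norm X * (2 * norm e)"
    proof -
      have "norm (dexp X z - z) \<le> K * norm X * norm z" using X r by (intro K) simp
      also have "\<dots> \<le> K * norm X * (2 * norm e)" using zn K(1) by (intro mult_left_mono) auto
      finally show ?thesis using z by (simp add: norm_minus_commute)
    qed
    have "z - e - (- (1/2) *\<^sub>R lie_bracket e X) = - (dexp X z - z - (1/2) *\<^sub>R lie_bracket z X) - (1/2) *\<^sub>R lie_bracket (z - e) X"
      using z(2) by (simp add: lie_bracket_simps scaleR_diff_right)
    then have "norm (z - e - (- (1/2) *\<^sub>R lie_bracket e X)) \<le> norm (dexp X z - z - (1/2) *\<^sub>R lie_bracket z X) + (1/2) * norm (lie_bracket (z - e) X)"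
      using norm_triangle_ineq4[of "- (dexp X z - z - (1/2) *\<^sub>R lie_bracket z X)" "(1/2) *\<^sub>R lie_bracket (z - e) X"]
      by (simp only: norm_minus_cancel norm_scaleR abs_of_nonneg zero_le_divide_1_iff zero_le_numeral)
    also have "norm (dexp X z - z - (1/2) *\<^sub>R lie_bracket z X) \<le> K * (norm X)\<^sup>2 * norm z" using X r by (intro K) simp
    also have "K * (norm X)\<^sup>2 * norm z \<le> K * (norm X)\<^sup>2 * (2 * norm e)" using zn K(1) by (intro mult_left_mono) auto
    also have "norm (lie_bracket (z - e) X) \<le> norm (z - e) * norm X * Kl" by (rule Kl)
    also have "norm (z - e) * norm X * Kl \<le> K * norm X * (2 * norm e) * norm X * Kl"
      using ze Kl(1) by (intro mult_right_mono) auto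
    finally have est: "norm (z - e - (- (1/2) *\<^sub>R lie_bracket e X)) \<le> (2 * K + K * Kl) * (norm X)\<^sup>2 * norm e"
      by (simp add: power2_eq_square algebra_simps)
    have "inv_into L (chart_deriv g X) (exp_chart g X ** e) = z" if g: "g \<in> G" for g
    proof (rule inv_into_f_eq)
      have gX: "g ** mexp X \<in> G" by (intro G_mult g L_exp X)
      have cd: "chart_deriv g X V = (g ** mexp X) ** dexp X V" for V by (simp add: exp_chart_deriv matrix_mul_assoc)
      show "inj_on (chart_deriv g X) L"
      proof (rule inj_onI)
        fix x y assume xy: "x \<in> L" "y \<in> L" "chart_deriv g X x = chart_deriv g X y"
        then have "matrix_inv (g ** mexp X) ** ((g ** mexp X) ** dexp X x) = matrix_inv (g ** mexp X) ** ((g ** mexp X) ** dexp X y)"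
          unfolding cd by simp
        then have "dexp X x = dexp X y" unfolding inv_cancel(1)[OF gX] .
        then show "x = y" using inj xy by (simp add: inj_on_def)
      qed
      show "chart_deriv g X z = exp_chart g X ** e" unfolding cd exp_chart_def z(2) ..
    qed (rule z(1))
    then show "\<exists>z\<in>L. dexp X z = e \<and> norm (z - e - (- (1/2) *\<^sub>R lie_bracket e X)) \<le> (2 * K + K * Kl) * (norm X)\<^sup>2 * norm e \<and>
       (\<forall>g\<in>G. inv_into L (chart_deriv g X) (exp_chart g X ** e) = z)"
      using z est by blast
  qed
qed

text \<open>The logarithms are picked without any continuity. Still, the bound |X s| <= 2 |f s - 1|
  and the expansion exp X = 1 + X + o(X) force differentiability at the base point \<open>t\<close>,
  the only place where Hamilton's equations are evaluated in this chart.\<close>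

lemma log_curve:
  assumes log: "\<And>r. r > 0 \<Longrightarrow> \<exists>e>0. \<forall>g\<in>G. norm (g - mat 1) < e \<longrightarrow> (\<exists>X\<in>L. norm X < r \<and> mexp X = g)"
    and f: "\<And>s. s \<in> S \<Longrightarrow> f s \<in> G" "f t = mat 1" "(f has_vector_derivative u) (at t within S)" and t: "t \<in> S"
  obtains X where "X t = 0" "\<forall>\<^sub>F s in at t within S. X s \<in> L \<and> mexp (X s) = f s" "(X has_vector_derivative u) (at t within S)"
proof -
  obtain r where r: "r > 0" "\<And>X::'k^'n^'n. norm X \<le> r \<Longrightarrow> norm (mexp X - mat 1 - X) \<le> (1/2) * norm X"
    using mexp_eq_imp_near by blast
  obtain e where e: "e > 0" "\<And>g. g \<in> G \<Longrightarrow> norm (g - mat 1) < e \<Longrightarrow> \<exists>X\<in>L. norm X < r \<and> mexp X = g"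
    using log[OF r(1)] by blast
  define Q where "Q = (\<lambda>s Y. Y \<in> L \<and> norm Y < r \<and> mexp Y = f s)"
  \<comment> \<open>Where no small logarithm is guaranteed the value is the default 0; only the germ
    at \<open>t\<close> matters.\<close>
  define X where "X = (\<lambda>s. if s \<in> S \<and> s \<noteq> t \<and> norm (f s - mat 1) < e then SOME Y. Q s Y else 0)"
  have Xt: "X t = 0" by (simp add: X_def)
  have near: "X s \<in> L \<and> mexp (X s) = f s \<and> norm (X s) \<le> 2 * norm (f s - mat 1) \<and> norm (X s) < r" if s: "s \<in> S" "norm (f s - mat 1) < e" for s
  proof (cases "s = t")
    case True
    then show ?thesis using Xt in_L(1) f(2) r(1) by simp
  next
    case False
    have "\<exists>Y. Q s Y" using e(2)[OF f(1)[OF s(1)] s(2)] by (auto simp: Q_def)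
    then have "Q s (X s)" using s False by (simp add: X_def someI_ex)
    then have q: "X s \<in> L" "norm (X s) < r" "mexp (X s) = f s" by (auto simp: Q_def)
    have "norm (mexp (X s) - mat 1 - X s) \<le> (1/2) * norm (X s)" using q by (intro r) simp
    then have "norm (X s) \<le> 2 * norm (f s - mat 1)"
      using norm_triangle_ineq2[of "X s" "mexp (X s) - mat 1"] by (simp add: q(3) norm_minus_commute)
    then show ?thesis using q by blast
  qed
  have fd: "\<exists>d>0. \<forall>s\<in>S. \<bar>s - t\<bar> < d \<longrightarrow> norm (f s - mat 1 - (s - t) *\<^sub>R u) \<le> \<epsilon> * \<bar>s - t\<bar>" if "\<epsilon> > 0" for \<epsilon>
    using f(3) that unfolding has_vector_derivative_def has_derivative_within_alt f(2) by auto
  have small: "\<exists>d>0. \<forall>s\<in>S. \<bar>s - t\<bar> < d \<longrightarrow> norm (f s - mat 1) \<le> (norm u + 1) * \<bar>s - t\<bar> \<and> norm (f s - mat 1) < \<epsilon>" if \<epsilon>: "\<epsilon> > 0" for \<epsilon>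
  proof -
    obtain d where d: "d > 0" "\<And>s. s \<in> S \<Longrightarrow> \<bar>s - t\<bar> < d \<Longrightarrow> norm (f s - mat 1 - (s - t) *\<^sub>R u) \<le> 1 * \<bar>s - t\<bar>"
      using fd[of 1] by auto
    show ?thesis
    proof (intro exI[of _ "min d (\<epsilon> / (norm u + 1))"] conjI ballI impI)
      have nu: "norm u + 1 > 0" by (simp add: add_nonneg_pos)
      show "min d (\<epsilon> / (norm u + 1)) > 0" using d \<epsilon> nu by simp
      fix s assume s: "s \<in> S" "\<bar>s - t\<bar> < min d (\<epsilon> / (norm u + 1))"
      have "norm (f s - mat 1) \<le> norm (f s - mat 1 - (s - t) *\<^sub>R u) + norm ((s - t) *\<^sub>R u)" by (metis diff_add_cancel norm_triangle_ineq)
      also have "\<dots> \<le> 1 * \<bar>s - t\<bar> + \<bar>s - t\<bar> * norm u" using d(2)[of s] s by (intro add_mono) auto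
      also have "\<dots> = (norm u + 1) * \<bar>s - t\<bar>" by (simp add: algebra_simps)
      finally show 1: "norm (f s - mat 1) \<le> (norm u + 1) * \<bar>s - t\<bar>" .
      have "(norm u + 1) * \<bar>s - t\<bar> < \<epsilon>" using s nu by (simp add: pos_less_divide_eq mult.commute)
      with 1 show "norm (f s - mat 1) < \<epsilon>" by linarith
    qed
  qed
  show ?thesis
  proof (rule that[of X, OF Xt])
    obtain d where d: "d > 0" "\<And>s. s \<in> S \<Longrightarrow> \<bar>s - t\<bar> < d \<Longrightarrow> norm (f s - mat 1) < e" using small[OF e(1)] by blast
    show "\<forall>\<^sub>F s in at t within S. X s \<in> L \<and> mexp (X s) = f s"
      unfolding eventually_at by (rule exI[of _ d]) (use d near in \<open>auto simp: dist_real_def\<close>)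
    show "(X has_vector_derivative u) (at t within S)"
      unfolding has_vector_derivative_def has_derivative_within_alt
    proof (intro conjI allI impI)
      show "bounded_linear (\<lambda>x. x *\<^sub>R u)" by (rule bounded_linear_scaleR_left)
      fix \<epsilon> :: real assume \<epsilon>: "\<epsilon> > 0"
      \<comment> \<open>Near \<open>t\<close> the logarithm has norm at most 2(|u| + 1)|s - t|, so
        an error of \<epsilon>1 times that norm uses up half of the tolerance; the other half goes
        to the derivative of \<open>f\<close>.\<close>
      define \<epsilon>1 where "\<epsilon>1 = \<epsilon> / (4 * (norm u + 1))"
      have nu: "norm u + 1 > 0" by (simp add: add_nonneg_pos)
      have \<epsilon>1: "\<epsilon>1 > 0" "\<epsilon>1 * (2 * (norm u + 1)) = \<epsilon> / 2" using \<epsilon> nu by (auto simp: \<epsilon>1_def field_simps)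
      have "(mexp has_derivative (\<lambda>V::'k^'n^'n. V)) (at 0)"
        using mexp_has_derivative[of "0::'k^'n^'n"] by simp
      then obtain d1 where d1: "d1 > 0" "\<And>Y::'k^'n^'n. norm Y < d1 \<Longrightarrow> norm (mexp Y - mat 1 - Y) \<le> \<epsilon>1 * norm Y"
        unfolding has_derivative_at_alt using \<epsilon>1(1) by auto
      obtain d2 where d2: "d2 > 0" "\<And>s. s \<in> S \<Longrightarrow> \<bar>s - t\<bar> < d2 \<Longrightarrow> norm (f s - mat 1) \<le> (norm u + 1) * \<bar>s - t\<bar> \<and> norm (f s - mat 1) < min e (d1 / 2)"
        using small[of "min e (d1 / 2)"] e(1) d1(1) by auto
      obtain d3 where d3: "d3 > 0" "\<And>s. s \<in> S \<Longrightarrow> \<bar>s - t\<bar> < d3 \<Longrightarrow> norm (f s - mat 1 - (s - t) *\<^sub>R u) \<le> (\<epsilon> / 2) * \<bar>s - t\<bar>"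
        using fd[of "\<epsilon> / 2"] \<epsilon> by auto
      show "\<exists>d>0. \<forall>s\<in>S. norm (s - t) < d \<longrightarrow> norm (X s - X t - (s - t) *\<^sub>R u) \<le> \<epsilon> * norm (s - t)"
      proof (intro exI[of _ "min d2 d3"] conjI ballI impI)
        show "min d2 d3 > 0" using d2 d3 by simp
        fix s assume s: "s \<in> S" "norm (s - t) < min d2 d3"
        have f2: "norm (f s - mat 1) \<le> (norm u + 1) * \<bar>s - t\<bar>" "norm (f s - mat 1) < e" "norm (f s - mat 1) < d1 / 2"
          using d2(2)[of s] s by auto
        have n: "mexp (X s) = f s" "norm (X s) \<le> 2 * norm (f s - mat 1)" using near[OF s(1) f2(2)] by auto
        have "norm (f s - mat 1 - X s) \<le> \<epsilon>1 * norm (X s)" using d1(2)[of "X s"] n f2(3) by simp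
        also have "\<dots> \<le> \<epsilon>1 * (2 * ((norm u + 1) * \<bar>s - t\<bar>))" using n(2) f2(1) \<epsilon>1(1) by (intro mult_left_mono) auto
        also have "\<dots> = (\<epsilon> / 2) * \<bar>s - t\<bar>" unfolding \<epsilon>1(2)[symmetric] by (simp add: mult_ac)
        finally have 1: "norm (f s - mat 1 - X s) \<le> (\<epsilon> / 2) * \<bar>s - t\<bar>" .
        have 2: "norm (f s - mat 1 - (s - t) *\<^sub>R u) \<le> (\<epsilon> / 2) * \<bar>s - t\<bar>" using d3(2)[of s] s by auto
        have "X s - (s - t) *\<^sub>R u = (f s - mat 1 - (s - t) *\<^sub>R u) - (f s - mat 1 - X s)" by simp
        then have "norm (X s - (s - t) *\<^sub>R u) \<le> norm (f s - mat 1 - (s - t) *\<^sub>R u) + norm (f s - mat 1 - X s)"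
          by (metis norm_triangle_ineq4)
        then show "norm (X s - X t - (s - t) *\<^sub>R u) \<le> \<epsilon> * norm (s - t)" using 1 2 Xt by (simp add: algebra_simps)
      qed
    qed
  qed
qed

text \<open>After left translation to the identity the covector is dual under \<open>B\<close> to
  \<open>u + Z\<close>. As the chart is centred at \<gamma>(t), only the first-order terms of
  \<open>dexp\<close> and of its inverse at 0 enter, namely +1/2 and -1/2 times a bracket. Both
  sides of the momentum equation become (1/2) B(u + Z, [u, Y]).\<close>

lemma hamilton_equations:
  assumes log: "\<And>r. r > 0 \<Longrightarrow> \<exists>e>0. \<forall>g\<in>G. norm (g - mat 1) < e \<longrightarrow> (\<exists>X\<in>L. norm X < r \<and> mexp X = g)"
    and \<gamma>: "\<And>t. t \<in> S \<Longrightarrow> \<gamma> t \<in> G" and form: "geo_form \<gamma> S p U Z" and UZ: "U \<in> H" "Z \<in> C"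
    and E: "orthonormal_basis ip H E" and t: "t \<in> S"
  shows "hamilton_equations_at L E S \<gamma> (\<lambda>s V. B (geo_control p U Z s + Z) (matrix_inv (\<gamma> s) ** V)) t"
proof -
  define u where "u = geo_control p U Z"
  define l where "l = (\<lambda>s. u s + Z)"
  have uH: "u s \<in> H" for s unfolding u_def by (rule geo_control_H[OF UZ])
  have uL: "u s \<in> L" for s by (rule H_L[OF uH])
  have ZL: "Z \<in> L" by (rule in_C(6)[OF UZ(2)])
  have EB: "finite E" "span E = H" "\<And>e e'. e \<in> E \<Longrightarrow> e' \<in> E \<Longrightarrow> B e e' = (if e = e' then 1 else 0)"
  proof -
    show "finite E" "span E = H" using E by (auto simp: orthonormal_basis_def)
    then have "e \<in> L" if "e \<in> E" for e using that span_base H_L by blast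
    then show "B e e' = (if e = e' then 1 else 0)" if "e \<in> E" "e' \<in> E" for e e'
      using E ip_eq[of e e'] that by (simp add: orthonormal_basis_def)
  qed
  have EH: "e \<in> H" if "e \<in> E" for e using EB(2) that span_base by blast
  have EL: "e \<in> L" if "e \<in> E" for e using H_L[OF EH[OF that]] .
  \<comment> \<open>Z is orthogonal to \<open>H\<close>, so the horizontal part of
    \<open>u + Z\<close> is \<open>u\<close>. This is the velocity that the Hamiltonian
    prescribes.\<close>
  have lu: "(\<Sum>e\<in>E. B (l t) e *\<^sub>R e) = u t"
  proof -
    have "B (l t) e = B (u t) e" if "e \<in> E" for e
      using EH[OF that] UZ(2) by (simp add: l_def B.add_left H_iff)
    then have "(\<Sum>e\<in>E. B (l t) e *\<^sub>R e) = (\<Sum>e\<in>E. B (u t) e *\<^sub>R e)" by simp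
    also have "\<dots> = u t" using orthonormal_expansion[OF B_bilinear EB(1,3), of "u t"] uH EB(2) by simp
    finally show ?thesis .
  qed
  define P where "P = (\<lambda>s V. B (l s) (matrix_inv (\<gamma> s) ** V))"
  let ?f = "\<lambda>s. matrix_inv (\<gamma> t) ** \<gamma> s"
  have fG: "?f s \<in> G" if "s \<in> S" for s by (intro G_mult G_inv \<gamma> that t)
  have ft: "?f t = mat 1" by (rule inv_mult(1)[OF \<gamma>[OF t]])
  have "(?f has_vector_derivative matrix_inv (\<gamma> t) ** (\<gamma> t ** u t)) (at t within S)"
    unfolding u_def by (rule bounded_linear.has_vector_derivative[OF mm.bounded_linear_right geo_form_deriv[OF form t]])
  then have fd: "(?f has_vector_derivative u t) (at t within S)" by (simp only: inv_cancel(1)[OF \<gamma>[OF t]])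
  obtain X where X: "X t = 0" "\<forall>\<^sub>F s in at t within S. X s \<in> L \<and> mexp (X s) = ?f s" "(X has_vector_derivative u t) (at t within S)"
    by (rule log_curve[OF log fG ft fd t])
  have ev: "\<forall>\<^sub>F s in at t within S. X s \<in> L \<and> exp_chart (\<gamma> t) (X s) = \<gamma> s"
    using X(2) by eventually_elim (simp add: exp_chart_def inv_cancel(2)[OF \<gamma>[OF t]])
  define \<xi> where "\<xi> = (\<lambda>s. P s \<circ> chart_deriv (\<gamma> t) (X s))"
  define \<xi>' where "\<xi>' = (\<lambda>Y. (1/2) * B (l t) (lie_bracket (u t) Y))"
  have \<xi>t: "\<xi> t Y = B (l t) Y" for Y
    by (simp add: \<xi>_def P_def exp_chart_deriv X(1) inv_cancel(1)[OF \<gamma>[OF t]])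
  have \<xi>s: "\<forall>\<^sub>F s in at t within S. \<xi> s Y = B (l s) (dexp (X s) Y)" for Y
  proof -
    have "\<forall>\<^sub>F s in at t within S. s \<in> S" by (simp add: eventually_at_filter)
    with ev show ?thesis
    proof eventually_elim
      case (elim s)
      have "chart_deriv (\<gamma> t) (X s) Y = \<gamma> s ** dexp (X s) Y"
        using elim(1) by (simp add: exp_chart_deriv exp_chart_def matrix_mul_assoc)
      then show ?case by (simp add: \<xi>_def P_def inv_cancel(1)[OF \<gamma>[OF elim(2)]])
    qed
  qed
  have \<xi>der: "((\<lambda>s. \<xi> s Y) has_real_derivative \<xi>' Y) (at t within S)" if Y: "Y \<in> L" for Y
  proof -
    have 1: "(l has_vector_derivative lie_bracket Z (u t)) (at t within S)"
      using has_vector_derivative_add[OF geo_control_deriv[of p U Z t S] has_vector_derivative_const[of Z]]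
      by (simp add: l_def[abs_def] u_def)
    have "((\<lambda>X. dexp X Y) has_derivative (\<lambda>X. (1/2) *\<^sub>R lie_bracket Y X)) (at (X t) within X ` S)"
      unfolding X(1) by (rule has_derivative_at_withinI[OF dexp_has_derivative_0])
    from vector_derivative_diff_chain_within[OF X(3) this]
    have 2: "((\<lambda>s. dexp (X s) Y) has_vector_derivative (1/2) *\<^sub>R lie_bracket Y (u t)) (at t within S)" by (simp add: o_def)
    have "((\<lambda>s. B (l s) (dexp (X s) Y)) has_vector_derivative
        B (l t) ((1/2) *\<^sub>R lie_bracket Y (u t)) + B (lie_bracket Z (u t)) (dexp (X t) Y)) (at t within S)"
      by (rule B.has_vector_derivative[OF 1 2])
    \<comment> \<open>The motion of the covector contributes B([Z, u], Y), which equals B(u + Z,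
      [u, Y]) since B(u, [u, Y]) = 0; the motion of the chart point takes away one half of
      it.\<close>
    moreover have "B (l t) ((1/2) *\<^sub>R lie_bracket Y (u t)) + B (lie_bracket Z (u t)) (dexp (X t) Y) = \<xi>' Y"
    proof -
      have "B (u t) (lie_bracket (u t) Y) = 0"
        using B_ad[OF uL uL Y, of t t] by (simp add: lie_bracket_simps B.zero_left)
      moreover have "B (lie_bracket Z (u t)) Y = B Z (lie_bracket (u t) Y)" by (rule B_ad[OF uL ZL Y])
      ultimately have "B (lie_bracket Z (u t)) Y = B (l t) (lie_bracket (u t) Y)" by (simp add: l_def B.add_left)
      then show ?thesis
        by (subst lie_bracket_commute[of Y]) (simp add: X(1) \<xi>'_def B.scaleR_right B.minus_right)
    qed
    ultimately have "((\<lambda>s. B (l s) (dexp (X s) Y)) has_real_derivative \<xi>' Y) (at t within S)"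
      by (simp add: has_real_derivative_iff_has_vector_derivative)
    moreover have "\<xi> t Y = B (l t) (dexp (X t) Y)" by (simp add: \<xi>t X(1))
    ultimately show ?thesis
      using has_field_derivative_cong_eventually[OF \<xi>s[of Y]] by blast
  qed
  have gt: "\<gamma> t \<in> G" by (rule \<gamma>[OF t])
  obtain r K where rK: "r > 0" "K > 0"
    "\<And>X e. X \<in> L \<Longrightarrow> norm X \<le> r \<Longrightarrow> e \<in> L \<Longrightarrow> \<exists>z\<in>L. dexp X z = e \<and>
       norm (z - e - (- (1/2) *\<^sub>R lie_bracket e X)) \<le> K * (norm X)\<^sup>2 * norm e \<and>
       (\<forall>g\<in>G. inv_into L (chart_deriv g X) (exp_chart g X ** e) = z)"
    by (rule dexp_inverse) (rule that)
  have inv0: "inv_into L (chart_deriv (\<gamma> t) 0) (exp_chart (\<gamma> t) 0 ** e) = e" if "e \<in> E" for e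
    using rK(3)[OF in_L(1) _ EL[OF that]] rK(1) gt by auto
  have \<eta>der: "((\<lambda>\<epsilon>. coord_hamiltonian L E (\<gamma> t) (X t) (\<lambda>Y. \<xi> t Y + \<epsilon> * \<eta> Y)) has_real_derivative \<eta> (u t)) (at 0)"
    if \<eta>: "linear \<eta>" for \<eta> :: "'k^'n^'n \<Rightarrow> real"
  proof -
    have c: "coord_hamiltonian L E (\<gamma> t) (X t) (\<lambda>Y. \<xi> t Y + \<epsilon> * \<eta> Y) = 1/2 * (\<Sum>e\<in>E. (B (l t) e + \<epsilon> * \<eta> e)\<^sup>2)" for \<epsilon>
      unfolding coord_hamiltonian_def sr_hamiltonian_def X(1)
      by (intro arg_cong[where f = "\<lambda>x. 1/2 * x"] sum.cong refl) (simp add: inv0 \<xi>t)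
    have "((\<lambda>\<epsilon>. 1/2 * (\<Sum>e\<in>E. (B (l t) e + \<epsilon> * \<eta> e)\<^sup>2)) has_real_derivative (1/2 * (\<Sum>e\<in>E. 2 * (B (l t) e + 0 * \<eta> e) * \<eta> e))) (at 0)"
      by (auto intro!: derivative_eq_intros sum.cong)
    moreover have "1/2 * (\<Sum>e\<in>E. 2 * (B (l t) e + 0 * \<eta> e) * \<eta> e) = \<eta> (u t)"
      unfolding lu[symmetric] by (simp add: linear_sum[OF \<eta>] linear_scale[OF \<eta>] sum_distrib_left mult.assoc)
    ultimately show ?thesis unfolding c by simp
  qed
  have Xder: "((\<lambda>\<epsilon>. coord_hamiltonian L E (\<gamma> t) (X t + \<epsilon> *\<^sub>R Y) (\<xi> t)) has_real_derivative - \<xi>' Y) (at 0)"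
    if Y: "Y \<in> L" for Y
  proof -
    \<comment> \<open>The translated frame vector \<open>e\<close> read in the chart. Its derivative
      in \<epsilon> at 0 is the only way in which the Hamiltonian depends on the position to first
      order.\<close>
    define z where "z = (\<lambda>\<epsilon> e. inv_into L (chart_deriv (\<gamma> t) (\<epsilon> *\<^sub>R Y)) (exp_chart (\<gamma> t) (\<epsilon> *\<^sub>R Y) ** e))"
    have c: "coord_hamiltonian L E (\<gamma> t) (X t + \<epsilon> *\<^sub>R Y) (\<xi> t) = 1/2 * (\<Sum>e\<in>E. (B (l t) (z \<epsilon> e))\<^sup>2)" for \<epsilon>
      unfolding coord_hamiltonian_def sr_hamiltonian_def X(1)
      by (intro arg_cong[where f = "\<lambda>x. 1/2 * x"] sum.cong refl) (simp add: \<xi>t z_def)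
    have z0: "z 0 e = e" if "e \<in> E" for e using inv0[OF that] by (simp add: z_def)
    have zd: "((\<lambda>\<epsilon>. z \<epsilon> e) has_vector_derivative (- (1/2) *\<^sub>R lie_bracket e Y)) (at 0)" if e: "e \<in> E" for e
      unfolding has_vector_derivative_def
    proof (rule has_derivative_quadratic_0)
      show "bounded_linear (\<lambda>x. x *\<^sub>R - (1/2) *\<^sub>R lie_bracket e Y)" by (rule bounded_linear_scaleR_left)
      show "r / (norm Y + 1) > 0" using rK(1) by (simp add: add_nonneg_pos)
      fix \<epsilon> :: real assume \<epsilon>: "norm \<epsilon> < r / (norm Y + 1)"
      have nY: "norm Y + 1 > 0" by (simp add: add_nonneg_pos)
      have "\<bar>\<epsilon>\<bar> * norm Y \<le> \<bar>\<epsilon>\<bar> * (norm Y + 1)" by (intro mult_left_mono) auto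
      also have "\<dots> < r" using \<epsilon> nY by (simp add: pos_less_divide_eq)
      finally have "norm (\<epsilon> *\<^sub>R Y) \<le> r" by simp
      then obtain w where w: "norm (w - e - (- (1/2) *\<^sub>R lie_bracket e (\<epsilon> *\<^sub>R Y))) \<le> K * (norm (\<epsilon> *\<^sub>R Y))\<^sup>2 * norm e"
        "inv_into L (chart_deriv (\<gamma> t) (\<epsilon> *\<^sub>R Y)) (exp_chart (\<gamma> t) (\<epsilon> *\<^sub>R Y) ** e) = w"
        using rK(3)[OF in_L(4)[OF Y] _ EL[OF e], of \<epsilon>] gt by blast
      have "- (1/2) *\<^sub>R lie_bracket e (\<epsilon> *\<^sub>R Y) = \<epsilon> *\<^sub>R - (1/2) *\<^sub>R lie_bracket e Y" by (simp add: lie_bracket_simps)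
      then show "norm (z \<epsilon> e - z 0 e - \<epsilon> *\<^sub>R - (1/2) *\<^sub>R lie_bracket e Y) \<le> (K * (norm Y)\<^sup>2 * norm e) * (norm \<epsilon>)\<^sup>2"
        using w z0[OF e] by (simp add: z_def power_mult_distrib mult_ac)
    qed
    have sq: "((\<lambda>\<epsilon>. (B (l t) (z \<epsilon> e))\<^sup>2) has_real_derivative 2 * B (l t) e * B (l t) (- (1/2) *\<^sub>R lie_bracket e Y)) (at 0)" if e: "e \<in> E" for e
    proof -
      have "((\<lambda>\<epsilon>. B (l t) (z \<epsilon> e)) has_real_derivative B (l t) (- (1/2) *\<^sub>R lie_bracket e Y)) (at 0)"
        using bounded_linear.has_vector_derivative[OF B.bounded_linear_right zd[OF e]]
        by (simp add: has_real_derivative_iff_has_vector_derivative)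
      from DERIV_power[OF this, of 2] show ?thesis by (simp add: z0[OF e] mult_ac)
    qed
    have "((\<lambda>\<epsilon>. 1/2 * (\<Sum>e\<in>E. (B (l t) (z \<epsilon> e))\<^sup>2)) has_real_derivative 1/2 * (\<Sum>e\<in>E. 2 * B (l t) e * B (l t) (- (1/2) *\<^sub>R lie_bracket e Y))) (at 0)"
      by (intro DERIV_cmult DERIV_sum sq)
    moreover have "1/2 * (\<Sum>e\<in>E. 2 * B (l t) e * B (l t) (- (1/2) *\<^sub>R lie_bracket e Y)) = - \<xi>' Y"
    proof -
      have "\<xi>' Y = (1/2) * B (l t) (lie_bracket (\<Sum>e\<in>E. B (l t) e *\<^sub>R e) Y)" by (simp add: \<xi>'_def lu)
      also have "\<dots> = (1/2) * (\<Sum>e\<in>E. B (l t) e * B (l t) (lie_bracket e Y))"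
        by (simp add: lb.sum_left lb.scaleR_left B.sum_right B.scaleR_right)
      finally show ?thesis
        by (simp add: B.minus_right B.scaleR_right sum_negf sum_distrib_left mult_ac)
    qed
    ultimately show ?thesis unfolding c by simp
  qed
  show ?thesis
    unfolding hamilton_equations_at_def u_def[symmetric]
  proof (intro exI conjI)
    show "X t = 0" by (rule X(1))
    show "\<forall>\<^sub>F s in at t within S. X s \<in> L \<and> exp_chart (\<gamma> t) (X s) = \<gamma> s" by (rule ev)
    show "\<forall>s. \<xi> s = (\<lambda>V. B (u s + Z) (matrix_inv (\<gamma> s) ** V)) \<circ> chart_deriv (\<gamma> t) (X s)" by (simp add: \<xi>_def P_def l_def)
    show "(X has_vector_derivative u t) (at t within S)" by (rule X(3))
    show "\<forall>Y\<in>L. ((\<lambda>s. \<xi> s Y) has_real_derivative \<xi>' Y) (at t within S)" using \<xi>der by blast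
    show "\<forall>\<eta>. linear \<eta> \<longrightarrow> ((\<lambda>\<epsilon>. coord_hamiltonian L E (\<gamma> t) (X t) (\<lambda>Y. \<xi> t Y + \<epsilon> * \<eta> Y)) has_real_derivative \<eta> (u t)) (at 0)"
      using \<eta>der by blast
    show "\<forall>Y\<in>L. ((\<lambda>\<epsilon>. coord_hamiltonian L E (\<gamma> t) (X t + \<epsilon> *\<^sub>R Y) (\<xi> t)) has_real_derivative - \<xi>' Y) (at 0)"
      using Xder by blast
  qed
qed

end

section \<open>Compact semisimple groups\<close>

lemma torus_commute:
  assumes "is_torus T" "A \<in> T" "A' \<in> T" shows "A ** A' = A' ** A"
proof -
  obtain k f where hm: "homeomorphic_map (product_topology (\<lambda>_. top_of_set (sphere (0::complex) 1)) {..<k}) (top_of_set T) f"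
    and f: "\<forall>z \<in> {..<k::nat} \<rightarrow>\<^sub>E sphere 0 1. \<forall>w \<in> {..<k} \<rightarrow>\<^sub>E sphere 0 1. f (\<lambda>i\<in>{..<k}. z i * w i) = f z ** f w"
    using assms(1) unfolding is_torus_def by (elim exE conjE)
  have im: "f ` ({..<k} \<rightarrow>\<^sub>E sphere 0 1) = T"
    using homeomorphic_imp_surjective_map[OF hm] by (simp add: topspace_product_topology)
  obtain z w where zw: "z \<in> {..<k} \<rightarrow>\<^sub>E sphere 0 1" "w \<in> {..<k} \<rightarrow>\<^sub>E sphere 0 1" "A = f z" "A' = f w"
    using assms(2,3) unfolding im[symmetric] by blast
  have "f z ** f w = f (\<lambda>i\<in>{..<k}. z i * w i)" using f zw(1,2) by simp
  also have "\<dots> = f (\<lambda>i\<in>{..<k}. w i * z i)" by (simp add: mult.commute)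
  also have "\<dots> = f w ** f z" using f zw(1,2) by simp
  finally show ?thesis using zw by simp
qed

lemma matrix_inv_mexp: "matrix_inv (mexp X) = mexp (- X)"
proof -
  have "invertible (mexp X)" unfolding invertible_def by (intro exI[of _ "mexp (- X)"]) simp
  then have "matrix_inv (mexp X) = matrix_inv (mexp X) ** (mexp X ** mexp (- X))" by simp
  also have "\<dots> = mexp (- X)" using matrix_inv_mult[OF \<open>invertible _\<close>] by (simp only: matrix_mul_assoc matrix_mul_lid)
  finally show ?thesis .
qed

lemma commute_of_mexp_commute:
  assumes "\<And>s t::real. mexp (s *\<^sub>R X) ** mexp (t *\<^sub>R Y) = mexp (t *\<^sub>R Y) ** mexp (s *\<^sub>R X)"
  shows "X ** Y = Y ** X"
proof -
  have d: "((\<lambda>t. mexp (t *\<^sub>R Y)) has_vector_derivative Y) (at 0)" for Y :: "'a^'b^'b"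
    using mexp_scaleR_has_vector_derivative_left[of Y 0 UNIV] by simp
  have 1: "mexp (s *\<^sub>R X) ** Y = Y ** mexp (s *\<^sub>R X)" for s
  proof (rule vector_derivative_unique_at)
    show "((\<lambda>t. mexp (s *\<^sub>R X) ** mexp (t *\<^sub>R Y)) has_vector_derivative mexp (s *\<^sub>R X) ** Y) (at 0)"
      by (rule bounded_linear.has_vector_derivative[OF mm.bounded_linear_right d])
    show "((\<lambda>t. mexp (s *\<^sub>R X) ** mexp (t *\<^sub>R Y)) has_vector_derivative Y ** mexp (s *\<^sub>R X)) (at 0)"
      unfolding assms by (rule bounded_linear.has_vector_derivative[OF mm.bounded_linear_left d])
  qed
  show ?thesis
  proof (rule vector_derivative_unique_at)
    show "((\<lambda>s. mexp (s *\<^sub>R X) ** Y) has_vector_derivative X ** Y) (at 0)"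
      by (rule bounded_linear.has_vector_derivative[OF mm.bounded_linear_left d])
    show "((\<lambda>s. mexp (s *\<^sub>R X) ** Y) has_vector_derivative Y ** X) (at 0)"
      unfolding 1 by (rule bounded_linear.has_vector_derivative[OF mm.bounded_linear_right d])
  qed
qed

text \<open>Differentiating the commutation of one-parameter groups in both parameters makes their
  generators commute. Then exp(t(X + Y)) splits into exp(tX) exp(tY), so sums stay in the Lie
  algebra.\<close>

lemma torus_lie_algebra:
  assumes T: "is_torus T"
  shows "subspace (lie_algebra T)" "X \<in> lie_algebra T \<Longrightarrow> Y \<in> lie_algebra T \<Longrightarrow> lie_bracket X Y = 0"
proof -
  have G: "mat 1 \<in> T" "\<And>A A'. A \<in> T \<Longrightarrow> A' \<in> T \<Longrightarrow> A ** A' \<in> T"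
    using T by (auto simp: is_torus_def matrix_lie_group_def)
  have c: "X ** Y = Y ** X" if "X \<in> lie_algebra T" "Y \<in> lie_algebra T" for X Y
    by (rule commute_of_mexp_commute) (use that torus_commute[OF T] in \<open>simp add: lie_algebra_def\<close>)
  then show "X \<in> lie_algebra T \<Longrightarrow> Y \<in> lie_algebra T \<Longrightarrow> lie_bracket X Y = 0"
    by (simp add: lie_bracket_def)
  show "subspace (lie_algebra T)"
    unfolding subspace_def
  proof (intro conjI ballI allI)
    show "0 \<in> lie_algebra T" using G by (simp add: lie_algebra_def)
    fix X Y assume XY: "X \<in> lie_algebra T" "Y \<in> lie_algebra T"
    have "mexp (t *\<^sub>R (X + Y)) = mexp (t *\<^sub>R X) ** mexp (t *\<^sub>R Y)" for t
      unfolding scaleR_add_right by (rule mexp_add_commuting) (simp add: mm.scaleR_left mm.scaleR_right c[OF XY])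
    then show "X + Y \<in> lie_algebra T" using XY G(2) by (simp add: lie_algebra_def)
  next
    fix r X assume "X \<in> lie_algebra T"
    then show "r *\<^sub>R X \<in> lie_algebra T" by (simp add: lie_algebra_def)
  qed
qed

text \<open>All three properties are read off the components, since distinct summands commute. For
  the centre: the elements of a summand that commute with the whole summand form an ideal, which is
  proper because the summand is not commutative, hence zero. For the Lie algebra of \<open>G\<close>
  this lemma is the source of closure under sums and brackets.\<close>

lemma semisimple_properties:
  assumes "semisimple_lie_algebra L"
  shows "subspace L" "X \<in> L \<Longrightarrow> Y \<in> L \<Longrightarrow> lie_bracket X Y \<in> L"
    "X \<in> L \<Longrightarrow> (\<And>Y. Y \<in> L \<Longrightarrow> lie_bracket X Y = 0) \<Longrightarrow> X = 0"
proof -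
  obtain \<S> where S0: "finite \<S>" "\<forall>I\<in>\<S>. simple_lie_algebra I"
    "\<forall>I\<in>\<S>. \<forall>J\<in>\<S>. I \<noteq> J \<longrightarrow> (\<forall>X\<in>I. \<forall>Y\<in>J. lie_bracket X Y = 0)"
    and L: "L = {(\<Sum>I\<in>\<S>. f I) | f. \<forall>I\<in>\<S>. f I \<in> I}"
    using assms unfolding semisimple_lie_algebra_def by (elim exE conjE)
  have S: "finite \<S>" "\<And>I. I \<in> \<S> \<Longrightarrow> simple_lie_algebra I"
    "\<And>I J X Y. I \<in> \<S> \<Longrightarrow> J \<in> \<S> \<Longrightarrow> I \<noteq> J \<Longrightarrow> X \<in> I \<Longrightarrow> Y \<in> J \<Longrightarrow> lie_bracket X Y = 0"
    using S0 by simp_all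
  have sub: "subspace I" "\<And>X Y. X \<in> I \<Longrightarrow> Y \<in> I \<Longrightarrow> lie_bracket X Y \<in> I" if "I \<in> \<S>" for I
    using S(2)[OF that] by (auto simp: simple_lie_algebra_def lie_subalgebra_def)
  have LI: "(\<Sum>I\<in>\<S>. f I) \<in> L" if "\<And>I. I \<in> \<S> \<Longrightarrow> f I \<in> I" for f
    unfolding L mem_Collect_eq by (intro exI[of _ f] conjI refl ballI that)
  have LE: "\<exists>f. X = (\<Sum>I\<in>\<S>. f I) \<and> (\<forall>I\<in>\<S>. f I \<in> I)" if "X \<in> L" for X
    using that unfolding L mem_Collect_eq .
  interpret lb: bounded_bilinear "lie_bracket :: 'a^'b^'b \<Rightarrow> _" by (rule bounded_bilinear_lie_bracket)
  have cross: "lie_bracket (\<Sum>J\<in>\<S>. f J) Y = lie_bracket (f I) Y" if "I \<in> \<S>" "Y \<in> I" "\<And>J. J \<in> \<S> \<Longrightarrow> f J \<in> J" for f I Y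
  proof -
    have "lie_bracket (\<Sum>J\<in>\<S>. f J) Y = (\<Sum>J\<in>\<S>. if J = I then lie_bracket (f I) Y else 0)"
      unfolding lb.sum_left using S(3) that by (intro sum.cong refl) auto
    then show ?thesis using S(1) that(1) by simp
  qed
  show "subspace L"
    unfolding subspace_def
  proof (intro conjI ballI allI)
    show "0 \<in> L" using LI[of "\<lambda>_. 0"] sub(1) subspace_0 by auto
    fix X Y assume XY: "X \<in> L" "Y \<in> L"
    obtain f g where fg: "X = (\<Sum>I\<in>\<S>. f I)" "\<forall>I\<in>\<S>. f I \<in> I" "Y = (\<Sum>I\<in>\<S>. g I)" "\<forall>I\<in>\<S>. g I \<in> I"
      using LE[OF XY(1)] LE[OF XY(2)] by (elim exE conjE)
    have "X + Y = (\<Sum>I\<in>\<S>. f I + g I)" by (simp add: fg sum.distrib)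
    then show "X + Y \<in> L" using fg sub(1) by (simp add: LI subspace_add)
  next
    fix r X assume X: "X \<in> L"
    obtain f where f: "X = (\<Sum>I\<in>\<S>. f I)" "\<forall>I\<in>\<S>. f I \<in> I" using LE[OF X] by (elim exE conjE)
    have "r *\<^sub>R X = (\<Sum>I\<in>\<S>. r *\<^sub>R f I)" by (simp add: f scaleR_sum_right)
    then show "r *\<^sub>R X \<in> L" using f sub(1) by (simp add: LI subspace_scale)
  qed
  show "lie_bracket X Y \<in> L" if XY: "X \<in> L" "Y \<in> L"
  proof -
    obtain f g where fg: "X = (\<Sum>I\<in>\<S>. f I)" "\<forall>I\<in>\<S>. f I \<in> I" "Y = (\<Sum>I\<in>\<S>. g I)" "\<forall>I\<in>\<S>. g I \<in> I"
      using LE[OF XY(1)] LE[OF XY(2)] by (elim exE conjE)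
    have "lie_bracket X Y = (\<Sum>I\<in>\<S>. lie_bracket X (g I))" by (simp add: fg(3) lb.sum_right)
    also have "\<dots> = (\<Sum>I\<in>\<S>. lie_bracket (f I) (g I))"
      unfolding fg(1) using cross fg(2,4) by (intro sum.cong refl) auto
    finally show ?thesis using fg(2,4) sub(2) by (simp add: LI)
  qed
  show "X = 0" if X: "X \<in> L" "\<And>Y. Y \<in> L \<Longrightarrow> lie_bracket X Y = 0"
  proof -
    obtain f where f: "X = (\<Sum>I\<in>\<S>. f I)" "\<forall>I\<in>\<S>. f I \<in> I" using LE[OF X(1)] by (elim exE conjE)
    have "f I = 0" if I: "I \<in> \<S>" for I
    proof -
      define Z where "Z = {W \<in> I. \<forall>Y\<in>I. lie_bracket W Y = 0}"
      have "lie_bracket (f I) Y = 0" if Y: "Y \<in> I" for Y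
      proof -
        have "(\<Sum>J\<in>\<S>. if J = I then Y else 0) \<in> L" by (rule LI) (use Y sub(1) subspace_0 in auto)
        then have "Y \<in> L" using S(1) I by simp
        then show ?thesis using X(2)[of Y] cross[OF I Y, of f] f by simp
      qed
      then have fZ: "f I \<in> Z" using f(2) I by (simp add: Z_def)
      have "lie_ideal Z I"
        unfolding lie_ideal_def
      proof (intro conjI ballI)
        show "subspace Z" using sub(1)[OF I] by (auto simp: subspace_def Z_def lie_bracket_simps)
        show "Z \<subseteq> I" by (auto simp: Z_def)
        fix V W assume "V \<in> I" "W \<in> Z"
        then have "lie_bracket V W = 0" using lie_bracket_commute[of V W] by (simp add: Z_def)
        then show "lie_bracket V W \<in> Z" using \<open>subspace Z\<close> subspace_0 by simp
      qed
      then have "Z = {0} \<or> Z = I" using S(2)[OF I] by (simp add: simple_lie_algebra_def)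
      moreover have "Z \<noteq> I" using S(2)[OF I] by (auto simp: simple_lie_algebra_def Z_def)
      ultimately show ?thesis using fZ by simp
    qed
    then show ?thesis using f(1) by simp
  qed
qed

section \<open>Logarithms near the identity and the Killing form of a compact semisimple
  group\<close>

locale compact_matrix_group =
  fixes G L :: "(('k::{real_normed_field,euclidean_space})^'n^'n) set"
  assumes lie_group: "matrix_lie_group G" and compact: "compact G" and L_eq: "L = lie_algebra G"
    and semisimple: "semisimple_lie_algebra L"
begin

lemma group: "A \<in> G \<Longrightarrow> invertible A" "A \<in> G \<Longrightarrow> A' \<in> G \<Longrightarrow> A ** A' \<in> G" "A \<in> G \<Longrightarrow> matrix_inv A \<in> G" "mat 1 \<in> G"
  using lie_group by (auto simp: matrix_lie_group_def)

lemma mexp_G: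
  assumes "X \<in> L" shows "mexp X \<in> G"
proof -
  have "mexp (1 *\<^sub>R X) \<in> G" using assms unfolding L_eq lie_algebra_def mem_Collect_eq by (rule spec)
  then show ?thesis by simp
qed

lemmas sub = semisimple_properties(1)[OF semisimple] and bracket = semisimple_properties(2)[OF semisimple]
  and centre = semisimple_properties(3)[OF semisimple]

lemma conj_L: assumes "X \<in> L" "Y \<in> L" shows "conj_mexp X Y \<in> L"
proof -
  have "mexp (t *\<^sub>R conj_mexp X Y) \<in> G" for t
  proof -
    have "t *\<^sub>R conj_mexp X Y = mexp (- X) ** (t *\<^sub>R Y) ** mexp X"
      by (simp add: conj_mexp_def mm.scaleR_left mm.scaleR_right)
    then have "mexp (t *\<^sub>R conj_mexp X Y) = mexp (- X) ** mexp (t *\<^sub>R Y) ** mexp X" by (simp add: mexp_conj)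
    then show ?thesis using mexp_G sub assms by (simp add: group subspace_neg subspace_scale)
  qed
  then show ?thesis by (simp add: L_eq lie_algebra_def)
qed

text \<open>The Euclidean projection onto \<open>L\<close>. It splits matrices into a part in the
  Lie algebra and a normal part near the identity, and it extends the Killing form bilinearly to all
  matrices.\<close>

definition \<pi> :: "'k^'n^'n \<Rightarrow> 'k^'n^'n" where "\<pi> = bproj (\<bullet>) L"

lemma \<pi>: "linear \<pi>" "\<pi> X \<in> L" "X \<in> L \<Longrightarrow> \<pi> X = X"
proof -
  note b = bproj[OF sub bilinear_inner inner_commute]
  show "linear \<pi>" unfolding \<pi>_def by (rule b) simp
  show "\<pi> X \<in> L" unfolding \<pi>_def by (rule b) simp
  show "X \<in> L \<Longrightarrow> \<pi> X = X" unfolding \<pi>_def by (rule b) simp_all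
qed

text \<open>
  Von Neumann's argument: otherwise some \<open>e\<^sup>y \<in> G\<close> with \<open>y \<rightarrow> 0\<close>, \<open>y \<noteq> 0\<close> orthogonal to \<open>L\<close>; a limit \<open>l\<close> of the
  directions of the \<open>y\<close> satisfies \<open>e\<^sup>t\<^sup>l \<in> G\<close> for all \<open>t\<close> because \<open>G\<close> is closed, so that \<open>l \<in> L\<close>.
\<close>

lemma log_near:
  assumes r: "r > 0"
  shows "\<exists>e>0. \<forall>g\<in>G. norm (g - mat 1) < e \<longrightarrow> (\<exists>X\<in>L. norm X < r \<and> mexp X = g)"
proof (rule ccontr)
  assume contra: "\<not> ?thesis"
  have bad: "\<exists>g\<in>G. norm (g - mat 1) < e \<and> \<not> (\<exists>X\<in>L. norm X < r \<and> mexp X = g)" if "e > 0" for e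
    using contra that by blast
  have \<pi>b: "bounded_linear \<pi>" using \<pi>(1) by (simp add: linear_conv_bounded_linear)
  obtain k where k: "k > 0" "\<And>X. norm (\<pi> X) \<le> norm X * k" using bounded_linear.pos_bounded[OF \<pi>b] by blast
  \<comment> \<open>Coordinates adapted to the splitting of a matrix into its part in
    \<open>L\<close> and its normal part. The derivative at 0 is the identity, so by the open
    mapping argument \<open>f\<close> covers a neighbourhood of the identity matrix.\<close>
  define f where "f = (\<lambda>Y. mexp (\<pi> Y) ** mexp (Y - \<pi> Y))"
  have f0: "f 0 = mat 1" by (simp add: f_def linear_0[OF \<pi>(1)])
  have contf: "continuous_on UNIV f"
    unfolding f_def by (intro mm.continuous_on continuous_intros bounded_linear.continuous_on[OF \<pi>b])
  have m: "(mexp has_derivative (\<lambda>V::'k^'n^'n. V)) (at 0)" using mexp_has_derivative[of "0::'k^'n^'n"] by simp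
  have derf: "(f has_derivative (\<lambda>V. V)) (at 0)"
  proof -
    have p1: "((\<lambda>Y. mexp (\<pi> Y)) has_derivative (\<lambda>V. \<pi> V)) (at 0)"
      using diff_chain_at[OF bounded_linear_imp_has_derivative[OF \<pi>b], of mexp "\<lambda>V. V" 0] m by (simp add: linear_0[OF \<pi>(1)] o_def)
    have bl: "bounded_linear (\<lambda>Y. Y - \<pi> Y)" by (intro bounded_linear_sub bounded_linear_ident \<pi>b)
    have p2: "((\<lambda>Y. mexp (Y - \<pi> Y)) has_derivative (\<lambda>V. V - \<pi> V)) (at 0)"
      using diff_chain_at[OF bounded_linear_imp_has_derivative[OF bl], of mexp "\<lambda>V. V" 0] m by (simp add: linear_0[OF \<pi>(1)] o_def)
    from mm.FDERIV[OF p1 p2] show ?thesis by (simp add: f_def[abs_def] linear_0[OF \<pi>(1)])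
  qed
  have ex: "\<exists>Y. norm Y < \<delta> \<and> norm (\<pi> Y) < r \<and> Y - \<pi> Y \<noteq> 0 \<and> mexp (Y - \<pi> Y) \<in> G" if \<delta>: "\<delta> > 0" for \<delta>
  proof -
    \<comment> \<open>The bound r/k makes the part of \<open>Y\<close> in \<open>L\<close> shorter
      than \<open>r\<close>. If the normal part were 0, that part would be a logarithm which
      \<open>g\<close> is assumed not to have.\<close>
    define \<delta>' where "\<delta>' = min \<delta> (r / k)"
    have \<delta>': "\<delta>' > 0" using \<delta> r k by (simp add: \<delta>'_def)
    have "f 0 \<in> interior (f ` ball 0 \<delta>')"
      by (rule sussmann_open_mapping[OF open_UNIV contf _ derf bounded_linear_ident]) (use \<delta>' in \<open>auto simp: fun_eq_iff\<close>)
    then obtain e where e: "e > 0" "ball (mat 1) e \<subseteq> f ` ball 0 \<delta>'" unfolding f0 mem_interior by blast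
    obtain g where g: "g \<in> G" "norm (g - mat 1) < e" "\<not> (\<exists>X\<in>L. norm X < r \<and> mexp X = g)" using bad[OF e(1)] by blast
    have "g \<in> ball (mat 1) e" using g(2) by (simp add: dist_norm norm_minus_commute)
    then obtain Y where Y: "norm Y < \<delta>'" "f Y = g" using e(2) by auto
    have n: "norm (\<pi> Y) < r"
    proof -
      have "norm Y * k < r" using Y(1) k(1) by (simp add: \<delta>'_def pos_less_divide_eq)
      then show ?thesis using k(2)[of Y] by linarith
    qed
    have "Y - \<pi> Y \<noteq> 0"
    proof
      assume "Y - \<pi> Y = 0"
      then have "mexp (\<pi> Y) = g" using Y(2) by (simp add: f_def)
      then show False using g(3) n \<pi>(2) by blast
    qed
    moreover have "mexp (Y - \<pi> Y) = matrix_inv (mexp (\<pi> Y)) ** g"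
      unfolding Y(2)[symmetric] f_def matrix_inv_mexp matrix_mul_assoc by simp
    ultimately show ?thesis using Y(1) n group mexp_G[OF \<pi>(2)] g(1) by (intro exI[of _ Y]) (auto simp: \<delta>'_def)
  qed
  have "\<forall>n. \<exists>Y. norm Y < inverse (real (Suc n)) \<and> Y - \<pi> Y \<noteq> 0 \<and> mexp (Y - \<pi> Y) \<in> G"
  proof
    fix n
    show "\<exists>Y. norm Y < inverse (real (Suc n)) \<and> Y - \<pi> Y \<noteq> 0 \<and> mexp (Y - \<pi> Y) \<in> G"
      using ex[of "inverse (real (Suc n))"] by auto
  qed
  from choice[OF this] obtain Y where Y: "\<And>n. norm (Y n) < inverse (real (Suc n))" "\<And>n. Y n - \<pi> (Y n) \<noteq> 0" "\<And>n. mexp (Y n - \<pi> (Y n)) \<in> G"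
    by blast
  \<comment> \<open>The normal parts are killed by \<pi>, and so is every limit of their directions;
    a limit direction that lies in \<open>L\<close> must then be 0.\<close>
  define y where "y = (\<lambda>n. Y n - \<pi> (Y n))"
  have y: "y n \<noteq> 0" "mexp (y n) \<in> G" "\<pi> (y n) = 0" for n
    using Y \<pi>(3)[OF \<pi>(2)] by (auto simp: y_def linear_diff[OF \<pi>(1)])
  have Y0: "Y \<longlonglongrightarrow> 0"
    by (rule Lim_null_comparison[OF _ LIMSEQ_inverse_real_of_nat]) (intro always_eventually allI less_imp_le[OF Y(1)])
  have y0: "y \<longlonglongrightarrow> 0"
    using tendsto_diff[OF Y0 bounded_linear.tendsto[OF \<pi>b Y0]] by (simp add: y_def[abs_def] linear_0[OF \<pi>(1)])
  define w where "w = (\<lambda>n. y n /\<^sub>R norm (y n))"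
  have "\<forall>n. w n \<in> sphere 0 1" using y(1) by (simp add: w_def)
  from seq_compactE[OF compact_imp_seq_compact[OF compact_sphere] this]
  obtain l \<sigma> where l: "l \<in> sphere 0 1" "strict_mono \<sigma>" "(w \<circ> \<sigma>) \<longlonglongrightarrow> l" .
  have "\<pi> l = 0"
  proof -
    have "(\<lambda>n. \<pi> ((w \<circ> \<sigma>) n)) \<longlonglongrightarrow> \<pi> l" by (rule bounded_linear.tendsto[OF \<pi>b l(3)])
    moreover have "\<pi> ((w \<circ> \<sigma>) n) = 0" for n by (simp add: w_def linear_scale[OF \<pi>(1)] y(3))
    ultimately show ?thesis by (simp add: LIMSEQ_const_iff)
  qed
  have nat_G: "mexp (real j *\<^sub>R X) \<in> G" if "mexp X \<in> G" for j and X :: "'k^'n^'n"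
  proof (induction j)
    case (Suc j)
    have "mexp (real j *\<^sub>R X + X) = mexp (real j *\<^sub>R X) ** mexp X"
      by (rule mexp_add_commuting) (simp add: mm.scaleR_left mm.scaleR_right)
    then show ?case using Suc that group(2) by (simp add: scaleR_add_left add.commute)
  qed (simp add: group)
  have pos: "mexp (t *\<^sub>R l) \<in> G" if t: "t \<ge> 0" for t
  proof -
    \<comment> \<open>The integer multiple of the short vector \<open>y\<close> whose length is
      closest to \<open>t\<close> from below: the length differs from \<open>t\<close> by at most
      the norm of \<open>y\<close>, and the exponential of an integer multiple stays in
      \<open>G\<close>.\<close>
    define j where "j = (\<lambda>n. nat \<lfloor>t / norm (y (\<sigma> n))\<rfloor>)"
    have yn: "norm (y (\<sigma> n)) > 0" for n using y(1) by simp
    have y\<sigma>: "(\<lambda>n. norm (y (\<sigma> n))) \<longlonglongrightarrow> 0"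
      using LIMSEQ_subseq_LIMSEQ[OF y0 l(2)] by (simp add: o_def tendsto_norm_zero)
    have "(\<lambda>n. real (j n) * norm (y (\<sigma> n)) - t) \<longlonglongrightarrow> 0"
    proof (rule Lim_null_comparison[OF _ y\<sigma>], rule always_eventually, rule allI)
      fix n
      have q: "t / norm (y (\<sigma> n)) \<ge> 0" using t by simp
      then have "real (j n) \<le> t / norm (y (\<sigma> n))" "t / norm (y (\<sigma> n)) < real (j n) + 1"
        unfolding j_def by linarith+
      then have "real (j n) * norm (y (\<sigma> n)) \<le> t" "t < (real (j n) + 1) * norm (y (\<sigma> n))"
        using yn[of n] by (simp_all add: pos_le_divide_eq pos_divide_less_eq)
      then show "norm (real (j n) * norm (y (\<sigma> n)) - t) \<le> norm (y (\<sigma> n))" by (simp add: algebra_simps)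
    qed
    then have "(\<lambda>n. real (j n) * norm (y (\<sigma> n))) \<longlonglongrightarrow> t" by (rule LIM_zero_cancel)
    from tendsto_mexp[OF tendsto_scaleR[OF this l(3)]]
    have lim: "(\<lambda>n. mexp ((real (j n) * norm (y (\<sigma> n))) *\<^sub>R (w \<circ> \<sigma>) n)) \<longlonglongrightarrow> mexp (t *\<^sub>R l)" .
    have "(real (j n) * norm (y (\<sigma> n))) *\<^sub>R (w \<circ> \<sigma>) n = real (j n) *\<^sub>R y (\<sigma> n)" for n
      using yn[of n] by (simp add: w_def)
    then have "mexp ((real (j n) * norm (y (\<sigma> n))) *\<^sub>R (w \<circ> \<sigma>) n) \<in> G" for n using nat_G[OF y(2)] by simp
    then show ?thesis using closed_sequentially[OF compact_imp_closed[OF compact] _ lim] by blast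
  qed
  have "mexp (t *\<^sub>R l) \<in> G" for t
  proof (cases "t \<ge> 0")
    case False
    then have "mexp ((- t) *\<^sub>R l) \<in> G" by (intro pos) simp
    from group(3)[OF this] show ?thesis unfolding matrix_inv_mexp by simp
  qed (rule pos)
  then have "l \<in> L" by (simp add: L_eq lie_algebra_def)
  then have "l = 0" using \<pi>(3) \<open>\<pi> l = 0\<close> by simp
  then show False using l(1) by simp
qed

lemma linear_ad: "linear (lie_bracket X)"
  by (rule bounded_linear.linear[OF bounded_bilinear.bounded_linear_right[OF bounded_bilinear_lie_bracket]])

text \<open>Compactness bounds the maps Ad(exp(-tX)) for all \<open>t\<close>, and their inverses
  are of the same form; the trivial centre makes ad X nonzero. So \<open>trace_on_square_neg\<close>
  applies. It is used for W -> [W, X], the generator of these conjugations, whose square is that of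
  ad X because the signs cancel.\<close>

lemma killing_neg:
  assumes X: "X \<in> L" "X \<noteq> 0" shows "killing_form L X X < 0"
proof -
  obtain Y where Y: "Y \<in> L" "lie_bracket X Y \<noteq> 0" using centre[OF X(1)] X(2) by blast
  obtain R where R: "R > 0" "\<And>A. A \<in> G \<Longrightarrow> norm A \<le> R" using compact_imp_bounded[OF compact] by (auto simp: bounded_pos)
  obtain M where M: "M > 0" "\<And>(A::'k^'n^'n) (B::'k^'n^'n). norm (A ** B) \<le> norm A * norm B * M"
    using mm.pos_bounded by blast
  have bd: "norm (conj_mexp (t *\<^sub>R X) W) \<le> (R * R * M * M) * norm W" for t W
  proof -
    have g: "mexp (- (t *\<^sub>R X)) \<in> G" "mexp (t *\<^sub>R X) \<in> G"
      using X(1) sub by (auto intro!: mexp_G simp: subspace_neg subspace_scale)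
    have "norm (conj_mexp (t *\<^sub>R X) W) \<le> norm (mexp (- (t *\<^sub>R X)) ** W) * norm (mexp (t *\<^sub>R X)) * M"
      unfolding conj_mexp_def by (rule M)
    also have "\<dots> \<le> (norm (mexp (- (t *\<^sub>R X))) * norm W * M) * norm (mexp (t *\<^sub>R X)) * M"
      using M by (intro mult_right_mono) auto
    also have "\<dots> \<le> (R * norm W * M) * R * M"
      using R(2)[OF g(1)] R(2)[OF g(2)] R(1) M(1) by (intro mult_mono mult_nonneg_nonneg) auto
    finally show ?thesis by (simp add: mult_ac)
  qed
  have "trace_on L ((\<lambda>W. lie_bracket W X) \<circ> (\<lambda>W. lie_bracket W X)) < 0"
  proof (rule trace_on_square_neg[OF sub, where S = "\<lambda>t. conj_mexp (t *\<^sub>R X)" and M = "R * R * M * M" and y = Y])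
    show "linear (\<lambda>W. lie_bracket W X)"
      by (rule bounded_linear.linear[OF bounded_bilinear.bounded_linear_left[OF bounded_bilinear_lie_bracket]])
    show "(\<lambda>W. lie_bracket W X) ` L \<subseteq> L" using bracket X(1) by blast
    show "linear (conj_mexp (t *\<^sub>R X))" for t by (rule linear_conj_mexp)
    show "conj_mexp (0 *\<^sub>R X) W = W" for W by simp
    show "((\<lambda>t. conj_mexp (t *\<^sub>R X) W) has_vector_derivative conj_mexp (t *\<^sub>R X) (lie_bracket W X)) (at t)" for t W
      by (rule conj_mexp_has_vector_derivative)
    show "norm (conj_mexp (t *\<^sub>R X) W) \<le> R * R * M * M * norm W" for t W by (rule bd)
    show "norm W \<le> R * R * M * M * norm (conj_mexp (t *\<^sub>R X) W)" for t W
      using bd[of "- t" "conj_mexp (t *\<^sub>R X) W"] by simp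
    show "Y \<in> L" by (rule Y)
    show "lie_bracket Y X \<noteq> 0" using Y(2) lie_bracket_commute[of X Y] by simp
  qed
  moreover have "(\<lambda>W. lie_bracket W X) \<circ> (\<lambda>W. lie_bracket W X) = lie_bracket X \<circ> lie_bracket X"
  proof
    fix W
    have "lie_bracket (lie_bracket W X) X = lie_bracket X (lie_bracket X W)"
      using lie_bracket_commute[of "lie_bracket W X" X] lie_bracket_commute[of W X] by (simp add: lie_bracket_simps)
    then show "((\<lambda>W. lie_bracket W X) \<circ> (\<lambda>W. lie_bracket W X)) W = (lie_bracket X \<circ> lie_bracket X) W" by simp
  qed
  ultimately show ?thesis by (simp add: killing_form_def)
qed

lemma ad_comp: "X \<in> L \<Longrightarrow> Y \<in> L \<Longrightarrow> linear (lie_bracket X \<circ> lie_bracket Y) \<and> (lie_bracket X \<circ> lie_bracket Y) ` L \<subseteq> L"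
  by (auto simp: bracket intro!: linear_compose linear_ad)

lemma killing_sym: "X \<in> L \<Longrightarrow> Y \<in> L \<Longrightarrow> killing_form L X Y = killing_form L Y X"
  unfolding killing_form_def
  by (rule trace_on_commute[where f = "lie_bracket X" and g = "lie_bracket Y", OF sub linear_ad _ linear_ad])
    (use bracket in auto)

text \<open>Conjugation is an automorphism of the bracket, so ad of a conjugated element is the
  conjugated ad, and the trace is cyclic.\<close>

lemma killing_conj:
  assumes X: "X \<in> L" and Y: "Y \<in> L" and Z: "Z \<in> L"
  shows "killing_form L (conj_mexp X Y) (conj_mexp X Z) = killing_form L Y Z"
proof -
  let ?f = "lie_bracket Y \<circ> lie_bracket Z"
  have X': "- X \<in> L" using X sub by (simp add: subspace_neg)
  have cc: "conj_mexp X (conj_mexp (- X) W) = W" for W using conj_mexp_minus[of "- X" W] by simp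
  have e: "lie_bracket (conj_mexp X Y) \<circ> lie_bracket (conj_mexp X Z) = conj_mexp X \<circ> (?f \<circ> conj_mexp (- X))"
  proof
    fix W
    have "lie_bracket (conj_mexp X Y) (lie_bracket (conj_mexp X Z) (conj_mexp X (conj_mexp (- X) W))) = conj_mexp X (lie_bracket Y (lie_bracket Z (conj_mexp (- X) W)))"
      by (simp only: conj_mexp_bracket)
    then show "(lie_bracket (conj_mexp X Y) \<circ> lie_bracket (conj_mexp X Z)) W = (conj_mexp X \<circ> (?f \<circ> conj_mexp (- X))) W"
      by (simp add: cc)
  qed
  have "trace_on L (conj_mexp X \<circ> (?f \<circ> conj_mexp (- X))) = trace_on L ((?f \<circ> conj_mexp (- X)) \<circ> conj_mexp X)"
  proof (rule trace_on_commute[where f = "conj_mexp X" and g = "?f \<circ> conj_mexp (- X)", OF sub linear_conj_mexp])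
    show "conj_mexp X ` L \<subseteq> L" using conj_L X by auto
    show "linear (?f \<circ> conj_mexp (- X))" by (intro linear_compose linear_conj_mexp linear_ad)
    show "(?f \<circ> conj_mexp (- X)) ` L \<subseteq> L" by (auto intro!: bracket Y Z conj_L[OF X'])
  qed
  moreover have "(?f \<circ> conj_mexp (- X)) \<circ> conj_mexp X = ?f" by (rule ext) simp
  ultimately show ?thesis by (simp add: killing_form_def e)
qed

end

section \<open>The sub-Riemannian structure of the Killing form and the two assertions\<close>

theorem theorem2p1:
  fixes G T L C H :: "(('k::{real_normed_field,euclidean_space})^'n^'n) set"
    and ip :: "'k^'n^'n \<Rightarrow> 'k^'n^'n \<Rightarrow> real"
    and \<rho> :: real
  assumes "matrix_lie_group G" and "compact G" and "connected G"
    and "L = lie_algebra G" and "semisimple_lie_algebra L"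
    and "maximal_torus T G" and "C = lie_algebra T"
    and "\<rho> > 0" and "ip = (\<lambda>X Y. - \<rho> * killing_form L X Y)"
    and "H = orth_complement ip L C"
  shows "(\<forall>a b \<gamma>. sr_geodesic G ip H a b \<gamma> \<and> constant_speed ip a b \<gamma>
             \<longrightarrow> normal_geodesic G ip H a b \<gamma>)
       \<and> (\<forall>a b \<gamma> t\<^sub>0. sr_geodesic G ip H a b \<gamma> \<and> constant_speed ip a b \<gamma> \<and>
             t\<^sub>0 \<in> {a..b} \<and> \<gamma> t\<^sub>0 = mat 1
             \<longrightarrow> (\<exists>X\<in>L. \<forall>t\<in>{a..b}.
                   \<gamma> t = mexp ((t - t\<^sub>0) *\<^sub>R X) ** mexp (- (t - t\<^sub>0) *\<^sub>R orth_proj ip C X)))"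
proof -
  interpret K: compact_matrix_group G L by unfold_locales (use assms in auto)
  define B where "B = (\<lambda>X Y. ip (K.\<pi> X) (K.\<pi> Y))"
  have ipK: "ip X Y = - \<rho> * killing_form L X Y" for X Y by (simp add: assms(9))
  have T: "is_torus T" "T \<subseteq> G" using assms(6) by (auto simp: maximal_torus_def)
  have CL: "C \<subseteq> L" unfolding assms(7) K.L_eq lie_algebra_def using T(2) by blast
  obtain E where E: "finite E" "\<And>f. linear f \<Longrightarrow> f ` L \<subseteq> L \<Longrightarrow> trace_on L f = (\<Sum>e\<in>E. f e \<bullet> e)"
    by (rule trace_on_inner[OF K.sub]) (rule that)
  \<comment> \<open>In a fixed Euclidean orthonormal basis of \<open>L\<close> the trace is a finite
    sum in which linearity in both arguments is visible. Projecting the arguments first keeps the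
    composed brackets inside \<open>L\<close>, where this formula for the trace is valid.\<close>
  have B_sum: "B X Y = - \<rho> * (\<Sum>e\<in>E. lie_bracket (K.\<pi> X) (lie_bracket (K.\<pi> Y) e) \<bullet> e)" for X Y
    unfolding B_def ipK killing_form_def using E(2) K.ad_comp[OF K.\<pi>(2) K.\<pi>(2)] by simp
  have B_bil: "bilinear B"
    by (auto simp: bilinear_def linear_iff B_sum linear_add[OF K.\<pi>(1)] linear_scale[OF K.\<pi>(1)] lie_bracket_simps
        inner_add_left sum.distrib sum_subtractf sum_negf sum_distrib_left algebra_simps)
  interpret S: sr_structure G L C H B ip
  proof
    show "invertible A" if "A \<in> G" for A by (rule K.group(1)[OF that])
    show "A ** A' \<in> G" if "A \<in> G" "A' \<in> G" for A A' by (rule K.group(2)[OF that])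
    show "matrix_inv A \<in> G" if "A \<in> G" for A by (rule K.group(3)[OF that])
    show "compact G" "subspace L" by (rule assms, rule K.sub)
    show "lie_bracket X Y \<in> L" if "X \<in> L" "Y \<in> L" for X Y by (rule K.bracket[OF that])
    show "mexp X \<in> G" if "X \<in> L" for X by (rule K.mexp_G[OF that])
    show "conj_mexp X Y \<in> L" if "X \<in> L" "Y \<in> L" for X Y by (rule K.conj_L[OF that])
    show "bilinear B" by (rule B_bil)
    show "B X Y = B Y X" for X Y unfolding B_def ipK using K.killing_sym[OF K.\<pi>(2) K.\<pi>(2)] by simp
    show "B X X > 0" if "X \<in> L" "X \<noteq> 0" for X
      unfolding B_def ipK K.\<pi>(3)[OF that(1)] using K.killing_neg[OF that] assms(8) by (simp add: mult_pos_neg)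
    show "B (conj_mexp X Y) (conj_mexp X Z) = B Y Z" if "X \<in> L" "Y \<in> L" "Z \<in> L" for X Y Z
      unfolding B_def ipK using that K.conj_L K.killing_conj[OF that] by (simp add: K.\<pi>(3))
    show "ip X Y = B X Y" if "X \<in> L" "Y \<in> L" for X Y unfolding B_def using that by (simp add: K.\<pi>(3))
    show "subspace C" unfolding assms(7) by (rule torus_lie_algebra[OF T(1)])
    show "C \<subseteq> L" by (rule CL)
    show "lie_bracket X Y = 0" if "X \<in> C" "Y \<in> C" for X Y using torus_lie_algebra(2)[OF T(1)] that unfolding assms(7) .
    show "H = orth_complement ip L C" by (rule assms(10))
  qed
  obtain EH where "orthonormal_basis B H EH"
    using ex_orthonormal_basis[OF S.H_subspace B_bil S.B_sym S.B_pos[OF S.H_L]] by blast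
  then have EH: "orthonormal_basis ip H EH"
  proof -
    have "ip e e' = B e e'" if "e \<in> EH" "e' \<in> EH" for e e'
    proof -
      have "e \<in> H" "e' \<in> H" using that \<open>orthonormal_basis B H EH\<close> span_base[of _ EH] by (auto simp: orthonormal_basis_def)
      then show ?thesis by (intro S.ip_eq S.H_L)
    qed
    then show ?thesis using \<open>orthonormal_basis B H EH\<close> by (simp add: orthonormal_basis_def)
  qed
  have normal: "normal_geodesic G ip H a b \<gamma>" if g: "sr_geodesic G ip H a b \<gamma>" "constant_speed ip a b \<gamma>" for a b \<gamma>
  proof -
    obtain Z U p where f: "Z \<in> C" "U \<in> H" "p \<in> {a..b}" "S.geo_form \<gamma> {a..b} p U Z" using S.geodesic_form[OF g] by blast
    have \<gamma>: "\<gamma> t \<in> G" if "t \<in> {a..b}" for t using g(1) that by (auto simp: sr_geodesic_def horizontal_curve_def)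
    have ham: "hamilton_equations_at L EH {a..b} \<gamma> (\<lambda>s V. B (S.geo_control p U Z s + Z) (matrix_inv (\<gamma> s) ** V)) t" if "t \<in> {a..b}" for t
      by (rule S.hamilton_equations[OF K.log_near \<gamma> f(4,2,1) EH that])
    have lin: "linear (\<lambda>V. B W (A ** V))" for A :: "'k^'n^'n" and W
      by (rule bounded_linear.linear[OF bounded_linear_compose[OF S.B.bounded_linear_right mm.bounded_linear_right]])
    show ?thesis
      unfolding normal_geodesic_def K.L_eq[symmetric]
      by (intro conjI exI[of _ EH] exI[of _ "\<lambda>s V. B (S.geo_control p U Z s + Z) (matrix_inv (\<gamma> s) ** V)"] ballI g(1) EH ham lin)
  qed
  have form: "\<exists>X\<in>L. \<forall>t\<in>{a..b}. \<gamma> t = mexp ((t - t\<^sub>0) *\<^sub>R X) ** mexp (- (t - t\<^sub>0) *\<^sub>R orth_proj ip C X)"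
    if g: "sr_geodesic G ip H a b \<gamma>" "constant_speed ip a b \<gamma>" and t0: "t\<^sub>0 \<in> {a..b}" "\<gamma> t\<^sub>0 = mat 1" for a b \<gamma> t\<^sub>0
  proof -
    obtain Z U' p where f: "Z \<in> C" "U' \<in> H" "p \<in> {a..b}" "S.geo_form \<gamma> {a..b} p U' Z" using S.geodesic_form[OF g] by blast
    \<comment> \<open>Restarting the formula at the time when the curve passes through the identity
      removes the left factor and makes \<open>U + Z\<close> the vector sought.\<close>
    define U where "U = S.geo_control p U' Z t\<^sub>0"
    have UH: "U \<in> H" unfolding U_def by (rule S.geo_control_H[OF f(2,1)])
    have gf: "S.geo_form \<gamma> {a..b} t\<^sub>0 U Z" unfolding U_def by (rule S.geo_form_rebase[OF f(4) t0(1)])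
    \<comment> \<open>\<open>U\<close> is orthogonal to \<open>C\<close>, so Z satisfies the
      description of the projection; two candidates differ by an element of \<open>C\<close> that is
      orthogonal to itself.\<close>
    have proj: "orth_proj ip C (U + Z) = Z"
      unfolding orth_proj_def
    proof (rule the_equality)
      have "ip U W = 0" if "W \<in> C" for W
        using UH that S.ip_eq[OF S.H_L[OF UH] S.in_C(6)[OF that]] S.B_sym[of U W] by (simp add: S.H_iff)
      then show "Z \<in> C \<and> (\<forall>W\<in>C. ip (U + Z - Z) W = 0)" using f(1) by simp
      fix Y assume Y: "Y \<in> C \<and> (\<forall>W\<in>C. ip (U + Z - Y) W = 0)"
      have D: "Z - Y \<in> C" using Y f(1) by (intro S.in_C) auto
      have "U + Z - Y \<in> L" using UH Y f(1) by (intro S.in_L S.H_L S.in_C(6)) auto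
      then have "B (U + Z - Y) (Z - Y) = 0" using Y D S.ip_eq[OF _ S.in_C(6)[OF D]] by auto
      moreover have "B U (Z - Y) = 0" using UH D S.B_sym[of U] by (simp add: S.H_iff)
      moreover have "U + Z - Y = U + (Z - Y)" by simp
      ultimately have "B (Z - Y) (Z - Y) = 0" by (simp only: S.B.add_left)
      then have "Z - Y = 0" using S.B_pos[OF S.in_C(6)[OF D]] by fastforce
      then show "Y = Z" by simp
    qed
    show ?thesis
    proof (intro bexI[of _ "U + Z"] ballI)
      show "U + Z \<in> L" using UH f(1) by (intro S.in_L S.H_L S.in_C(6)) auto
      fix t assume "t \<in> {a..b}"
      then have "\<gamma> t = mat 1 ** mexp ((t - t\<^sub>0) *\<^sub>R (U + Z)) ** mexp ((t - t\<^sub>0) *\<^sub>R (- Z))"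
        using gf t0(2) unfolding S.geo_form_def by simp
      then show "\<gamma> t = mexp ((t - t\<^sub>0) *\<^sub>R (U + Z)) ** mexp (- (t - t\<^sub>0) *\<^sub>R orth_proj ip C (U + Z))"
        unfolding proj by (simp add: scaleR_diff_left)
    qed
  qed
  show ?thesis by (intro conjI allI impI) (elim conjE, rule normal form; assumption)+
qed

end
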